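(* Let $p(\rho)=\rho^\gamma$ with $1\le\gamma<3$. There exist constants $\rho_\pm>0$ and $v_\pm\in\mathbb{R}^2$ such that the self-similar solution of the two-dimensional compressible isentropic Euler system (with the energy inequality) emanating from the Riemann data $$(\rho^0(x),v^0(x))=\begin{cases}(\rho_-,v_-) & \text{if } x_2<0,\\ (\rho_+,v_+) & \text{if } x_2>0,\end{cases}$$ is not entropy rate admissible.
   Context: The compressible isentropic Euler system in two space dimensions, $x=(x_1,x_2)\in\mathbb{R}^2$, for the density $\rho$ and velocity $v$ is $$\partial_t\rho+\mathrm{div}_x(\rho v)=0,\qquad \partial_t(\rho v)+\mathrm{div}_x(\rho v\otimes v)+\nabla_x[p(\rho)]=0,\qquad \rho(\cdot,0)=\rho^0,\ v(\cdot,0)=v^0 .$$ The internal energy $\varepsilon$ is given by $p(r)=r^2\varepsilon'(r)$: $\varepsilon(\rho)=\rho^{\gamma-1}/(\gamma-1)$ if $\gamma>1$ and $\varepsilon(\rho)=\log\rho$ if $\gamma=1$. Weak solution: a pair $(\rho,v)\in L^\infty(\mathbb{R}^2\times[0,\infty))$ satisfying the system and the initial condition in the sense of distributions, i.e. for every scalar $\psi$ and every $\mathbb{R}^2$-valued $\phi$ in $C_c^\infty(\mathbb{R}^2\times[0,\infty))$ $$\int_0^\infty\!\!\int_{\mathbb{R}^2}[\rho\,\partial_t\psi+\rho v\cdot\nabla_x\psi]\,dx\,dt+\int_{\mathbb{R}^2}\rho^0(x)\psi(x,0)\,dx=0,$$ $$\int_0^\infty\!\!\int_{\mathbb{R}^2}[\rho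 v\cdot\partial_t\phi+\rho v\otimes v:\nabla_x\phi+p(\rho)\,\mathrm{div}_x\phi]\,dx\,dt+\int_{\mathbb{R}^2}\rho^0(x)v^0(x)\cdot\phi(x,0)\,dx=0.$$ The value of a solution at time $t=0$ is its initial datum. Energy inequality (admissibility): $\partial_t\big(\rho\varepsilon(\rho)+\rho\frac{|v|^2}{2}\big)+\mathrm{div}_x\big[\big(\rho\varepsilon(\rho)+\rho\frac{|v|^2}{2}+p(\rho)\big)v\big]\le 0$ in the sense of distributions (including the initial datum). Self-similar solution: the classical solution of the Riemann problem, i.e. the one depending only on $x_2/t$, made of constant states separated by admissible shocks, rarefaction waves (and contact discontinuities), satisfying the energy inequality. For $L>0$ define $$E_L[\rho,v](t)=\int_{(-L,L)^2}\Big(\rho\varepsilon(\rho)+\rho\frac{|v|^2}{2}\Big)dx,\qquad D_L[\rho,v](t)=\frac{d_+E_L[\rho,v](t)}{dt}\quad(\text{right derivative in }t).$$ Entropy rate admissible: a weak solution $(\rho,v)$ is called entropy rate admissible if there exists $L^*>0$ such that there is no other weak solution $(\overline\rho,\overline v)$ with the property that for some $\tau\ge0$, $(\overline\rho,\overline v)(x,t)=(\rho,v)(x,t)$ on $\mathbb{R}^2\times[0,\tau]$ and $D_L[\overline\rho,\overline v](\tau)<D_L[\rho,v](\tau)$ for all $L\ge L^*$. *)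

theory Defs
  imports "HOL-Analysis.Analysis"
begin

text \<open>
  Fields are functions of \<open>x :: real^2\<close> and \<open>t :: real\<close>, of which only the values at \<open>t \<ge> 0\<close> matter;
  the value at \<open>t = 0\<close> is the initial datum.
\<close>

section \<open>Constitutive laws\<close>

definition pressure :: "real \<Rightarrow> real \<Rightarrow> real" where
  "pressure \<gamma> r = r powr \<gamma>"

definition internal_energy :: "real \<Rightarrow> real \<Rightarrow> real" where
  "internal_energy \<gamma> r = (if \<gamma> = 1 then ln r else r powr (\<gamma> - 1) / (\<gamma> - 1))"

definition sound_speed :: "real \<Rightarrow> real \<Rightarrow> real" where
  "sound_speed \<gamma> r = sqrt (deriv (pressure \<gamma>) r)"

definition energy_density :: "real \<Rightarrow> real \<Rightarrow> real^2 \<Rightarrow> real" where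
  "energy_density \<gamma> r w = r * internal_energy \<gamma> r + r * (norm w)\<^sup>2 / 2"

section \<open>Test functions\<close>

primrec Ck :: "nat \<Rightarrow> ('a::real_normed_vector \<Rightarrow> 'b::real_normed_vector) \<Rightarrow> bool" where
  "Ck 0 f \<longleftrightarrow> continuous_on UNIV f"
| "Ck (Suc k) f \<longleftrightarrow>
     (\<exists>f'. (\<forall>z. (f has_derivative f' z) (at z)) \<and> (\<forall>h. Ck k (\<lambda>z. f' z h)))"

text \<open>
  A test function on \<open>\<real>\<^sup>2 \<times> [0,\<infinity>)\<close> is the restriction of a smooth, compactly supported function on the
  whole of \<open>\<real>\<^sup>2 \<times> \<real>\<close>; it need not vanish at \<open>t = 0\<close>.
\<close>

definition test_function :: "((real^2) \<times> real \<Rightarrow> 'b::real_normed_vector) \<Rightarrow> bool" where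
  "test_function \<psi> \<longleftrightarrow> (\<forall>k. Ck k \<psi>) \<and> compact (closure {z. \<psi> z \<noteq> 0})"

definition dt :: "((real^2) \<times> real \<Rightarrow> 'b::real_normed_vector) \<Rightarrow> (real^2) \<times> real \<Rightarrow> 'b" where
  "dt \<psi> z = frechet_derivative \<psi> (at z) (0, 1)"

definition dx :: "2 \<Rightarrow> ((real^2) \<times> real \<Rightarrow> 'b::real_normed_vector) \<Rightarrow> (real^2) \<times> real \<Rightarrow> 'b" where
  "dx j \<psi> z = frechet_derivative \<psi> (at z) (axis j 1, 0)"

section \<open>Weak solutions and the energy inequality\<close>

abbreviation half_space :: "((real^2) \<times> real) set" where
  "half_space \<equiv> UNIV \<times> {0..}"

text \<open>
  The bounds are required on every time slice, so that the initial datum is in \<open>L\<^sup>\<infinity>\<close> and the energy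
  below is meaningful at every time. Each nonnegative density and velocity in \<open>L\<^sup>\<infinity>\<close> with
  \<open>L\<^sup>\<infinity>\<close> initial datum has a representative of this kind.
\<close>

definition bounded_state :: "(real^2 \<Rightarrow> real \<Rightarrow> real) \<Rightarrow> (real^2 \<Rightarrow> real \<Rightarrow> real^2) \<Rightarrow> bool" where
  "bounded_state \<rho> v \<longleftrightarrow>
     set_borel_measurable borel half_space (\<lambda>(x, t). \<rho> x t) \<and>
     set_borel_measurable borel half_space (\<lambda>(x, t). v x t) \<and>
     (\<exists>M. \<forall>t\<ge>0. AE x in lborel. 0 \<le> \<rho> x t \<and> \<rho> x t \<le> M \<and> norm (v x t) \<le> M)"

definition weak_solution ::
  "real \<Rightarrow> (real^2 \<Rightarrow> real \<Rightarrow> real) \<Rightarrow> (real^2 \<Rightarrow> real \<Rightarrow> real^2) \<Rightarrow> bool" where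
  "weak_solution \<gamma> \<rho> v \<longleftrightarrow>
     bounded_state \<rho> v \<and>
     (\<forall>\<psi> :: (real^2) \<times> real \<Rightarrow> real. test_function \<psi> \<longrightarrow>
        (LINT (x, t):half_space|lborel.
           \<rho> x t * dt \<psi> (x, t) + (\<Sum>j\<in>UNIV. \<rho> x t * v x t $ j * dx j \<psi> (x, t)))
        + (LINT x|lborel. \<rho> x 0 * \<psi> (x, 0)) = 0) \<and>
     (\<forall>\<phi> :: (real^2) \<times> real \<Rightarrow> real^2. test_function \<phi> \<longrightarrow>
        (LINT (x, t):half_space|lborel.
           \<rho> x t * (v x t \<bullet> dt \<phi> (x, t))
           + (\<Sum>i\<in>UNIV. \<Sum>j\<in>UNIV. \<rho> x t * v x t $ i * v x t $ j * dx j \<phi> (x, t) $ i)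
           + pressure \<gamma> (\<rho> x t) * (\<Sum>j\<in>UNIV. dx j \<phi> (x, t) $ j))
        + (LINT x|lborel. \<rho> x 0 * (v x 0 \<bullet> \<phi> (x, 0))) = 0)"

definition energy_inequality ::
  "real \<Rightarrow> (real^2 \<Rightarrow> real \<Rightarrow> real) \<Rightarrow> (real^2 \<Rightarrow> real \<Rightarrow> real^2) \<Rightarrow> bool" where
  "energy_inequality \<gamma> \<rho> v \<longleftrightarrow>
     (\<forall>\<psi> :: (real^2) \<times> real \<Rightarrow> real.
        test_function \<psi> \<and> (\<forall>x. \<forall>t\<ge>0. 0 \<le> \<psi> (x, t)) \<longrightarrow>
        (LINT (x, t):half_space|lborel.
           energy_density \<gamma> (\<rho> x t) (v x t) * dt \<psi> (x, t)
           + (\<Sum>j\<in>UNIV. (energy_density \<gamma> (\<rho> x t) (v x t) + pressure \<gamma> (\<rho> x t))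
                          * v x t $ j * dx j \<psi> (x, t)))
        + (LINT x|lborel. energy_density \<gamma> (\<rho> x 0) (v x 0) * \<psi> (x, 0)) \<ge> 0)"

section \<open>The self-similar solution of the Riemann problem\<close>

text \<open>
  A rarefaction wave is an integral curve of the eigenvector field \<open>(\<rho>, v\<^sub>1, v\<^sub>2) \<mapsto> (\<rho>, 0, \<sigma> c(\<rho>))\<close>,
  \<open>\<sigma> = \<plusminus>1\<close>, up to parametrisation, with the parameter \<open>s = x\<^sub>2/t\<close> equal to the eigenvalue
  \<open>v\<^sub>2 + \<sigma> c(\<rho>)\<close>.
\<close>

definition rarefaction_on ::
  "real \<Rightarrow> (real \<Rightarrow> real) \<Rightarrow> (real \<Rightarrow> real^2) \<Rightarrow> real set \<Rightarrow> bool" where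
  "rarefaction_on \<gamma> R V C \<longleftrightarrow>
     (\<lambda>s. V s $ 1) constant_on C \<and>
     (\<exists>\<sigma>\<in>{-1, 1}. \<exists>R' W'. \<forall>s\<in>C.
        R s > 0 \<and>
        V s $ 2 + \<sigma> * sound_speed \<gamma> (R s) = s \<and>
        (R has_real_derivative R' s) (at s) \<and>
        ((\<lambda>s. V s $ 2) has_real_derivative W' s) (at s) \<and>
        R s * W' s = \<sigma> * sound_speed \<gamma> (R s) * R' s)"

text \<open>
  The jumps of the profile at the finitely many points of \<open>B\<close> are shocks or contact discontinuities:
  the Rankine--Hugoniot conditions are contained in \<open>weak_solution\<close>, the admissibility of the shocks in
  \<open>energy_inequality\<close>. The values on the lines \<open>x\<^sub>2 = s t\<close>, \<open>s \<in> B\<close>, are irrelevant.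
\<close>

definition self_similar_solution ::
  "real \<Rightarrow> real \<Rightarrow> real^2 \<Rightarrow> real \<Rightarrow> real^2 \<Rightarrow>
    (real^2 \<Rightarrow> real \<Rightarrow> real) \<Rightarrow> (real^2 \<Rightarrow> real \<Rightarrow> real^2) \<Rightarrow> bool" where
  "self_similar_solution \<gamma> \<rho>m vm \<rho>p vp \<rho> v \<longleftrightarrow>
     (\<forall>x. x $ 2 < 0 \<longrightarrow> \<rho> x 0 = \<rho>m \<and> v x 0 = vm) \<and>
     (\<forall>x. x $ 2 > 0 \<longrightarrow> \<rho> x 0 = \<rho>p \<and> v x 0 = vp) \<and>
     weak_solution \<gamma> \<rho> v \<and>
     energy_inequality \<gamma> \<rho> v \<and>
     (\<exists>R V B. (\<forall>x. \<forall>t>0. \<rho> x t = R (x $ 2 / t) \<and> v x t = V (x $ 2 / t)) \<and>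
        finite B \<and>
        (\<forall>C\<in>components (- B).
           (R constant_on C \<and> V constant_on C) \<or> rarefaction_on \<gamma> R V C))"

section \<open>Entropy rate admissibility\<close>

definition energy ::
  "real \<Rightarrow> real \<Rightarrow> (real^2 \<Rightarrow> real \<Rightarrow> real) \<Rightarrow> (real^2 \<Rightarrow> real \<Rightarrow> real^2) \<Rightarrow> real \<Rightarrow> real" where
  "energy \<gamma> L \<rho> v t =
     (LINT x:{x. \<forall>i. - L < x $ i \<and> x $ i < L}|lborel. energy_density \<gamma> (\<rho> x t) (v x t))"

text \<open>\<open>has_energy_rate \<gamma> L \<rho> v \<tau> d\<close>: the right derivative \<open>D\<^sub>L[\<rho>, v](\<tau>)\<close> exists and equals \<open>d\<close>.\<close>

definition has_energy_rate ::
  "real \<Rightarrow> real \<Rightarrow> (real^2 \<Rightarrow> real \<Rightarrow> real) \<Rightarrow> (real^2 \<Rightarrow> real \<Rightarrow> real^2) \<Rightarrow> real \<Rightarrow> real \<Rightarrow> bool" where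
  "has_energy_rate \<gamma> L \<rho> v \<tau> d \<longleftrightarrow> (energy \<gamma> L \<rho> v has_real_derivative d) (at_right \<tau>)"

text \<open>
  The competitor automatically has the same initial datum, since \<open>\<tau> \<ge> 0\<close>, and differs from
  \<open>(\<rho>, v)\<close>, since its energy rate does. It is not required to satisfy the energy inequality.
\<close>

definition entropy_rate_admissible ::
  "real \<Rightarrow> (real^2 \<Rightarrow> real \<Rightarrow> real) \<Rightarrow> (real^2 \<Rightarrow> real \<Rightarrow> real^2) \<Rightarrow> bool" where
  "entropy_rate_admissible \<gamma> \<rho> v \<longleftrightarrow>
     weak_solution \<gamma> \<rho> v \<and>
     (\<exists>Ls>0. \<not> (\<exists>r u. weak_solution \<gamma> r u \<and>
        (\<exists>\<tau>\<ge>0. (\<forall>x. \<forall>t\<in>{0..\<tau>}. r x t = \<rho> x t \<and> u x t = v x t) \<and>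
           (\<forall>L\<ge>Ls. \<exists>d' d. has_energy_rate \<gamma> L r u \<tau> d' \<and> has_energy_rate \<gamma> L \<rho> v \<tau> d \<and>
              d' < d))))"

end

theory Submission
  imports Defs
begin

text \<open>
  The data are a vortex sheet: density 1 and velocity \<open>\<plusminus>W e\<^sub>1\<close> above and below \<open>x\<^sub>2 = 0\<close>, with \<open>W\<close> large.

  Self-similar solutions cannot dissipate energy. In the variable \<open>s = x\<^sub>2/t\<close> the relative mass flux
  \<open>R (v\<^sub>2 - s)\<close> vanishes at some \<open>s\<^sub>0\<close>, where the flux of tangential momentum vanishes too, so that
  mass and tangential momentum are conserved on either side of \<open>s\<^sub>0\<close>; by convexity of \<open>r \<mapsto> r \<epsilon>(r)\<close> and of the
  kinetic energy the total energy is then at least its initial value.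

  A solution with less energy comes from convex integration. Two shocks of speed \<open>\<plusminus>2b\<close> enclose states of density 2,
  which enclose a turbulent wedge of density 1/4. In the wedge the mean velocity is 0 and the mean of \<open>v \<otimes> v\<close> is
  given by the Rankine--Hugoniot conditions, except that \<open>v\<^sub>1\<^sup>2\<close> may have any mean; oscillating solutions of the
  pressureless linear system realize these means with constant \<open>|v|\<^sup>2\<close>. Since the mean of \<open>v\<^sub>1\<^sup>2\<close> is chosen as
  \<open>W\<^sup>2/2\<close> instead of \<open>W\<^sup>2\<close>, energy is lost at a rate of order \<open>W\<^sup>2\<close>, while all the other contributions to
  the energy rate are independent of \<open>W\<close>.
\<close>

text \<open>The compressed layers are what makes the wedge possible. A wedge of mean velocity 0 put
  directly between the initial states would be forced by the jump conditions to have density 1 and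
  normal stress 0, but a nonzero shear stress; no velocity field has such second moments. Between
  compressed layers the normal stress is a positive number \<open>normal_stress\<close> independent
  of W, and the prescribed moments are attainable when (W^2/2) \<open>normal_stress\<close> > (8/7 b
  W)^2. Here W cancels, which is why W may be taken large afterwards. With theta W^2 in place of
  W^2/2 the condition is theta > (8/7 b)^2 / \<open>normal_stress\<close>, and the W^2 part of the
  energy rate becomes 4/7 b (theta - 1) W^2, negative for theta < 1; the densities 2 and 1/4 leave
  room for theta = 1/2 at every exponent \<gamma> \<ge> 1. Since convex integration prescribes |v|^2
  pointwise, the energy density in the wedge is known although the velocity is not, and the energy
  rate is an exact number that can be compared with that of every self-similar solution.\<close>

section \<open>Integration by parts and smooth functions of compact support\<close>

text \<open>Translation invariance makes every difference quotient of \<open>h\<close> integrate to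
  0; the mean value theorem bounds the quotients by \<open>M\<close> on a fixed ball, so dominated
  convergence applies. Regularity is asked along \<open>e\<close> alone: \<open>h\<close> will also
  be a test function times the indicator of a strip that is invariant in direction
  \<open>e\<close>.\<close>

lemma integral_directional_derivative_eq_0:
  fixes h g :: "'a::euclidean_space \<Rightarrow> real" and e :: 'a
  assumes der: "\<And>y. ((\<lambda>t. h (y + t *\<^sub>R e)) has_real_derivative g y) (at 0)"
    and meas: "h \<in> borel_measurable borel"
    and g: "\<And>y. \<bar>g y\<bar> \<le> M" and h: "\<And>y. \<bar>h y\<bar> \<le> M" and K: "\<And>y. K < norm y \<Longrightarrow> h y = 0"
  shows "integral\<^sup>L lborel g = 0"
proof -
  define D where "D n y = (h (y + (1 / real (Suc n)) *\<^sub>R e) - h y) / (1 / real (Suc n))" for n y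
  have derx: "((\<lambda>t. h (y + t *\<^sub>R e)) has_real_derivative g (y + s *\<^sub>R e)) (at s)" for y s
  proof -
    have "((\<lambda>t. h ((y + s *\<^sub>R e) + t *\<^sub>R e)) has_real_derivative g (y + s *\<^sub>R e)) (at (s - s))"
      using der by simp
    hence "((\<lambda>t. h ((y + s *\<^sub>R e) + (t - s) *\<^sub>R e)) has_real_derivative g (y + s *\<^sub>R e)) (at s)"
      using DERIV_shift[of "\<lambda>t. h ((y + s *\<^sub>R e) + t *\<^sub>R e)" "g (y + s *\<^sub>R e)" s "-s"] by simp
    thus ?thesis by (simp add: algebra_simps)
  qed
  have mh: "h \<in> borel_measurable lborel" using meas by simp
  have mhs: "(\<lambda>y. h (y + c)) \<in> borel_measurable lborel" for c
    using meas by measurable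
  have lim: "(\<lambda>n. D n y) \<longlonglongrightarrow> g y" for y
  proof -
    have "((\<lambda>t. (h (y + t *\<^sub>R e) - h y) / t) \<longlongrightarrow> g y) (at 0)"
      using der[of y] by (simp add: DERIV_def)
    moreover have "filterlim (\<lambda>n. 1 / real (Suc n)) (at 0) sequentially"
      unfolding filterlim_at using LIMSEQ_Suc[OF lim_1_over_n] by simp
    ultimately show ?thesis unfolding D_def by (rule filterlim_compose)
  qed
  have Db: "\<bar>D n y\<bar> \<le> M" for n y
  proof -
    obtain z where z: "h (y + (1 / real (Suc n)) *\<^sub>R e) - h (y + 0 *\<^sub>R e)
        = (1 / real (Suc n) - 0) * g (y + z *\<^sub>R e)"
      using MVT2[of 0 "1 / real (Suc n)" "\<lambda>t. h (y + t *\<^sub>R e)" "\<lambda>s. g (y + s *\<^sub>R e)"] derx by auto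
    hence "D n y = g (y + z *\<^sub>R e)" unfolding D_def by simp
    thus ?thesis using g by simp
  qed
  define K' where "K' = K + norm e"
  have D0: "D n y = 0" if "K' < norm y" for n y
  proof -
    have "norm (y + (1 / real (Suc n)) *\<^sub>R e) \<ge> norm y - norm ((1 / real (Suc n)) *\<^sub>R e)"
      by (metis add.commute add_diff_cancel_left' diff_le_eq norm_triangle_ineq4)
    moreover have "norm ((1 / real (Suc n)) *\<^sub>R e) \<le> norm e" by (simp add: divide_simps) (simp add: algebra_simps)
    ultimately have "K < norm (y + (1 / real (Suc n)) *\<^sub>R e)" "K < norm y"
      using that unfolding K'_def by (linarith, smt (verit) norm_ge_zero)
    thus ?thesis unfolding D_def using K by simp
  qed
  have intb: "integrable lborel (\<lambda>y. M * indicator (cball (0::'a) K') y)"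
    by (intro integrable_mult_right integrable_real_indicator) (use emeasure_bounded_finite[OF bounded_cball] in auto)
  have inth: "integrable lborel h"
  proof (rule Bochner_Integration.integrable_bound)
    show "integrable lborel (\<lambda>y. M * indicator (cball (0::'a) K) y)"
      by (intro integrable_mult_right integrable_real_indicator) (use emeasure_bounded_finite[OF bounded_cball] in auto)
    show "AE x in lborel. norm (h x) \<le> norm (M * indicator (cball 0 K) x)"
    proof (intro AE_I2)
      fix x show "norm (h x) \<le> norm (M * indicator (cball 0 K) x)"
        using h[of x] K[of x] by (cases "norm x \<le> K") (auto simp: indicator_def)
    qed
  qed (use mh in simp)
  have intD: "integral\<^sup>L lborel (D n) = 0" for n
  proof -
    have eq: "integral\<^sup>L lborel (\<lambda>y. h (y + c)) = integral\<^sup>L lborel h" for c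
    proof -
      have "integral\<^sup>L lborel h = integral\<^sup>L (distr lborel borel ((+) c)) h" by (simp add: lborel_distr_plus)
      also have "\<dots> = integral\<^sup>L lborel (\<lambda>y. h (c + y))" by (subst integral_distr) (use meas in auto)
      finally show ?thesis by (simp add: add.commute)
    qed
    have ints: "integrable lborel (\<lambda>y. h (y + c))" for c
    proof -
      have "integrable (distr lborel borel ((+) c)) h" using inth by (simp add: lborel_distr_plus)
      hence "integrable lborel (\<lambda>y. h (c + y))" by (subst (asm) integrable_distr_eq) (use meas in auto)
      thus ?thesis by (simp add: add.commute)
    qed
    show ?thesis unfolding D_def
      by (subst integral_divide_zero, subst Bochner_Integration.integral_diff) (auto intro: ints inth simp: eq)
  qed
  have "(\<lambda>n. integral\<^sup>L lborel (D n)) \<longlonglongrightarrow> integral\<^sup>L lborel g"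
  proof (rule integral_dominated_convergence[OF _ _ intb])
    show mD: "D n \<in> borel_measurable lborel" for n unfolding D_def using mh mhs by measurable
    show "g \<in> borel_measurable lborel"
      by (rule borel_measurable_LIMSEQ_real[OF lim mD])
    show "AE x in lborel. (\<lambda>n. D n x) \<longlonglongrightarrow> g x" using lim by simp
    show "AE x in lborel. norm (D n x) \<le> M * indicator (cball 0 K') x" for n
    proof (intro AE_I2)
      fix x show "norm (D n x) \<le> M * indicator (cball 0 K') x"
        using Db[of n x] D0[of x n] by (cases "norm x \<le> K'") (auto simp: indicator_def)
    qed
  qed
  thus ?thesis using intD by (simp add: LIMSEQ_const_iff)
qed

lemma Ck_SucD: "Ck (Suc k) f \<Longrightarrow> Ck k f"
proof (induction k arbitrary: f)
  case 0
  then obtain f' where "\<forall>z. (f has_derivative f' z) (at z)" by auto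
  thus ?case by (auto intro!: continuous_at_imp_continuous_on has_derivative_continuous)
next
  case (Suc k)
  from Suc.prems obtain f' where "\<forall>z. (f has_derivative f' z) (at z)" "\<forall>h. Ck (Suc k) (\<lambda>z. f' z h)"
    by (auto simp: Ck.simps(2)[of "Suc k"])
  thus ?case using Suc.IH by (auto simp: Ck.simps(2)[of k])
qed

lemma Ck_const: "Ck k (\<lambda>_. c)"
proof (induction k arbitrary: c)
  case (Suc k)
  show ?case by (auto intro!: exI[of _ "\<lambda>_ _. 0"] Suc)
qed simp

lemma Ck_add: "Ck k f \<Longrightarrow> Ck k g \<Longrightarrow> Ck k (\<lambda>z. f z + g z)"
proof (induction k arbitrary: f g)
  case (Suc k)
  then obtain f' g' where "\<forall>z. (f has_derivative f' z) (at z)" "\<forall>h. Ck k (\<lambda>z. f' z h)"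
    "\<forall>z. (g has_derivative g' z) (at z)" "\<forall>h. Ck k (\<lambda>z. g' z h)" by auto
  thus ?case using Suc.IH by (auto intro!: exI[of _ "\<lambda>z h. f' z h + g' z h"] has_derivative_add)
qed (auto intro: continuous_on_add)

lemma Ck_bounded_linear: "bounded_linear L \<Longrightarrow> Ck k f \<Longrightarrow> Ck k (\<lambda>z. L (f z))"
proof (induction k arbitrary: f)
  case (Suc k)
  then obtain f' where "\<forall>z. (f has_derivative f' z) (at z)" "\<forall>h. Ck k (\<lambda>z. f' z h)" by auto
  thus ?case using Suc.IH Suc.prems(1)
    by (simp, intro exI[of _ "\<lambda>z h. L (f' z h)"])
      (simp add: bounded_linear.has_derivative[OF Suc.prems(1)])
next
  case 0
  thus ?case using bounded_linear.continuous_on[OF 0(1), of UNIV f] by simp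
qed

lemma Ck_cmult: "Ck k f \<Longrightarrow> Ck k (\<lambda>z. c * (f z :: real))"
  by (rule Ck_bounded_linear[OF bounded_linear_mult_right])

lemma test_function_has_derivative:
  assumes "test_function \<psi>"
  shows "(\<psi> has_derivative frechet_derivative \<psi> (at z)) (at z)"
    and "continuous_on UNIV (\<lambda>z. frechet_derivative \<psi> (at z) h)"
proof -
  from assms have "Ck (Suc 0) \<psi>" unfolding test_function_def by blast
  then obtain f' where f': "\<And>z. (\<psi> has_derivative f' z) (at z)" "\<And>h. continuous_on UNIV (\<lambda>z. f' z h)" by auto
  have "frechet_derivative \<psi> (at z) = f' z" for z using f'(1) frechet_derivative_at by metis
  thus "(\<psi> has_derivative frechet_derivative \<psi> (at z)) (at z)"
    "continuous_on UNIV (\<lambda>z. frechet_derivative \<psi> (at z) h)" using f' by auto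
qed

lemma test_function_continuous: "test_function \<psi> \<Longrightarrow> continuous_on UNIV \<psi>"
  by (metis Ck.simps(1) test_function_def)

lemma test_function_bounded_support:
  assumes "test_function \<psi>"
  obtains K where "K > 0" "\<And>z. K < norm z \<Longrightarrow> \<psi> z = 0"
    "\<And>z h. K < norm z \<Longrightarrow> frechet_derivative \<psi> (at z) h = 0"
proof -
  have "bounded {z. \<psi> z \<noteq> 0}"
    using assms closure_subset compact_imp_bounded bounded_subset unfolding test_function_def by metis
  then obtain K where K: "K > 0" "\<And>z. \<psi> z \<noteq> 0 \<Longrightarrow> norm z \<le> K" by (auto simp: bounded_pos)
  have 1: "\<psi> z = 0" if "K < norm z" for z using K(2)[of z] that by auto
  have "frechet_derivative \<psi> (at z) h = 0" if z: "K < norm z" for z h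
  proof -
    have "open {z::(real^2)\<times>real. K < norm z}" by (intro open_Collect_less continuous_intros)
    hence "(\<psi> has_derivative (\<lambda>_. 0)) (at z)"
      using z 1 has_derivative_transform_within_open[of "\<lambda>_. 0" "\<lambda>_. 0" z UNIV "{z. K < norm z}" \<psi>] by auto
    thus ?thesis using frechet_derivative_at by metis
  qed
  thus ?thesis using that K(1) 1 by blast
qed

lemma compact_support_bound:
  fixes f :: "'a::euclidean_space \<Rightarrow> 'b::real_normed_vector"
  assumes "continuous_on UNIV f" "\<And>z. K < norm z \<Longrightarrow> f z = 0"
  obtains M where "M > 0" "\<And>z. norm (f z) \<le> M"
proof -
  have "bounded (f ` cball 0 K)"
    by (intro compact_imp_bounded compact_continuous_image) (use assms(1) in \<open>auto intro: continuous_on_subset\<close>)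
  then obtain M where M: "M > 0" "\<And>z. norm z \<le> K \<Longrightarrow> norm (f z) \<le> M" by (auto simp: bounded_pos)
  have "norm (f z) \<le> M" for z using M assms(2)[of z] by (cases "norm z \<le> K") auto
  thus ?thesis using that M by blast
qed

lemma compact_support_integrable:
  fixes f w :: "'a::euclidean_space \<Rightarrow> real"
  assumes "continuous_on UNIV f" "\<And>z. K < norm z \<Longrightarrow> f z = 0"
    and "w \<in> borel_measurable borel" "\<And>z. \<bar>w z\<bar> \<le> B"
  shows "integrable lborel (\<lambda>z. w z * f z)"
proof -
  obtain M where M: "M > 0" "\<And>z. norm (f z) \<le> M" using compact_support_bound[OF assms(1,2)] by blast
  show ?thesis
  proof (rule Bochner_Integration.integrable_bound)
    show "integrable lborel (\<lambda>y. (B * M) * indicator (cball (0::'a) K) y)"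
      by (intro integrable_mult_right integrable_real_indicator) (use emeasure_bounded_finite[OF bounded_cball] in auto)
    have "f \<in> borel_measurable borel" using assms(1) by (rule borel_measurable_continuous_onI)
    thus "(\<lambda>z. w z * f z) \<in> borel_measurable lborel" using assms(3) by measurable
    show "AE x in lborel. norm (w x * f x) \<le> norm (B * M * indicator (cball 0 K) x)"
    proof (intro AE_I2)
      fix x show "norm (w x * f x) \<le> norm (B * M * indicator (cball 0 K) x)"
      proof (cases "norm x \<le> K")
        case True
        have "\<bar>w x\<bar> * \<bar>f x\<bar> \<le> B * M" using assms(4)[of x] M(2)[of x] by (intro mult_mono) auto
        also have "\<dots> \<le> \<bar>B\<bar> * \<bar>M\<bar>" by (metis abs_ge_self abs_mult)
        finally show ?thesis using True by (auto simp: indicator_def abs_mult)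
      qed (use assms(2) in auto)
    qed
  qed
qed

lemma dt_dx_continuous:
  assumes "test_function \<psi>"
  shows "continuous_on UNIV (dt \<psi>)" "continuous_on UNIV (dx j \<psi>)"
  using test_function_has_derivative(2)[OF assms] unfolding dt_def[abs_def] dx_def[abs_def] by auto

lemma directional_real_derivative:
  assumes "(\<psi> has_derivative D) (at (z :: 'a::real_normed_vector))"
  shows "((\<lambda>s. \<psi> (z + s *\<^sub>R e) :: real) has_real_derivative D e) (at 0)"
proof -
  have "((\<lambda>s. \<psi> (z + s *\<^sub>R e)) has_derivative (\<lambda>s. D (s *\<^sub>R e))) (at 0)"
    by (rule has_derivative_compose[of "\<lambda>s. z + s *\<^sub>R e" "\<lambda>s. s *\<^sub>R e" 0 UNIV \<psi> D])
      (use assms in \<open>auto intro!: derivative_eq_intros\<close>)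
  moreover have "(\<lambda>s. D (s *\<^sub>R e)) = (*) (D e)"
    using has_derivative_bounded_linear[OF assms] by (auto simp: linear_simps fun_eq_iff)
  ultimately show ?thesis by (simp add: has_field_derivative_def)
qed

lemma Ck_mult:
  fixes f g :: "'a::real_normed_vector \<Rightarrow> real"
  shows "Ck k f \<Longrightarrow> Ck k g \<Longrightarrow> Ck k (\<lambda>z. f z * g z)"
proof (induction k arbitrary: f g)
  case 0
  thus ?case by (auto intro: continuous_on_mult)
next
  case (Suc k)
  from Suc.prems obtain f' g' where d: "\<forall>z. (f has_derivative f' z) (at z)" "\<forall>h. Ck k (\<lambda>z. f' z h)"
    "\<forall>z. (g has_derivative g' z) (at z)" "\<forall>h. Ck k (\<lambda>z. g' z h)" by auto
  have fg: "Ck k f" "Ck k g" using Suc.prems Ck_SucD by auto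
  have "((\<lambda>z. f z * g z) has_derivative (\<lambda>h. f z * g' z h + f' z h * g z)) (at z)" for z
    by (rule has_derivative_mult) (use d in auto)
  moreover have "Ck k (\<lambda>z. f z * g' z h + f' z h * g z)" for h
    using d fg by (intro Ck_add Suc.IH) auto
  ultimately show ?case
    unfolding Ck.simps(2) by (intro exI[of _ "\<lambda>z h. f z * g' z h + f' z h * g z"]) auto
qed

lemma Ck_compose_affine:
  assumes "bounded_linear L"
  shows "Ck k f \<Longrightarrow> Ck k (\<lambda>z. f (c + L z))"
proof (induction k arbitrary: f)
  case 0
  have "continuous_on UNIV (\<lambda>z. c + L z)"
    by (intro continuous_intros bounded_linear.continuous_on[OF assms])
  thus ?case using 0 continuous_on_compose2[of UNIV f UNIV "\<lambda>z. c + L z"] by auto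
next
  case (Suc k)
  from Suc.prems obtain f' where d: "\<forall>z. (f has_derivative f' z) (at z)" "\<forall>h. Ck k (\<lambda>z. f' z h)"
    by auto
  have "((\<lambda>z. f (c + L z)) has_derivative (\<lambda>h. f' (c + L z) (L h))) (at z)" for z
    by (rule has_derivative_compose[of "\<lambda>z. c + L z" L z UNIV f "f' (c + L z)"])
      (use d bounded_linear.has_derivative[OF assms has_derivative_ident] in
        \<open>auto intro!: derivative_eq_intros\<close>)
  moreover have "Ck k (\<lambda>z. f' (c + L z) (L h))" for h
    using d by (intro Suc.IH[of "\<lambda>z. f' z (L h)"]) auto
  ultimately show ?case
    unfolding Ck.simps(2) by (intro exI[of _ "\<lambda>z h. f' (c + L z) (L h)"]) auto
qed

lemma Ck_real_SucI:
  fixes f :: "real \<Rightarrow> real"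
  assumes "\<And>s. (f has_real_derivative g s) (at s)" "Ck k g"
  shows "Ck (Suc k) f"
  unfolding Ck.simps(2)
proof (intro exI[of _ "\<lambda>z h. g z * h"] conjI allI)
  show "(f has_derivative (*) (g z)) (at z)" for z using assms(1) by (simp add: has_field_derivative_def)
  show "Ck k (\<lambda>z. g z * h)" for h
    by (rule Ck_bounded_linear[OF bounded_linear_mult_left assms(2)])
qed

lemma Ck_real_SucD:
  fixes f :: "real \<Rightarrow> real"
  assumes "Ck (Suc k) f"
  shows "(f has_real_derivative deriv f s) (at s)" "Ck k (deriv f)"
proof -
  obtain f' where f': "\<And>z. (f has_derivative f' z) (at z)" "\<And>h. Ck k (\<lambda>z. f' z h)" using assms by auto
  have d: "(f has_real_derivative f' s 1) (at s)" for s
  proof -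
    have "f' s = (*) (f' s 1)"
    proof
      fix h show "f' s h = f' s 1 * h"
        using linear_scale[OF bounded_linear.linear[OF has_derivative_bounded_linear[OF f'(1)]], of s h 1]
        by (metis mult.commute mult.right_neutral real_scaleR_def)
    qed
    thus ?thesis using f'(1)[of s] unfolding has_field_derivative_def by simp
  qed
  hence "deriv f = (\<lambda>s. f' s 1)" by (auto simp: DERIV_imp_deriv)
  thus "(f has_real_derivative deriv f s) (at s)" "Ck k (deriv f)" using d f'(2) by auto
qed

lemma smooth_deriv_tower:
  fixes f :: "real \<Rightarrow> real"
  assumes "\<And>k. Ck k f"
  shows "Ck k ((deriv ^^ n) f)"
    and "((deriv ^^ n) f has_real_derivative (deriv ^^ Suc n) f s) (at s)"
    and "continuous_on UNIV ((deriv ^^ n) f)"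
proof -
  have *: "\<forall>k. Ck k ((deriv ^^ n) f)" for n
  proof (induction n)
    case (Suc n)
    thus ?case using Ck_real_SucD(2)[of _ "(deriv ^^ n) f"] by (simp del: Ck.simps)
  qed (use assms in simp)
  show "Ck k ((deriv ^^ n) f)" using * by auto
  show "((deriv ^^ n) f has_real_derivative (deriv ^^ Suc n) f s) (at s)"
    using Ck_real_SucD(1)[of 0 "(deriv ^^ n) f"] * by simp
  show "continuous_on UNIV ((deriv ^^ n) f)" using * Ck.simps(1) by metis
qed

lemma deriv_tower_support:
  fixes f :: "real \<Rightarrow> real"
  assumes "\<And>s. r < \<bar>s - c\<bar> \<Longrightarrow> f s = 0" "r < \<bar>s - c\<bar>"
  shows "(deriv ^^ n) f s = 0"
  using assms(2)
proof (induction n arbitrary: s)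
  case (Suc n)
  have o: "open {s. r < \<bar>s - c\<bar>}" by (intro open_Collect_less continuous_intros)
  have "((deriv ^^ n) f has_real_derivative 0) (at s)"
    using has_field_derivative_transform_within_open[OF DERIV_const o, of s 0 "(deriv ^^ n) f"] Suc by auto
  thus ?case by (simp add: DERIV_imp_deriv)
qed (use assms(1) in simp)

text \<open>All functions p(1/s) exp(-1/s), extended by 0, are treated at once: differentiation
  stays inside this family, so smoothness is a single induction.\<close>

definition flat_exp :: "real poly \<Rightarrow> real \<Rightarrow> real" where
  "flat_exp p s = (if s > 0 then poly p (1 / s) * exp (- (1 / s)) else 0)"

lemma poly_exp_minus_tendsto_0: "((\<lambda>u::real. poly p u * exp (- u)) \<longlongrightarrow> 0) at_top"
proof -
  have "((\<lambda>u::real. \<Sum>i\<le>degree p. coeff p i * (u ^ i / exp u)) \<longlongrightarrow> (\<Sum>i\<le>degree p. coeff p i * 0)) at_top"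
    by (intro tendsto_intros tendsto_power_div_exp_0)
  moreover have "(\<lambda>u. poly p u * exp (- u)) = (\<lambda>u. \<Sum>i\<le>degree p. coeff p i * (u ^ i / exp u))"
    by (auto simp: poly_altdef sum_distrib_right exp_minus divide_inverse mult.assoc fun_eq_iff)
  ultimately show ?thesis by simp
qed

text \<open>With u = 1/s the derivative of p(u) exp(-u) is u^2 (p - p')(u) exp(-u). At s = 0 the
  difference quotient is u p(u) exp(-u), whence \<open>pCons 0 p\<close>, and it tends to 0 as u
  grows.\<close>

lemma flat_exp_has_derivative:
  "(flat_exp p has_real_derivative flat_exp ([:0, 0, 1:] * (p - pderiv p)) s) (at s)"
proof -
  consider "s > 0" | "s < 0" | "s = 0" by linarith
  thus ?thesis
  proof cases
    case 1
    have "((\<lambda>s. poly p (1 / s) * exp (- (1 / s))) has_real_derivative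
        flat_exp ([:0, 0, 1:] * (p - pderiv p)) s) (at s)"
      using 1 unfolding flat_exp_def
      by (auto intro!: derivative_eq_intros DERIV_chain2[OF poly_DERIV] simp: field_simps power2_eq_square)
    thus ?thesis
      by (rule has_field_derivative_transform_within_open[of _ _ _ "{0<..}"]) (use 1 in \<open>auto simp: flat_exp_def\<close>)
  next
    case 2
    have "((\<lambda>s. 0) has_real_derivative flat_exp ([:0, 0, 1:] * (p - pderiv p)) s) (at s)"
      using 2 by (simp add: flat_exp_def)
    thus ?thesis
      by (rule has_field_derivative_transform_within_open[of _ _ _ "{..<0}"]) (use 2 in \<open>auto simp: flat_exp_def\<close>)
  next
    case 3
    have r: "((\<lambda>h. flat_exp p h / h) \<longlongrightarrow> 0) (at_right 0)"
    proof -
      have "((\<lambda>h. poly (pCons 0 p) (1 / h) * exp (- (1 / h))) \<longlongrightarrow> 0) (at_right 0)"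
        using filterlim_compose[OF poly_exp_minus_tendsto_0[of "pCons 0 p"] filterlim_inverse_at_top_right]
        by (simp add: inverse_eq_divide)
      thus ?thesis
        by (rule Lim_transform_eventually)
          (auto simp: eventually_at_right_field flat_exp_def intro!: exI[of _ 1])
    qed
    have l: "((\<lambda>h. flat_exp p h / h) \<longlongrightarrow> 0) (at_left 0)"
      by (rule Lim_transform_eventually[OF tendsto_const])
        (auto simp: eventually_at_left_field flat_exp_def intro!: exI[of _ "-1"])
    have "((\<lambda>h. flat_exp p h / h) \<longlongrightarrow> 0) (at 0)" using r l by (simp add: filterlim_at_split)
    thus ?thesis using 3 by (simp add: DERIV_def flat_exp_def[of _ 0])
  qed
qed

lemma flat_exp_smooth: "Ck k (flat_exp p)"
proof (induction k arbitrary: p)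
  case 0
  have "isCont (flat_exp p) s" for s using flat_exp_has_derivative DERIV_isCont by blast
  thus ?case by (auto intro: continuous_at_imp_continuous_on)
next
  case (Suc k)
  show ?case by (rule Ck_real_SucI[OF flat_exp_has_derivative Suc])
qed

definition bump :: "real \<Rightarrow> real" where
  "bump s = flat_exp 1 (1 - s) * flat_exp 1 (1 + s)"

lemma bump_smooth: "Ck k bump"
proof -
  have "Ck k (\<lambda>s. flat_exp 1 (1 + (- s)))" "Ck k (\<lambda>s. flat_exp 1 (1 + s))"
    by (rule Ck_compose_affine[OF _ flat_exp_smooth]; intro bounded_linear_minus bounded_linear_ident)+
  from Ck_mult[OF this] show ?thesis by (simp add: bump_def[abs_def])
qed

lemma bump_support: "1 \<le> \<bar>s\<bar> \<Longrightarrow> bump s = 0"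
  by (auto simp: bump_def flat_exp_def)

lemma bump_nonneg: "0 \<le> bump s"
  by (auto simp: bump_def flat_exp_def)

lemma bump_le_1: "bump s \<le> 1"
proof -
  have "flat_exp 1 u \<le> 1" "0 \<le> flat_exp 1 u" for u by (auto simp: flat_exp_def)
  thus ?thesis unfolding bump_def by (intro mult_le_one) auto
qed

text \<open>Both 1 - s and 1 + s are at least 1/2, so each factor is at least exp(-2). This explicit
  bound is the origin of exp(-24) in \<open>wave_const\<close>: three bumps are multiplied and the
  product is squared.\<close>

lemma bump_ge: "\<bar>s\<bar> \<le> 1/2 \<Longrightarrow> exp (-4) \<le> bump s"
proof -
  assume s: "\<bar>s\<bar> \<le> 1/2"
  have *: "exp (-2) \<le> flat_exp 1 u" if "u \<ge> 1/2" for u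
    using that by (auto simp: flat_exp_def field_simps)
  have "exp (-2) * exp (-2) \<le> bump s" unfolding bump_def
    by (intro mult_mono *) (use s in \<open>auto simp: flat_exp_def abs_le_iff\<close>)
  thus ?thesis by (simp flip: exp_add)
qed

definition scaled_bump :: "real \<Rightarrow> real \<Rightarrow> real \<Rightarrow> real" where
  "scaled_bump c r s = bump ((s - c) / r)"

lemma scaled_bump_smooth: "Ck k (scaled_bump c r)"
proof -
  have "Ck k (\<lambda>s. bump (- c / r + s / r))"
    by (rule Ck_compose_affine[OF _ bump_smooth]) (rule bounded_linear_divide)
  moreover have "(\<lambda>s. bump (- c / r + s / r)) = scaled_bump c r"
    by (auto simp: scaled_bump_def fun_eq_iff diff_divide_distrib)
  ultimately show ?thesis by simp
qed

lemma scaled_bump_support: "r > 0 \<Longrightarrow> r \<le> \<bar>s - c\<bar> \<Longrightarrow> scaled_bump c r s = 0"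
  unfolding scaled_bump_def by (rule bump_support) (simp add: abs_divide)

section \<open>Localized plane waves\<close>

text \<open>The k-th derivative of f^(m)(s) exp(i l s), with the product rule as recursion. In this
  form bounds that are explicit in the frequency l follow by induction on k with m
  arbitrary.\<close>

fun wave_tower :: "(real \<Rightarrow> real) \<Rightarrow> real \<Rightarrow> nat \<Rightarrow> nat \<Rightarrow> real \<Rightarrow> complex" where
  "wave_tower f l 0 m s = of_real ((deriv ^^ m) f s) * cis (l * s)"
| "wave_tower f l (Suc k) m s = wave_tower f l k (Suc m) s + \<i> * of_real l * wave_tower f l k m s"

lemma wave_tower_has_derivative:
  assumes "\<And>k. Ck k f"
  shows "(wave_tower f l k m has_vector_derivative wave_tower f l (Suc k) m s) (at s)"
proof (induction k arbitrary: m)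
  case 0
  have "((\<lambda>z. exp (\<i> * (of_real l * z))) has_field_derivative
      \<i> * of_real l * exp (\<i> * (of_real l * of_real s))) (at (of_real s))"
    by (auto intro!: derivative_eq_intros)
  from has_vector_derivative_real_field[OF this]
  have "((\<lambda>s. cis (l * s)) has_vector_derivative (l *\<^sub>R (\<i> * cis (l * s)))) (at s)"
    by (simp add: cis_conv_exp scaleR_conv_of_real mult_ac)
  moreover have "((\<lambda>s. complex_of_real ((deriv ^^ m) f s)) has_vector_derivative
       of_real ((deriv ^^ Suc m) f s)) (at s)"
    using smooth_deriv_tower(2)[OF assms, of m s]
    by (intro has_vector_derivative_of_real) (simp add: has_real_derivative_iff_has_vector_derivative)
  ultimately have "((\<lambda>s. complex_of_real ((deriv ^^ m) f s) * cis (l * s)) has_vector_derivative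
       of_real ((deriv ^^ m) f s) * (l *\<^sub>R (\<i> * cis (l * s))) + of_real ((deriv ^^ Suc m) f s) * cis (l * s)) (at s)"
    by (intro has_vector_derivative_mult)
  thus ?case by (simp add: scaleR_conv_of_real algebra_simps)
next
  case (Suc k)
  have "((\<lambda>s. wave_tower f l k (Suc m) s + \<i> * of_real l * wave_tower f l k m s) has_vector_derivative
      wave_tower f l (Suc k) (Suc m) s + \<i> * of_real l * wave_tower f l (Suc k) m s) (at s)"
    by (intro has_vector_derivative_add has_vector_derivative_mult_right Suc)
  thus ?case by simp
qed

lemma wave_tower_support:
  assumes "\<And>s. r < \<bar>s - c\<bar> \<Longrightarrow> f s = 0" "r < \<bar>s - c\<bar>"
  shows "wave_tower f l k m s = 0"
  by (induction k arbitrary: m) (use deriv_tower_support[OF assms] in auto)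

lemma wave_tower_bound:
  assumes "\<And>m s. m \<le> n \<Longrightarrow> \<bar>(deriv ^^ m) f s\<bar> \<le> K" "k + m \<le> n"
  shows "norm (wave_tower f l k m s) \<le> K * (1 + \<bar>l\<bar>) ^ k"
  using assms(2)
proof (induction k arbitrary: m)
  case 0
  thus ?case using assms(1)[of m s] by (simp add: norm_mult)
next
  case (Suc k)
  have "norm (wave_tower f l (Suc k) m s)
      \<le> norm (wave_tower f l k (Suc m) s) + \<bar>l\<bar> * norm (wave_tower f l k m s)"
    by (simp, rule norm_triangle_le) (simp add: norm_mult)
  also have "\<dots> \<le> K * (1 + \<bar>l\<bar>) ^ k + \<bar>l\<bar> * (K * (1 + \<bar>l\<bar>) ^ k)"
    by (intro add_mono mult_left_mono Suc.IH) (use Suc.prems in auto)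
  finally show ?case by (simp add: algebra_simps)
qed

text \<open>The subtracted term is the one in which all k derivatives fall on the exponential; in
  every other term at least one derivative falls on \<open>f\<close>, which costs a power of the
  frequency.\<close>

lemma wave_tower_leading:
  assumes "\<And>m s. m \<le> n \<Longrightarrow> \<bar>(deriv ^^ m) f s\<bar> \<le> K" "k \<le> n"
  shows "norm (wave_tower f l k 0 s - (\<i> * of_real l) ^ k * (of_real (f s) * cis (l * s)))
    \<le> real k * K * (1 + \<bar>l\<bar>) ^ (k - 1)"
  using assms(2)
proof (induction k)
  case (Suc k)
  have K: "K \<ge> 0" using assms(1)[of 0 0] by (smt (verit) abs_ge_zero le0)
  have "norm (wave_tower f l (Suc k) 0 s - (\<i> * of_real l) ^ Suc k * (of_real (f s) * cis (l * s)))
     = norm (wave_tower f l k 1 s + \<i> * of_real l * (wave_tower f l k 0 s - (\<i> * of_real l) ^ k * (of_real (f s) * cis (l * s))))"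
    by (simp add: algebra_simps)
  also have "\<dots> \<le> norm (wave_tower f l k 1 s) + \<bar>l\<bar> * norm (wave_tower f l k 0 s - (\<i> * of_real l) ^ k * (of_real (f s) * cis (l * s)))"
    by (rule norm_triangle_le) (simp add: norm_mult)
  also have "\<dots> \<le> K * (1 + \<bar>l\<bar>) ^ k + \<bar>l\<bar> * (real k * K * (1 + \<bar>l\<bar>) ^ (k - 1))"
    by (intro add_mono mult_left_mono Suc.IH wave_tower_bound[of n]) (use Suc.prems assms(1) in auto)
  \<comment> \<open>The exponent k - 1 is truncated at k = 0, but there the factor
    \<open>real k\<close> makes the second summand 0.\<close>
  also have "\<dots> \<le> K * (1 + \<bar>l\<bar>) ^ k + real k * K * (1 + \<bar>l\<bar>) ^ k"
  proof (cases k)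
    case (Suc j)
    have "\<bar>l\<bar> * (1 + \<bar>l\<bar>) ^ j \<le> (1 + \<bar>l\<bar>) * (1 + \<bar>l\<bar>) ^ j" by (intro mult_right_mono) auto
    hence "real k * K * (\<bar>l\<bar> * (1 + \<bar>l\<bar>) ^ j) \<le> real k * K * ((1 + \<bar>l\<bar>) * (1 + \<bar>l\<bar>) ^ j)"
      using K by (intro mult_left_mono) auto
    thus ?thesis using Suc by (simp add: mult_ac)
  qed simp
  finally show ?case by (simp add: algebra_simps)
qed simp

text \<open>For frequency N a, the k-th derivative grows like N^k. Division by (i N)^k normalises it
  to a^k f(s) exp(i N a s) + O(1/N), and each further derivative is multiplication by i N together
  with a step in k.\<close>

definition wave_factor :: "(real \<Rightarrow> real) \<Rightarrow> real \<Rightarrow> real \<Rightarrow> nat \<Rightarrow> real \<Rightarrow> complex" where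
  "wave_factor f a N k s = wave_tower f (N * a) k 0 s / (\<i> * of_real N) ^ k"

lemma wave_factor_has_derivative:
  assumes "\<And>k. Ck k f" "N \<noteq> 0"
  shows "(wave_factor f a N k has_vector_derivative \<i> * of_real N * wave_factor f a N (Suc k) s) (at s)"
proof -
  have "((\<lambda>s. wave_tower f (N * a) k 0 s / (\<i> * of_real N) ^ k) has_vector_derivative
      wave_tower f (N * a) (Suc k) 0 s / (\<i> * of_real N) ^ k) (at s)"
    by (intro has_vector_derivative_divide wave_tower_has_derivative assms)
  thus ?thesis using assms(2) by (simp add: wave_factor_def[abs_def] del: wave_tower.simps)
qed

text \<open>K is found before N, so that N can be chosen large in terms of K. Orders up to 3 are
  covered because \<open>localized_wave\<close> applies third-order operators to its
  potential.\<close>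

lemma wave_factor_estimates:
  assumes "\<And>k. Ck k f" and supp: "\<And>s. r < \<bar>s - c\<bar> \<Longrightarrow> f s = 0"
  obtains K where "K > 0"
    "\<And>N k s. N \<ge> 1 \<Longrightarrow> k \<le> 3 \<Longrightarrow> norm (wave_factor f a N k s) \<le> K"
    "\<And>N k s. N \<ge> 1 \<Longrightarrow> k \<le> 3 \<Longrightarrow>
       norm (wave_factor f a N k s - of_real (a ^ k) * (of_real (f s) * cis (N * a * s))) \<le> K / N"
proof -
  have "\<exists>M>0. \<forall>s. \<bar>(deriv ^^ m) f s\<bar> \<le> M" for m
  proof -
    have "(deriv ^^ m) f s = 0" if "\<bar>r\<bar> + \<bar>c\<bar> < norm s" for s
      by (rule deriv_tower_support[of r c f, OF supp]) (use that in auto)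
    from compact_support_bound[OF smooth_deriv_tower(3)[OF assms(1)] this]
    show ?thesis by (metis real_norm_def)
  qed
  then obtain M where M: "\<And>m. M m > 0" "\<And>m s. \<bar>(deriv ^^ m) f s\<bar> \<le> M m" by metis
  define L where "L = M 0 + M 1 + M 2 + M 3"
  have L: "\<bar>(deriv ^^ m) f s\<bar> \<le> L" if "m \<le> 3" for m s
  proof -
    have "m = 0 \<or> m = 1 \<or> m = 2 \<or> m = 3" using that by auto
    thus ?thesis using M(2)[of m s] M(1)[of 0] M(1)[of 1] M(1)[of 2] M(1)[of 3]
      unfolding L_def by (elim disjE) (simp only:; linarith)+
  qed
  have Lp: "L > 0" unfolding L_def using M(1) by (simp add: add_pos_pos)
  define K where "K = 3 * L * (1 + \<bar>a\<bar>) ^ 3"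
  have Kp: "K > 0" unfolding K_def using Lp by simp
  have one: "1 + \<bar>N * a\<bar> \<le> N * (1 + \<bar>a\<bar>)" if "N \<ge> 1" for N :: real
    using that by (simp add: abs_mult algebra_simps)
  have b1: "norm (wave_factor f a N k s) \<le> K" if N: "N \<ge> 1" and k: "k \<le> 3" for N k s
  proof -
    have "norm (wave_tower f (N * a) k 0 s) \<le> L * (1 + \<bar>N * a\<bar>) ^ k"
      by (rule wave_tower_bound[of 3]) (use L k in auto)
    also have "\<dots> \<le> L * (N * (1 + \<bar>a\<bar>)) ^ k"
      using Lp by (intro mult_left_mono power_mono one N) auto
    also have "\<dots> \<le> L * (N ^ k * (1 + \<bar>a\<bar>) ^ 3)"
      using Lp N k by (simp add: power_mult_distrib mult_left_mono power_increasing)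
    also have "\<dots> \<le> K * N ^ k"
      unfolding K_def using Lp N by (simp add: mult_ac)
    finally show ?thesis using N unfolding wave_factor_def
      by (simp add: norm_divide norm_mult norm_power divide_simps)
  qed
  have b2: "norm (wave_factor f a N k s - of_real (a ^ k) * (of_real (f s) * cis (N * a * s))) \<le> K / N"
    if N: "N \<ge> 1" and k: "k \<le> 3" for N k s
  proof (cases "k = 0")
    case True
    thus ?thesis using Kp N by (simp add: wave_factor_def)
  next
    case False
    define w where "w = (\<i> * complex_of_real N) ^ k"
    have w: "norm w = N ^ k" "w \<noteq> 0" using N unfolding w_def by (auto simp: norm_power norm_mult)
    have eq: "wave_factor f a N k s - of_real (a ^ k) * (of_real (f s) * cis (N * a * s))
      = (wave_tower f (N * a) k 0 s - (\<i> * of_real (N * a)) ^ k * (of_real (f s) * cis (N * a * s))) / w"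
      using w(2) unfolding wave_factor_def w_def by (simp add: field_simps power_mult_distrib)
    have "norm (wave_tower f (N * a) k 0 s - (\<i> * of_real (N * a)) ^ k * (of_real (f s) * cis (N * a * s)))
      \<le> real k * L * (1 + \<bar>N * a\<bar>) ^ (k - 1)"
      by (rule wave_tower_leading[of 3]) (use L k in auto)
    also have "\<dots> \<le> 3 * L * (N * (1 + \<bar>a\<bar>)) ^ (k - 1)"
      using Lp k by (intro mult_mono power_mono one N) auto
    also have "\<dots> \<le> 3 * L * (N ^ (k - 1) * (1 + \<bar>a\<bar>) ^ 3)"
      using Lp N k by (simp add: power_mult_distrib mult_left_mono power_increasing)
    also have "\<dots> = K / N * N ^ k"
      using False N unfolding K_def by (cases k) (auto simp: field_simps)
    finally show ?thesis unfolding eq using w N by (simp add: norm_divide divide_simps)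
  qed
  show ?thesis using that Kp b1 b2 by blast
qed

lemma integration_by_parts:
  fixes \<psi> :: "(real^2) \<times> real \<Rightarrow> real"
  assumes "test_function \<psi>" "continuous_on UNIV Y" "continuous_on UNIV Y'"
    and der: "\<And>y. ((\<lambda>t. Y (y + t *\<^sub>R e)) has_real_derivative Y' y) (at 0)"
  shows "has_bochner_integral lborel (\<lambda>y. Y y * frechet_derivative \<psi> (at y) e)
    (- integral\<^sup>L lborel (\<lambda>y. Y' y * \<psi> y))"
proof -
  let ?D = "\<lambda>y. frechet_derivative \<psi> (at y) e"
  obtain K where K: "K > 0" "\<And>z. K < norm z \<Longrightarrow> \<psi> z = 0" "\<And>z. K < norm z \<Longrightarrow> ?D z = 0"
    using test_function_bounded_support[OF assms(1)] by metis
  have c\<psi>: "continuous_on UNIV \<psi>" "continuous_on UNIV ?D"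
    by (rule test_function_continuous[OF assms(1)], rule test_function_has_derivative(2)[OF assms(1)])
  have c: "continuous_on UNIV (\<lambda>y. Y y * \<psi> y)" "continuous_on UNIV (\<lambda>y. Y' y * \<psi> y)" "continuous_on UNIV (\<lambda>y. Y y * ?D y)"
    by (intro continuous_on_mult assms c\<psi>)+
  have i: "integrable lborel (\<lambda>y. Y' y * \<psi> y)" "integrable lborel (\<lambda>y. Y y * ?D y)"
    using compact_support_integrable[OF c(2), of K "\<lambda>_. 1" 1] compact_support_integrable[OF c(3), of K "\<lambda>_. 1" 1] K by auto
  have "continuous_on UNIV (\<lambda>y. Y' y * \<psi> y + Y y * ?D y)" by (intro continuous_intros c)
  then obtain M1 where M1: "M1 > 0" "\<And>y. norm (Y' y * \<psi> y + Y y * ?D y) \<le> M1"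
    using compact_support_bound[of "\<lambda>y. Y' y * \<psi> y + Y y * ?D y" K] K by auto
  obtain M2 where M2: "M2 > 0" "\<And>y. norm (Y y * \<psi> y) \<le> M2"
    using compact_support_bound[OF c(1), of K] K by auto
  have "integral\<^sup>L lborel (\<lambda>y. Y' y * \<psi> y + Y y * ?D y) = 0"
  proof (rule integral_directional_derivative_eq_0[where h = "\<lambda>y. Y y * \<psi> y" and M = "max M1 M2" and e = e])
    fix y
    have "((\<lambda>t. \<psi> (y + t *\<^sub>R e)) has_real_derivative ?D y) (at 0)"
      by (rule directional_real_derivative[OF test_function_has_derivative(1)[OF assms(1)]])
    from DERIV_mult[OF der[of y] this]
    show "((\<lambda>t. Y (y + t *\<^sub>R e) * \<psi> (y + t *\<^sub>R e)) has_real_derivative Y' y * \<psi> y + Y y * ?D y) (at 0)"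
      by (simp add: algebra_simps)
    show "\<bar>Y' y * \<psi> y + Y y * ?D y\<bar> \<le> max M1 M2" "\<bar>Y y * \<psi> y\<bar> \<le> max M1 M2"
      using M1(2)[of y] M2(2)[of y] by auto
    show "K < norm y \<Longrightarrow> Y y * \<psi> y = 0" using K by simp
  qed (use c(1) in \<open>rule borel_measurable_continuous_onI\<close>)
  hence "integral\<^sup>L lborel (\<lambda>y. Y y * ?D y) = - integral\<^sup>L lborel (\<lambda>y. Y' y * \<psi> y)"
    using i by (simp add: Bochner_Integration.integral_add)
  thus ?thesis using i(2) by (simp add: has_bochner_integral_iff)
qed

text \<open>
  Velocities are written as complex numbers \<open>v\<^sub>1 + \<i> v\<^sub>2\<close> and trace-free symmetric matrices with first
  row \<open>(c, d)\<close> as \<open>c + \<i> d\<close>, so that the trace-free part of \<open>v \<otimes> v\<close> is \<open>v\<^sup>2/2\<close>.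
\<close>

definition euler_null :: "((real^2) \<times> real \<Rightarrow> complex) \<Rightarrow> ((real^2) \<times> real \<Rightarrow> complex) \<Rightarrow> bool" where
  "euler_null V Q \<longleftrightarrow> (\<forall>\<psi> :: (real^2) \<times> real \<Rightarrow> real. test_function \<psi> \<longrightarrow>
     integral\<^sup>L lborel (\<lambda>z. Re (V z) * dx 1 \<psi> z + Im (V z) * dx 2 \<psi> z) = 0 \<and>
     integral\<^sup>L lborel (\<lambda>z. Re (V z) * dt \<psi> z + Re (Q z) * dx 1 \<psi> z + Im (Q z) * dx 2 \<psi> z) = 0 \<and>
     integral\<^sup>L lborel (\<lambda>z. Im (V z) * dt \<psi> z + Im (Q z) * dx 1 \<psi> z - Re (Q z) * dx 2 \<psi> z) = 0)"

text \<open>Telescoping: one factor is replaced at a time, the other two being bounded by K.\<close>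

lemma product_bound_leading:
  fixes a b c a' b' c' :: complex
  assumes "norm a \<le> K" "norm b \<le> K" "norm c \<le> K" "norm a' \<le> K" "norm b' \<le> K" "norm c' \<le> K"
    and "norm (a - a') \<le> d" "norm (b - b') \<le> d" "norm (c - c') \<le> d"
  shows "norm (a * b * c - a' * b' * c') \<le> 3 * K ^ 2 * d"
proof -
  have K: "K \<ge> 0" and d: "d \<ge> 0" using assms(1,7) norm_ge_zero order_trans by blast+
  have "a * b * c - a' * b' * c' = (a - a') * b * c + a' * (b - b') * c + a' * b' * (c - c')"
    by (simp add: algebra_simps)
  also have "norm \<dots> \<le> norm ((a - a') * b * c) + norm (a' * (b - b') * c) + norm (a' * b' * (c - c'))"
    by (intro norm_triangle_le add_mono order_refl)
  also have "\<dots> \<le> d * K * K + K * d * K + K * K * d"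
    unfolding norm_mult using K d by (intro add_mono mult_mono assms) auto
  finally show ?thesis by (simp add: power2_eq_square algebra_simps)
qed

lemma measure_ball_le_cube:
  fixes y0 :: "(real^2) \<times> real"
  assumes "r > 0"
  shows "measure lborel (ball y0 r) \<le> (2 * r) ^ 3"
    and "measure lborel (cbox (y0 - (r/4) *\<^sub>R One) (y0 + (r/4) *\<^sub>R One)) = (r / 2) ^ 3"
proof -
  have *: "measure lborel (cbox (y0 - s *\<^sub>R One) (y0 + s *\<^sub>R One)) = (2 * s) ^ 3" if "s > 0" for s
  proof -
    have "\<forall>b\<in>Basis. (y0 - s *\<^sub>R One) \<bullet> b \<le> (y0 + s *\<^sub>R One) \<bullet> b"
      using that by (simp add: inner_simps)
    hence "measure lborel (cbox (y0 - s *\<^sub>R One) (y0 + s *\<^sub>R One)) = (\<Prod>b\<in>(Basis::((real^2) \<times> real) set). 2 * s)"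
      by (subst content_cbox) (auto simp: inner_simps intro!: prod.cong)
    thus ?thesis by simp
  qed
  have "ball y0 r \<subseteq> cbox (y0 - r *\<^sub>R One) (y0 + r *\<^sub>R One)"
  proof
    fix y assume "y \<in> ball y0 r"
    hence n: "norm (y - y0) < r" by (simp add: dist_norm norm_minus_commute)
    have "\<bar>(y - y0) \<bullet> b\<bar> \<le> r" if "b \<in> Basis" for b
      using Basis_le_norm[OF that, of "y - y0"] n by linarith
    thus "y \<in> cbox (y0 - r *\<^sub>R One) (y0 + r *\<^sub>R One)"
      by (force simp: mem_box inner_simps abs_le_iff)
  qed
  hence "measure lborel (ball y0 r) \<le> measure lborel (cbox (y0 - r *\<^sub>R One) (y0 + r *\<^sub>R One))"
    by (intro measure_mono_fmeasurable) (auto intro: fmeasurable_cbox)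
  thus "measure lborel (ball y0 r) \<le> (2 * r) ^ 3" using *[OF assms] by simp
  show "measure lborel (cbox (y0 - (r/4) *\<^sub>R One) (y0 + (r/4) *\<^sub>R One)) = (r / 2) ^ 3"
    using *[of "r/4"] assms by simp
qed

lemma norm_Pair_vec2: "norm (y :: (real^2) \<times> real)
    = sqrt ((fst y $ 1)\<^sup>2 + (fst y $ 2)\<^sup>2 + (snd y)\<^sup>2)"
  by (cases y) (simp add: norm_Pair norm_vec_def L2_set_def UNIV_2 real_norm_def)

text \<open>The squared envelope is at least exp(-24) on a cube of at least 1/64 of the volume of
  the ball. Choosing the better of two phases costs a factor 2, passing from the leading term to the
  wave another factor 2 and an error of exp(-24)/512: in total 1/256 - 1/512.\<close>

definition wave_const :: real where "wave_const = exp (-24) / 512"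

lemma wave_const_pos: "wave_const > 0" by (simp add: wave_const_def)

text \<open>Every scalar potential phi solves the linear system exactly through V = (- d2 Lap phi,
  d1 Lap phi) and Q = (2 d1 d2 dt phi, (d2^2 - d1^2) dt phi), so a plane wave is cut off inside the
  potential without destroying the equations. For phi of frequency N, the derivatives that fall on
  the cutoff are smaller by a factor 1/N; to leading order V and Q are then real multiples of e and
  of i \<beta> e^2.\<close>

lemma localized_wave:
  fixes e :: complex and \<beta> \<epsilon> r :: real and y0 :: "(real^2) \<times> real"
  assumes e: "norm e = 1" and \<epsilon>: "\<epsilon> > 0" and r: "r > 0"
  obtains V Q :: "(real^2) \<times> real \<Rightarrow> complex" where
    "continuous_on UNIV V" "continuous_on UNIV Q"
    "\<And>y. y \<notin> ball y0 r \<Longrightarrow> V y = 0" "\<And>y. y \<notin> ball y0 r \<Longrightarrow> Q y = 0"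
    "euler_null V Q"
    "integral\<^sup>L lborel (\<lambda>y. Re (V y)) = 0" "integral\<^sup>L lborel (\<lambda>y. Im (V y)) = 0"
    "\<And>y. \<exists>\<sigma>. \<bar>\<sigma>\<bar> \<le> 1 \<and> norm (V y - of_real \<sigma> * e) \<le> \<epsilon> \<and> norm (Q y - of_real \<sigma> * (\<i> * of_real \<beta> * e\<^sup>2)) \<le> \<epsilon>"
    "wave_const * measure lborel (ball y0 r) \<le> integral\<^sup>L lborel (\<lambda>y. (norm (V y))\<^sup>2)"
proof -
  \<comment> \<open>The spatial wave vector is orthogonal to e because V is free of divergence;
    \<beta> is the frequency in time.\<close>
  define \<xi> where "\<xi> = - \<i> * e"
  define a1 a2 where "a1 = Re \<xi>" and "a2 = Im \<xi>"
  have xi1: "a1\<^sup>2 + a2\<^sup>2 = 1" using e unfolding a1_def a2_def \<xi>_def by (simp add: cmod_def add.commute)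
  have e12: "e = Complex (- a2) a1" unfolding a1_def a2_def \<xi>_def by (simp add: complex_eq_iff)
  define f1 f2 f3 where "f1 = scaled_bump (fst y0 $ 1) (r/2)" and "f2 = scaled_bump (fst y0 $ 2) (r/2)"
    and "f3 = scaled_bump (snd y0) (r/2)"
  have sm: "Ck k f1" "Ck k f2" "Ck k f3" for k unfolding f1_def f2_def f3_def by (rule scaled_bump_smooth)+
  have sp: "r/2 < \<bar>s - fst y0 $ 1\<bar> \<Longrightarrow> f1 s = 0" "r/2 < \<bar>s - fst y0 $ 2\<bar> \<Longrightarrow> f2 s = 0"
     "r/2 < \<bar>s - snd y0\<bar> \<Longrightarrow> f3 s = 0" for s
    unfolding f1_def f2_def f3_def using r by (auto intro: scaled_bump_support)
  obtain K1 where K1: "K1 > 0" "\<And>N k s. N \<ge> 1 \<Longrightarrow> k \<le> 3 \<Longrightarrow> norm (wave_factor f1 a1 N k s) \<le> K1"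
    "\<And>N k s. N \<ge> 1 \<Longrightarrow> k \<le> 3 \<Longrightarrow>
       norm (wave_factor f1 a1 N k s - of_real (a1 ^ k) * (of_real (f1 s) * cis (N * a1 * s))) \<le> K1 / N"
    using wave_factor_estimates[OF sm(1) sp(1)] by blast
  obtain K2 where K2: "K2 > 0" "\<And>N k s. N \<ge> 1 \<Longrightarrow> k \<le> 3 \<Longrightarrow> norm (wave_factor f2 a2 N k s) \<le> K2"
    "\<And>N k s. N \<ge> 1 \<Longrightarrow> k \<le> 3 \<Longrightarrow>
       norm (wave_factor f2 a2 N k s - of_real (a2 ^ k) * (of_real (f2 s) * cis (N * a2 * s))) \<le> K2 / N"
    using wave_factor_estimates[OF sm(2) sp(2)] by blast
  obtain K3 where K3: "K3 > 0" "\<And>N k s. N \<ge> 1 \<Longrightarrow> k \<le> 3 \<Longrightarrow> norm (wave_factor f3 \<beta> N k s) \<le> K3"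
    "\<And>N k s. N \<ge> 1 \<Longrightarrow> k \<le> 3 \<Longrightarrow>
       norm (wave_factor f3 \<beta> N k s - of_real (\<beta> ^ k) * (of_real (f3 s) * cis (N * \<beta> * s))) \<le> K3 / N"
    using wave_factor_estimates[OF sm(3) sp(3)] by blast
  \<comment> \<open>The last summand bounds the powers of \<beta> and 1, so that K majorises the
    leading terms as well as the exact factors.\<close>
  define K where "K = K1 + K2 + K3 + (1 + \<bar>\<beta>\<bar>) ^ 3"
  have K: "K > 0" "K1 \<le> K" "K2 \<le> K" "K3 \<le> K" "(1 + \<bar>\<beta>\<bar>) ^ 3 \<le> K"
    unfolding K_def using K1 K2 K3 by (auto simp: add_pos_pos)
  \<comment> \<open>The second bound keeps \<epsilon>'^2 below exp(-24)/512, half of what the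
    leading term contributes to the energy.\<close>
  define \<epsilon>' where "\<epsilon>' = min \<epsilon> (exp (-24) / 512)"
  have \<epsilon>': "\<epsilon>' > 0" "\<epsilon>' \<le> \<epsilon>" "\<epsilon>'\<^sup>2 \<le> exp (-24) / 512"
  proof -
    show e0: "\<epsilon>' > 0" "\<epsilon>' \<le> \<epsilon>" using \<epsilon> unfolding \<epsilon>'_def by auto
    have "\<epsilon>' \<le> exp (-24) / 512" unfolding \<epsilon>'_def by simp
    moreover have "exp (-24) \<le> (1::real)" by simp
    ultimately have "\<epsilon>' \<le> exp (-24) / 512" "\<epsilon>' \<le> 1" by linarith+
    hence "\<epsilon>' * \<epsilon>' \<le> exp (-24) / 512 * 1" using e0 by (intro mult_mono) auto
    thus "\<epsilon>'\<^sup>2 \<le> exp (-24) / 512" by (simp add: power2_eq_square)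
  qed
  \<comment> \<open>A product of three factors is off by 3 K^2 K/N. The 4 pays for two real
    components, each consisting of two terms or of one term taken twice.\<close>
  define N where "N = max 1 (4 * (3 * K\<^sup>2 * K) / \<epsilon>')"
  have N: "N \<ge> 1" "N \<noteq> 0" unfolding N_def by auto
  have small: "4 * (3 * K\<^sup>2 * (K / N)) \<le> \<epsilon>'"
  proof -
    have "4 * (3 * K\<^sup>2 * K) / \<epsilon>' \<le> N" unfolding N_def by simp
    thus ?thesis using \<epsilon>'(1) N by (simp add: field_simps)
  qed
  define X where "X i j k y = wave_factor f1 a1 N i (fst y $ 1) * wave_factor f2 a2 N j (fst y $ 2)
      * wave_factor f3 \<beta> N k (snd y)" for i j k and y :: "(real^2) \<times> real"
  define \<Phi> where "\<Phi> y = f1 (fst y $ 1) * f2 (fst y $ 2) * f3 (snd y)" for y :: "(real^2) \<times> real"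
  define \<theta> where "\<theta> y = cis (N * a1 * fst y $ 1) * cis (N * a2 * fst y $ 2) * cis (N * \<beta> * snd y)" for y :: "(real^2) \<times> real"
  have f01: "0 \<le> f1 s" "f1 s \<le> 1" "0 \<le> f2 s" "f2 s \<le> 1" "0 \<le> f3 s" "f3 s \<le> 1" for s
    unfolding f1_def f2_def f3_def scaled_bump_def by (auto simp: bump_nonneg bump_le_1)
  have \<Phi>01: "0 \<le> \<Phi> y" "\<Phi> y \<le> 1" for y
    unfolding \<Phi>_def using f01 by (auto intro!: mult_le_one mult_nonneg_nonneg)
  have wfd: "(wave_factor f1 a1 N k has_vector_derivative \<i> * of_real N * wave_factor f1 a1 N (Suc k) s) (at s)"
    "(wave_factor f2 a2 N k has_vector_derivative \<i> * of_real N * wave_factor f2 a2 N (Suc k) s) (at s)"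
    "(wave_factor f3 \<beta> N k has_vector_derivative \<i> * of_real N * wave_factor f3 \<beta> N (Suc k) s) (at s)" for k s
    by (intro wave_factor_has_derivative sm N)+
  have wfc: "continuous_on UNIV (wave_factor f1 a1 N k)" "continuous_on UNIV (wave_factor f2 a2 N k)"
    "continuous_on UNIV (wave_factor f3 \<beta> N k)" for k
    using wfd has_vector_derivative_continuous by (blast intro: continuous_at_imp_continuous_on)+
  have Xc: "continuous_on UNIV (X i j k)" for i j k
  proof -
    have "continuous_on UNIV (\<lambda>y :: (real^2) \<times> real. wave_factor f1 a1 N i (fst y $ 1))"
      "continuous_on UNIV (\<lambda>y :: (real^2) \<times> real. wave_factor f2 a2 N j (fst y $ 2))"
      "continuous_on UNIV (\<lambda>y :: (real^2) \<times> real. wave_factor f3 \<beta> N k (snd y))"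
      by (rule continuous_on_compose2[OF wfc(1)] continuous_on_compose2[OF wfc(2)] continuous_on_compose2[OF wfc(3)];
          auto intro!: continuous_intros)+
    thus ?thesis unfolding X_def[abs_def] by (intro continuous_intros)
  qed
  have sh: "((\<lambda>t. g (c + t)) has_vector_derivative g') (at 0)"
    if "(g has_vector_derivative g') (at c)" for g :: "real \<Rightarrow> complex" and g' c
  proof -
    have "((+) c has_vector_derivative 1) (at 0)"
      by (auto intro!: derivative_eq_intros simp flip: has_real_derivative_iff_has_vector_derivative)
    from vector_diff_chain_at[OF this, of g g'] show ?thesis using that by (simp add: o_def)
  qed
  have Xd: "((\<lambda>t. X i j k (y + t *\<^sub>R (axis 1 1, 0))) has_vector_derivative \<i> * of_real N * X (Suc i) j k y) (at 0)"
    "((\<lambda>t. X i j k (y + t *\<^sub>R (axis 2 1, 0))) has_vector_derivative \<i> * of_real N * X i (Suc j) k y) (at 0)"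
    "((\<lambda>t. X i j k (y + t *\<^sub>R (0, 1))) has_vector_derivative \<i> * of_real N * X i j (Suc k) y) (at 0)" for i j k y
  proof -
    have 1: "(\<lambda>t. X i j k (y + t *\<^sub>R (axis 1 1, 0))) = (\<lambda>t. wave_factor f1 a1 N i (fst y $ 1 + t)
       * (wave_factor f2 a2 N j (fst y $ 2) * wave_factor f3 \<beta> N k (snd y)))"
      by (auto simp: X_def axis_def fun_eq_iff)
    have 2: "(\<lambda>t. X i j k (y + t *\<^sub>R (axis 2 1, 0))) = (\<lambda>t. wave_factor f2 a2 N j (fst y $ 2 + t)
       * (wave_factor f1 a1 N i (fst y $ 1) * wave_factor f3 \<beta> N k (snd y)))"
      by (auto simp: X_def axis_def fun_eq_iff)
    have 3: "(\<lambda>t. X i j k (y + t *\<^sub>R (0, 1))) = (\<lambda>t. wave_factor f3 \<beta> N k (snd y + t)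
       * (wave_factor f1 a1 N i (fst y $ 1) * wave_factor f2 a2 N j (fst y $ 2)))"
      by (auto simp: X_def axis_def fun_eq_iff)
    show "((\<lambda>t. X i j k (y + t *\<^sub>R (axis 1 1, 0))) has_vector_derivative \<i> * of_real N * X (Suc i) j k y) (at 0)"
      unfolding 1 using has_vector_derivative_mult_left[OF sh[OF wfd(1)[of i "fst y $ 1"]], of "wave_factor f2 a2 N j (fst y $ 2) * wave_factor f3 \<beta> N k (snd y)"]
      by (simp add: X_def mult_ac)
    show "((\<lambda>t. X i j k (y + t *\<^sub>R (axis 2 1, 0))) has_vector_derivative \<i> * of_real N * X i (Suc j) k y) (at 0)"
      unfolding 2 using has_vector_derivative_mult_left[OF sh[OF wfd(2)[of j "fst y $ 2"]], of "wave_factor f1 a1 N i (fst y $ 1) * wave_factor f3 \<beta> N k (snd y)"]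
      by (simp add: X_def mult_ac)
    show "((\<lambda>t. X i j k (y + t *\<^sub>R (0, 1))) has_vector_derivative \<i> * of_real N * X i j (Suc k) y) (at 0)"
      unfolding 3 using has_vector_derivative_mult_left[OF sh[OF wfd(3)[of k "snd y"]], of "wave_factor f1 a1 N i (fst y $ 1) * wave_factor f2 a2 N j (fst y $ 2)"]
      by (simp add: X_def mult_ac)
  qed
  have Xs: "X i j k y = 0" if "y \<notin> ball y0 r" for i j k y
  proof -
    have "\<not> (\<bar>fst y $ 1 - fst y0 $ 1\<bar> \<le> r/2 \<and> \<bar>fst y $ 2 - fst y0 $ 2\<bar> \<le> r/2 \<and> \<bar>snd y - snd y0\<bar> \<le> r/2)"
    proof
      assume "\<bar>fst y $ 1 - fst y0 $ 1\<bar> \<le> r/2 \<and> \<bar>fst y $ 2 - fst y0 $ 2\<bar> \<le> r/2 \<and> \<bar>snd y - snd y0\<bar> \<le> r/2"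
      hence "(fst y $ 1 - fst y0 $ 1)\<^sup>2 \<le> (r/2)\<^sup>2" "(fst y $ 2 - fst y0 $ 2)\<^sup>2 \<le> (r/2)\<^sup>2" "(snd y - snd y0)\<^sup>2 \<le> (r/2)\<^sup>2"
        using r by (auto simp: abs_le_square_iff[symmetric])
      moreover have "(r/2)\<^sup>2 + (r/2)\<^sup>2 + (r/2)\<^sup>2 < r\<^sup>2" using r by (simp add: field_simps power2_eq_square)
      ultimately have "sqrt ((fst (y - y0) $ 1)\<^sup>2 + (fst (y - y0) $ 2)\<^sup>2 + (snd (y - y0))\<^sup>2) < sqrt (r\<^sup>2)"
        by (intro real_sqrt_less_mono) simp
      hence "norm (y - y0) < r" unfolding norm_Pair_vec2 using r by simp
      thus False using that by (simp add: dist_norm norm_minus_commute)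
    qed
    thus ?thesis unfolding X_def wave_factor_def
      using wave_tower_support[where f = f1 and r = "r/2" and c = "fst y0 $ 1" and s = "fst y $ 1" and m = 0, OF sp(1)]
        wave_tower_support[where f = f2 and r = "r/2" and c = "fst y0 $ 2" and s = "fst y $ 2" and m = 0, OF sp(2)]
        wave_tower_support[where f = f3 and r = "r/2" and c = "snd y0" and s = "snd y" and m = 0, OF sp(3)] by force
  qed
  have a12: "\<bar>a1\<bar> \<le> 1" "\<bar>a2\<bar> \<le> 1"
    using xi1 by (simp_all add: abs_square_le_1[symmetric])
       (smt (verit) zero_le_power2)+
  have one_le: "1 \<le> K"
    using K(5) one_le_power[of "1 + \<bar>\<beta>\<bar>" 3] by linarith
  have Xl: "norm (X i j k y - of_real (a1 ^ i * a2 ^ j * \<beta> ^ k) * (of_real (\<Phi> y) * \<theta> y)) \<le> \<epsilon>' / 4"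
    if "i \<le> 3" "j \<le> 3" "k \<le> 3" for i j k y
  proof -
    have KN: "K1 / N \<le> K / N" "K2 / N \<le> K / N" "K3 / N \<le> K / N" using K N by (auto simp: divide_simps)
    have p1: "\<bar>a1 ^ i\<bar> \<le> 1" "\<bar>a2 ^ j\<bar> \<le> 1" using a12 by (auto simp: power_abs power_le_one)
    have p3: "\<bar>\<beta> ^ k\<bar> \<le> K"
    proof -
      have "\<bar>\<beta>\<bar> ^ k \<le> (1 + \<bar>\<beta>\<bar>) ^ k" by (intro power_mono) auto
      also have "\<dots> \<le> (1 + \<bar>\<beta>\<bar>) ^ 3" using that by (intro power_increasing) auto
      finally show ?thesis using K(5) by (simp add: power_abs)
    qed
    have nb: "norm (of_real (a1 ^ i) * (of_real (f1 s) * cis u)) \<le> K"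
       "norm (of_real (a2 ^ j) * (of_real (f2 s) * cis u)) \<le> K"
       "norm (of_real (\<beta> ^ k) * (of_real (f3 s) * cis u)) \<le> K" for s u
    proof -
      have "\<bar>a1 ^ i\<bar> * \<bar>f1 s\<bar> \<le> 1" "\<bar>a2 ^ j\<bar> * \<bar>f2 s\<bar> \<le> 1"
        using p1 f01[of s] by (auto intro!: mult_le_one)
      moreover have "\<bar>\<beta> ^ k\<bar> * \<bar>f3 s\<bar> \<le> K * 1" using p3 f01[of s] K by (intro mult_mono) auto
      moreover have "norm (complex_of_real p * (complex_of_real q * cis u)) = \<bar>p\<bar> * \<bar>q\<bar>" for p q
        by (simp only: norm_mult norm_of_real norm_cis mult_1_right)
      ultimately show "norm (of_real (a1 ^ i) * (of_real (f1 s) * cis u)) \<le> K"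
       "norm (of_real (a2 ^ j) * (of_real (f2 s) * cis u)) \<le> K"
       "norm (of_real (\<beta> ^ k) * (of_real (f3 s) * cis u)) \<le> K"
        using one_le by (simp_all only:)
    qed
    have "norm (X i j k y - (of_real (a1 ^ i) * (of_real (f1 (fst y $ 1)) * cis (N * a1 * fst y $ 1)))
        * (of_real (a2 ^ j) * (of_real (f2 (fst y $ 2)) * cis (N * a2 * fst y $ 2)))
        * (of_real (\<beta> ^ k) * (of_real (f3 (snd y)) * cis (N * \<beta> * snd y)))) \<le> 3 * K\<^sup>2 * (K / N)"
      unfolding X_def
      by (rule product_bound_leading)
        (use K1(2)[OF N(1) that(1)] K2(2)[OF N(1) that(2)] K3(2)[OF N(1) that(3)] K nb
          order_trans[OF K1(3)[OF N(1) that(1)] KN(1)] order_trans[OF K2(3)[OF N(1) that(2)] KN(2)]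
          order_trans[OF K3(3)[OF N(1) that(3)] KN(3)] in \<open>auto intro: order_trans\<close>)
    moreover have "(of_real (a1 ^ i) * (of_real (f1 (fst y $ 1)) * cis (N * a1 * fst y $ 1)))
        * (of_real (a2 ^ j) * (of_real (f2 (fst y $ 2)) * cis (N * a2 * fst y $ 2)))
        * (of_real (\<beta> ^ k) * (of_real (f3 (snd y)) * cis (N * \<beta> * snd y)))
      = of_real (a1 ^ i * a2 ^ j * \<beta> ^ k) * (of_real (\<Phi> y) * \<theta> y)"
      by (simp add: \<Phi>_def \<theta>_def mult_ac)
    ultimately have "norm (X i j k y - of_real (a1 ^ i * a2 ^ j * \<beta> ^ k) * (of_real (\<Phi> y) * \<theta> y)) \<le> 3 * K\<^sup>2 * (K / N)"
      by (simp only:)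
    thus ?thesis using small by linarith
  qed
  \<comment> \<open>The unit number \<omega> is a phase: 1 gives the cosine and -i the sine.
    Differentiation multiplies it by i N.\<close>
  define Y where "Y \<omega> i j k y = Re (\<omega> * X i j k y)" for \<omega> i j k y
  \<comment> \<open>The entries of V and Q are the third derivatives of the potential listed above,
    the three indices counting derivatives in x_1, x_2 and t.\<close>
  define V where "V \<omega> y = Complex (- (Y \<omega> 2 1 0 y + Y \<omega> 0 3 0 y)) (Y \<omega> 3 0 0 y + Y \<omega> 1 2 0 y)" for \<omega> y
  define Q where "Q \<omega> y = Complex (2 * Y \<omega> 1 1 1 y) (Y \<omega> 0 2 1 y - Y \<omega> 2 0 1 y)" for \<omega> y
  have Yc: "continuous_on UNIV (Y \<omega> i j k)" for \<omega> i j k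
    unfolding Y_def[abs_def] by (intro continuous_intros Xc)
  have Yd: "((\<lambda>t. Y \<omega> i j k (y + t *\<^sub>R (axis 1 1, 0))) has_real_derivative Y (\<omega> * \<i> * of_real N) (Suc i) j k y) (at 0)"
    "((\<lambda>t. Y \<omega> i j k (y + t *\<^sub>R (axis 2 1, 0))) has_real_derivative Y (\<omega> * \<i> * of_real N) i (Suc j) k y) (at 0)"
    "((\<lambda>t. Y \<omega> i j k (y + t *\<^sub>R (0, 1))) has_real_derivative Y (\<omega> * \<i> * of_real N) i j (Suc k) y) (at 0)" for \<omega> i j k y
  proof -
    show "((\<lambda>t. Y \<omega> i j k (y + t *\<^sub>R (axis 1 1, 0))) has_real_derivative Y (\<omega> * \<i> * of_real N) (Suc i) j k y) (at 0)"
      using bounded_linear.has_vector_derivative[OF bounded_linear_Re has_vector_derivative_mult_right[OF Xd(1), of \<omega>]]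
      by (simp add: Y_def has_real_derivative_iff_has_vector_derivative mult_ac)
    show "((\<lambda>t. Y \<omega> i j k (y + t *\<^sub>R (axis 2 1, 0))) has_real_derivative Y (\<omega> * \<i> * of_real N) i (Suc j) k y) (at 0)"
      using bounded_linear.has_vector_derivative[OF bounded_linear_Re has_vector_derivative_mult_right[OF Xd(2), of \<omega>]]
      by (simp add: Y_def has_real_derivative_iff_has_vector_derivative mult_ac)
    show "((\<lambda>t. Y \<omega> i j k (y + t *\<^sub>R (0, 1))) has_real_derivative Y (\<omega> * \<i> * of_real N) i j (Suc k) y) (at 0)"
      using bounded_linear.has_vector_derivative[OF bounded_linear_Re has_vector_derivative_mult_right[OF Xd(3), of \<omega>]]
      by (simp add: Y_def has_real_derivative_iff_has_vector_derivative mult_ac)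
  qed
  have Ys: "Y \<omega> i j k y = 0" if "y \<notin> ball y0 r" for \<omega> i j k y using Xs[OF that] by (simp add: Y_def)
  have far: "y \<notin> ball y0 r" if "norm y0 + r < norm y" for y
    using that norm_triangle_ineq2[of y y0] by (auto simp: dist_norm norm_minus_commute)
  have Yint: "has_bochner_integral lborel (Y \<omega> i j k) (integral\<^sup>L lborel (Y \<omega> i j k))" for \<omega> i j k
    using compact_support_integrable[OF Yc[of \<omega> i j k], where K = "norm y0 + r" and w = "\<lambda>_. 1" and B = 1] Ys[OF far]
    by (simp add: has_bochner_integral_iff)
  have Y0: "integral\<^sup>L lborel (Y \<omega> (Suc i) j k) = 0" "integral\<^sup>L lborel (Y \<omega> i (Suc j) k) = 0" for \<omega> i j k
  proof -
    \<comment> \<open>Undoes the factor i N of one derivative: each term of V contains a spatial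
      derivative and is therefore the derivative of a compactly supported function, of mean
      0.\<close>
    define \<omega>' where "\<omega>' = \<omega> / (\<i> * of_real N)"
    have w: "\<omega>' * \<i> * of_real N = \<omega>" using N unfolding \<omega>'_def by simp
    obtain M0 where M0: "\<And>y. norm (Y \<omega>' i j k y) \<le> M0"
      using compact_support_bound[OF Yc, of "norm y0 + r"] Ys[OF far] by metis
    obtain M1 where M1: "\<And>y. norm (Y \<omega> (Suc i) j k y) \<le> M1"
      using compact_support_bound[OF Yc, of "norm y0 + r"] Ys[OF far] by metis
    obtain M2 where M2: "\<And>y. norm (Y \<omega> i (Suc j) k y) \<le> M2"
      using compact_support_bound[OF Yc, of "norm y0 + r"] Ys[OF far] by metis
    show "integral\<^sup>L lborel (Y \<omega> (Suc i) j k) = 0"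
    proof (rule integral_directional_derivative_eq_0[where h = "Y \<omega>' i j k" and e = "(axis 1 1, 0)"
          and M = "max M0 M1" and K = "norm y0 + r"])
      fix y
      show "((\<lambda>t. Y \<omega>' i j k (y + t *\<^sub>R (axis 1 1, 0))) has_real_derivative Y \<omega> (Suc i) j k y) (at 0)"
        using Yd(1)[of \<omega>' i j k y] by (simp only: w)
      show "\<bar>Y \<omega> (Suc i) j k y\<bar> \<le> max M0 M1" "\<bar>Y \<omega>' i j k y\<bar> \<le> max M0 M1"
        using M0[of y] M1[of y] by auto
      show "norm y0 + r < norm y \<Longrightarrow> Y \<omega>' i j k y = 0" using Ys[OF far] by simp
    qed (rule borel_measurable_continuous_onI[OF Yc])
    show "integral\<^sup>L lborel (Y \<omega> i (Suc j) k) = 0"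
    proof (rule integral_directional_derivative_eq_0[where h = "Y \<omega>' i j k" and e = "(axis 2 1, 0)"
          and M = "max M0 M2" and K = "norm y0 + r"])
      fix y
      show "((\<lambda>t. Y \<omega>' i j k (y + t *\<^sub>R (axis 2 1, 0))) has_real_derivative Y \<omega> i (Suc j) k y) (at 0)"
        using Yd(2)[of \<omega>' i j k y] by (simp only: w)
      show "\<bar>Y \<omega> i (Suc j) k y\<bar> \<le> max M0 M2" "\<bar>Y \<omega>' i j k y\<bar> \<le> max M0 M2"
        using M0[of y] M2[of y] by auto
      show "norm y0 + r < norm y \<Longrightarrow> Y \<omega>' i j k y = 0" using Ys[OF far] by simp
    qed (rule borel_measurable_continuous_onI[OF Yc])
  qed
  have null: "euler_null (V \<omega>) (Q \<omega>)" for \<omega>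
    unfolding euler_null_def
  proof (intro allI impI conjI)
    fix \<psi> :: "(real^2) \<times> real \<Rightarrow> real" assume \<psi>: "test_function \<psi>"
    define Z where "Z i j k = integral\<^sup>L lborel (\<lambda>y. Y (\<omega> * \<i> * of_real N) i j k y * \<psi> y)" for i j k
    have I1: "has_bochner_integral lborel (\<lambda>y. Y \<omega> i j k y * dx 1 \<psi> y) (- Z (Suc i) j k)" for i j k
      unfolding Z_def dx_def by (rule integration_by_parts[OF \<psi> Yc Yc Yd(1)])
    have I2: "has_bochner_integral lborel (\<lambda>y. Y \<omega> i j k y * dx 2 \<psi> y) (- Z i (Suc j) k)" for i j k
      unfolding Z_def dx_def by (rule integration_by_parts[OF \<psi> Yc Yc Yd(2)])
    have I3: "has_bochner_integral lborel (\<lambda>y. Y \<omega> i j k y * dt \<psi> y) (- Z i j (Suc k))" for i j k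
      unfolding Z_def dt_def by (rule integration_by_parts[OF \<psi> Yc Yc Yd(3)])
    have "has_bochner_integral lborel (\<lambda>y. - (Y \<omega> 2 1 0 y * dx 1 \<psi> y + Y \<omega> 0 3 0 y * dx 1 \<psi> y)
        + (Y \<omega> 3 0 0 y * dx 2 \<psi> y + Y \<omega> 1 2 0 y * dx 2 \<psi> y))
       (- (- Z (Suc 2) 1 0 + - Z (Suc 0) 3 0) + (- Z 3 (Suc 0) 0 + - Z 1 (Suc 2) 0))"
      by (intro has_bochner_integral_add has_bochner_integral_minus I1 I2)
    thus "integral\<^sup>L lborel (\<lambda>z. Re (V \<omega> z) * dx 1 \<psi> z + Im (V \<omega> z) * dx 2 \<psi> z) = 0"
      by (simp add: has_bochner_integral_iff V_def algebra_simps numeral_eq_Suc)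
    have "has_bochner_integral lborel (\<lambda>y. - (Y \<omega> 2 1 0 y * dt \<psi> y + Y \<omega> 0 3 0 y * dt \<psi> y)
        + 2 * (Y \<omega> 1 1 1 y * dx 1 \<psi> y) + (Y \<omega> 0 2 1 y * dx 2 \<psi> y - Y \<omega> 2 0 1 y * dx 2 \<psi> y))
       (- (- Z 2 1 (Suc 0) + - Z 0 3 (Suc 0)) + 2 * (- Z (Suc 1) 1 1) + (- Z 0 (Suc 2) 1 - - Z 2 (Suc 0) 1))"
      by (intro has_bochner_integral_add has_bochner_integral_diff has_bochner_integral_minus
           has_bochner_integral_mult_right I1 I2 I3)
    thus "integral\<^sup>L lborel (\<lambda>z. Re (V \<omega> z) * dt \<psi> z + Re (Q \<omega> z) * dx 1 \<psi> z + Im (Q \<omega> z) * dx 2 \<psi> z) = 0"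
      by (simp add: has_bochner_integral_iff V_def Q_def algebra_simps numeral_eq_Suc)
    have "has_bochner_integral lborel (\<lambda>y. (Y \<omega> 3 0 0 y * dt \<psi> y + Y \<omega> 1 2 0 y * dt \<psi> y)
        + (Y \<omega> 0 2 1 y * dx 1 \<psi> y - Y \<omega> 2 0 1 y * dx 1 \<psi> y) - 2 * (Y \<omega> 1 1 1 y * dx 2 \<psi> y))
       ((- Z 3 0 (Suc 0) + - Z 1 2 (Suc 0)) + (- Z (Suc 0) 2 1 - - Z (Suc 2) 0 1) - 2 * (- Z 1 (Suc 1) 1))"
      by (intro has_bochner_integral_add has_bochner_integral_diff has_bochner_integral_minus
           has_bochner_integral_mult_right I1 I2 I3)
    thus "integral\<^sup>L lborel (\<lambda>z. Im (V \<omega> z) * dt \<psi> z + Im (Q \<omega> z) * dx 1 \<psi> z - Re (Q \<omega> z) * dx 2 \<psi> z) = 0"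
      by (simp add: has_bochner_integral_iff V_def Q_def algebra_simps numeral_eq_Suc)
  qed
  have mean: "integral\<^sup>L lborel (\<lambda>y. Re (V \<omega> y)) = 0" "integral\<^sup>L lborel (\<lambda>y. Im (V \<omega> y)) = 0" for \<omega>
  proof -
    have "has_bochner_integral lborel (\<lambda>y. - (Y \<omega> 2 1 0 y + Y \<omega> 0 3 0 y))
      (- (integral\<^sup>L lborel (Y \<omega> 2 1 0) + integral\<^sup>L lborel (Y \<omega> 0 3 0)))"
      by (intro has_bochner_integral_add has_bochner_integral_minus Yint)
    thus "integral\<^sup>L lborel (\<lambda>y. Re (V \<omega> y)) = 0"
      using Y0(1)[of \<omega> 1 1 0] Y0(2)[of \<omega> 0 2 0] by (simp add: has_bochner_integral_iff V_def numeral_eq_Suc)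
    have "has_bochner_integral lborel (\<lambda>y. Y \<omega> 3 0 0 y + Y \<omega> 1 2 0 y)
      (integral\<^sup>L lborel (Y \<omega> 3 0 0) + integral\<^sup>L lborel (Y \<omega> 1 2 0))"
      by (intro has_bochner_integral_add has_bochner_integral_minus Yint)
    thus "integral\<^sup>L lborel (\<lambda>y. Im (V \<omega> y)) = 0"
      using Y0(1)[of \<omega> 2 0 0] Y0(2)[of \<omega> 1 1 0] by (simp add: has_bochner_integral_iff V_def numeral_eq_Suc)
  qed
  define S where "S \<omega> y = Re (\<omega> * (of_real (\<Phi> y) * \<theta> y))" for \<omega> y
  have n\<theta>: "norm (\<theta> y) = 1" for y unfolding \<theta>_def by (simp add: norm_mult)
  have S1: "\<bar>S \<omega> y\<bar> \<le> 1" if "norm \<omega> = 1" for \<omega> y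
  proof -
    have "\<bar>S \<omega> y\<bar> \<le> norm (\<omega> * (of_real (\<Phi> y) * \<theta> y))" unfolding S_def by (rule abs_Re_le_cmod)
    also have "\<dots> \<le> 1" using that n\<theta>[of y] \<Phi>01[of y] by (simp add: norm_mult)
    finally show ?thesis .
  qed
  have Yl: "\<bar>Y \<omega> i j k y - a1 ^ i * a2 ^ j * \<beta> ^ k * S \<omega> y\<bar> \<le> \<epsilon>' / 4"
    if "i \<le> 3" "j \<le> 3" "k \<le> 3" "norm \<omega> = 1" for \<omega> i j k y
  proof -
    have "Y \<omega> i j k y - a1 ^ i * a2 ^ j * \<beta> ^ k * S \<omega> y
      = Re (\<omega> * (X i j k y - of_real (a1 ^ i * a2 ^ j * \<beta> ^ k) * (of_real (\<Phi> y) * \<theta> y)))"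
    proof -
      have "\<omega> * (X i j k y - of_real (a1 ^ i * a2 ^ j * \<beta> ^ k) * (of_real (\<Phi> y) * \<theta> y))
         = \<omega> * X i j k y - of_real (a1 ^ i * a2 ^ j * \<beta> ^ k) * (\<omega> * (of_real (\<Phi> y) * \<theta> y))"
        by (simp add: algebra_simps)
      moreover have "Re (of_real p * z) = p * Re z" for p z by simp
      ultimately show ?thesis unfolding Y_def S_def by (simp only: minus_complex.sel)
    qed
    also have "\<bar>\<dots>\<bar> \<le> norm (\<omega> * (X i j k y - of_real (a1 ^ i * a2 ^ j * \<beta> ^ k) * (of_real (\<Phi> y) * \<theta> y)))"
      by (rule abs_Re_le_cmod)
    also have "\<dots> \<le> \<epsilon>' / 4" using Xl[OF that(1-3)] that(4) by (simp add: norm_mult)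
    finally show ?thesis .
  qed
  have lead: "norm (V \<omega> y - of_real (S \<omega> y) * e) \<le> \<epsilon>'" "norm (Q \<omega> y - of_real (S \<omega> y) * (\<i> * of_real \<beta> * e\<^sup>2)) \<le> \<epsilon>'"
    if w: "norm \<omega> = 1" for \<omega> y
  proof -
    have q1: "\<bar>Y \<omega> 2 1 0 y - a1\<^sup>2 * a2 * S \<omega> y\<bar> \<le> \<epsilon>' / 4" using Yl[of 2 1 0, OF _ _ _ w] by simp
    have q2: "\<bar>Y \<omega> 0 3 0 y - a2 ^ 3 * S \<omega> y\<bar> \<le> \<epsilon>' / 4" using Yl[of 0 3 0, OF _ _ _ w] by simp
    have q3: "\<bar>Y \<omega> 3 0 0 y - a1 ^ 3 * S \<omega> y\<bar> \<le> \<epsilon>' / 4" using Yl[of 3 0 0, OF _ _ _ w] by simp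
    have q4: "\<bar>Y \<omega> 1 2 0 y - a1 * a2\<^sup>2 * S \<omega> y\<bar> \<le> \<epsilon>' / 4" using Yl[of 1 2 0, OF _ _ _ w] by simp
    have q5: "\<bar>Y \<omega> 1 1 1 y - a1 * a2 * \<beta> * S \<omega> y\<bar> \<le> \<epsilon>' / 4" using Yl[of 1 1 1, OF _ _ _ w] by simp
    have q6: "\<bar>Y \<omega> 0 2 1 y - a2\<^sup>2 * \<beta> * S \<omega> y\<bar> \<le> \<epsilon>' / 4" using Yl[of 0 2 1, OF _ _ _ w] by simp
    have q7: "\<bar>Y \<omega> 2 0 1 y - a1\<^sup>2 * \<beta> * S \<omega> y\<bar> \<le> \<epsilon>' / 4" using Yl[of 2 0 1, OF _ _ _ w] by simp
    have r1: "a1\<^sup>2 * a2 * S \<omega> y + a2 ^ 3 * S \<omega> y = a2 * S \<omega> y"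
    proof -
      have "a1\<^sup>2 * a2 * S \<omega> y + a2 ^ 3 * S \<omega> y = (a1\<^sup>2 + a2\<^sup>2) * a2 * S \<omega> y" by (simp add: algebra_simps power2_eq_square power3_eq_cube)
      thus ?thesis using xi1 by simp
    qed
    have r2: "a1 ^ 3 * S \<omega> y + a1 * a2\<^sup>2 * S \<omega> y = a1 * S \<omega> y"
    proof -
      have "a1 ^ 3 * S \<omega> y + a1 * a2\<^sup>2 * S \<omega> y = (a1\<^sup>2 + a2\<^sup>2) * a1 * S \<omega> y" by (simp add: algebra_simps power2_eq_square power3_eq_cube)
      thus ?thesis using xi1 by simp
    qed
    have ab: "\<bar>- (p + q)\<bar> \<le> \<epsilon>' / 2 \<and> \<bar>p + q\<bar> \<le> \<epsilon>' / 2 \<and> \<bar>p - q\<bar> \<le> \<epsilon>' / 2 \<and> \<bar>2 * p\<bar> \<le> \<epsilon>' / 2"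
      if "\<bar>p\<bar> \<le> \<epsilon>' / 4" "\<bar>q\<bar> \<le> \<epsilon>' / 4" for p q :: real
      using that by (intro conjI; linarith)
    have "Re (V \<omega> y - of_real (S \<omega> y) * e) = - ((Y \<omega> 2 1 0 y - a1\<^sup>2 * a2 * S \<omega> y) + (Y \<omega> 0 3 0 y - a2 ^ 3 * S \<omega> y))"
      "Im (V \<omega> y - of_real (S \<omega> y) * e) = (Y \<omega> 3 0 0 y - a1 ^ 3 * S \<omega> y) + (Y \<omega> 1 2 0 y - a1 * a2\<^sup>2 * S \<omega> y)"
      using r1 r2 by (simp_all add: V_def e12 algebra_simps)
    hence "\<bar>Re (V \<omega> y - of_real (S \<omega> y) * e)\<bar> \<le> \<epsilon>' / 2" "\<bar>Im (V \<omega> y - of_real (S \<omega> y) * e)\<bar> \<le> \<epsilon>' / 2"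
      using ab[OF q1 q2] ab[OF q3 q4] by (simp_all only:)
    thus "norm (V \<omega> y - of_real (S \<omega> y) * e) \<le> \<epsilon>'"
      using cmod_le[of "V \<omega> y - of_real (S \<omega> y) * e"] by linarith
    have "Re (Q \<omega> y - of_real (S \<omega> y) * (\<i> * of_real \<beta> * e\<^sup>2)) = 2 * (Y \<omega> 1 1 1 y - a1 * a2 * \<beta> * S \<omega> y)"
      "Im (Q \<omega> y - of_real (S \<omega> y) * (\<i> * of_real \<beta> * e\<^sup>2))
        = (Y \<omega> 0 2 1 y - a2\<^sup>2 * \<beta> * S \<omega> y) - (Y \<omega> 2 0 1 y - a1\<^sup>2 * \<beta> * S \<omega> y)"
      by (simp_all add: Q_def e12 algebra_simps power2_eq_square)
    hence "\<bar>Re (Q \<omega> y - of_real (S \<omega> y) * (\<i> * of_real \<beta> * e\<^sup>2))\<bar> \<le> \<epsilon>' / 2"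
      "\<bar>Im (Q \<omega> y - of_real (S \<omega> y) * (\<i> * of_real \<beta> * e\<^sup>2))\<bar> \<le> \<epsilon>' / 2"
      using ab[OF q5 q5] ab[OF q6 q7] by (simp_all only:)
    thus "norm (Q \<omega> y - of_real (S \<omega> y) * (\<i> * of_real \<beta> * e\<^sup>2)) \<le> \<epsilon>'"
      using cmod_le[of "Q \<omega> y - of_real (S \<omega> y) * (\<i> * of_real \<beta> * e\<^sup>2)"] by linarith
  qed
  have Vc: "continuous_on UNIV (V \<omega>)" "continuous_on UNIV (Q \<omega>)" for \<omega>
    unfolding V_def[abs_def] Q_def[abs_def] by (intro continuous_intros Yc)+
  have Vs: "V \<omega> y = 0" "Q \<omega> y = 0" if "y \<notin> ball y0 r" for \<omega> y
    using Ys[OF that] unfolding V_def Q_def by (simp_all add: complex_eq_iff)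
  let ?B = "ball y0 r" and ?C = "cbox (y0 - (r/4) *\<^sub>R One) (y0 + (r/4) *\<^sub>R One)"
  \<comment> \<open>Cosine and sine together carry the full envelope, so one of the two phases has
    at least half of its energy. This replaces an averaging argument for large N.\<close>
  have Ssum: "(S 1 y)\<^sup>2 + (S (- \<i>) y)\<^sup>2 = (\<Phi> y)\<^sup>2" for y
  proof -
    have "(S 1 y)\<^sup>2 + (S (- \<i>) y)\<^sup>2 = (Re (of_real (\<Phi> y) * \<theta> y))\<^sup>2 + (Im (of_real (\<Phi> y) * \<theta> y))\<^sup>2"
      unfolding S_def by simp
    also have "\<dots> = (norm (of_real (\<Phi> y) * \<theta> y))\<^sup>2" by (simp only: cmod_power2)
    finally show ?thesis using n\<theta>[of y] by (simp add: norm_mult power_mult_distrib)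
  qed
  have fc: "continuous_on UNIV f1" "continuous_on UNIV f2" "continuous_on UNIV f3" using sm[of 0] by auto
  have \<Phi>c: "continuous_on UNIV \<Phi>"
  proof -
    have "continuous_on UNIV (\<lambda>y :: (real^2) \<times> real. f1 (fst y $ 1))"
      "continuous_on UNIV (\<lambda>y :: (real^2) \<times> real. f2 (fst y $ 2))"
      "continuous_on UNIV (\<lambda>y :: (real^2) \<times> real. f3 (snd y))"
      by (rule continuous_on_compose2[OF fc(1)] continuous_on_compose2[OF fc(2)] continuous_on_compose2[OF fc(3)];
          auto intro!: continuous_intros)+
    thus ?thesis unfolding \<Phi>_def[abs_def] by (intro continuous_intros)
  qed
  have \<theta>c: "continuous_on UNIV \<theta>" unfolding \<theta>_def[abs_def] cis_conv_exp by (intro continuous_intros)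
  have Sc: "continuous_on UNIV (S \<omega>)" for \<omega> unfolding S_def[abs_def] by (intro continuous_intros \<Phi>c \<theta>c)
  have X0: "X 0 0 0 y = of_real (\<Phi> y) * \<theta> y" for y
    unfolding X_def \<Phi>_def \<theta>_def wave_factor_def by (simp add: mult_ac)
  have Ss: "S \<omega> y = 0" "\<Phi> y = 0" if "y \<notin> ball y0 r" for \<omega> y
    using Xs[OF that, of 0 0 0] n\<theta>[of y] unfolding S_def X0 by auto
  have cint: "integrable lborel g" if "continuous_on UNIV g" "\<And>y. y \<notin> ?B \<Longrightarrow> g y = 0" for g :: "(real^2) \<times> real \<Rightarrow> real"
    using compact_support_integrable[OF that(1), where w = "\<lambda>_. 1" and B = 1 and K = "norm y0 + r"] that(2) far by auto
  have Sint: "integrable lborel (\<lambda>y. (S \<omega> y)\<^sup>2)" for \<omega>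
    using Ss by (intro cint) (auto intro!: continuous_intros Sc)
  have Vint: "integrable lborel (\<lambda>y. (norm (V \<omega> y))\<^sup>2)" for \<omega>
    using Vs by (intro cint) (auto intro!: continuous_intros Vc)
  have Bint: "integrable lborel (\<lambda>y. c * indicator ?B y)" for c :: real
    by (intro integrable_mult_right integrable_real_indicator) (use emeasure_bounded_finite[OF bounded_ball] in auto)
  \<comment> \<open>Inside the cube of side r/2 all three bumps are at least exp(-4). Its volume is
    1/64 of that of the cube of side 2 r around the ball.\<close>
  have \<Phi>int: "exp (-24) / 64 * measure lborel ?B \<le> integral\<^sup>L lborel (\<lambda>y. (\<Phi> y)\<^sup>2)"
  proof -
    have ge: "exp (-24) * indicator ?C y \<le> (\<Phi> y)\<^sup>2" for y
    proof (cases "y \<in> ?C")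
      case True
      have bb: "\<bar>(y - y0) \<bullet> b\<bar> \<le> r / 4" if "b \<in> Basis" for b
      proof -
        have "(y0 - (r/4) *\<^sub>R One) \<bullet> b \<le> y \<bullet> b" "y \<bullet> b \<le> (y0 + (r/4) *\<^sub>R One) \<bullet> b"
          using True that by (simp_all add: mem_box)
        hence "(y - y0) \<bullet> b \<le> r / 4" "- ((y - y0) \<bullet> b) \<le> r / 4" using that by (simp_all add: inner_simps)
        thus ?thesis by (rule abs_leI)
      qed
      have "\<bar>fst y $ 1 - fst y0 $ 1\<bar> \<le> r/4" "\<bar>fst y $ 2 - fst y0 $ 2\<bar> \<le> r/4" "\<bar>snd y - snd y0\<bar> \<le> r/4"
        using bb[of "(axis 1 1, 0)"] bb[of "(axis 2 1, 0)"] bb[of "(0, 1)"]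
        by (auto simp: Basis_prod_def Basis_vec_def inner_prod_def inner_axis)
      moreover have "\<bar>u\<bar> \<le> r / 4 \<Longrightarrow> \<bar>u / (r / 2)\<bar> \<le> 1 / 2" for u :: real
        using r by (subst abs_divide) (simp add: divide_le_eq del: abs_divide)
      ultimately have "exp (-4) \<le> f1 (fst y $ 1)" "exp (-4) \<le> f2 (fst y $ 2)" "exp (-4) \<le> f3 (snd y)"
        unfolding f1_def f2_def f3_def scaled_bump_def by (blast intro: bump_ge)+
      hence "exp (-4) * exp (-4) * exp (-4) \<le> \<Phi> y" unfolding \<Phi>_def using f01 by (intro mult_mono mult_nonneg_nonneg) auto
      hence "(exp (-12))\<^sup>2 \<le> (\<Phi> y)\<^sup>2" by (intro power_mono) (auto simp flip: exp_add)
      moreover have "(exp (-12::real))\<^sup>2 = exp (-24)" by (simp add: power2_eq_square flip: exp_add)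
      ultimately show ?thesis using True by simp
    qed auto
    have "integral\<^sup>L lborel (\<lambda>y. exp (-24) * indicator ?C y) \<le> integral\<^sup>L lborel (\<lambda>y. (\<Phi> y)\<^sup>2)"
    proof (rule integral_mono)
      show "integrable lborel (\<lambda>y. (\<Phi> y)\<^sup>2)" using Ss by (intro cint) (auto intro!: continuous_intros \<Phi>c)
      show "integrable lborel (\<lambda>y. exp (-24) * indicator ?C y :: real)"
        by (intro integrable_mult_right integrable_real_indicator) (use emeasure_bounded_finite[OF bounded_cbox] in auto)
    qed (rule ge)
    moreover have "integral\<^sup>L lborel (\<lambda>y. exp (-24) * indicator ?C y :: real) = exp (-24) * (r / 2) ^ 3"
      using measure_ball_le_cube(2)[OF r, of y0] by simp
    moreover have "exp (-24) / 64 * measure lborel ?B \<le> exp (-24) / 64 * (2 * r) ^ 3"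
      by (intro mult_left_mono measure_ball_le_cube r) auto
    moreover have "exp (-24) / 64 * (2 * r) ^ 3 = exp (-24) * (r / 2) ^ 3" by (simp add: power3_eq_cube)
    ultimately show ?thesis by linarith
  qed
  have "integral\<^sup>L lborel (\<lambda>y. (\<Phi> y)\<^sup>2) = integral\<^sup>L lborel (\<lambda>y. (S 1 y)\<^sup>2) + integral\<^sup>L lborel (\<lambda>y. (S (- \<i>) y)\<^sup>2)"
    by (subst Bochner_Integration.integral_add[symmetric]) (auto intro: Sint simp: Ssum)
  with \<Phi>int have "exp (-24) / 128 * measure lborel ?B \<le> integral\<^sup>L lborel (\<lambda>y. (S 1 y)\<^sup>2)
     \<or> exp (-24) / 128 * measure lborel ?B \<le> integral\<^sup>L lborel (\<lambda>y. (S (- \<i>) y)\<^sup>2)" by linarith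
  then obtain \<omega> where \<omega>: "norm \<omega> = 1" "exp (-24) / 128 * measure lborel ?B \<le> integral\<^sup>L lborel (\<lambda>y. (S \<omega> y)\<^sup>2)"
    by (metis norm_ii norm_minus_cancel norm_one)
  have energy: "wave_const * measure lborel ?B \<le> integral\<^sup>L lborel (\<lambda>y. (norm (V \<omega> y))\<^sup>2)"
  proof -
    \<comment> \<open>From |S| \<le> |V| + \<epsilon>' and (x + y)^2 \<le> 2 x^2 + 2 y^2.\<close>
    have pt: "(S \<omega> y)\<^sup>2 / 2 - \<epsilon>'\<^sup>2 * indicator ?B y \<le> (norm (V \<omega> y))\<^sup>2" for y
    proof (cases "y \<in> ?B")
      case True
      have "\<bar>S \<omega> y\<bar> \<le> norm (V \<omega> y) + \<epsilon>'"
        using lead(1)[OF \<omega>(1), of y] norm_triangle_ineq2[of "of_real (S \<omega> y) * e" "V \<omega> y"] e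
        by (simp add: norm_mult norm_minus_commute)
      hence "(S \<omega> y)\<^sup>2 \<le> (norm (V \<omega> y) + \<epsilon>')\<^sup>2" using \<epsilon>'(1) by (simp add: abs_le_square_iff[symmetric])
      also have "\<dots> \<le> 2 * (norm (V \<omega> y))\<^sup>2 + 2 * \<epsilon>'\<^sup>2"
        using sum_squares_ge_zero[of "norm (V \<omega> y) - \<epsilon>'" 0] by (simp add: power2_eq_square algebra_simps)
      finally show ?thesis using True by simp
    qed (use Ss in simp)
    have "integral\<^sup>L lborel (\<lambda>y. (S \<omega> y)\<^sup>2 / 2 - \<epsilon>'\<^sup>2 * indicator ?B y) \<le> integral\<^sup>L lborel (\<lambda>y. (norm (V \<omega> y))\<^sup>2)"
      by (intro integral_mono Bochner_Integration.integrable_diff integrable_divide Sint Vint Bint pt)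
    moreover have "integral\<^sup>L lborel (\<lambda>y. (S \<omega> y)\<^sup>2 / 2 - \<epsilon>'\<^sup>2 * indicator ?B y)
      = integral\<^sup>L lborel (\<lambda>y. (S \<omega> y)\<^sup>2) / 2 - \<epsilon>'\<^sup>2 * measure lborel ?B"
      using Bochner_Integration.integral_diff[OF integrable_divide[OF Sint[of \<omega>], of 2] Bint[of "\<epsilon>'\<^sup>2"]] by simp
    moreover have "\<epsilon>'\<^sup>2 * measure lborel ?B \<le> exp (-24) / 512 * measure lborel ?B"
      by (intro mult_right_mono \<epsilon>') auto
    ultimately show ?thesis using \<omega>(2) unfolding wave_const_def by linarith
  qed
  show ?thesis
  proof (rule that[of "V \<omega>" "Q \<omega>"])
    show "\<exists>\<sigma>. \<bar>\<sigma>\<bar> \<le> 1 \<and> norm (V \<omega> y - of_real \<sigma> * e) \<le> \<epsilon> \<and> norm (Q \<omega> y - of_real \<sigma> * (\<i> * of_real \<beta> * e\<^sup>2)) \<le> \<epsilon>" for y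
      using S1[OF \<omega>(1), of y] lead[OF \<omega>(1), of y] \<epsilon>'(2) by (intro exI[of _ "S \<omega> y"]) auto
  qed (use Vc Vs null mean energy in auto)
qed

section \<open>Convex integration\<close>

text \<open>Positivity of the smaller eigenvalue of the defect C/2 I + u - v \<otimes> v, which is
  half of C - |v|^2 - |2 q - v^2|. When |v|^2 tends to C, the term |2 q - v^2| is squeezed to 0: the
  nonlinear relation 2 q = v^2 results from saturating the speed.\<close>

definition subsolution_state :: "real \<Rightarrow> complex \<Rightarrow> complex \<Rightarrow> bool" where
  "subsolution_state C v q \<longleftrightarrow> (norm v)\<^sup>2 + norm (2 * q - v\<^sup>2) < C"

lemma subsolution_state_norm:
  assumes "subsolution_state C v q"
  shows "(norm v)\<^sup>2 < C" "norm v \<le> sqrt C" "norm q \<le> C" "C > 0"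
proof -
  show 1: "(norm v)\<^sup>2 < C" using assms norm_ge_zero[of "2 * q - v\<^sup>2"] unfolding subsolution_state_def by linarith
  thus "norm v \<le> sqrt C" by (simp add: real_le_rsqrt)
  show "C > 0" using 1 zero_le_power2[of "norm v"] by linarith
  have "norm (2 * q) \<le> norm (2 * q - v\<^sup>2) + norm (v\<^sup>2)" using norm_triangle_sub[of "2 * q" "v\<^sup>2"] by simp
  hence "2 * norm q \<le> C" using assms unfolding subsolution_state_def by (simp add: norm_mult norm_power)
  thus "norm q \<le> C" using norm_ge_zero[of q] by linarith
qed

text \<open>
  The direction is the top eigenvector of the (positive definite) defect
  \<open>C/2 I + u - v \<otimes> v\<close>, whose trace is \<open>C - |v|\<^sup>2\<close> and whose trace-free part is \<open>q - v\<^sup>2/2\<close>; moving the wave with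
  the normal velocity of \<open>v\<close> keeps the other eigenvalue fixed.
\<close>

lemma perturbation_direction:
  assumes sub: "subsolution_state C v q"
  defines "s \<equiv> (C - (norm v)\<^sup>2) / (8 * sqrt C)"
  shows "\<exists>e \<beta> L. norm e = 1 \<and> L < C \<and> (\<forall>\<sigma>. \<bar>\<sigma>\<bar> \<le> s \<longrightarrow> (norm (v + of_real \<sigma> * e))\<^sup>2
       + norm (2 * (q + of_real \<sigma> * (\<i> * of_real \<beta> * e\<^sup>2)) - (v + of_real \<sigma> * e)\<^sup>2) \<le> L)"
proof -
  define m where "m = 2 * q - v\<^sup>2"
  \<comment> \<open>The trace-free part of e \<otimes> e is e^2/2 in complex notation, so a unit
    eigenvector for the larger eigenvalue of m is a square root of m/|m|; for m = 0 every direction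
    qualifies.\<close>
  define e where "e = (if m = 0 then 1 else csqrt (m / of_real (norm m)))"
  define G where "G = C - (norm v)\<^sup>2"
  have C: "C > 0" and G: "G > 0" "G \<le> C" using subsolution_state_norm[OF sub] unfolding G_def by auto
  have m_e: "m = of_real (norm m) * e\<^sup>2" unfolding e_def by simp
  have ne: "norm e = 1"
  proof (cases "m = 0")
    case False
    hence "norm (e\<^sup>2) = 1" unfolding e_def by (simp add: norm_divide)
    hence "(norm e)\<^sup>2 = 1" by (simp add: norm_power)
    thus ?thesis by (simp add: abs_square_eq_1 power2_eq_1_iff)
  qed (simp add: e_def)
  define \<alpha> \<beta> where "\<alpha> = Re (v * cnj e)" and "\<beta> = Im (v * cnj e)"
  have "v * cnj e * e = v" using ne by (simp add: mult.assoc complex_norm_square[symmetric] mult.commute[of "cnj e"])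
  hence v_e: "v = (of_real \<alpha> + \<i> * of_real \<beta>) * e"
    unfolding \<alpha>_def \<beta>_def by (metis complex_eq)
  have nv: "(norm v)\<^sup>2 = \<alpha>\<^sup>2 + \<beta>\<^sup>2"
  proof -
    have "norm v = norm (Complex \<alpha> \<beta>)" using v_e ne by (metis complex_eq Complex_eq norm_mult mult.right_neutral)
    thus ?thesis by (simp add: cmod_power2)
  qed
  have \<alpha>: "\<bar>\<alpha>\<bar> \<le> sqrt C"
  proof -
    have "\<bar>\<alpha>\<bar> \<le> norm (v * cnj e)" unfolding \<alpha>_def by (rule abs_Re_le_cmod)
    thus ?thesis using ne subsolution_state_norm(2)[OF sub] by (simp add: norm_mult)
  qed
  have s: "s \<ge> 0" "s * sqrt C = G / 8" "s\<^sup>2 \<le> G / 64"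
  proof -
    have "s = G / (8 * sqrt C)" unfolding s_def G_def ..
    thus "s \<ge> 0" "s * sqrt C = G / 8" using C G by auto
    have "s\<^sup>2 = G * G / (64 * C)" unfolding s_def G_def[symmetric] using C by (simp add: power_divide power_mult_distrib power2_eq_square)
    also have "\<dots> \<le> G * C / (64 * C)" using G C by (intro divide_right_mono mult_left_mono) auto
    finally show "s\<^sup>2 \<le> G / 64" using C by simp
  qed
  \<comment> \<open>Let \<kappa> be the change of |v|^2. Then |m| turns into ||m| - \<kappa>|, so
    the sum keeps its value as long as \<kappa> \<le> |m| and is at most |v|^2 + 2 \<kappa>
    otherwise. The amplitude s gives \<kappa> \<le> 2/8 G + 1/64 G = 17/64 G.\<close>
  define L where "L = max ((norm v)\<^sup>2 + norm m) ((norm v)\<^sup>2 + 17 / 32 * G)"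
  have "L < C"
  proof -
    have "(norm v)\<^sup>2 + 17 / 32 * G < (norm v)\<^sup>2 + G" using G by linarith
    thus ?thesis using sub unfolding L_def subsolution_state_def m_def by (simp add: G_def)
  qed
  moreover have "(norm (v + of_real \<sigma> * e))\<^sup>2
       + norm (2 * (q + of_real \<sigma> * (\<i> * of_real \<beta> * e\<^sup>2)) - (v + of_real \<sigma> * e)\<^sup>2) \<le> L" if \<sigma>: "\<bar>\<sigma>\<bar> \<le> s" for \<sigma>
  proof -
    define \<kappa> where "\<kappa> = 2 * \<sigma> * \<alpha> + \<sigma>\<^sup>2"
    have "\<sigma> * \<alpha> \<le> \<bar>\<sigma>\<bar> * \<bar>\<alpha>\<bar>" by (metis abs_ge_self abs_mult)
    also have "\<dots> \<le> s * sqrt C" by (intro mult_mono \<sigma> \<alpha> s) auto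
    finally have "\<sigma> * \<alpha> \<le> G / 8" using s by simp
    moreover have "\<sigma>\<^sup>2 \<le> s\<^sup>2" using \<sigma> by (simp add: abs_le_square_iff[symmetric])
    ultimately have \<kappa>: "\<kappa> \<le> 17 / 64 * G" using s unfolding \<kappa>_def by linarith
    have 1: "(norm (v + of_real \<sigma> * e))\<^sup>2 = (norm v)\<^sup>2 + \<kappa>"
    proof -
      have "v + of_real \<sigma> * e = Complex (\<alpha> + \<sigma>) \<beta> * e"
        by (subst v_e) (simp add: Complex_eq algebra_simps)
      hence "norm (v + of_real \<sigma> * e) = norm (Complex (\<alpha> + \<sigma>) \<beta>)" using ne by (simp add: norm_mult)
      hence "(norm (v + of_real \<sigma> * e))\<^sup>2 = (\<alpha> + \<sigma>)\<^sup>2 + \<beta>\<^sup>2" by (simp add: cmod_power2)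
      thus ?thesis unfolding nv \<kappa>_def by (simp add: power2_eq_square algebra_simps)
    qed
    \<comment> \<open>The coefficient i \<beta> e^2 of the wave in q cancels the contribution of the
      normal component of v in the square; what is left is a real multiple of e^2, parallel to
      m.\<close>
    have "2 * (q + of_real \<sigma> * (\<i> * of_real \<beta> * e\<^sup>2)) - (v + of_real \<sigma> * e)\<^sup>2
       = m + 2 * of_real \<sigma> * \<i> * of_real \<beta> * e\<^sup>2 - 2 * of_real \<sigma> * (v * e) - of_real (\<sigma>\<^sup>2) * e\<^sup>2"
      unfolding m_def by (simp add: power2_eq_square algebra_simps)
    also have "v * e = (of_real \<alpha> + \<i> * of_real \<beta>) * e\<^sup>2" by (subst v_e) (simp add: power2_eq_square)
    also have "m + 2 * of_real \<sigma> * \<i> * of_real \<beta> * e\<^sup>2 - 2 * of_real \<sigma> * ((of_real \<alpha> + \<i> * of_real \<beta>) * e\<^sup>2) - of_real (\<sigma>\<^sup>2) * e\<^sup>2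
       = of_real (norm m - \<kappa>) * e\<^sup>2"
      by (subst m_e) (simp add: \<kappa>_def algebra_simps)
    finally have "norm (2 * (q + of_real \<sigma> * (\<i> * of_real \<beta> * e\<^sup>2)) - (v + of_real \<sigma> * e)\<^sup>2)
        = norm (complex_of_real (norm m - \<kappa>)) * norm (e\<^sup>2)" by (simp only: norm_mult)
    hence 2: "norm (2 * (q + of_real \<sigma> * (\<i> * of_real \<beta> * e\<^sup>2)) - (v + of_real \<sigma> * e)\<^sup>2) = \<bar>norm m - \<kappa>\<bar>"
      by (simp only: norm_of_real norm_power ne power_one mult_1_right)
    have "(norm v)\<^sup>2 + norm m \<le> L" "(norm v)\<^sup>2 + 17 / 32 * G \<le> L" unfolding L_def by simp_all
    with \<kappa> norm_ge_zero[of m] have "(norm v)\<^sup>2 + \<kappa> + (norm m - \<kappa>) \<le> L" "(norm v)\<^sup>2 + \<kappa> + (\<kappa> - norm m) \<le> L"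
      by (simp, linarith)
    hence "(norm v)\<^sup>2 + \<kappa> + \<bar>norm m - \<kappa>\<bar> \<le> L" by (simp add: abs_if)
    thus ?thesis unfolding 1 2 .
  qed
  ultimately show ?thesis using ne by (intro exI[of _ e] exI[of _ \<beta>] exI[of _ L] conjI allI impI)
qed

lemma bounded_integrable:
  fixes f :: "'a::euclidean_space \<Rightarrow> real"
  assumes "f \<in> borel_measurable borel" "S \<in> sets borel" "bounded S"
    and "\<And>y. y \<in> S \<Longrightarrow> \<bar>f y\<bar> \<le> M" "\<And>y. y \<notin> S \<Longrightarrow> f y = 0"
  shows "integrable lborel f"
proof (rule Bochner_Integration.integrable_bound)
  show "integrable lborel (\<lambda>y. M * indicator S y)"
    by (intro integrable_mult_right integrable_real_indicator) (use assms emeasure_bounded_finite in auto)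
  show "AE y in lborel. norm (f y) \<le> norm (M * indicator S y)"
  proof (intro AE_I2)
    fix y show "norm (f y) \<le> norm (M * indicator S y)"
      using assms(4)[of y] assms(5)[of y] by (cases "y \<in> S") auto
  qed
qed (use assms in simp)

lemma continuous_ball_integrable:
  fixes f :: "'a::euclidean_space \<Rightarrow> real"
  assumes "continuous_on UNIV f" "bounded S" "\<And>y. y \<notin> S \<Longrightarrow> f y = 0"
  shows "integrable lborel f"
proof -
  obtain K where K: "\<And>y. y \<in> S \<Longrightarrow> norm y \<le> K" using assms(2) by (auto simp: bounded_pos)
  show ?thesis
    using compact_support_integrable[OF assms(1), where K = K and w = "\<lambda>_. 1" and B = 1] assms(3) K by force
qed

lemma euler_null_scale:
  assumes "euler_null V Q"
  shows "euler_null (\<lambda>y. of_real s * V y) (\<lambda>y. of_real s * Q y)"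
proof -
  have *: "integral\<^sup>L lborel g = 0" if "integral\<^sup>L lborel f = 0" "g = (\<lambda>z. s * f z)" for f g :: "(real^2) \<times> real \<Rightarrow> real"
    using that by simp
  show ?thesis
    unfolding euler_null_def
  proof (intro allI impI conjI)
    fix \<psi> :: "(real^2) \<times> real \<Rightarrow> real" assume "test_function \<psi>"
    note n = assms[unfolded euler_null_def, rule_format, OF this]
    show "integral\<^sup>L lborel (\<lambda>z. Re (of_real s * V z) * dx 1 \<psi> z + Im (of_real s * V z) * dx 2 \<psi> z) = 0"
      by (rule *[OF n[THEN conjunct1]]) (simp add: fun_eq_iff algebra_simps)
    show "integral\<^sup>L lborel (\<lambda>z. Re (of_real s * V z) * dt \<psi> z + Re (of_real s * Q z) * dx 1 \<psi> z
        + Im (of_real s * Q z) * dx 2 \<psi> z) = 0"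
      by (rule *[OF n[THEN conjunct2, THEN conjunct1]]) (simp add: fun_eq_iff algebra_simps)
    show "integral\<^sup>L lborel (\<lambda>z. Im (of_real s * V z) * dt \<psi> z + Im (of_real s * Q z) * dx 1 \<psi> z
        - Re (of_real s * Q z) * dx 2 \<psi> z) = 0"
      by (rule *[OF n[THEN conjunct2, THEN conjunct2]]) (simp add: fun_eq_iff algebra_simps)
  qed
qed

lemma euler_null_integrable:
  fixes f D :: "(real^2) \<times> real \<Rightarrow> real"
  assumes "f \<in> borel_measurable borel" "\<And>y. \<bar>f y\<bar> \<le> M" "test_function \<psi>"
  shows "integrable lborel (\<lambda>z. f z * dt \<psi> z)" "integrable lborel (\<lambda>z. f z * dx j \<psi> z)"
    "integrable lborel (\<lambda>z. f z * \<psi> z)"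
proof -
  obtain K where K: "\<And>z. K < norm z \<Longrightarrow> \<psi> z = 0" "\<And>z h. K < norm z \<Longrightarrow> frechet_derivative \<psi> (at z) h = 0"
    using test_function_bounded_support[OF assms(3)] by metis
  show "integrable lborel (\<lambda>z. f z * dt \<psi> z)"
    by (rule compact_support_integrable[OF dt_dx_continuous(1)[OF assms(3)] _ assms(1,2)]) (use K in \<open>auto simp: dt_def\<close>)
  show "integrable lborel (\<lambda>z. f z * dx j \<psi> z)"
    by (rule compact_support_integrable[OF dt_dx_continuous(2)[OF assms(3)] _ assms(1,2)]) (use K in \<open>auto simp: dx_def\<close>)
  show "integrable lborel (\<lambda>z. f z * \<psi> z)"
    by (rule compact_support_integrable[OF test_function_continuous[OF assms(3)] _ assms(1,2)]) (use K in auto)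
qed

definition bounded_borel :: "((real^2) \<times> real \<Rightarrow> complex) \<Rightarrow> bool" where
  "bounded_borel V \<longleftrightarrow> V \<in> borel_measurable borel \<and> (\<exists>M. \<forall>y. norm (V y) \<le> M)"

lemma bounded_borelD:
  assumes "bounded_borel V"
  obtains M where "(\<lambda>y. Re (V y)) \<in> borel_measurable borel" "(\<lambda>y. Im (V y)) \<in> borel_measurable borel"
    "\<And>y. \<bar>Re (V y)\<bar> \<le> M" "\<And>y. \<bar>Im (V y)\<bar> \<le> M"
proof -
  obtain M where M: "V \<in> borel_measurable borel" "\<And>y. norm (V y) \<le> M"
    using assms unfolding bounded_borel_def by blast
  show ?thesis
  proof (rule that[of M])
    show "(\<lambda>y. Re (V y)) \<in> borel_measurable borel" "(\<lambda>y. Im (V y)) \<in> borel_measurable borel"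
      using M(1) by measurable
    show "\<bar>Re (V y)\<bar> \<le> M" "\<bar>Im (V y)\<bar> \<le> M" for y
      using abs_Re_le_cmod[of "V y"] abs_Im_le_cmod[of "V y"] M(2)[of y] by linarith+
  qed
qed

lemma bounded_borel_integrable:
  assumes "bounded_borel V" "test_function \<psi>"
  shows "integrable lborel (\<lambda>z. Re (V z) * dt \<psi> z)" "integrable lborel (\<lambda>z. Im (V z) * dt \<psi> z)"
    "integrable lborel (\<lambda>z. Re (V z) * dx j \<psi> z)" "integrable lborel (\<lambda>z. Im (V z) * dx j \<psi> z)"
proof -
  obtain M where M: "(\<lambda>y. Re (V y)) \<in> borel_measurable borel" "(\<lambda>y. Im (V y)) \<in> borel_measurable borel"
    "\<And>y. \<bar>Re (V y)\<bar> \<le> M" "\<And>y. \<bar>Im (V y)\<bar> \<le> M" using bounded_borelD[OF assms(1)] by blast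
  show "integrable lborel (\<lambda>z. Re (V z) * dt \<psi> z)" "integrable lborel (\<lambda>z. Im (V z) * dt \<psi> z)"
    "integrable lborel (\<lambda>z. Re (V z) * dx j \<psi> z)" "integrable lborel (\<lambda>z. Im (V z) * dx j \<psi> z)"
    using euler_null_integrable[OF M(1,3) assms(2)] euler_null_integrable[OF M(2,4) assms(2)] by auto
qed

lemma bounded_borel_add: "bounded_borel V \<Longrightarrow> bounded_borel W \<Longrightarrow> bounded_borel (\<lambda>y. V y + W y)"
  unfolding bounded_borel_def
proof (elim conjE exE, intro conjI)
  fix M N assume "\<forall>y. norm (V y) \<le> M" "\<forall>y. norm (W y) \<le> N"
  thus "\<exists>M. \<forall>y. norm (V y + W y) \<le> M" by (intro exI[of _ "M + N"]) (meson add_mono norm_triangle_le)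
qed measurable

lemma euler_null_add:
  assumes "euler_null V Q" "euler_null V' Q'"
    and b: "bounded_borel V" "bounded_borel Q" "bounded_borel V'" "bounded_borel Q'"
  shows "euler_null (\<lambda>y. V y + V' y) (\<lambda>y. Q y + Q' y)"
  unfolding euler_null_def
proof (intro allI impI)
  fix \<psi> :: "(real^2) \<times> real \<Rightarrow> real" assume t: "test_function \<psi>"
  note n = assms(1)[unfolded euler_null_def, rule_format, OF t] assms(2)[unfolded euler_null_def, rule_format, OF t]
  note i = bounded_borel_integrable[OF b(1) t] bounded_borel_integrable[OF b(2) t]
    bounded_borel_integrable[OF b(3) t] bounded_borel_integrable[OF b(4) t]
  have *: "integral\<^sup>L lborel g = 0" if "integral\<^sup>L lborel f = 0" "integral\<^sup>L lborel f' = 0"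
      "integrable lborel f" "integrable lborel f'" "g = (\<lambda>z. f z + f' z)" for f f' g :: "(real^2) \<times> real \<Rightarrow> real"
    using that by simp
  show "integral\<^sup>L lborel (\<lambda>z. Re (V z + V' z) * dx 1 \<psi> z + Im (V z + V' z) * dx 2 \<psi> z) = 0 \<and>
     integral\<^sup>L lborel (\<lambda>z. Re (V z + V' z) * dt \<psi> z + Re (Q z + Q' z) * dx 1 \<psi> z + Im (Q z + Q' z) * dx 2 \<psi> z) = 0 \<and>
     integral\<^sup>L lborel (\<lambda>z. Im (V z + V' z) * dt \<psi> z + Im (Q z + Q' z) * dx 1 \<psi> z - Re (Q z + Q' z) * dx 2 \<psi> z) = 0"
  proof (intro conjI)
    show "integral\<^sup>L lborel (\<lambda>z. Re (V z + V' z) * dx 1 \<psi> z + Im (V z + V' z) * dx 2 \<psi> z) = 0"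
      by (rule *[OF n(1)[THEN conjunct1] n(2)[THEN conjunct1]])
        (auto simp: fun_eq_iff algebra_simps intro!: Bochner_Integration.integrable_add i)
    show "integral\<^sup>L lborel (\<lambda>z. Re (V z + V' z) * dt \<psi> z + Re (Q z + Q' z) * dx 1 \<psi> z + Im (Q z + Q' z) * dx 2 \<psi> z) = 0"
      by (rule *[OF n(1)[THEN conjunct2, THEN conjunct1] n(2)[THEN conjunct2, THEN conjunct1]])
        (auto simp: fun_eq_iff algebra_simps intro!: Bochner_Integration.integrable_add i)
    show "integral\<^sup>L lborel (\<lambda>z. Im (V z + V' z) * dt \<psi> z + Im (Q z + Q' z) * dx 1 \<psi> z - Re (Q z + Q' z) * dx 2 \<psi> z) = 0"
      by (rule *[OF n(1)[THEN conjunct2, THEN conjunct2] n(2)[THEN conjunct2, THEN conjunct2]])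
        (auto simp: fun_eq_iff algebra_simps intro!: Bochner_Integration.integrable_add Bochner_Integration.integrable_diff i)
  qed
qed

lemma continuous_ball_bounded_borel:
  assumes "continuous_on UNIV V" "bounded S" "\<And>y. y \<notin> S \<Longrightarrow> V y = 0"
  shows "bounded_borel V"
proof -
  obtain K where K: "\<And>y. y \<in> S \<Longrightarrow> norm y \<le> K" using assms(2) by (auto simp: bounded_pos)
  obtain M where "\<And>y. norm (V y) \<le> M"
    using compact_support_bound[OF assms(1), of K] K assms(3) by (metis not_le)
  thus ?thesis unfolding bounded_borel_def using borel_measurable_continuous_onI[OF assms(1)] by blast
qed

text \<open>Quantitative openness: the square of the velocity moves by at most d (2 sqrt C + 1) and
  enters twice, while q enters as 2 q, which makes d (4 sqrt C + 4) in all.\<close>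

lemma subsolution_state_near:
  assumes L: "(norm a)\<^sup>2 + norm (2 * b - a\<^sup>2) \<le> L" "L < C"
    and d: "norm (v - a) \<le> d" "norm (q - b) \<le> d" "d \<le> 1" "d * (4 * sqrt C + 5) < C - L"
  shows "subsolution_state C v q"
proof -
  have sub: "subsolution_state C a b" using L unfolding subsolution_state_def by linarith
  note a = subsolution_state_norm(2)[OF sub]
  have d0: "d \<ge> 0" using d(1) norm_ge_zero order_trans by blast
  have va: "norm v \<le> sqrt C + 1" using norm_triangle_sub[of v a] a d by linarith
  have "norm (v\<^sup>2 - a\<^sup>2) = norm (v - a) * norm (v + a)"
    by (simp add: norm_mult[symmetric] power2_eq_square algebra_simps)
  also have "\<dots> \<le> d * (2 * sqrt C + 1)"
    using d norm_triangle_ineq[of v a] va a d0 by (intro mult_mono) auto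
  finally have sq: "norm (v\<^sup>2 - a\<^sup>2) \<le> d * (2 * sqrt C + 1)" .
  have "(norm v)\<^sup>2 - (norm a)\<^sup>2 \<le> norm (v\<^sup>2 - a\<^sup>2)"
    using norm_triangle_ineq2[of "v\<^sup>2" "a\<^sup>2"] by (simp add: norm_power)
  moreover have "norm (2 * q - v\<^sup>2) \<le> norm (2 * b - a\<^sup>2) + (2 * norm (q - b) + norm (v\<^sup>2 - a\<^sup>2))"
  proof -
    have "2 * q - v\<^sup>2 = (2 * b - a\<^sup>2) + (2 * (q - b) - (v\<^sup>2 - a\<^sup>2))" by (simp add: algebra_simps)
    also have "norm \<dots> \<le> norm (2 * b - a\<^sup>2) + (norm (2 * (q - b)) + norm (v\<^sup>2 - a\<^sup>2))"
      by (intro norm_triangle_le add_left_mono norm_triangle_ineq4)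
    also have "norm (2 * (q - b)) = 2 * norm (q - b)" by (subst norm_mult) simp
    finally show ?thesis .
  qed
  ultimately have "(norm v)\<^sup>2 + norm (2 * q - v\<^sup>2) \<le> L + 2 * d * (2 * sqrt C + 1) + 2 * d"
    using sq d L by linarith
  also have "\<dots> < C" using d d0 by (simp add: algebra_simps)
  finally show ?thesis unfolding subsolution_state_def .
qed

text \<open>A wave of amplitude s gains \<open>wave_const\<close> s^2 per volume, and the amplitude
  (C - |v|^2) / (8 sqrt C) of \<open>perturbation_direction\<close> has s^2 = (C - |v|^2)^2 / (64
  C).\<close>

definition gain_const :: "real \<Rightarrow> real" where
  "gain_const C = wave_const / (64 * C)"

text \<open>\<open>A\<close> collects fields to which V has to be almost orthogonal, so that the
  energies of successive steps add up. The last clause bounds the gain below by the remaining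
  defect, so that a sequence of such steps cannot stall before |v|^2 = C.\<close>

definition perturbation ::
  "real \<Rightarrow> ((real^2) \<times> real \<Rightarrow> complex) \<Rightarrow> ((real^2) \<times> real \<Rightarrow> complex) \<Rightarrow> ((real^2) \<times> real \<Rightarrow> complex) set
    \<Rightarrow> real \<Rightarrow> ((real^2) \<times> real) set \<Rightarrow> ((real^2) \<times> real \<Rightarrow> complex) \<Rightarrow> ((real^2) \<times> real \<Rightarrow> complex) \<Rightarrow> bool" where
  "perturbation C v q A \<delta> S V Q \<longleftrightarrow>
    continuous_on UNIV V \<and> continuous_on UNIV Q \<and> (\<forall>y. y \<notin> S \<longrightarrow> V y = 0 \<and> Q y = 0) \<and>
    euler_null V Q \<and> (\<forall>y. subsolution_state C (v y + V y) (q y + Q y)) \<and>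
    (\<forall>g\<in>A. \<bar>integral\<^sup>L lborel (\<lambda>y. V y \<bullet> g y)\<bar> \<le> \<delta>) \<and>
    gain_const C * integral\<^sup>L lborel (\<lambda>y. indicator S y * (C - (norm (v y))\<^sup>2)\<^sup>2) - \<delta>
      \<le> integral\<^sup>L lborel (\<lambda>y. (norm (V y))\<^sup>2)"

lemma perturbationD:
  assumes "perturbation C v q A \<delta> S V Q"
  shows "continuous_on UNIV V" "continuous_on UNIV Q" "y \<notin> S \<Longrightarrow> V y = 0" "y \<notin> S \<Longrightarrow> Q y = 0"
    "euler_null V Q" "subsolution_state C (v y + V y) (q y + Q y)"
    "g \<in> A \<Longrightarrow> \<bar>integral\<^sup>L lborel (\<lambda>y. V y \<bullet> g y)\<bar> \<le> \<delta>"
    "gain_const C * integral\<^sup>L lborel (\<lambda>y. indicator S y * (C - (norm (v y))\<^sup>2)\<^sup>2) - \<delta>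
      \<le> integral\<^sup>L lborel (\<lambda>y. (norm (V y))\<^sup>2)"
  using assms unfolding perturbation_def by blast+

lemma continuous_eventually_dist_less:
  fixes f :: "'a::t2_space \<Rightarrow> 'b::metric_space"
  assumes "continuous_on UNIV f" "k > 0"
  shows "\<forall>\<^sub>F y in nhds y0. dist (f y) (f y0) < k"
proof -
  have "isCont f y0" using assms(1) continuous_on_eq_continuous_at[OF open_UNIV] by blast
  hence "(f \<longlongrightarrow> f y0) (nhds y0)" by (simp add: tendsto_nhds_iff isCont_def)
  thus ?thesis using assms(2) by (rule tendstoD)
qed

text \<open>On a small ball v, q, the gap and the members of \<open>A\<close> are nearly constant.
  The state at the centre decides direction and amplitude of a single wave, and a wave of mean 0 is
  nearly orthogonal to nearly constant fields. The errors are proportional to the volume of the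
  ball, so they can be summed over disjoint balls.\<close>

lemma local_perturbation:
  fixes v q :: "(real^2) \<times> real \<Rightarrow> complex"
  assumes cv: "continuous_on UNIV v" and cq: "continuous_on UNIV q"
    and sub: "\<And>y. subsolution_state C (v y) (q y)"
    and A: "finite A" "\<And>g. g \<in> A \<Longrightarrow> continuous_on UNIV g" and \<epsilon>: "\<epsilon> > 0"
  shows "\<exists>r0>0. \<forall>r. 0 < r \<and> r \<le> r0 \<longrightarrow>
    (\<exists>V Q. perturbation C v q A (\<epsilon> * measure lborel (ball y0 r)) (ball y0 r) V Q)"
proof -
  define s where "s = (C - (norm (v y0))\<^sup>2) / (8 * sqrt C)"
  obtain e \<beta> L where eL: "norm e = 1 \<and> L < C \<and> (\<forall>\<sigma>. \<bar>\<sigma>\<bar> \<le> s \<longrightarrow> (norm (v y0 + of_real \<sigma> * e))\<^sup>2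
       + norm (2 * (q y0 + of_real \<sigma> * (\<i> * of_real \<beta> * e\<^sup>2)) - (v y0 + of_real \<sigma> * e)\<^sup>2) \<le> L)"
    using perturbation_direction[OF sub[of y0]] unfolding s_def by (elim exE)
  note e = eL[THEN conjunct1] and L = eL[THEN conjunct2, THEN conjunct1]
    and dir = eL[THEN conjunct2, THEN conjunct2, rule_format]
  have C: "C > 0" using subsolution_state_norm(4)[OF sub] .
  have s: "s > 0" unfolding s_def using subsolution_state_norm(1)[OF sub[of y0]] C by simp
  have gc: "gain_const C > 0" unfolding gain_const_def using C wave_const_pos by simp
  \<comment> \<open>One half of d is spent on freezing v and q at the centre, the other half on the
    error of the wave.\<close>
  define d where "d = min 1 ((C - L) / (2 * (4 * sqrt C + 5)))"
  have sC: "4 * sqrt C + 5 > 0" using C by (simp add: add_pos_pos)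
  have d: "d > 0" "d \<le> 1" "d * (4 * sqrt C + 5) < C - L"
  proof -
    show "d > 0" "d \<le> 1" unfolding d_def using L sC by auto
    have "d * (4 * sqrt C + 5) \<le> (C - L) / (2 * (4 * sqrt C + 5)) * (4 * sqrt C + 5)"
      unfolding d_def using sC by (intro mult_right_mono) auto
    also have "\<dots> = (C - L) / 2" using sC by (simp add: field_simps)
    also have "\<dots> < C - L" using L by simp
    finally show "d * (4 * sqrt C + 5) < C - L" .
  qed
  \<comment> \<open>The scaled wave is bounded by 2 s, so an oscillation \<eta> of a field in
    \<open>A\<close> costs at most \<epsilon> per volume.\<close>
  define \<eta> where "\<eta> = \<epsilon> / (2 * s)"
  have \<eta>: "\<eta> > 0" unfolding \<eta>_def using \<epsilon> s by simp
  define gap where "gap y = (C - (norm (v y))\<^sup>2)\<^sup>2" for y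
  define \<zeta> where "\<zeta> = \<epsilon> / gain_const C"
  have \<zeta>: "\<zeta> > 0" unfolding \<zeta>_def using \<epsilon> gc by simp
  have cgap: "continuous_on UNIV gap" unfolding gap_def[abs_def] by (intro continuous_intros cv)
  have "\<forall>\<^sub>F y in nhds y0. \<forall>g\<in>A. dist (g y) (g y0) < \<eta>"
    by (intro eventually_ball_finite A(1) ballI continuous_eventually_dist_less A(2) \<eta>)
  hence "\<forall>\<^sub>F y in nhds y0. dist (v y) (v y0) < d / 2 \<and> dist (q y) (q y0) < d / 2 \<and>
     dist (gap y) (gap y0) < \<zeta> \<and> (\<forall>g\<in>A. dist (g y) (g y0) < \<eta>)"
    using d(1) by (intro eventually_conj continuous_eventually_dist_less cv cq cgap \<zeta>) auto
  then obtain r0 where r0: "r0 > 0" and near: "\<And>y. dist y y0 < r0 \<Longrightarrow> dist (v y) (v y0) < d / 2 \<and> dist (q y) (q y0) < d / 2 \<and>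
     dist (gap y) (gap y0) < \<zeta> \<and> (\<forall>g\<in>A. dist (g y) (g y0) < \<eta>)"
    unfolding eventually_nhds_metric by blast
  show ?thesis
  proof (intro exI[of _ r0] conjI r0 allI impI; elim conjE)
    fix r assume r: "0 < r" "r \<le> r0"
    let ?B = "ball y0 r"
    have nearB: "norm (v y - v y0) \<le> d / 2" "norm (q y - q y0) \<le> d / 2" "gap y \<le> gap y0 + \<zeta>"
       "\<And>g. g \<in> A \<Longrightarrow> norm (g y - g y0) \<le> \<eta>" if "y \<in> ?B" for y
    proof -
      have "dist y y0 < r0" using that r by (simp add: dist_commute)
      note n = near[OF this]
      show "norm (v y - v y0) \<le> d / 2" "norm (q y - q y0) \<le> d / 2" using n by (auto simp: dist_norm)
      show "gap y \<le> gap y0 + \<zeta>" using n abs_ge_self[of "gap y - gap y0"] by (simp add: dist_real_def)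
      show "norm (g y - g y0) \<le> \<eta>" if "g \<in> A" for g using n that by (auto simp: dist_norm)
    qed
    \<comment> \<open>The bound 1 keeps the unscaled wave below 2; the other one keeps the scaled
      error below d/2.\<close>
    define \<epsilon>' where "\<epsilon>' = min 1 (d / (2 * s))"
    have \<epsilon>': "\<epsilon>' > 0" "\<epsilon>' \<le> 1" "s * \<epsilon>' \<le> d / 2"
    proof -
      show "\<epsilon>' > 0" "\<epsilon>' \<le> 1" unfolding \<epsilon>'_def using d s by auto
      have "s * \<epsilon>' \<le> s * (d / (2 * s))" unfolding \<epsilon>'_def using s by (intro mult_left_mono) auto
      thus "s * \<epsilon>' \<le> d / 2" using s by simp
    qed
    obtain V Q where VQ: "continuous_on UNIV V" "continuous_on UNIV Q"
      "\<And>y. y \<notin> ?B \<Longrightarrow> V y = 0" "\<And>y. y \<notin> ?B \<Longrightarrow> Q y = 0" "euler_null V Q"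
      "integral\<^sup>L lborel (\<lambda>y. Re (V y)) = 0" "integral\<^sup>L lborel (\<lambda>y. Im (V y)) = 0"
      "\<And>y. \<exists>\<sigma>. \<bar>\<sigma>\<bar> \<le> 1 \<and> norm (V y - of_real \<sigma> * e) \<le> \<epsilon>' \<and> norm (Q y - of_real \<sigma> * (\<i> * of_real \<beta> * e\<^sup>2)) \<le> \<epsilon>'"
      "wave_const * measure lborel ?B \<le> integral\<^sup>L lborel (\<lambda>y. (norm (V y))\<^sup>2)"
      by (rule localized_wave[where ?y0.0 = y0 and \<beta> = \<beta>, OF e \<epsilon>'(1) r(1)]) (rule that)
    define V' Q' where "V' y = of_real s * V y" and "Q' y = of_real s * Q y" for y
    have c': "continuous_on UNIV V'" "continuous_on UNIV Q'"
      unfolding V'_def[abs_def] Q'_def[abs_def] by (intro continuous_intros VQ)+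
    have z': "V' y = 0" "Q' y = 0" if "y \<notin> ?B" for y using VQ(3,4)[OF that] by (auto simp: V'_def Q'_def)
    have nV: "norm (V' y) \<le> 2 * s" for y
    proof -
      obtain \<sigma> where "\<bar>\<sigma>\<bar> \<le> 1" "norm (V y - of_real \<sigma> * e) \<le> \<epsilon>'" using VQ(8) by blast
      moreover have "norm (of_real \<sigma> * e) = \<bar>\<sigma>\<bar>" using e by (simp add: norm_mult)
      ultimately have "norm (V y) \<le> 2" using norm_triangle_sub[of "V y" "of_real \<sigma> * e"] \<epsilon>'(2) by linarith
      thus ?thesis unfolding V'_def using s by (simp add: norm_mult)
    qed
    have sub': "subsolution_state C (v y + V' y) (q y + Q' y)" for y
    proof (cases "y \<in> ?B")
      case True
      obtain \<sigma> where \<sigma>: "\<bar>\<sigma>\<bar> \<le> 1" "norm (V y - of_real \<sigma> * e) \<le> \<epsilon>'"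
        "norm (Q y - of_real \<sigma> * (\<i> * of_real \<beta> * e\<^sup>2)) \<le> \<epsilon>'" using VQ(8) by blast
      have s\<sigma>: "\<bar>s * \<sigma>\<bar> \<le> s" using \<sigma>(1) s by (simp add: abs_mult)
      show ?thesis
      proof (rule subsolution_state_near[OF dir[OF s\<sigma>] L _ _ d(2,3)])
        have "norm ((v y + V' y) - (v y0 + of_real (s * \<sigma>) * e)) = norm ((v y - v y0) + of_real s * (V y - of_real \<sigma> * e))"
          by (simp add: V'_def algebra_simps)
        also have "\<dots> \<le> norm (v y - v y0) + s * norm (V y - of_real \<sigma> * e)"
          by (rule norm_triangle_le) (use s in \<open>simp add: norm_mult\<close>)
        also have "\<dots> \<le> d / 2 + s * \<epsilon>'" using nearB[OF True] \<sigma> s by (intro add_mono mult_left_mono) auto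
        finally show "norm ((v y + V' y) - (v y0 + of_real (s * \<sigma>) * e)) \<le> d" using \<epsilon>'(3) by linarith
        have "norm ((q y + Q' y) - (q y0 + of_real (s * \<sigma>) * (\<i> * of_real \<beta> * e\<^sup>2)))
          = norm ((q y - q y0) + of_real s * (Q y - of_real \<sigma> * (\<i> * of_real \<beta> * e\<^sup>2)))"
          by (simp add: Q'_def algebra_simps)
        also have "\<dots> \<le> norm (q y - q y0) + s * norm (Q y - of_real \<sigma> * (\<i> * of_real \<beta> * e\<^sup>2))"
          by (rule norm_triangle_le) (use s in \<open>simp add: norm_mult\<close>)
        also have "\<dots> \<le> d / 2 + s * \<epsilon>'" using nearB[OF True] \<sigma> s by (intro add_mono mult_left_mono) auto
        finally show "norm ((q y + Q' y) - (q y0 + of_real (s * \<sigma>) * (\<i> * of_real \<beta> * e\<^sup>2))) \<le> d" using \<epsilon>'(3) by linarith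
      qed
    qed (use z' sub in simp)
    have mean: "integral\<^sup>L lborel (\<lambda>y. V' y \<bullet> c) = 0" for c
    proof -
      have i: "integrable lborel (\<lambda>y. Re (V y))" "integrable lborel (\<lambda>y. Im (V y))"
        by (rule continuous_ball_integrable[OF _ bounded_ball[of y0 r]]; use VQ(3) in \<open>auto intro!: continuous_intros VQ(1)\<close>)+
      have "(\<lambda>y. V' y \<bullet> c) = (\<lambda>y. (s * Re c) * Re (V y) + (s * Im c) * Im (V y))"
        by (auto simp: V'_def inner_complex_def fun_eq_iff algebra_simps)
      thus ?thesis using i VQ(6,7) by simp
    qed
    have Vg: "integrable lborel (\<lambda>y. V' y \<bullet> g y)" if "continuous_on UNIV g" for g
      by (rule continuous_ball_integrable[OF _ bounded_ball[of y0 r]]) (use that z' in \<open>auto intro!: continuous_intros c'\<close>)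
    have Bint: "integrable lborel (\<lambda>y. c * indicator ?B y)" for c :: real
      by (intro integrable_mult_right integrable_real_indicator) (use emeasure_bounded_finite[OF bounded_ball] in auto)
    have Bm: "integral\<^sup>L lborel (\<lambda>y. c * indicator ?B y) = c * measure lborel ?B" for c :: real by simp
    have orth: "\<bar>integral\<^sup>L lborel (\<lambda>y. V' y \<bullet> g y)\<bar> \<le> \<epsilon> * measure lborel ?B" if g: "g \<in> A" for g
    proof -
      have "integral\<^sup>L lborel (\<lambda>y. V' y \<bullet> g y) = integral\<^sup>L lborel (\<lambda>y. V' y \<bullet> (g y - g y0))"
        using Vg[OF A(2)[OF g]] Vg[OF continuous_on_const] mean by (simp add: inner_diff_right)
      also have "\<bar>\<dots>\<bar> \<le> integral\<^sup>L lborel (\<lambda>y. \<epsilon> * indicator ?B y)"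
      proof (rule order_trans[OF integral_abs_bound])
        show "integral\<^sup>L lborel (\<lambda>y. \<bar>V' y \<bullet> (g y - g y0)\<bar>) \<le> integral\<^sup>L lborel (\<lambda>y. \<epsilon> * indicator ?B y)"
        proof (rule integral_mono[OF _ Bint])
          show "integrable lborel (\<lambda>y. \<bar>V' y \<bullet> (g y - g y0)\<bar>)"
            by (intro integrable_abs Vg continuous_intros A(2) g)
          fix y show "\<bar>V' y \<bullet> (g y - g y0)\<bar> \<le> \<epsilon> * indicator ?B y"
          proof (cases "y \<in> ?B")
            case True
            have "\<bar>V' y \<bullet> (g y - g y0)\<bar> \<le> norm (V' y) * norm (g y - g y0)" by (rule Cauchy_Schwarz_ineq2)
            also have "\<dots> \<le> (2 * s) * \<eta>" using nV nearB(4)[OF True g] s by (intro mult_mono) auto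
            also have "\<dots> = \<epsilon>" unfolding \<eta>_def using s by simp
            finally show ?thesis using True by simp
          qed (use z' in simp)
        qed
      qed
      finally show ?thesis using Bm by simp
    qed
    have en: "euler_null V' Q'"
      unfolding V'_def[abs_def] Q'_def[abs_def] by (rule euler_null_scale[OF VQ(5)])
    have gain: "gain_const C * integral\<^sup>L lborel (\<lambda>y. indicator ?B y * (C - (norm (v y))\<^sup>2)\<^sup>2) - \<epsilon> * measure lborel ?B
      \<le> integral\<^sup>L lborel (\<lambda>y. (norm (V' y))\<^sup>2)"
    proof -
      have "integral\<^sup>L lborel (\<lambda>y. indicator ?B y * gap y) \<le> integral\<^sup>L lborel (\<lambda>y. (gap y0 + \<zeta>) * indicator ?B y)"
      proof (rule integral_mono[OF _ Bint])
        show "integrable lborel (\<lambda>y. indicator ?B y * gap y)"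
        proof (rule bounded_integrable[of _ ?B "gap y0 + \<zeta>"])
          show "\<bar>indicator ?B y * gap y\<bar> \<le> gap y0 + \<zeta>" if "y \<in> ?B" for y
            using nearB(3)[OF that] that by (simp add: gap_def)
        qed (use borel_measurable_continuous_onI[OF cgap] in
            \<open>auto intro!: borel_measurable_times borel_measurable_indicator\<close>)
        fix y show "indicator ?B y * gap y \<le> (gap y0 + \<zeta>) * indicator ?B y"
          using nearB(3)[of y] by (simp add: indicator_def)
      qed
      hence "gain_const C * integral\<^sup>L lborel (\<lambda>y. indicator ?B y * gap y) \<le> gain_const C * ((gap y0 + \<zeta>) * measure lborel ?B)"
        using gc Bm by (intro mult_left_mono) auto
      also have "\<dots> = gain_const C * gap y0 * measure lborel ?B + \<epsilon> * measure lborel ?B"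
        unfolding \<zeta>_def using gc by (simp add: field_simps)
      also have "gain_const C * gap y0 = s\<^sup>2 * wave_const"
        unfolding gain_const_def gap_def s_def using C by (simp add: power_divide power_mult_distrib)
      also have "s\<^sup>2 * wave_const * measure lborel ?B \<le> s\<^sup>2 * integral\<^sup>L lborel (\<lambda>y. (norm (V y))\<^sup>2)"
        using VQ(9) by (simp add: mult.assoc mult_left_mono)
      also have "\<dots> = integral\<^sup>L lborel (\<lambda>y. (norm (V' y))\<^sup>2)"
        by (simp add: V'_def norm_mult power_mult_distrib)
      finally show ?thesis unfolding gap_def by linarith
    qed
    show "\<exists>V Q. perturbation C v q A (\<epsilon> * measure lborel ?B) ?B V Q"
      unfolding perturbation_def
      by (intro exI[of _ V'] exI[of _ Q'] conjI allI ballI impI) (use c' z' sub' orth gain en in auto)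
  qed
qed

text \<open>Vitali's theorem covers almost all of \<Omega> by countably many disjoint balls.
  Finitely many are kept, at the price of an uncovered set of measure below \<delta>, because a
  finite sum of perturbations is continuous and solves the linear system without any limit.\<close>

lemma finite_disjoint_ball_cover:
  fixes \<Omega> :: "'a::euclidean_space set"
  assumes \<Omega>: "open \<Omega>" "bounded \<Omega>" and \<delta>: "\<delta> > 0"
    and good: "\<And>x. x \<in> \<Omega> \<Longrightarrow> \<exists>r0>0. \<forall>r. 0 < r \<and> r \<le> r0 \<longrightarrow> P x r"
  obtains F where "finite F" "\<And>x r. (x, r) \<in> F \<Longrightarrow> 0 < r \<and> ball x r \<subseteq> \<Omega> \<and> P x r"
    "pairwise (\<lambda>i j. disjnt (ball (fst i) (snd i)) (ball (fst j) (snd j))) F"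
    "measure lborel (\<Omega> - (\<Union>i\<in>F. ball (fst i) (snd i))) < \<delta>"
proof -
  define K where "K = {(x, r). x \<in> \<Omega> \<and> 0 < r \<and> ball x r \<subseteq> \<Omega> \<and> P x r}"
  let ?b = "\<lambda>i::'a \<times> real. ball (fst i) (snd i)"
  obtain C where C: "countable C" "C \<subseteq> K" "pairwise (\<lambda>i j. disjnt (?b i) (?b j)) C"
    "negligible (\<Omega> - (\<Union>i\<in>C. ?b i))"
  proof (rule Vitali_covering_theorem_balls[of \<Omega> K fst snd])
    fix x and d :: real assume x: "x \<in> \<Omega>" and d: "0 < d"
    obtain r0 where r0: "r0 > 0" "\<And>r. 0 < r \<Longrightarrow> r \<le> r0 \<Longrightarrow> P x r" using good[OF x] by blast
    obtain r1 where r1: "r1 > 0" "ball x r1 \<subseteq> \<Omega>" using \<Omega>(1) x openE by blast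
    define r where "r = min r0 (min r1 (d / 2))"
    have r: "r > 0" "r \<le> r0" "r \<le> r1" "r < d" unfolding r_def using r0 r1 d by (auto simp: min_def)
    have "ball x r \<subseteq> \<Omega>" using r(3) r1(2) subset_ball by blast
    hence "(x, r) \<in> K" unfolding K_def using x r r0(2) by auto
    thus "\<exists>i. i \<in> K \<and> x \<in> ?b i \<and> snd i < d" using r by (intro exI[of _ "(x, r)"]) auto
  qed (use that in blast)
  have sub: "(\<Union>i\<in>C. ?b i) \<subseteq> \<Omega>" using C(2) unfolding K_def by fastforce
  define A where "A n = (\<Union>i\<in>{i\<in>C. to_nat_on C i < n}. ?b i)" for n
  have fin: "finite {i\<in>C. to_nat_on C i < n}" for n
  proof (rule finite_imageD[of "to_nat_on C"])
    show "finite (to_nat_on C ` {i \<in> C. to_nat_on C i < n})" by (rule finite_subset[of _ "{..<n}"]) auto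
    show "inj_on (to_nat_on C) {i \<in> C. to_nat_on C i < n}"
      using inj_on_to_nat_on[OF C(1)] by (rule inj_on_subset) auto
  qed
  have AU: "(\<Union>n. A n) = (\<Union>i\<in>C. ?b i)" unfolding A_def by (auto intro: lessI)
  have mA: "A n \<in> sets lborel" for n unfolding A_def by (auto intro!: borel_open)
  have m\<Omega>: "\<Omega> \<in> sets lborel" using \<Omega> by auto
  have f\<Omega>: "emeasure lborel \<Omega> < \<infinity>" using emeasure_bounded_finite \<Omega>(2) by auto
  have "(\<lambda>n. measure lborel (\<Omega> - A n)) \<longlonglongrightarrow> measure lborel (\<Inter>n. \<Omega> - A n)"
  proof (rule Lim_measure_decseq)
    show "range (\<lambda>n. \<Omega> - A n) \<subseteq> sets lborel" using mA m\<Omega> by blast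
    show "decseq (\<lambda>n. \<Omega> - A n)" unfolding decseq_def A_def by fastforce
    show "emeasure lborel (\<Omega> - A n) \<noteq> \<infinity>" for n
      using emeasure_mono[of "\<Omega> - A n" \<Omega> lborel] f\<Omega> m\<Omega> by (auto simp: top_unique)
  qed
  moreover have "measure lborel (\<Inter>n. \<Omega> - A n) = 0"
  proof -
    have "(\<Inter>n. \<Omega> - A n) = \<Omega> - (\<Union>i\<in>C. ?b i)" using AU by auto
    moreover have "measure lebesgue (\<Omega> - (\<Union>i\<in>C. ?b i)) = 0" using C(4) negligible_imp_measure0 by blast
    moreover have "\<Omega> - (\<Union>i\<in>C. ?b i) \<in> sets lborel"
      using m\<Omega> by (intro sets.Diff) (auto intro!: borel_open)
    ultimately show ?thesis by simp
  qed
  ultimately have "(\<lambda>n. measure lborel (\<Omega> - A n)) \<longlonglongrightarrow> 0" by simp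
  then obtain n where n: "measure lborel (\<Omega> - A n) < \<delta>"
    using \<delta> by (metis (no_types, lifting) eventually_sequentially order_tendstoD(2) order_refl)
  show ?thesis
  proof (rule that[of "{i\<in>C. to_nat_on C i < n}"])
    show "pairwise (\<lambda>i j. disjnt (?b i) (?b j)) {i\<in>C. to_nat_on C i < n}"
      using C(3) by (rule pairwise_subset) auto
    show "measure lborel (\<Omega> - (\<Union>i\<in>{i\<in>C. to_nat_on C i < n}. ?b i)) < \<delta>" using n unfolding A_def .
    show "0 < r \<and> ball x r \<subseteq> \<Omega> \<and> P x r" if "(x, r) \<in> {i\<in>C. to_nat_on C i < n}" for x r
      using that C(2) unfolding K_def by auto
  qed (rule fin)
qed

lemma euler_null_sum:
  assumes "finite F" "\<And>i. i \<in> F \<Longrightarrow> euler_null (V i) (Q i)"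
    "\<And>i. i \<in> F \<Longrightarrow> bounded_borel (V i)" "\<And>i. i \<in> F \<Longrightarrow> bounded_borel (Q i)"
  shows "euler_null (\<lambda>y. \<Sum>i\<in>F. V i y) (\<lambda>y. \<Sum>i\<in>F. Q i y) \<and> bounded_borel (\<lambda>y. \<Sum>i\<in>F. V i y) \<and> bounded_borel (\<lambda>y. \<Sum>i\<in>F. Q i y)"
  using assms
proof (induction F rule: finite_induct)
  case empty
  show ?case by (auto simp: euler_null_def bounded_borel_def)
next
  case (insert i F)
  hence "euler_null (\<lambda>y. V i y + (\<Sum>i\<in>F. V i y)) (\<lambda>y. Q i y + (\<Sum>i\<in>F. Q i y)) \<and>
    bounded_borel (\<lambda>y. V i y + (\<Sum>i\<in>F. V i y)) \<and> bounded_borel (\<lambda>y. Q i y + (\<Sum>i\<in>F. Q i y))"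
    by (intro conjI euler_null_add bounded_borel_add) auto
  thus ?case using insert(1,2) by simp
qed

lemma perturbation_step:
  fixes v q :: "(real^2) \<times> real \<Rightarrow> complex"
  assumes \<Omega>: "open \<Omega>" "bounded \<Omega>"
    and cv: "continuous_on UNIV v" and cq: "continuous_on UNIV q"
    and sub: "\<And>y. subsolution_state C (v y) (q y)"
    and A: "finite A" "\<And>g. g \<in> A \<Longrightarrow> continuous_on UNIV g" and \<epsilon>: "\<epsilon> > 0"
  shows "\<exists>V Q. perturbation C v q A \<epsilon> \<Omega> V Q"
proof -
  have C: "C > 0" using subsolution_state_norm(4)[OF sub] .
  have gc: "gain_const C > 0" unfolding gain_const_def using C wave_const_pos by simp
  define gap where "gap y = (C - (norm (v y))\<^sup>2)\<^sup>2" for y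
  have cgap: "continuous_on UNIV gap" unfolding gap_def[abs_def] by (intro continuous_intros cv)
  have gap01: "0 \<le> gap y" "gap y \<le> C\<^sup>2" for y
    using subsolution_state_norm(1)[OF sub[of y]] C unfolding gap_def by (auto intro!: power_mono)
  define m where "m = measure lborel \<Omega>"
  \<comment> \<open>Errors per volume add up to at most \<epsilon>' m \<le> \<epsilon>/2 over
    disjoint balls.\<close>
  define \<epsilon>' where "\<epsilon>' = \<epsilon> / (2 * (m + 1))"
  have m: "m \<ge> 0" unfolding m_def by simp
  have \<epsilon>': "\<epsilon>' > 0" "\<epsilon>' * m \<le> \<epsilon> / 2"
  proof -
    show "\<epsilon>' > 0" unfolding \<epsilon>'_def using \<epsilon> m by simp
    thus "\<epsilon>' * m \<le> \<epsilon> / 2" unfolding \<epsilon>'_def using m \<epsilon> by (simp add: field_simps)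
  qed
  \<comment> \<open>On the uncovered set the squared gap is at most C^2, so this set takes the other
    half of \<epsilon> from the gain.\<close>
  define \<delta> where "\<delta> = \<epsilon> / (2 * gain_const C * C\<^sup>2)"
  have \<delta>: "\<delta> > 0" "gain_const C * (C\<^sup>2 * \<delta>) = \<epsilon> / 2" unfolding \<delta>_def using \<epsilon> gc C by auto
  define P where "P x r \<longleftrightarrow> (\<exists>V Q. perturbation C v q A (\<epsilon>' * measure lborel (ball x r)) (ball x r) V Q)" for x r
  have good: "\<exists>r0>0. \<forall>r. 0 < r \<and> r \<le> r0 \<longrightarrow> P x r" for x
    unfolding P_def by (rule local_perturbation[OF cv cq sub A \<epsilon>'(1)])
  obtain F where F: "finite F" "\<And>x r. (x, r) \<in> F \<Longrightarrow> 0 < r \<and> ball x r \<subseteq> \<Omega> \<and> P x r"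
    "pairwise (\<lambda>i j. disjnt (ball (fst i) (snd i)) (ball (fst j) (snd j))) F"
    "measure lborel (\<Omega> - (\<Union>i\<in>F. ball (fst i) (snd i))) < \<delta>"
    by (rule finite_disjoint_ball_cover[OF \<Omega> \<delta>(1) good]) (rule that)
  define b where "b i = ball (fst i) (snd i)" for i :: "((real^2) \<times> real) \<times> real"
  have b\<Omega>: "b i \<subseteq> \<Omega>" if "i \<in> F" for i using F(2)[of "fst i" "snd i"] that unfolding b_def by auto
  have disj: "i = j" if "i \<in> F" "j \<in> F" "y \<in> b i" "y \<in> b j" for i j y
    using F(3) that unfolding pairwise_def disjnt_def b_def by blast
  have "\<forall>i. \<exists>V Q. i \<in> F \<longrightarrow> perturbation C v q A (\<epsilon>' * measure lborel (b i)) (b i) V Q"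
    using F(2) unfolding P_def b_def by (metis prod.collapse)
  then obtain V Q where p: "\<And>i. i \<in> F \<Longrightarrow> perturbation C v q A (\<epsilon>' * measure lborel (b i)) (b i) (V i) (Q i)"
    by metis
  note VQ = perturbationD[OF p, folded gap_def]
  have bB: "b i \<in> sets borel" for i unfolding b_def by simp
  have bb: "bounded (b i)" for i unfolding b_def by (rule bounded_ball)
  have bbV: "bounded_borel (V i)" "bounded_borel (Q i)" if "i \<in> F" for i
    using continuous_ball_bounded_borel[OF VQ(1)[OF that] bb VQ(3)[OF that]]
      continuous_ball_bounded_borel[OF VQ(2)[OF that] bb VQ(4)[OF that]] by auto
  define V' Q' where "V' y = (\<Sum>i\<in>F. V i y)" and "Q' y = (\<Sum>i\<in>F. Q i y)" for y
  have one: "V' y = V i y \<and> Q' y = Q i y" if "i \<in> F" "y \<in> b i" for i y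
  proof -
    have "V j y = 0 \<and> Q j y = 0" if "j \<in> F - {i}" for j
      using disj[OF \<open>i \<in> F\<close> _ \<open>y \<in> b i\<close>, of j] that VQ(3,4) by blast
    thus ?thesis unfolding V'_def Q'_def using sum.remove[OF F(1) that(1), of "\<lambda>i. V i y"]
      sum.remove[OF F(1) that(1), of "\<lambda>i. Q i y"] by simp
  qed
  have none: "V' y = 0 \<and> Q' y = 0" if "\<And>i. i \<in> F \<Longrightarrow> y \<notin> b i" for y
    unfolding V'_def Q'_def using VQ(3,4) that by (auto intro!: sum.neutral)
  have sumb: "(\<Sum>i\<in>F. measure lborel (b i)) \<le> m"
  proof -
    have "disjoint_family_on b F"
      unfolding disjoint_family_on_def using disj by blast
    hence "(\<Sum>i\<in>F. measure lborel (b i)) = measure lborel (\<Union>i\<in>F. b i)"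
      using less_imp_neq[OF emeasure_bounded_finite[OF bb]] bB
      by (intro measure_finite_Union[symmetric] F(1)) auto
    also have "\<dots> \<le> m" unfolding m_def
      by (rule measure_mono_fmeasurable) (use b\<Omega> \<Omega> F(1) in \<open>auto simp: b_def intro!: fmeasurableI emeasure_bounded_finite borel_open open_UN\<close>)
    finally show ?thesis .
  qed
  have cV': "continuous_on UNIV V'" "continuous_on UNIV Q'"
    unfolding V'_def[abs_def] Q'_def[abs_def] by (intro continuous_on_sum VQ; assumption)+
  have null: "euler_null V' Q'"
    unfolding V'_def[abs_def] Q'_def[abs_def] using euler_null_sum[of F V Q, OF F(1) VQ(5) bbV] by blast
  have sub': "subsolution_state C (v y + V' y) (q y + Q' y)" for y
  proof (cases "\<exists>i\<in>F. y \<in> b i")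
    case True
    then obtain i where "i \<in> F" "y \<in> b i" by blast
    thus ?thesis using one VQ(6) by metis
  next
    case False
    thus ?thesis using none[of y] sub by auto
  qed
  have orth: "\<bar>integral\<^sup>L lborel (\<lambda>y. V' y \<bullet> g y)\<bar> \<le> \<epsilon>" if g: "g \<in> A" for g
  proof -
    have i: "integrable lborel (\<lambda>y. V i y \<bullet> g y)" if "i \<in> F" for i
      by (rule continuous_ball_integrable[OF _ bb[of i]])
        (use VQ(3)[OF that] in \<open>auto intro!: continuous_intros VQ(1)[OF that] A(2)[OF g]\<close>)
    have "integral\<^sup>L lborel (\<lambda>y. V' y \<bullet> g y) = (\<Sum>i\<in>F. integral\<^sup>L lborel (\<lambda>y. V i y \<bullet> g y))"
      unfolding V'_def inner_sum_left by (rule Bochner_Integration.integral_sum) (rule i)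
    also have "\<bar>\<dots>\<bar> \<le> (\<Sum>i\<in>F. \<epsilon>' * measure lborel (b i))"
      by (rule order_trans[OF sum_abs sum_mono]) (use VQ(7) g in auto)
    also have "\<dots> \<le> \<epsilon>' * m" unfolding sum_distrib_left[symmetric] using sumb \<epsilon>' by (intro mult_left_mono) auto
    finally show ?thesis using \<epsilon>' \<epsilon> by linarith
  qed
  have gain: "gain_const C * integral\<^sup>L lborel (\<lambda>y. indicator \<Omega> y * gap y) - \<epsilon> \<le> integral\<^sup>L lborel (\<lambda>y. (norm (V' y))\<^sup>2)"
  proof -
    have i: "integrable lborel (\<lambda>y. (norm (V i y))\<^sup>2)" if "i \<in> F" for i
      by (rule continuous_ball_integrable[OF _ bb[of i]])
        (use VQ(3)[OF that] in \<open>auto intro!: continuous_intros VQ(1)[OF that]\<close>)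
    have ind: "integrable lborel (\<lambda>y. indicator S y * gap y)" if "S \<in> sets borel" "bounded S" for S
      by (rule bounded_integrable[of _ S "C\<^sup>2"])
        (use borel_measurable_continuous_onI[OF cgap] that gap01 in
          \<open>auto intro!: borel_measurable_times borel_measurable_indicator\<close>)
    have bS: "b i \<in> sets borel" for i unfolding b_def by simp
    let ?R = "\<Omega> - (\<Union>i\<in>F. b i)"
    have "(\<Union>i\<in>F. b i) \<in> sets borel" unfolding b_def by (intro borel_open open_UN) auto
    hence R: "?R \<in> sets borel" "bounded ?R"
      using borel_open[OF \<Omega>(1)] bounded_subset[OF \<Omega>(2)] by (auto intro: sets.Diff)
    have split: "indicator \<Omega> y * gap y \<le> (\<Sum>i\<in>F. indicator (b i) y * gap y) + C\<^sup>2 * indicator ?R y" for y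
    proof (cases "\<exists>i\<in>F. y \<in> b i")
      case True
      then obtain i where iF: "i \<in> F" "y \<in> b i" by blast
      have "gap y = indicator (b i) y * gap y" using iF by simp
      also have "\<dots> \<le> (\<Sum>i\<in>F. indicator (b i) y * gap y)"
        by (rule member_le_sum[OF iF(1) _ F(1)]) (use gap01 in auto)
      finally show ?thesis using b\<Omega>[OF iF(1)] iF by (auto simp: indicator_def)
    next
      case False
      hence "(\<Sum>i\<in>F. indicator (b i) y * gap y) = 0" by (auto intro!: sum.neutral)
      thus ?thesis using gap01[of y] False by (auto simp: indicator_def)
    qed
    have iR: "integrable lborel (\<lambda>y. C\<^sup>2 * indicator ?R y)"
      by (intro integrable_mult_right integrable_real_indicator) (use R emeasure_bounded_finite[OF R(2)] in auto)
    have "integral\<^sup>L lborel (\<lambda>y. indicator \<Omega> y * gap y)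
       \<le> integral\<^sup>L lborel (\<lambda>y. (\<Sum>i\<in>F. indicator (b i) y * gap y) + C\<^sup>2 * indicator ?R y)"
      using \<Omega> by (intro integral_mono ind Bochner_Integration.integrable_add Bochner_Integration.integrable_sum bS bb iR split) (auto intro: borel_open)
    also have "\<dots> = (\<Sum>i\<in>F. integral\<^sup>L lborel (\<lambda>y. indicator (b i) y * gap y)) + C\<^sup>2 * measure lborel ?R"
      by (subst Bochner_Integration.integral_add; (subst Bochner_Integration.integral_sum)?)
         (use ind bS bb iR in \<open>auto intro!: Bochner_Integration.integrable_sum\<close>)
    also have "\<dots> \<le> (\<Sum>i\<in>F. integral\<^sup>L lborel (\<lambda>y. indicator (b i) y * gap y)) + C\<^sup>2 * \<delta>"
      using F(4) unfolding b_def by (intro add_left_mono mult_left_mono) auto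
    finally have "gain_const C * integral\<^sup>L lborel (\<lambda>y. indicator \<Omega> y * gap y)
      \<le> gain_const C * ((\<Sum>i\<in>F. integral\<^sup>L lborel (\<lambda>y. indicator (b i) y * gap y)) + C\<^sup>2 * \<delta>)"
      using gc by (intro mult_left_mono) auto
    also have "\<dots> = (\<Sum>i\<in>F. gain_const C * integral\<^sup>L lborel (\<lambda>y. indicator (b i) y * gap y)) + \<epsilon> / 2"
      using \<delta>(2) by (simp add: distrib_left sum_distrib_left)
    also have "\<dots> \<le> (\<Sum>i\<in>F. integral\<^sup>L lborel (\<lambda>y. (norm (V i y))\<^sup>2) + \<epsilon>' * measure lborel (b i)) + \<epsilon> / 2"
      using VQ(8) by (intro add_right_mono sum_mono) (simp add: diff_le_eq)
    also have "\<dots> = (\<Sum>i\<in>F. integral\<^sup>L lborel (\<lambda>y. (norm (V i y))\<^sup>2)) + \<epsilon>' * (\<Sum>i\<in>F. measure lborel (b i)) + \<epsilon> / 2"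
      by (simp add: sum.distrib sum_distrib_left)
    also have "\<dots> \<le> (\<Sum>i\<in>F. integral\<^sup>L lborel (\<lambda>y. (norm (V i y))\<^sup>2)) + \<epsilon>"
    proof -
      have "\<epsilon>' * (\<Sum>i\<in>F. measure lborel (b i)) \<le> \<epsilon>' * m" using sumb \<epsilon>' by (intro mult_left_mono) auto
      thus ?thesis using \<epsilon>' by linarith
    qed
    also have "(\<Sum>i\<in>F. integral\<^sup>L lborel (\<lambda>y. (norm (V i y))\<^sup>2)) = integral\<^sup>L lborel (\<lambda>y. (norm (V' y))\<^sup>2)"
    proof -
      have "(norm (V' y))\<^sup>2 = (\<Sum>i\<in>F. (norm (V i y))\<^sup>2)" for y
      proof (cases "\<exists>i\<in>F. y \<in> b i")
        case True
        then obtain i where iF: "i \<in> F" "y \<in> b i" by blast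
        have "V j y = 0" if "j \<in> F - {i}" for j
          using disj[OF iF(1) _ iF(2), of j] that VQ(3) by blast
        hence "(\<Sum>j\<in>F. (norm (V j y))\<^sup>2) = (norm (V i y))\<^sup>2"
          using sum.remove[OF F(1) iF(1), of "\<lambda>j. (norm (V j y))\<^sup>2"] by simp
        thus ?thesis using one[OF iF] by simp
      next
        case False
        hence "(\<Sum>j\<in>F. (norm (V j y))\<^sup>2) = 0" using VQ(3) by (intro sum.neutral) auto
        thus ?thesis using none[of y] False by auto
      qed
      thus ?thesis using i by (simp add: Bochner_Integration.integral_sum)
    qed
    finally show ?thesis by linarith
  qed
  have "V' y = 0 \<and> Q' y = 0" if "y \<notin> \<Omega>" for y using none[of y] b\<Omega> that by blast
  hence "perturbation C v q A \<epsilon> \<Omega> V' Q'"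
    unfolding perturbation_def using cV' null sub' orth gain[unfolded gap_def] by blast
  thus ?thesis by blast
qed

section \<open>Limits of perturbation sequences, and regions without bound\<close>

lemma euler_null_limit:
  fixes V :: "(real^2) \<times> real \<Rightarrow> complex"
  assumes n: "\<And>n :: nat. euler_null (Vn n) (Qn n)"
    and m: "\<And>n. Vn n \<in> borel_measurable borel" "\<And>n. Qn n \<in> borel_measurable borel"
    and b: "\<And>n y. norm (Vn n y) \<le> M" "\<And>n y. norm (Qn n y) \<le> M"
    and l: "AE y in lborel. (\<lambda>n. Vn n y) \<longlonglongrightarrow> V y \<and> (\<lambda>n. Qn n y) \<longlonglongrightarrow> Q y"
    and mV: "V \<in> borel_measurable borel" "Q \<in> borel_measurable borel"
  shows "euler_null V Q"
  unfolding euler_null_def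
proof (intro allI impI)
  fix \<psi> :: "(real^2) \<times> real \<Rightarrow> real" assume t: "test_function \<psi>"
  note nn = n[unfolded euler_null_def, rule_format, OF t]
  have M: "M \<ge> 0" using b(1) norm_ge_zero order_trans by blast
  have cts: "continuous_on UNIV (dt \<psi>)" "continuous_on UNIV (dx 1 \<psi>)" "continuous_on UNIV (dx 2 \<psi>)"
    using dt_dx_continuous[OF t] by auto
  have msr: "dt \<psi> \<in> borel_measurable borel" "dx 1 \<psi> \<in> borel_measurable borel" "dx 2 \<psi> \<in> borel_measurable borel"
    using cts by (auto intro: borel_measurable_continuous_onI)
  define w where "w z = M * (\<bar>dt \<psi> z\<bar> + \<bar>dx 1 \<psi> z\<bar> + \<bar>dx 2 \<psi> z\<bar>)" for z
  have iw: "integrable lborel w"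
  proof -
    have "integrable lborel (dt \<psi>)" "integrable lborel (dx 1 \<psi>)" "integrable lborel (dx 2 \<psi>)"
      using euler_null_integrable[of "\<lambda>_. 1" 1, OF _ _ t] by auto
    thus ?thesis unfolding w_def
      by (intro integrable_mult_right Bochner_Integration.integrable_add integrable_abs)
  qed
  have bd: "\<bar>Re (Vn n z) * x\<bar> \<le> M * \<bar>x\<bar>" "\<bar>Im (Vn n z) * x\<bar> \<le> M * \<bar>x\<bar>"
    "\<bar>Re (Qn n z) * x\<bar> \<le> M * \<bar>x\<bar>" "\<bar>Im (Qn n z) * x\<bar> \<le> M * \<bar>x\<bar>" for n z x
    unfolding abs_mult
    using abs_Re_le_cmod[of "Vn n z"] abs_Im_le_cmod[of "Vn n z"] abs_Re_le_cmod[of "Qn n z"] abs_Im_le_cmod[of "Qn n z"]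
      b(1)[of n z] b(2)[of n z] by (auto intro!: mult_right_mono)
  have dx0: "0 \<le> M * \<bar>x\<bar>" for x using M by simp
  note m' = m[THEN measurable_compose[OF _ borel_measurable_Re]] m[THEN measurable_compose[OF _ borel_measurable_Im]]
     mV[THEN measurable_compose[OF _ borel_measurable_Re]] mV[THEN measurable_compose[OF _ borel_measurable_Im]]
  have *: "integral\<^sup>L lborel g = 0"
    if "\<And>n. integral\<^sup>L lborel (f n) = 0" "\<And>n. f n \<in> borel_measurable lborel" "g \<in> borel_measurable lborel"
      "\<And>n z. \<bar>f n z\<bar> \<le> w z" "\<And>z. (\<lambda>n. Vn n z) \<longlonglongrightarrow> V z \<Longrightarrow> (\<lambda>n. Qn n z) \<longlonglongrightarrow> Q z \<Longrightarrow> (\<lambda>n. f n z) \<longlonglongrightarrow> g z"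
    for f g
  proof -
    have "(\<lambda>n. integral\<^sup>L lborel (f n)) \<longlonglongrightarrow> integral\<^sup>L lborel g"
    proof (rule integral_dominated_convergence[OF that(3,2) iw])
      show "AE z in lborel. (\<lambda>n. f n z) \<longlonglongrightarrow> g z" by (rule eventually_mono[OF l]) (use that(5) in blast)
      show "AE z in lborel. norm (f n z) \<le> w z" for n using that(4) by auto
    qed
    thus ?thesis using that(1) by (simp add: LIMSEQ_const_iff)
  qed
  show "integral\<^sup>L lborel (\<lambda>z. Re (V z) * dx 1 \<psi> z + Im (V z) * dx 2 \<psi> z) = 0 \<and>
     integral\<^sup>L lborel (\<lambda>z. Re (V z) * dt \<psi> z + Re (Q z) * dx 1 \<psi> z + Im (Q z) * dx 2 \<psi> z) = 0 \<and>
     integral\<^sup>L lborel (\<lambda>z. Im (V z) * dt \<psi> z + Im (Q z) * dx 1 \<psi> z - Re (Q z) * dx 2 \<psi> z) = 0"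
  proof (intro conjI)
    show "integral\<^sup>L lborel (\<lambda>z. Re (V z) * dx 1 \<psi> z + Im (V z) * dx 2 \<psi> z) = 0"
    proof (rule *[OF nn[THEN conjunct1]])
      show "\<bar>Re (Vn n z) * dx 1 \<psi> z + Im (Vn n z) * dx 2 \<psi> z\<bar> \<le> w z" for n z
        using bd(1)[of n z "dx 1 \<psi> z"] bd(2)[of n z "dx 2 \<psi> z"] dx0[of "dt \<psi> z"] unfolding w_def distrib_left by linarith
    qed (use m' msr in \<open>auto intro!: tendsto_intros\<close>)
    show "integral\<^sup>L lborel (\<lambda>z. Re (V z) * dt \<psi> z + Re (Q z) * dx 1 \<psi> z + Im (Q z) * dx 2 \<psi> z) = 0"
    proof (rule *[OF nn[THEN conjunct2, THEN conjunct1]])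
      show "\<bar>Re (Vn n z) * dt \<psi> z + Re (Qn n z) * dx 1 \<psi> z + Im (Qn n z) * dx 2 \<psi> z\<bar> \<le> w z" for n z
        using bd(1)[of n z "dt \<psi> z"] bd(3)[of n z "dx 1 \<psi> z"] bd(4)[of n z "dx 2 \<psi> z"] unfolding w_def distrib_left by linarith
    qed (use m' msr in \<open>auto intro!: tendsto_intros\<close>)
    show "integral\<^sup>L lborel (\<lambda>z. Im (V z) * dt \<psi> z + Im (Q z) * dx 1 \<psi> z - Re (Q z) * dx 2 \<psi> z) = 0"
    proof (rule *[OF nn[THEN conjunct2, THEN conjunct2]])
      show "\<bar>Im (Vn n z) * dt \<psi> z + Im (Qn n z) * dx 1 \<psi> z - Re (Qn n z) * dx 2 \<psi> z\<bar> \<le> w z" for n z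
        using bd(2)[of n z "dt \<psi> z"] bd(4)[of n z "dx 1 \<psi> z"] bd(3)[of n z "dx 2 \<psi> z"] unfolding w_def distrib_left by linarith
    qed (use m' msr in \<open>auto intro!: tendsto_intros\<close>)
  qed
qed

text \<open>The state of the dependent choice carries a finite set with all fields constructed so
  far: each increment has to be almost orthogonal to every earlier field and not only to the current
  one, since the limit argument compares the fields with indices m and k for all k \<le> m.\<close>

lemma convex_integration_sequence:
  fixes v0 q0 :: complex and \<Omega> :: "((real^2) \<times> real) set"
  assumes \<Omega>: "open \<Omega>" "bounded \<Omega>" and sub0: "subsolution_state C v0 q0"
  obtains v q :: "nat \<Rightarrow> (real^2) \<times> real \<Rightarrow> complex" where
    "\<And>n. continuous_on UNIV (v n)" "\<And>n. continuous_on UNIV (q n)"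
    "\<And>n y. subsolution_state C (v n y) (q n y)"
    "\<And>n y. y \<notin> \<Omega> \<Longrightarrow> v n y = v0" "\<And>n y. y \<notin> \<Omega> \<Longrightarrow> q n y = q0"
    "\<And>n. euler_null (\<lambda>y. v n y - v0) (\<lambda>y. q n y - q0)"
    "\<And>n j. j \<le> n \<Longrightarrow> \<bar>integral\<^sup>L lborel (\<lambda>y. (v (Suc n) y - v n y) \<bullet> v j y)\<bar> \<le> (1/2) ^ n"
    "\<And>n. gain_const C * integral\<^sup>L lborel (\<lambda>y. indicator \<Omega> y * (C - (norm (v n y))\<^sup>2)\<^sup>2) - (1/2) ^ n
      \<le> integral\<^sup>L lborel (\<lambda>y. (norm (v (Suc n) y - v n y))\<^sup>2)"
proof -
  define P where "P = (\<lambda>(v, q, A). continuous_on UNIV v \<and> continuous_on UNIV q \<and>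
    (\<forall>y. subsolution_state C (v y) (q y)) \<and> (\<forall>y. y \<notin> \<Omega> \<longrightarrow> v y = v0 \<and> q y = q0) \<and>
    euler_null (\<lambda>y. v y - v0) (\<lambda>y. q y - q0) \<and> finite A \<and> (\<forall>g\<in>A. continuous_on UNIV g) \<and> v \<in> A)"
  define R where "R n s s' \<longleftrightarrow> snd (snd s) \<subseteq> snd (snd s') \<and>
    perturbation C (fst s) (fst (snd s)) (snd (snd s)) ((1/2) ^ n) \<Omega> (\<lambda>y. fst s' y - fst s y) (\<lambda>y. fst (snd s') y - fst (snd s) y)"
    for n :: nat and s s' :: "((real^2) \<times> real \<Rightarrow> complex) \<times> ((real^2) \<times> real \<Rightarrow> complex) \<times> ((real^2) \<times> real \<Rightarrow> complex) set"
  have "\<exists>f. \<forall>n. P (f n) \<and> R n (f n) (f (Suc n))"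
  proof (rule dependent_nat_choice)
    have "P (\<lambda>_. v0, \<lambda>_. q0, {\<lambda>_. v0})" unfolding P_def using sub0 by (auto simp: euler_null_def)
    thus "\<exists>x. P x" by blast
  next
    fix s :: "((real^2) \<times> real \<Rightarrow> complex) \<times> ((real^2) \<times> real \<Rightarrow> complex) \<times> ((real^2) \<times> real \<Rightarrow> complex) set" and n :: nat
    assume Ps: "P s"
    obtain v q A where s: "s = (v, q, A)" by (cases s)
    have p: "continuous_on UNIV v" "continuous_on UNIV q" "\<And>y. subsolution_state C (v y) (q y)"
      "\<And>y. y \<notin> \<Omega> \<Longrightarrow> v y = v0" "\<And>y. y \<notin> \<Omega> \<Longrightarrow> q y = q0"
      "euler_null (\<lambda>y. v y - v0) (\<lambda>y. q y - q0)" "finite A" "\<And>g. g \<in> A \<Longrightarrow> continuous_on UNIV g" "v \<in> A"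
      using Ps unfolding P_def s by blast+
    obtain V Q where VQ: "perturbation C v q A ((1/2) ^ n) \<Omega> V Q"
      using perturbation_step[OF \<Omega> p(1-3,7,8), of "(1/2) ^ n"] by auto
    note V = perturbationD[OF VQ]
    let ?v = "\<lambda>y. v y + V y" and ?q = "\<lambda>y. q y + Q y"
    have "euler_null (\<lambda>y. (v y - v0) + V y) (\<lambda>y. (q y - q0) + Q y)"
      by (intro euler_null_add p(6) V(5) continuous_ball_bounded_borel[OF _ \<Omega>(2)])
        (use p V in \<open>auto intro!: continuous_intros\<close>)
    hence null: "euler_null (\<lambda>y. ?v y - v0) (\<lambda>y. ?q y - q0)" by (simp add: algebra_simps)
    have "P (?v, ?q, insert ?v A)" unfolding P_def
      using p V null by (auto intro!: continuous_on_add)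
    moreover have "R n s (?v, ?q, insert ?v A)" unfolding R_def s using VQ by auto
    ultimately show "\<exists>s'. P s' \<and> R n s s'" by blast
  qed
  then obtain f where f: "\<And>n. P (f n)" "\<And>n. R n (f n) (f (Suc n))" by blast
  define v q A where "v n = fst (f n)" and "q n = fst (snd (f n))" and "A n = snd (snd (f n))" for n
  have fe: "f n = (v n, q n, A n)" for n unfolding v_def q_def A_def by simp
  note Pn = f(1)[unfolded fe P_def prod.case]
  note Rn = f(2)[unfolded R_def, folded v_def q_def A_def]
  have mem: "v j \<in> A n" if "j \<le> n" for j n
    using that by (induction n rule: dec_induct) (use Pn Rn in blast)+
  show ?thesis
  proof (rule that[of v q])
    show "\<bar>integral\<^sup>L lborel (\<lambda>y. (v (Suc n) y - v n y) \<bullet> v j y)\<bar> \<le> (1/2) ^ n" if "j \<le> n" for n j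
      using perturbationD(7)[OF Rn[THEN conjunct2] mem[OF that]] .
    show "gain_const C * integral\<^sup>L lborel (\<lambda>y. indicator \<Omega> y * (C - (norm (v n y))\<^sup>2)\<^sup>2) - (1/2) ^ n
      \<le> integral\<^sup>L lborel (\<lambda>y. (norm (v (Suc n) y - v n y))\<^sup>2)" for n
      using perturbationD(8)[OF Rn[THEN conjunct2]] .
  qed (use Pn in blast)+
qed

text \<open>An explicit sequence instead of a category argument. By near orthogonality the energies
  increase up to summable errors, and they are bounded by C times the volume; hence they converge,
  the fields are Cauchy in L^2, and the guaranteed gain forces the squared gap to 0 in mean. Along a
  subsequence everything converges almost everywhere, with |v|^2 = C in the limit.\<close>

theorem convex_integration:
  fixes v0 q0 :: complex and \<Omega> :: "((real^2) \<times> real) set"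
  assumes \<Omega>: "open \<Omega>" "bounded \<Omega>" and sub0: "subsolution_state C v0 q0"
  obtains V Q where "V \<in> borel_measurable borel" "Q \<in> borel_measurable borel"
    "\<And>y. y \<notin> \<Omega> \<Longrightarrow> V y = 0" "\<And>y. y \<notin> \<Omega> \<Longrightarrow> Q y = 0"
    "\<And>y. y \<in> \<Omega> \<Longrightarrow> (norm (v0 + V y))\<^sup>2 = C" "\<And>y. y \<in> \<Omega> \<Longrightarrow> 2 * (q0 + Q y) = (v0 + V y)\<^sup>2"
    "euler_null V Q"
proof -
  obtain v q :: "nat \<Rightarrow> (real^2) \<times> real \<Rightarrow> complex" where
    c: "\<And>n. continuous_on UNIV (v n)" "\<And>n. continuous_on UNIV (q n)"
    and sub: "\<And>n y. subsolution_state C (v n y) (q n y)"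
    and off: "\<And>n y. y \<notin> \<Omega> \<Longrightarrow> v n y = v0" "\<And>n y. y \<notin> \<Omega> \<Longrightarrow> q n y = q0"
    and null: "\<And>n. euler_null (\<lambda>y. v n y - v0) (\<lambda>y. q n y - q0)"
    and orth: "\<And>n j. j \<le> n \<Longrightarrow> \<bar>integral\<^sup>L lborel (\<lambda>y. (v (Suc n) y - v n y) \<bullet> v j y)\<bar> \<le> (1/2) ^ n"
    and gain: "\<And>n. gain_const C * integral\<^sup>L lborel (\<lambda>y. indicator \<Omega> y * (C - (norm (v n y))\<^sup>2)\<^sup>2) - (1/2) ^ n
      \<le> integral\<^sup>L lborel (\<lambda>y. (norm (v (Suc n) y - v n y))\<^sup>2)"
    by (rule convex_integration_sequence[OF assms]) (rule that)
  have C: "C > 0" using subsolution_state_norm(4)[OF sub0] .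
  have gc: "gain_const C > 0" unfolding gain_const_def using C wave_const_pos by simp
  have nv: "(norm (v n y))\<^sup>2 < C" "norm (v n y) \<le> sqrt C" "norm (q n y) \<le> C" for n y
    using subsolution_state_norm[OF sub] by auto
  have b\<Omega>: "\<Omega> \<in> sets borel" using \<Omega>(1) by (rule borel_open)
  define a where "a n = integral\<^sup>L lborel (\<lambda>y. indicator \<Omega> y * (norm (v n y))\<^sup>2)" for n
  define gap where "gap n y = (C - (norm (v n y))\<^sup>2)\<^sup>2" for n y
  define b where "b n = integral\<^sup>L lborel (\<lambda>y. indicator \<Omega> y * gap n y)" for n
  have mv: "v n \<in> borel_measurable borel" "q n \<in> borel_measurable borel" for n
    using c by (auto intro: borel_measurable_continuous_onI)
  have gap0: "0 \<le> gap n y" "gap n y \<le> C\<^sup>2" for n y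
    using nv(1)[of n y] C unfolding gap_def by (auto intro!: power_mono)
  have mgap: "gap n \<in> borel_measurable borel" for n unfolding gap_def[abs_def] using mv(1)[of n] by measurable
  have ia: "integrable lborel (\<lambda>y. indicator \<Omega> y * (norm (v n y))\<^sup>2)" for n
    by (rule bounded_integrable[of _ \<Omega> C])
      (use b\<Omega> \<Omega>(2) nv(1)[of n] mv(1)[of n] in \<open>auto intro!: less_imp_le borel_measurable_times borel_measurable_indicator\<close>)
  have ib: "integrable lborel (\<lambda>y. indicator \<Omega> y * gap n y)" for n
    by (rule bounded_integrable[of _ \<Omega> "C\<^sup>2"])
      (use b\<Omega> \<Omega>(2) gap0[of n] mgap[of n] in \<open>auto intro!: borel_measurable_times borel_measurable_indicator\<close>)
  have idot: "integrable lborel (\<lambda>y. (v m y - v k y) \<bullet> v j y)" for m k j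
    by (rule continuous_ball_integrable[OF _ \<Omega>(2)]) (use off in \<open>auto intro!: continuous_intros c\<close>)
  have isq: "integrable lborel (\<lambda>y. (norm (v m y - v k y))\<^sup>2)" for m k
    by (rule continuous_ball_integrable[OF _ \<Omega>(2)]) (use off in \<open>auto intro!: continuous_intros c\<close>)
  have expand: "a m - a k = 2 * integral\<^sup>L lborel (\<lambda>y. (v m y - v k y) \<bullet> v k y) + integral\<^sup>L lborel (\<lambda>y. (norm (v m y - v k y))\<^sup>2)" for m k
  proof -
    have pt: "indicator \<Omega> y * (norm (v m y))\<^sup>2 - indicator \<Omega> y * (norm (v k y))\<^sup>2
       = 2 * ((v m y - v k y) \<bullet> v k y) + (norm (v m y - v k y))\<^sup>2" for y
    proof (cases "y \<in> \<Omega>")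
      case True
      thus ?thesis unfolding power2_norm_eq_inner by (simp add: inner_diff_left inner_diff_right inner_commute)
    qed (simp add: off)
    have "a m - a k = integral\<^sup>L lborel (\<lambda>y. indicator \<Omega> y * (norm (v m y))\<^sup>2 - indicator \<Omega> y * (norm (v k y))\<^sup>2)"
      unfolding a_def using ia by simp
    thus ?thesis unfolding pt using idot isq by simp
  qed
  have orth': "\<bar>integral\<^sup>L lborel (\<lambda>y. (v m y - v k y) \<bullet> v k y)\<bar> \<le> 2 * (1/2) ^ k - 2 * (1/2) ^ m" if "k \<le> m" for m k
    using that
  proof (induction m rule: dec_induct)
    case (step m)
    have "integral\<^sup>L lborel (\<lambda>y. (v (Suc m) y - v k y) \<bullet> v k y)
      = integral\<^sup>L lborel (\<lambda>y. (v (Suc m) y - v m y) \<bullet> v k y) + integral\<^sup>L lborel (\<lambda>y. (v m y - v k y) \<bullet> v k y)"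
      using Bochner_Integration.integral_add[OF idot[of "Suc m" m k] idot[of m k k]] by (simp add: inner_diff_left)
    thus ?case using orth[of k m] step by simp
  qed simp
  \<comment> \<open>One step loses at most 2 (1/2)^n through the cross term and (1/2)^n in the gain.
    The correction 6 (1/2)^n decreases by exactly 3 (1/2)^n, so \<alpha> is monotone.\<close>
  define \<alpha> where "\<alpha> n = a n - 6 * (1/2) ^ n" for n
  have \<alpha>_step: "gain_const C * b n \<le> \<alpha> (Suc n) - \<alpha> n" for n
    using expand[of "Suc n" n] orth[of n n] gain[of n] unfolding \<alpha>_def b_def gap_def by simp
  have b0: "b n \<ge> 0" for n unfolding b_def using gap0 by (intro integral_nonneg_AE) auto
  have "incseq \<alpha>"
  proof (rule incseq_SucI)
    fix n show "\<alpha> n \<le> \<alpha> (Suc n)" using \<alpha>_step[of n] b0[of n] gc mult_nonneg_nonneg[of "gain_const C" "b n"] by linarith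
  qed
  moreover have "\<alpha> n \<le> C * measure lborel \<Omega>" for n
  proof -
    have "a n \<le> integral\<^sup>L lborel (\<lambda>y. C * indicator \<Omega> y)" unfolding a_def
      by (intro integral_mono ia integrable_mult_right integrable_real_indicator)
        (use b\<Omega> emeasure_bounded_finite[OF \<Omega>(2)] less_imp_le[OF nv(1)] in \<open>auto simp: indicator_def\<close>)
    thus ?thesis unfolding \<alpha>_def by (simp add: add_increasing2 algebra_simps)
  qed
  ultimately obtain l where l: "\<alpha> \<longlonglongrightarrow> l" "\<And>n. \<alpha> n \<le> l" using incseq_convergent[of \<alpha>] by blast
  have bl: "b \<longlonglongrightarrow> 0"
  proof -
    have "(\<lambda>n. \<alpha> (Suc n) - \<alpha> n) \<longlonglongrightarrow> l - l" by (intro tendsto_diff LIMSEQ_Suc l)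
    hence "(\<lambda>n. (\<alpha> (Suc n) - \<alpha> n) / gain_const C) \<longlonglongrightarrow> 0 / gain_const C" using gc by (intro tendsto_divide) auto
    hence u: "(\<lambda>n. (\<alpha> (Suc n) - \<alpha> n) / gain_const C) \<longlonglongrightarrow> 0" by simp
    show ?thesis
    proof (rule tendsto_sandwich[OF _ _ tendsto_const u])
      show "\<forall>\<^sub>F n in sequentially. b n \<le> (\<alpha> (Suc n) - \<alpha> n) / gain_const C"
        using \<alpha>_step gc by (simp add: pos_le_divide_eq mult.commute)
    qed (use b0 in simp)
  qed
  \<comment> \<open>Bounds the squared distance of all later fields from the k-th one; the added
    term pays for the cross term, which is at most 2 (1/2)^k before doubling.\<close>
  define \<beta> where "\<beta> k = l - \<alpha> k + 4 * (1/2) ^ k" for k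
  have \<beta>: "\<beta> \<longlonglongrightarrow> 0"
  proof -
    have "(\<lambda>k. l - \<alpha> k + 4 * (1/2) ^ k) \<longlonglongrightarrow> l - l + 4 * 0"
      by (intro tendsto_intros l LIMSEQ_power_zero) auto
    thus ?thesis unfolding \<beta>_def by simp
  qed
  have sq: "integral\<^sup>L lborel (\<lambda>y. (norm (v m y - v k y))\<^sup>2) \<le> \<beta> k" if "k \<le> m" for m k
  proof -
    have "(1/2::real) ^ m \<le> (1/2) ^ k" using that by (intro power_decreasing) auto
    thus ?thesis using zero_le_power[of "1/2::real" k] expand[of m k] abs_le_D2[OF orth'[OF that]] l(2)[of m] unfolding \<beta>_def \<alpha>_def by linarith
  qed
  define D where "D n y = v n y - v0" for n y
  have mD: "D n \<in> borel_measurable borel" for n unfolding D_def[abs_def] using mv(1)[of n] by measurable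
  have iD: "integrable lborel (D n)" for n
  proof -
    have "continuous_on UNIV (\<lambda>y. norm (D n y))" unfolding D_def by (intro continuous_intros c)
    hence "integrable lborel (\<lambda>y. norm (D n y))"
      by (rule continuous_ball_integrable[OF _ \<Omega>(2)]) (simp add: D_def off)
    thus ?thesis by (rule integrable_norm_cancel) (simp add: mD)
  qed
  have L1: "\<exists>N. \<forall>i\<ge>N. \<forall>j\<ge>N. integral\<^sup>L lborel (\<lambda>y. norm (D i y - D j y)) < e" if e: "e > 0" for e
  proof -
    define m where "m = measure lborel \<Omega>"
    have m: "m \<ge> 0" unfolding m_def by simp
    define d where "d = e / (m + 1)"
    have d: "d > 0" "d * m \<le> e" unfolding d_def using e m by (auto simp: field_simps)
    have "\<forall>\<^sub>F k in sequentially. \<beta> k < d * e / 2" using order_tendstoD(2)[OF \<beta>, of "d * e / 2"] d e by auto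
    then obtain N where N: "\<And>k. k \<ge> N \<Longrightarrow> \<beta> k < d * e / 2" unfolding eventually_sequentially by blast
    have main: "integral\<^sup>L lborel (\<lambda>y. norm (v i y - v j y)) < e" if "N \<le> j" "j \<le> i" for i j
    proof -
      have "integral\<^sup>L lborel (\<lambda>y. norm (v i y - v j y))
        \<le> integral\<^sup>L lborel (\<lambda>y. (d / 2) * indicator \<Omega> y + (1 / (2 * d)) * (norm (v i y - v j y))\<^sup>2)"
      proof (intro integral_mono Bochner_Integration.integrable_add integrable_mult_right isq integrable_real_indicator)
        show "integrable lborel (\<lambda>y. norm (v i y - v j y))"
          by (rule continuous_ball_integrable[OF _ \<Omega>(2)]) (use off in \<open>auto intro!: continuous_intros c\<close>)
        fix y show "norm (v i y - v j y) \<le> (d / 2) * indicator \<Omega> y + (1 / (2 * d)) * (norm (v i y - v j y))\<^sup>2"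
        proof (cases "y \<in> \<Omega>")
          case True
          \<comment> \<open>Young's inequality |x| \<le> d/2 + |x|^2/(2 d) on the bounded set
            \<Omega> turns L^2 smallness into L^1 smallness, the form in which almost everywhere
            convergence of a subsequence is available.\<close>
          have "0 \<le> (d - norm (v i y - v j y))\<^sup>2" by simp
          hence "2 * d * norm (v i y - v j y) \<le> d\<^sup>2 + (norm (v i y - v j y))\<^sup>2" by (simp add: power2_eq_square algebra_simps)
          hence "(2 * d * norm (v i y - v j y)) / (2 * d) \<le> (d\<^sup>2 + (norm (v i y - v j y))\<^sup>2) / (2 * d)"
            using d by (intro divide_right_mono) auto
          thus ?thesis using True d by (simp add: add_divide_distrib power2_eq_square)
        qed (simp add: off)
      qed (use b\<Omega> emeasure_bounded_finite[OF \<Omega>(2)] in auto)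
      also have "\<dots> = (d / 2) * m + (1 / (2 * d)) * integral\<^sup>L lborel (\<lambda>y. (norm (v i y - v j y))\<^sup>2)"
        unfolding m_def using isq[of i j] b\<Omega> emeasure_bounded_finite[OF \<Omega>(2)] by simp
      also have "\<dots> \<le> e / 2 + (1 / (2 * d)) * \<beta> j"
        using d sq[OF that(2)] by (intro add_mono mult_left_mono) auto
      also have "\<dots> < e / 2 + (1 / (2 * d)) * (d * e / 2)"
        using d N[OF that(1)] by (intro add_strict_left_mono mult_strict_left_mono) auto
      also have "\<dots> < e" using d e by simp
      finally show ?thesis .
    qed
    have "integral\<^sup>L lborel (\<lambda>y. norm (D i y - D j y)) < e" if "N \<le> i" "N \<le> j" for i j
      using main[of i j] main[of j i] that by (cases "i \<le> j") (auto simp: D_def norm_minus_commute)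
    thus ?thesis by blast
  qed
  obtain r where r: "strict_mono r" "AE y in lborel. Cauchy (\<lambda>i. D (r i) y)"
    using cauchy_L1_AE_cauchy_subseq[of lborel D] iD L1 by blast
  have "(\<lambda>n. integral\<^sup>L lborel (\<lambda>y. norm (indicator \<Omega> y * gap (r n) y))) \<longlonglongrightarrow> 0"
  proof -
    have "(\<lambda>n. b (r n)) \<longlonglongrightarrow> 0" using LIMSEQ_subseq_LIMSEQ[OF bl r(1)] by (simp add: o_def)
    moreover have "norm (indicator \<Omega> y * gap (r n) y) = indicator \<Omega> y * gap (r n) y" for n y using gap0 by simp
    ultimately show ?thesis unfolding b_def by (simp only:)
  qed
  then obtain r' where r': "strict_mono r'" "AE y in lborel. (\<lambda>n. indicator \<Omega> y * gap (r (r' n)) y) \<longlonglongrightarrow> (0::real)"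
    using tendsto_L1_AE_subseq[of lborel "\<lambda>n y. indicator \<Omega> y * gap (r n) y"] ib by blast
  define s where "s n = r (r' n)" for n
  have "AE y in lborel. Cauchy (\<lambda>i. D (s i) y) \<and> (\<lambda>n. indicator \<Omega> y * gap (s n) y) \<longlonglongrightarrow> (0::real)"
    using r(2) r'(2)
  proof eventually_elim
    case (elim y)
    show ?case using Cauchy_subseq_Cauchy[OF elim(1) r'(1)] elim(2) unfolding s_def o_def by simp
  qed
  then obtain N where N0: "N \<in> null_sets lborel" "\<And>y. y \<in> space lborel - N \<Longrightarrow>
      Cauchy (\<lambda>i. D (s i) y) \<and> (\<lambda>n. indicator \<Omega> y * gap (s n) y) \<longlonglongrightarrow> (0::real)"
    by (rule AE_E3) (rule that)
  have N: "N \<in> null_sets lborel" "y \<notin> N \<Longrightarrow> Cauchy (\<lambda>i. D (s i) y)"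
    "y \<notin> N \<Longrightarrow> (\<lambda>n. indicator \<Omega> y * gap (s n) y) \<longlonglongrightarrow> (0::real)" for y
    using N0(1) N0(2)[of y] by simp_all
  \<comment> \<open>On the exceptional null set any vector of length sqrt C is taken for v0 + V, and
    Q is then defined by the quadratic relation: both relations hold at every point of \<Omega>, not
    just almost everywhere.\<close>
  define V where "V y = (if y \<in> \<Omega> then if y \<in> N then of_real (sqrt C) - v0 else lim (\<lambda>i. D (s i) y) else 0)" for y
  define Q where "Q y = (if y \<in> \<Omega> then (v0 + V y)\<^sup>2 / 2 - q0 else 0)" for y
  have mN: "N \<in> sets borel" using N(1) by auto
  have mV: "V \<in> borel_measurable borel"
    unfolding V_def[abs_def] using mD b\<Omega> mN by measurable
  have mQ: "Q \<in> borel_measurable borel"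
    unfolding Q_def[abs_def] using mV b\<Omega> by measurable
  have lim: "(\<lambda>i. D (s i) y) \<longlonglongrightarrow> V y \<and> (norm (v0 + V y))\<^sup>2 = C \<and> (\<lambda>i. q (s i) y - q0) \<longlonglongrightarrow> Q y"
    if y: "y \<in> \<Omega>" "y \<notin> N" for y
  proof -
    have 1: "(\<lambda>i. D (s i) y) \<longlonglongrightarrow> V y"
      using N(2)[OF y(2)] y unfolding V_def by (simp add: Cauchy_convergent_iff convergent_LIMSEQ_iff)
    have 2: "(\<lambda>i. v (s i) y) \<longlonglongrightarrow> v0 + V y" using tendsto_add[OF tendsto_const[of v0] 1] by (simp add: D_def)
    have "(\<lambda>n. gap (s n) y) \<longlonglongrightarrow> 0" using N(3)[OF y(2)] y by simp
    hence "(\<lambda>n. sqrt (gap (s n) y)) \<longlonglongrightarrow> sqrt 0" by (rule tendsto_real_sqrt)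
    moreover have "sqrt (gap (s n) y) = C - (norm (v (s n) y))\<^sup>2" for n unfolding gap_def using nv(1)[of "s n" y] by simp
    ultimately have 3: "(\<lambda>n. C - (norm (v (s n) y))\<^sup>2) \<longlonglongrightarrow> 0" by simp
    moreover have "(\<lambda>n. C - (norm (v (s n) y))\<^sup>2) \<longlonglongrightarrow> C - (norm (v0 + V y))\<^sup>2" by (intro tendsto_intros 2)
    ultimately have 4: "(norm (v0 + V y))\<^sup>2 = C" using LIMSEQ_unique by fastforce
    \<comment> \<open>The subsolution inequality bounds this by C - |v|^2, which tends to 0.\<close>
    have "(\<lambda>n. 2 * q (s n) y - (v (s n) y)\<^sup>2) \<longlonglongrightarrow> 0"
    proof (rule tendsto_norm_zero_cancel, rule tendsto_sandwich[OF _ _ tendsto_const 3])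
      show "\<forall>\<^sub>F n in sequentially. norm (2 * q (s n) y - (v (s n) y)\<^sup>2) \<le> C - (norm (v (s n) y))\<^sup>2"
        using sub unfolding subsolution_state_def by (intro always_eventually allI) (smt (verit))
    qed simp
    hence "(\<lambda>n. ((2 * q (s n) y - (v (s n) y)\<^sup>2) + (v (s n) y)\<^sup>2) / 2 - q0) \<longlonglongrightarrow> (0 + (v0 + V y)\<^sup>2) / 2 - q0"
      by (intro tendsto_intros 2) auto
    hence "(\<lambda>i. q (s i) y - q0) \<longlonglongrightarrow> Q y" unfolding Q_def using y by simp
    thus ?thesis using 1 4 by blast
  qed
  have K: "(norm (v0 + V y))\<^sup>2 = C" if "y \<in> \<Omega>" for y
    using lim[OF that] C that by (cases "y \<in> N") (auto simp: V_def)
  have "euler_null V Q"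
  proof (rule euler_null_limit[where Vn = "\<lambda>i y. D (s i) y" and Qn = "\<lambda>i y. q (s i) y - q0" and M = "sqrt C + C + norm v0 + norm q0"])
    show "euler_null (\<lambda>y. D (s n) y) (\<lambda>y. q (s n) y - q0)" for n using null unfolding D_def .
    show "(\<lambda>y. D (s n) y) \<in> borel_measurable borel" "(\<lambda>y. q (s n) y - q0) \<in> borel_measurable borel" for n
      using mD mv(2)[of "s n"] by (simp, measurable)
    show "norm (D (s n) y) \<le> sqrt C + C + norm v0 + norm q0" for n y
      unfolding D_def using norm_triangle_ineq4[of "v (s n) y" v0] nv(2)[of "s n" y] C norm_ge_zero[of q0] by linarith
    show "norm (q (s n) y - q0) \<le> sqrt C + C + norm v0 + norm q0" for n y
      using norm_triangle_ineq4[of "q (s n) y" q0] nv(3)[of "s n" y] C norm_ge_zero[of v0] real_sqrt_ge_zero[of C] by linarith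
    show "AE y in lborel. (\<lambda>i. D (s i) y) \<longlonglongrightarrow> V y \<and> (\<lambda>i. q (s i) y - q0) \<longlonglongrightarrow> Q y"
      using AE_not_in[OF N(1)]
    proof eventually_elim
      case (elim y)
      thus ?case using lim[of y] off[of y] by (cases "y \<in> \<Omega>") (auto simp: V_def Q_def D_def)
    qed
  qed (rule mV mQ)+
  moreover have "V y = 0" "Q y = 0" if "y \<notin> \<Omega>" for y using that by (auto simp: V_def Q_def)
  moreover have "2 * (q0 + Q y) = (v0 + V y)\<^sup>2" if "y \<in> \<Omega>" for y using that by (simp add: Q_def)
  ultimately show ?thesis using that[of V Q] mV mQ K by blast
qed

lemma euler_null_cong_AE:
  assumes "euler_null V Q" "V \<in> borel_measurable borel" "Q \<in> borel_measurable borel"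
    "V' \<in> borel_measurable borel" "Q' \<in> borel_measurable borel"
    and ae: "AE y in lborel. V y = V' y \<and> Q y = Q' y"
  shows "euler_null V' Q'"
  unfolding euler_null_def
proof (intro allI impI)
  fix \<psi> :: "(real^2) \<times> real \<Rightarrow> real" assume t: "test_function \<psi>"
  note n = assms(1)[unfolded euler_null_def, rule_format, OF t]
  have msr: "dt \<psi> \<in> borel_measurable borel" "dx 1 \<psi> \<in> borel_measurable borel" "dx 2 \<psi> \<in> borel_measurable borel"
    using dt_dx_continuous[OF t] by (auto intro: borel_measurable_continuous_onI)
  note m' = assms(2-5)[THEN measurable_compose[OF _ borel_measurable_Re]] assms(2-5)[THEN measurable_compose[OF _ borel_measurable_Im]]
  have *: "integral\<^sup>L lborel g = 0" if "integral\<^sup>L lborel f = 0" "f \<in> borel_measurable lborel" "g \<in> borel_measurable lborel"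
    "\<And>z. V z = V' z \<Longrightarrow> Q z = Q' z \<Longrightarrow> f z = g z" for f g :: "(real^2) \<times> real \<Rightarrow> real"
  proof -
    have "AE z in lborel. f z = g z" by (rule eventually_mono[OF ae]) (use that(4) in blast)
    thus ?thesis using integral_cong_AE[OF that(2,3)] that(1) by simp
  qed
  show "integral\<^sup>L lborel (\<lambda>z. Re (V' z) * dx 1 \<psi> z + Im (V' z) * dx 2 \<psi> z) = 0 \<and>
     integral\<^sup>L lborel (\<lambda>z. Re (V' z) * dt \<psi> z + Re (Q' z) * dx 1 \<psi> z + Im (Q' z) * dx 2 \<psi> z) = 0 \<and>
     integral\<^sup>L lborel (\<lambda>z. Im (V' z) * dt \<psi> z + Im (Q' z) * dx 1 \<psi> z - Re (Q' z) * dx 2 \<psi> z) = 0"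
  proof (intro conjI)
    show "integral\<^sup>L lborel (\<lambda>z. Re (V' z) * dx 1 \<psi> z + Im (V' z) * dx 2 \<psi> z) = 0"
      by (rule *[OF n[THEN conjunct1]]) (use m' msr in auto)
    show "integral\<^sup>L lborel (\<lambda>z. Re (V' z) * dt \<psi> z + Re (Q' z) * dx 1 \<psi> z + Im (Q' z) * dx 2 \<psi> z) = 0"
      by (rule *[OF n[THEN conjunct2, THEN conjunct1]]) (use m' msr in auto)
    show "integral\<^sup>L lborel (\<lambda>z. Im (V' z) * dt \<psi> z + Im (Q' z) * dx 1 \<psi> z - Re (Q' z) * dx 2 \<psi> z) = 0"
      by (rule *[OF n[THEN conjunct2, THEN conjunct2]]) (use m' msr in auto)
  qed
qed

lemma subsolution_solution_bounds:
  fixes v0 V q0 Q :: complex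
  assumes "C > 0" "(norm (v0 + V))\<^sup>2 = C" "2 * (q0 + Q) = (v0 + V)\<^sup>2"
  shows "norm V \<le> sqrt C + norm v0" "norm Q \<le> C / 2 + norm q0"
proof -
  have "norm (v0 + V) = sqrt C" using assms(1,2) by (metis norm_ge_zero real_sqrt_unique)
  thus "norm V \<le> sqrt C + norm v0" using norm_triangle_ineq4[of "v0 + V" v0] by simp
  have "norm (2 * (q0 + Q)) = C" unfolding assms(3) using assms(2) by (simp add: norm_power)
  moreover have "norm (2 * (q0 + Q)) = 2 * norm (q0 + Q)" by (subst norm_mult) simp
  ultimately have "2 * norm (q0 + Q) = C" by simp
  thus "norm Q \<le> C / 2 + norm q0" using norm_triangle_ineq4[of "q0 + Q" q0] by simp
qed

text \<open>The wedge has infinite extent. It is cut into shells n < |y| < n + 1, on which the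
  bounded case applies; the support of a test function meets finitely many shells, and the spheres
  between them are null sets.\<close>

theorem convex_integration_open:
  fixes v0 q0 :: complex and \<Omega> :: "((real^2) \<times> real) set"
  assumes \<Omega>: "open \<Omega>" and sub0: "subsolution_state C v0 q0"
  obtains V Q where "V \<in> borel_measurable borel" "Q \<in> borel_measurable borel"
    "\<And>y. y \<notin> \<Omega> \<Longrightarrow> V y = 0" "\<And>y. y \<notin> \<Omega> \<Longrightarrow> Q y = 0"
    "\<And>y. y \<in> \<Omega> \<Longrightarrow> (norm (v0 + V y))\<^sup>2 = C" "\<And>y. y \<in> \<Omega> \<Longrightarrow> 2 * (q0 + Q y) = (v0 + V y)\<^sup>2"
    "euler_null V Q"
proof -
  have C: "C > 0" using subsolution_state_norm(4)[OF sub0] .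
  define S where "S n = \<Omega> \<inter> {y. real n < norm y \<and> norm y < real n + 1}" for n
  have oS: "open (S n)" for n unfolding S_def
    by (intro open_Int \<Omega> open_Collect_conj open_Collect_less continuous_intros)
  have bS: "bounded (S n)" for n unfolding S_def bounded_iff by (auto intro!: exI[of _ "real n + 1"])
  define P where "P n V Q \<longleftrightarrow> V \<in> borel_measurable borel \<and> Q \<in> borel_measurable borel \<and>
    (\<forall>y. y \<notin> S n \<longrightarrow> V y = 0 \<and> Q y = 0) \<and> (\<forall>y. y \<in> S n \<longrightarrow> (norm (v0 + V y))\<^sup>2 = C \<and> 2 * (q0 + Q y) = (v0 + V y)\<^sup>2) \<and>
    euler_null V Q" for n V Q
  have "\<exists>V Q. P n V Q" for n
  proof -
    obtain V Q where "V \<in> borel_measurable borel" "Q \<in> borel_measurable borel"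
      "\<And>y. y \<notin> S n \<Longrightarrow> V y = 0" "\<And>y. y \<notin> S n \<Longrightarrow> Q y = 0"
      "\<And>y. y \<in> S n \<Longrightarrow> (norm (v0 + V y))\<^sup>2 = C" "\<And>y. y \<in> S n \<Longrightarrow> 2 * (q0 + Q y) = (v0 + V y)\<^sup>2"
      "euler_null V Q"
      by (rule convex_integration[OF oS[of n] bS[of n] sub0]) (rule that)
    hence "P n V Q" unfolding P_def by blast
    thus ?thesis by blast
  qed
  then obtain Vn Qn where Pn: "\<And>n. P n (Vn n) (Qn n)" by metis
  note Pn' = Pn[unfolded P_def]
  note VQ = Pn'[THEN conjunct1] Pn'[THEN conjunct2, THEN conjunct1]
    Pn'[THEN conjunct2, THEN conjunct2, THEN conjunct1, rule_format]
    Pn'[THEN conjunct2, THEN conjunct2, THEN conjunct2, THEN conjunct1, rule_format]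
    Pn'[THEN conjunct2, THEN conjunct2, THEN conjunct2, THEN conjunct2]
  have bb: "bounded_borel (Vn n)" "bounded_borel (Qn n)" for n
  proof -
    have "norm (Vn n y) \<le> sqrt C + norm v0 \<and> norm (Qn n y) \<le> C / 2 + norm q0" for y
    proof (cases "y \<in> S n")
      case True
      note v = VQ(4)[OF True]
      show ?thesis
        by (rule conjI; rule subsolution_solution_bounds[OF C v[THEN conjunct1] v[THEN conjunct2]])
    next
      case False
      have "0 \<le> sqrt C + norm v0" "0 \<le> C / 2 + norm q0" using C by (simp_all add: add_nonneg_nonneg)
      thus ?thesis using VQ(3)[OF False] by simp
    qed
    note b = this
    show "bounded_borel (Vn n)" unfolding bounded_borel_def
      by (intro conjI VQ(1) exI[of _ "sqrt C + norm v0"] allI b[THEN conjunct1])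
    show "bounded_borel (Qn n)" unfolding bounded_borel_def
      by (intro conjI VQ(2) exI[of _ "C / 2 + norm q0"] allI b[THEN conjunct2])
  qed
  \<comment> \<open>The index of the shell that contains y. Evaluating the k(y)-th piece at y glues
    the pieces without an infinite sum.\<close>
  define k where "k y = nat \<lfloor>norm y\<rfloor>" for y :: "(real^2) \<times> real"
  have mk: "k \<in> measurable borel (count_space UNIV)" unfolding k_def by measurable
  have Sk: "y \<in> S n \<Longrightarrow> k y = n" for y n unfolding S_def k_def by (auto simp: floor_unique nat_eq_iff; linarith)
  define W R where "W y = Vn (k y) y" and "R y = Qn (k y) y" for y
  have mW: "W \<in> borel_measurable borel" "R \<in> borel_measurable borel"
    unfolding W_def[abs_def] R_def[abs_def] by (rule measurable_compose_countable[OF VQ(1) mk], rule measurable_compose_countable[OF VQ(2) mk])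
  have sumW: "W y = (\<Sum>n<m. Vn n y) \<and> R y = (\<Sum>n<m. Qn n y)" if "norm y < real m" for y m
  proof -
    have km: "k y \<in> {..<m}" using that unfolding k_def by (simp add: nat_less_iff floor_less_iff)
    have "Vn n y = 0 \<and> Qn n y = 0" if "n \<in> {..<m} - {k y}" for n using VQ(3)[of y n] Sk[of y n] that by blast
    thus ?thesis unfolding W_def R_def
      using sum.remove[OF finite_lessThan km, of "\<lambda>n. Vn n y"] sum.remove[OF finite_lessThan km, of "\<lambda>n. Qn n y"] by simp
  qed
  have nullW: "euler_null W R" unfolding euler_null_def
  proof (intro allI impI)
    fix \<psi> :: "(real^2) \<times> real \<Rightarrow> real" assume t: "test_function \<psi>"
    obtain K where K: "\<And>z h. K < norm z \<Longrightarrow> frechet_derivative \<psi> (at z) h = 0"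
      using test_function_bounded_support[OF t] by metis
    obtain m :: nat where m: "K < real m" using reals_Archimedean2 by blast
    have far: "dt \<psi> z = 0 \<and> dx j \<psi> z = 0" if "\<not> norm z < real m" for z j
      using K[of z] that m unfolding dt_def dx_def by auto
    define V' Q' where "V' y = (\<Sum>n<m. Vn n y)" and "Q' y = (\<Sum>n<m. Qn n y)" for y
    have n': "euler_null V' Q'" unfolding V'_def[abs_def] Q'_def[abs_def]
      using euler_null_sum[of "{..<m}" Vn Qn] VQ(5) bb by blast
    have eq: "Re (W z) * x = Re (V' z) * x" "Im (W z) * x = Im (V' z) * x" "Re (R z) * x = Re (Q' z) * x" "Im (R z) * x = Im (Q' z) * x"
      if "\<not> norm z < real m \<Longrightarrow> x = 0" for x z
      using sumW[of z m] that unfolding V'_def Q'_def by (cases "norm z < real m"; simp)+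
    have e: "Re (W z) * dx j \<psi> z = Re (V' z) * dx j \<psi> z" "Im (W z) * dx j \<psi> z = Im (V' z) * dx j \<psi> z"
      "Re (R z) * dx j \<psi> z = Re (Q' z) * dx j \<psi> z" "Im (R z) * dx j \<psi> z = Im (Q' z) * dx j \<psi> z"
      "Re (W z) * dt \<psi> z = Re (V' z) * dt \<psi> z" "Im (W z) * dt \<psi> z = Im (V' z) * dt \<psi> z" for z j
      by (rule eq; use far in blast)+
    show "integral\<^sup>L lborel (\<lambda>z. Re (W z) * dx 1 \<psi> z + Im (W z) * dx 2 \<psi> z) = 0 \<and>
     integral\<^sup>L lborel (\<lambda>z. Re (W z) * dt \<psi> z + Re (R z) * dx 1 \<psi> z + Im (R z) * dx 2 \<psi> z) = 0 \<and>
     integral\<^sup>L lborel (\<lambda>z. Im (W z) * dt \<psi> z + Im (R z) * dx 1 \<psi> z - Re (R z) * dx 2 \<psi> z) = 0"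
      unfolding e by (rule n'[unfolded euler_null_def, rule_format, OF t])
  qed
  define U where "U = (\<Union>n. S n)"
  have oU: "U \<in> sets borel" unfolding U_def by (intro borel_open open_UN) (use oS in blast)
  have b\<Omega>: "\<Omega> \<in> sets borel" using \<Omega> by (rule borel_open)
  \<comment> \<open>Points of \<Omega> on the separating spheres lie in no shell; they receive a
    constant of the right length, so that the pointwise relations hold on all of \<Omega>.\<close>
  define V where "V y = (if y \<in> U then W y else if y \<in> \<Omega> then of_real (sqrt C) - v0 else 0)" for y
  define Q where "Q y = (if y \<in> \<Omega> then (v0 + V y)\<^sup>2 / 2 - q0 else 0)" for y
  have mV: "V \<in> borel_measurable borel" unfolding V_def[abs_def] using mW oU b\<Omega> by measurable
  have mQ: "Q \<in> borel_measurable borel" unfolding Q_def[abs_def] using mV b\<Omega> by measurable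
  have U\<Omega>: "U \<subseteq> \<Omega>" unfolding U_def S_def by blast
  have inU: "W y = V y \<and> R y = Q y \<and> (norm (v0 + V y))\<^sup>2 = C" if yU: "y \<in> U" for y
  proof -
    obtain n where n: "y \<in> S n" using yU unfolding U_def by blast
    have W: "W y = Vn n y" "R y = Qn n y" unfolding W_def R_def Sk[OF n] by auto
    have V: "V y = Vn n y" unfolding V_def using yU W by simp
    have "2 * Q y = 2 * R y" unfolding Q_def using U\<Omega> yU VQ(4)[OF n] V W by (auto simp: algebra_simps)
    thus ?thesis using V W VQ(4)[OF n] by simp
  qed
  have outU: "W y = 0 \<and> R y = 0" if "y \<notin> U" for y
    using VQ(3) that unfolding U_def W_def R_def by blast
  have "AE y in lborel. W y = V y \<and> R y = Q y"
  proof -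
    have "negligible (sphere (0::(real^2) \<times> real) (real n))" for n by (rule negligible_sphere)
    hence "sphere (0::(real^2) \<times> real) (real n) \<in> null_sets lborel" for n
      by (auto simp: negligible_iff_null_sets null_sets_def)
    hence "AE y in lborel. \<forall>n. (y::(real^2) \<times> real) \<notin> sphere 0 (real n)"
      unfolding AE_all_countable using AE_not_in by blast
    thus ?thesis
    proof eventually_elim
      case (elim y)
      show ?case
      proof (cases "y \<in> \<Omega>")
        case True
        have "norm y \<noteq> real n" for n using elim[rule_format, of n] by simp
        hence "norm y \<noteq> real (k y)" by blast
        moreover have "real (k y) \<le> norm y" "norm y < real (k y) + 1" unfolding k_def by auto
        ultimately have "y \<in> S (k y)" unfolding S_def using True by auto
        thus ?thesis using inU[of y] unfolding U_def by blast
      next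
        case False
        thus ?thesis using outU[of y] U\<Omega> unfolding V_def Q_def by auto
      qed
    qed
  qed
  hence "euler_null V Q" by (rule euler_null_cong_AE[OF nullW mW mV mQ])
  moreover have "(norm (v0 + V y))\<^sup>2 = C" if "y \<in> \<Omega>" for y
    using inU[of y] that C by (cases "y \<in> U") (auto simp: V_def)
  moreover have "V y = 0" "Q y = 0" if "y \<notin> \<Omega>" for y using that U\<Omega> by (auto simp: V_def Q_def)
  moreover have "2 * (q0 + Q y) = (v0 + V y)\<^sup>2" if "y \<in> \<Omega>" for y using that by (simp add: Q_def)
  ultimately show ?thesis using that[of V Q] mV mQ by blast
qed

section \<open>Planar discontinuities\<close>

text \<open>Takes the plane x_2 = 0 to x_2 = s t. After pulling back, transport along the second
  plane is differentiation in t.\<close>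

definition shear :: "real \<Rightarrow> (real^2) \<times> real \<Rightarrow> (real^2) \<times> real" where
  "shear s z = (fst z + (s * snd z) *\<^sub>R axis 2 1, snd z)"

lemma shear_measurable [measurable]: "shear s \<in> borel_measurable borel"
  unfolding shear_def[abs_def] by (intro borel_measurable_continuous_onI continuous_intros)

text \<open>Fubini with time outermost: every time slice is only translated.\<close>

lemma lborel_distr_shear: "distr lborel borel (shear s) = lborel"
proof (rule measure_eqI)
  fix A :: "((real^2) \<times> real) set" assume "A \<in> sets (distr lborel borel (shear s))"
  hence A [measurable]: "A \<in> sets borel" by simp
  have tr: "(\<integral>\<^sup>+x. f (x + c) \<partial>lborel) = (\<integral>\<^sup>+x. f x \<partial>lborel)" if [measurable]: "f \<in> borel_measurable borel"
    for f :: "real^2 \<Rightarrow> ennreal" and c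
  proof -
    have "(\<integral>\<^sup>+x. f x \<partial>lborel) = (\<integral>\<^sup>+x. f x \<partial>distr lborel borel ((+) c))" by (simp add: lborel_distr_plus)
    also have "\<dots> = (\<integral>\<^sup>+x. f (c + x) \<partial>lborel)" by (rule nn_integral_distr) auto
    finally show ?thesis by (simp add: add.commute)
  qed
  have sA: "shear s -` A \<in> sets borel" using measurable_sets[OF shear_measurable A] by simp
  have "emeasure (distr lborel borel (shear s)) A = emeasure lborel (shear s -` A)"
    by (subst emeasure_distr) auto
  also have "\<dots> = (\<integral>\<^sup>+z. indicator (shear s -` A) z \<partial>(lborel \<Otimes>\<^sub>M lborel))"
    using sA by (simp add: lborel_prod)
  also have "\<dots> = (\<integral>\<^sup>+t. \<integral>\<^sup>+x. indicator (shear s -` A) (x, t) \<partial>lborel \<partial>lborel)"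
    by (rule lborel_pair.nn_integral_snd[symmetric]) (use sA in \<open>simp add: lborel_prod\<close>)
  also have "\<dots> = (\<integral>\<^sup>+t. \<integral>\<^sup>+x. indicator A (x + (s * t) *\<^sub>R axis 2 1, t) \<partial>lborel \<partial>lborel)"
    by (simp add: indicator_def shear_def)
  also have "\<dots> = (\<integral>\<^sup>+t. \<integral>\<^sup>+x. indicator A (x, t) \<partial>lborel \<partial>lborel)"
    by (intro nn_integral_cong tr) measurable
  also have "\<dots> = (\<integral>\<^sup>+z. indicator A z \<partial>(lborel \<Otimes>\<^sub>M lborel))"
    by (rule lborel_pair.nn_integral_snd) (use A in \<open>simp add: lborel_prod\<close>)
  finally show "emeasure (distr lborel borel (shear s)) A = emeasure lborel A" by (simp add: lborel_prod)
qed simp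

lemma integral_shear:
  fixes f :: "(real^2) \<times> real \<Rightarrow> real"
  assumes [measurable]: "f \<in> borel_measurable borel"
  shows "integral\<^sup>L lborel f = integral\<^sup>L lborel (\<lambda>z. f (shear s z))"
    and "integrable lborel f \<Longrightarrow> integrable lborel (\<lambda>z. f (shear s z))"
  using integral_distr[of "shear s" lborel borel f] integrable_distr_eq[of "shear s" lborel borel f]
  by (simp_all add: lborel_distr_shear)

text \<open>With D the positive half line this is the part above a moving plane; with D the whole
  line it is the half space, for each s.\<close>

definition strip_region :: "real \<Rightarrow> real set \<Rightarrow> ((real^2) \<times> real) set" where
  "strip_region s D = {z. 0 \<le> snd z \<and> fst z $ 2 - s * snd z \<in> D}"

lemma strip_region_borel [measurable]:
  assumes [measurable]: "D \<in> sets borel"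
  shows "strip_region s D \<in> sets borel"
proof -
  have "(\<lambda>z :: (real^2) \<times> real. fst z $ 2 - s * snd z) \<in> borel_measurable borel"
    "(\<lambda>z :: (real^2) \<times> real. snd z) \<in> borel_measurable borel"
    by (intro borel_measurable_continuous_onI continuous_intros)+
  from measurable_sets[OF this(1) assms] measurable_sets[OF this(2), of "{0..}"]
  have "((\<lambda>z. snd z) -` {0..}) \<inter> ((\<lambda>z :: (real^2) \<times> real. fst z $ 2 - s * snd z) -` D) \<in> sets borel"
    by (intro sets.Int) (simp_all only: space_borel Int_UNIV_right atLeast_borel)
  moreover have "strip_region s D = ((\<lambda>z. snd z) -` {0..}) \<inter> ((\<lambda>z. fst z $ 2 - s * snd z) -` D)"
    unfolding strip_region_def by auto
  ultimately show ?thesis by simp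
qed

text \<open>The region is invariant under translation in x_1, so its indicator passes through the
  derivative.\<close>

lemma strip_integral_dx1:
  fixes \<psi> :: "(real^2) \<times> real \<Rightarrow> real"
  assumes t: "test_function \<psi>" and D: "D \<in> sets borel"
  shows "integral\<^sup>L lborel (\<lambda>z. indicator (strip_region s D) z * dx 1 \<psi> z) = 0"
proof -
  obtain K where K: "\<And>z. K < norm z \<Longrightarrow> \<psi> z = 0" "\<And>z h. K < norm z \<Longrightarrow> frechet_derivative \<psi> (at z) h = 0"
    using test_function_bounded_support[OF t] by metis
  obtain M1 where M1: "\<And>z. norm (\<psi> z) \<le> M1" using compact_support_bound[OF test_function_continuous[OF t] K(1)] by metis
  obtain M2 where M2: "\<And>z. norm (dx 1 \<psi> z) \<le> M2"
    using compact_support_bound[OF dt_dx_continuous(2)[OF t, of 1], of K] K(2) unfolding dx_def by metis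
  have m\<psi>: "\<psi> \<in> borel_measurable borel" using test_function_continuous[OF t] by (rule borel_measurable_continuous_onI)
  show ?thesis
  proof (rule integral_directional_derivative_eq_0[where h = "\<lambda>z. (indicator (strip_region s D) z :: real) * \<psi> z"
        and e = "(axis 1 1, 0)" and M = "max M1 M2" and K = K])
    fix z :: "(real^2) \<times> real"
    have "indicator (strip_region s D) (z + u *\<^sub>R (axis 1 1, 0)) = (indicator (strip_region s D) z :: real)" for u
      unfolding indicator_def strip_region_def by (simp add: axis_def)
    moreover have "((\<lambda>u. \<psi> (z + u *\<^sub>R (axis 1 1, 0))) has_real_derivative dx 1 \<psi> z) (at 0)"
      unfolding dx_def by (rule directional_real_derivative[OF test_function_has_derivative(1)[OF t]])
    ultimately show "((\<lambda>u. indicator (strip_region s D) (z + u *\<^sub>R (axis 1 1, 0)) * \<psi> (z + u *\<^sub>R (axis 1 1, 0)))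
       has_real_derivative indicator (strip_region s D) z * dx 1 \<psi> z) (at 0)"
      by (simp only:) (rule DERIV_cmult)
    show "\<bar>indicator (strip_region s D) z * dx 1 \<psi> z\<bar> \<le> max M1 M2" "\<bar>indicator (strip_region s D) z * \<psi> z\<bar> \<le> max M1 M2"
      using M1[of z] M2[of z] by (auto simp: indicator_def)
    show "indicator (strip_region s D) z * \<psi> z = 0" if "K < norm z" using K(1)[OF that] by simp
  next
    show "(\<lambda>z. indicator (strip_region s D) z * \<psi> z) \<in> borel_measurable borel"
      using m\<psi> D by (intro borel_measurable_times borel_measurable_indicator strip_region_borel)
  qed
qed

text \<open>The region is a union of half lines x_2 - s t = const that start at t = 0, and dt + s
  dx2 differentiates along them. The fundamental theorem leaves the boundary term at t = 0.\<close>

lemma strip_integral_transport: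
  fixes \<psi> :: "(real^2) \<times> real \<Rightarrow> real"
  assumes t: "test_function \<psi>" and D: "D \<in> sets borel"
  shows "integral\<^sup>L lborel (\<lambda>z. indicator (strip_region s D) z * (dt \<psi> z + s * dx 2 \<psi> z))
    = - integral\<^sup>L lborel (\<lambda>x. indicator D (x $ 2) * \<psi> (x, 0))"
proof -
  obtain K where Kp: "K > 0" and K: "\<And>z. K < norm z \<Longrightarrow> \<psi> z = 0" "\<And>z h. K < norm z \<Longrightarrow> frechet_derivative \<psi> (at z) h = 0"
    using test_function_bounded_support[OF t] by metis
  define g where "g z = dt \<psi> z + s * dx 2 \<psi> z" for z
  have cg: "continuous_on UNIV g" unfolding g_def[abs_def] by (intro continuous_intros dt_dx_continuous t)
  have g0: "g z = 0" if "K < norm z" for z using K(2)[OF that] unfolding g_def dt_def dx_def by simp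
  have mI: "(\<lambda>z. indicator (strip_region s D) z :: real) \<in> borel_measurable borel"
    using D by (intro borel_measurable_indicator strip_region_borel)
  have ig: "integrable lborel (\<lambda>z. indicator (strip_region s D) z * g z)"
    by (rule compact_support_integrable[OF cg g0 mI, of K 1]) (auto simp: indicator_def)
  have mg: "(\<lambda>z. indicator (strip_region s D) z * g z) \<in> borel_measurable borel" using ig by auto
  have ind: "indicator (strip_region s D) (shear s z) = indicator D (fst z $ 2) * (indicator {0..} (snd z) :: real)" for z
    unfolding strip_region_def shear_def indicator_def by (auto simp: axis_def)
  have ish: "integrable lborel (\<lambda>z. indicator D (fst z $ 2) * (indicator {0..} (snd z) * g (shear s z)))"
    using integral_shear(2)[OF mg ig, of s] by (simp add: ind mult.assoc)
  have FTC: "integral\<^sup>L lborel (\<lambda>u. indicator {0..} u * g (shear s (x, u))) = - \<psi> (x, 0)" for x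
  proof -
    have der: "((\<lambda>u. \<psi> (shear s (x, u))) has_real_derivative g (shear s (x, u))) (at u)" for u
    proof -
      let ?D = "frechet_derivative \<psi> (at (shear s (x, u)))"
      have "((\<lambda>u. \<psi> (shear s (x, u))) has_derivative (\<lambda>h. ?D ((s * h) *\<^sub>R axis 2 1, h))) (at u)"
        by (rule has_derivative_compose[of "\<lambda>u. shear s (x, u)" "\<lambda>h. ((s * h) *\<^sub>R axis 2 1, h)" u UNIV \<psi> ?D])
          (auto simp: shear_def intro!: derivative_eq_intros test_function_has_derivative(1)[OF t])
      moreover have "?D ((s * h) *\<^sub>R axis 2 1, h) = g (shear s (x, u)) * h" for h
      proof -
        interpret bounded_linear ?D by (rule has_derivative_bounded_linear[OF test_function_has_derivative(1)[OF t]])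
        have "((s * h) *\<^sub>R axis 2 1, h) = (s * h) *\<^sub>R (axis 2 1, 0) + h *\<^sub>R ((0::real^2), 1::real)" by simp
        hence "?D ((s * h) *\<^sub>R axis 2 1, h) = (s * h) * ?D (axis 2 1, 0) + h * ?D (0, 1)" by (simp only: add scale real_scaleR_def)
        thus ?thesis unfolding g_def dt_def dx_def by (simp add: algebra_simps)
      qed
      ultimately show ?thesis by (simp add: has_field_derivative_def)
    qed
    have far: "K < norm (shear s (x, u))" if "K < u" for u
    proof -
      have "\<bar>u\<bar> \<le> norm (shear s (x, u))" unfolding shear_def by (metis norm_snd_le snd_conv real_norm_def)
      thus ?thesis using that Kp by linarith
    qed
    have cgs: "continuous_on UNIV (\<lambda>u. g (shear s (x, u)))"
      by (rule continuous_on_compose2[OF cg]) (auto simp: shear_def intro!: continuous_intros)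
    have "integral\<^sup>L lborel (\<lambda>u. indicator {0..} u * g (shear s (x, u))) = (LINT u:{0..K+1}|lborel. g (shear s (x, u)))"
      unfolding set_lebesgue_integral_def
      by (rule Bochner_Integration.integral_cong) (use g0[OF far] in \<open>auto simp: indicator_def\<close>)
    also have "\<dots> = integral {0..K+1} (\<lambda>u. g (shear s (x, u)))"
      by (rule set_borel_integral_eq_integral(2)) (intro borel_integrable_atLeastAtMost' continuous_on_subset[OF cgs] subset_UNIV)
    also have "\<dots> = \<psi> (shear s (x, K+1)) - \<psi> (shear s (x, 0))"
      by (rule integral_unique, rule fundamental_theorem_of_calculus)
        (use der Kp in \<open>auto simp: has_real_derivative_iff_has_vector_derivative[symmetric] intro: has_field_derivative_at_within\<close>)
    also have "\<psi> (shear s (x, K+1)) = 0" using K(1)[OF far[of "K+1"]] by simp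
    finally show ?thesis by (simp add: shear_def)
  qed
  have "integral\<^sup>L lborel (\<lambda>z. indicator (strip_region s D) z * g z)
      = integral\<^sup>L (lborel \<Otimes>\<^sub>M lborel) (\<lambda>z. indicator D (fst z $ 2) * (indicator {0..} (snd z) * g (shear s z)))"
    by (subst integral_shear(1)[OF mg, of s]) (simp add: ind mult.assoc lborel_prod)
  also have "\<dots> = integral\<^sup>L lborel (\<lambda>x. integral\<^sup>L lborel (\<lambda>u. indicator D (x $ 2) * (indicator {0..} u * g (shear s (x, u)))))"
    using lborel_pair.integral_fst'[of "\<lambda>z. indicator D (fst z $ 2) * (indicator {0..} (snd z) * g (shear s z))"] ish
    by (simp add: lborel_prod)
  also have "\<dots> = integral\<^sup>L lborel (\<lambda>x. - (indicator D (x $ 2) * \<psi> (x, 0)))"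
    by (simp add: FTC)
  finally show ?thesis unfolding g_def by simp
qed

section \<open>Scalar balance laws in weak form\<close>

definition weak_balance ::
  "((real^2) \<times> real \<Rightarrow> real) \<Rightarrow> ((real^2) \<times> real \<Rightarrow> real) \<Rightarrow> ((real^2) \<times> real \<Rightarrow> real) \<Rightarrow> (real^2 \<Rightarrow> real) \<Rightarrow> bool" where
  "weak_balance A B1 B2 A0 \<longleftrightarrow> (\<forall>\<psi>. test_function \<psi> \<longrightarrow>
     integral\<^sup>L lborel (\<lambda>z. indicator half_space z * (A z * dt \<psi> z + B1 z * dx 1 \<psi> z + B2 z * dx 2 \<psi> z))
     + integral\<^sup>L lborel (\<lambda>x. A0 x * \<psi> (x, 0)) = 0)"

text \<open>The fields are arbitrary for negative times, so the indicator of the closed half space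
  is built into measurability.\<close>

definition bounded_measurable :: "((real^2) \<times> real \<Rightarrow> real) \<Rightarrow> bool" where
  "bounded_measurable f \<longleftrightarrow> (\<lambda>z. indicator half_space z * f z) \<in> borel_measurable borel \<and> (\<exists>M. \<forall>z\<in>half_space. \<bar>f z\<bar> \<le> M)"

lemma half_space_borel [measurable]: "half_space \<in> sets borel"
proof -
  have "half_space = (\<lambda>z :: (real^2) \<times> real. snd z) -` {0..}" by auto
  moreover have "closed ((\<lambda>z :: (real^2) \<times> real. snd z) -` {0..})"
    by (intro closed_vimage closed_atLeast continuous_intros)
  ultimately show ?thesis by (metis borel_closed)
qed

lemma bounded_measurable_integrable:
  fixes \<psi> :: "(real^2) \<times> real \<Rightarrow> real"
  assumes "bounded_measurable f" "test_function \<psi>"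
  shows "integrable lborel (\<lambda>z. indicator half_space z * f z * dt \<psi> z)"
    "integrable lborel (\<lambda>z. indicator half_space z * f z * dx j \<psi> z)"
proof -
  obtain M where M: "\<And>z. z \<in> half_space \<Longrightarrow> \<bar>f z\<bar> \<le> M" using assms unfolding bounded_measurable_def by blast
  have b: "\<bar>indicator half_space z * f z\<bar> \<le> \<bar>M\<bar>" for z
    using M[of z] by (cases "z \<in> half_space") auto
  have m: "(\<lambda>z. indicator half_space z * f z) \<in> borel_measurable borel" using assms(1) unfolding bounded_measurable_def by blast
  show "integrable lborel (\<lambda>z. indicator half_space z * f z * dt \<psi> z)"
    "integrable lborel (\<lambda>z. indicator half_space z * f z * dx j \<psi> z)"
    using euler_null_integrable[OF m b assms(2)] by auto
qed

lemma bounded_measurable_intros: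
  "bounded_measurable (\<lambda>_. c)"
  "bounded_measurable f \<Longrightarrow> bounded_measurable g \<Longrightarrow> bounded_measurable (\<lambda>z. f z + g z)"
  "bounded_measurable f \<Longrightarrow> bounded_measurable g \<Longrightarrow> bounded_measurable (\<lambda>z. f z * g z)"
proof -
  show "bounded_measurable (\<lambda>_. c)" unfolding bounded_measurable_def by (auto intro!: borel_measurable_times borel_measurable_indicator half_space_borel)
  assume f: "bounded_measurable f" and g: "bounded_measurable g"
  obtain M where M: "\<And>z. z \<in> half_space \<Longrightarrow> \<bar>f z\<bar> \<le> M" using f unfolding bounded_measurable_def by blast
  obtain N where N: "\<And>z. z \<in> half_space \<Longrightarrow> \<bar>g z\<bar> \<le> N" using g unfolding bounded_measurable_def by blast
  have mf: "(\<lambda>z. indicator half_space z * f z) \<in> borel_measurable borel" using f unfolding bounded_measurable_def by blast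
  have mg: "(\<lambda>z. indicator half_space z * g z) \<in> borel_measurable borel" using g unfolding bounded_measurable_def by blast
  show "bounded_measurable (\<lambda>z. f z + g z)" unfolding bounded_measurable_def
  proof (intro conjI exI[of _ "M + N"] ballI)
    show "(\<lambda>z. indicator half_space z * (f z + g z)) \<in> borel_measurable borel"
      using borel_measurable_add[OF mf mg] by (simp add: distrib_left)
    show "\<bar>f z + g z\<bar> \<le> M + N" if "z \<in> half_space" for z using M[OF that] N[OF that] by linarith
  qed
  show "bounded_measurable (\<lambda>z. f z * g z)" unfolding bounded_measurable_def
  proof (intro conjI exI[of _ "M * N"] ballI)
    have "(\<lambda>z. (indicator half_space z * f z) * (indicator half_space z * g z)) = (\<lambda>z. indicator half_space z * (f z * g z))"
      by (auto simp: fun_eq_iff indicator_def)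
    thus "(\<lambda>z. indicator half_space z * (f z * g z)) \<in> borel_measurable borel"
      using borel_measurable_times[OF mf mg] by simp
    show "\<bar>f z * g z\<bar> \<le> M * N" if "z \<in> half_space" for z
      unfolding abs_mult by (rule mult_mono[OF M[OF that] N[OF that] order_trans[OF abs_ge_zero M[OF that]] abs_ge_zero])
  qed
qed

lemma weak_balance_add_null:
  assumes b: "weak_balance A B1 B2 A0" and m: "bounded_measurable A" "bounded_measurable B1" "bounded_measurable B2"
    and m': "bounded_measurable a" "bounded_measurable b1" "bounded_measurable b2"
    and null: "\<And>\<psi>. test_function \<psi> \<Longrightarrow> integral\<^sup>L lborel (\<lambda>z. indicator half_space z * (a z * dt \<psi> z + b1 z * dx 1 \<psi> z + b2 z * dx 2 \<psi> z)) = 0"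
  shows "weak_balance (\<lambda>z. A z + a z) (\<lambda>z. B1 z + b1 z) (\<lambda>z. B2 z + b2 z) A0"
  unfolding weak_balance_def
proof (intro allI impI)
  fix \<psi> :: "(real^2) \<times> real \<Rightarrow> real" assume t: "test_function \<psi>"
  let ?h = "indicator half_space :: (real^2) \<times> real \<Rightarrow> real"
  note i = bounded_measurable_integrable[OF _ t]
  have "integrable lborel (\<lambda>z. ?h z * A z * dt \<psi> z + ?h z * B1 z * dx 1 \<psi> z + ?h z * B2 z * dx 2 \<psi> z)"
    "integrable lborel (\<lambda>z. ?h z * a z * dt \<psi> z + ?h z * b1 z * dx 1 \<psi> z + ?h z * b2 z * dx 2 \<psi> z)"
    by (intro Bochner_Integration.integrable_add i m m')+
  from Bochner_Integration.integral_add[OF this]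
  have "integral\<^sup>L lborel (\<lambda>z. ?h z * ((A z + a z) * dt \<psi> z + (B1 z + b1 z) * dx 1 \<psi> z + (B2 z + b2 z) * dx 2 \<psi> z))
    = integral\<^sup>L lborel (\<lambda>z. ?h z * (A z * dt \<psi> z + B1 z * dx 1 \<psi> z + B2 z * dx 2 \<psi> z))
     + integral\<^sup>L lborel (\<lambda>z. ?h z * (a z * dt \<psi> z + b1 z * dx 1 \<psi> z + b2 z * dx 2 \<psi> z))"
    by (simp add: algebra_simps)
  thus "integral\<^sup>L lborel (\<lambda>z. ?h z * ((A z + a z) * dt \<psi> z + (B1 z + b1 z) * dx 1 \<psi> z + (B2 z + b2 z) * dx 2 \<psi> z))
     + integral\<^sup>L lborel (\<lambda>x. A0 x * \<psi> (x, 0)) = 0"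
    using b[unfolded weak_balance_def, rule_format, OF t] null[OF t] by simp
qed

lemma weak_balance_cong_AE:
  assumes b: "weak_balance A B1 B2 A0" and m: "bounded_measurable A" "bounded_measurable B1" "bounded_measurable B2"
    and m': "bounded_measurable A'" "bounded_measurable B1'" "bounded_measurable B2'"
    and ae: "AE z in lborel. z \<in> half_space \<longrightarrow> A z = A' z \<and> B1 z = B1' z \<and> B2 z = B2' z"
    and ae0: "AE x in lborel. A0 x = A0' x" and m0: "A0 \<in> borel_measurable borel" "A0' \<in> borel_measurable borel"
  shows "weak_balance A' B1' B2' A0'"
  unfolding weak_balance_def
proof (intro allI impI)
  fix \<psi> :: "(real^2) \<times> real \<Rightarrow> real" assume t: "test_function \<psi>"
  let ?h = "indicator half_space :: (real^2) \<times> real \<Rightarrow> real"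
  note i = bounded_measurable_integrable[OF _ t]
  have i1: "integrable lborel (\<lambda>z. ?h z * A z * dt \<psi> z + ?h z * B1 z * dx 1 \<psi> z + ?h z * B2 z * dx 2 \<psi> z)"
    "integrable lborel (\<lambda>z. ?h z * A' z * dt \<psi> z + ?h z * B1' z * dx 1 \<psi> z + ?h z * B2' z * dx 2 \<psi> z)"
    by (intro Bochner_Integration.integrable_add i m m')+
  have "AE z in lborel. ?h z * A z * dt \<psi> z + ?h z * B1 z * dx 1 \<psi> z + ?h z * B2 z * dx 2 \<psi> z
     = ?h z * A' z * dt \<psi> z + ?h z * B1' z * dx 1 \<psi> z + ?h z * B2' z * dx 2 \<psi> z"
    using ae by eventually_elim (auto simp: indicator_def)
  from integral_cong_AE[OF _ _ this] i1
  have 1: "integral\<^sup>L lborel (\<lambda>z. ?h z * (A z * dt \<psi> z + B1 z * dx 1 \<psi> z + B2 z * dx 2 \<psi> z))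
     = integral\<^sup>L lborel (\<lambda>z. ?h z * (A' z * dt \<psi> z + B1' z * dx 1 \<psi> z + B2' z * dx 2 \<psi> z))"
    by (simp add: distrib_left mult.assoc borel_measurable_integrable)
  have "continuous_on UNIV (\<lambda>x. \<psi> (x, 0))"
    by (rule continuous_on_compose2[OF test_function_continuous[OF t]]) (auto intro!: continuous_intros)
  hence m\<psi>: "(\<lambda>x. \<psi> (x, 0)) \<in> borel_measurable borel" by (rule borel_measurable_continuous_onI)
  have "integral\<^sup>L lborel (\<lambda>x. A0 x * \<psi> (x, 0)) = integral\<^sup>L lborel (\<lambda>x. A0' x * \<psi> (x, 0))"
  proof (rule integral_cong_AE)
    show "AE x in lborel. A0 x * \<psi> (x, 0) = A0' x * \<psi> (x, 0)" using ae0 by eventually_elim simp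
  qed (use m0 m\<psi> in simp_all)
  thus "integral\<^sup>L lborel (\<lambda>z. ?h z * (A' z * dt \<psi> z + B1' z * dx 1 \<psi> z + B2' z * dx 2 \<psi> z))
     + integral\<^sup>L lborel (\<lambda>x. A0' x * \<psi> (x, 0)) = 0"
    using b[unfolded weak_balance_def, rule_format, OF t] 1 by simp
qed

text \<open>The Rankine--Hugoniot condition at the plane \<open>x\<^sub>2 = s i * t\<close> is built into the flux \<open>s i * a i\<close>.\<close>

lemma fan_balance:
  fixes s a c :: "nat \<Rightarrow> real"
  shows "weak_balance
    (\<lambda>z. A0 + (\<Sum>i<n. a i * indicator (strip_region (s i) {0<..}) z))
    (\<lambda>z. C0 + (\<Sum>i<n. c i * indicator (strip_region (s i) {0<..}) z))
    (\<lambda>z. B0 + (\<Sum>i<n. s i * a i * indicator (strip_region (s i) {0<..}) z))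
    (\<lambda>x. A0 + (\<Sum>i<n. a i * indicator {0<..} (x $ 2)))"
  unfolding weak_balance_def
proof (intro allI impI)
  fix \<psi> :: "(real^2) \<times> real \<Rightarrow> real" assume t: "test_function \<psi>"
  let ?h = "indicator half_space :: (real^2) \<times> real \<Rightarrow> real"
  let ?H = "\<lambda>s. indicator (strip_region s {0<..}) :: (real^2) \<times> real \<Rightarrow> real"
  have hs: "?h = indicator (strip_region s UNIV)" for s unfolding strip_region_def by (auto simp: indicator_def fun_eq_iff)
  have mI: "(\<lambda>z. indicator (strip_region s D) z :: real) \<in> borel_measurable borel" if "D \<in> sets borel" for s D
    using that by (intro borel_measurable_indicator strip_region_borel)
  have bI: "\<bar>indicator (strip_region s D) z :: real\<bar> \<le> 1" for s D z by (simp add: indicator_def)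
  have i: "integrable lborel (\<lambda>z. indicator (strip_region s D) z * dt \<psi> z)"
    "integrable lborel (\<lambda>z. indicator (strip_region s D) z * dx j \<psi> z)" if "D \<in> sets borel" for s D j
    using euler_null_integrable[OF mI[OF that] bI t] by auto
  have i2: "integrable lborel (\<lambda>z. indicator (strip_region s D) z * (dt \<psi> z + s * dx 2 \<psi> z))" if "D \<in> sets borel" for s D
  proof -
    have "integrable lborel (\<lambda>z. indicator (strip_region s D) z * dt \<psi> z + s * (indicator (strip_region s D) z * dx 2 \<psi> z))"
      by (intro Bochner_Integration.integrable_add integrable_mult_right i that)
    thus ?thesis by (simp add: algebra_simps)
  qed
  obtain K where K: "\<And>z. K < norm z \<Longrightarrow> \<psi> z = 0" using test_function_bounded_support[OF t] by metis
  have c\<psi>: "continuous_on UNIV (\<lambda>x. \<psi> (x, 0))"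
    by (rule continuous_on_compose2[OF test_function_continuous[OF t]]) (auto intro!: continuous_intros)
  have i0: "integrable lborel (\<lambda>x. indicator D (x $ 2) * \<psi> (x, 0))" if D: "D \<in> sets borel" for D
  proof (rule compact_support_integrable[OF c\<psi>, of K _ 1])
    show "\<psi> (x, 0) = 0" if "K < norm x" for x using K[of "(x, 0)"] that by (simp add: norm_Pair)
    have "(\<lambda>x::real^2. x $ 2) \<in> borel_measurable borel" by (intro borel_measurable_continuous_onI continuous_intros)
    thus "(\<lambda>x::real^2. indicator D (x $ 2) :: real) \<in> borel_measurable borel"
      using D by (rule measurable_compose[OF _ borel_measurable_indicator])
  qed (simp add: indicator_def)
  have T: "has_bochner_integral lborel (\<lambda>z. indicator (strip_region s D) z * (dt \<psi> z + s * dx 2 \<psi> z))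
     (- integral\<^sup>L lborel (\<lambda>x. indicator D (x $ 2) * \<psi> (x, 0)))" if "D \<in> sets borel" for s D
    using i2[OF that, of s] strip_integral_transport[OF t that, of s] by (simp add: has_bochner_integral_iff)
  have X: "has_bochner_integral lborel (\<lambda>z. indicator (strip_region s D) z * dx 1 \<psi> z) 0" if "D \<in> sets borel" for s D
    using i(2)[OF that, of s] strip_integral_dx1[OF t that, of s] by (simp add: has_bochner_integral_iff)
  define I0 I1 where "I0 = integral\<^sup>L lborel (\<lambda>x. \<psi> (x, 0))" and "I1 = integral\<^sup>L lborel (\<lambda>x. indicator {0<..} (x $ 2) * \<psi> (x, 0))"
  have Tu: "has_bochner_integral lborel (\<lambda>z. ?h z * (dt \<psi> z + s * dx 2 \<psi> z)) (- I0)" for s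
    using T[of UNIV s] unfolding hs[of s, symmetric] I0_def by simp
  have Xu: "has_bochner_integral lborel (\<lambda>z. ?h z * dx 1 \<psi> z) 0" using X[of UNIV 0] unfolding hs[of 0, symmetric] by simp
  \<comment> \<open>Subtracting transport with speed 0 from transport with speed 1 removes the
    initial term; therefore the constant B0 is free.\<close>
  have Yu: "has_bochner_integral lborel (\<lambda>z. ?h z * dx 2 \<psi> z) 0"
    using has_bochner_integral_diff[OF Tu[of 1] Tu[of 0]] by (simp add: algebra_simps)
  have "has_bochner_integral lborel
     (\<lambda>z. A0 * (?h z * (dt \<psi> z + 0 * dx 2 \<psi> z)) + C0 * (?h z * dx 1 \<psi> z) + B0 * (?h z * dx 2 \<psi> z)
       + (\<Sum>i<n. a i * (?H (s i) z * (dt \<psi> z + s i * dx 2 \<psi> z)) + c i * (?H (s i) z * dx 1 \<psi> z)))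
     (A0 * (- I0) + C0 * 0 + B0 * 0 + (\<Sum>i<n. a i * (- I1) + c i * 0))"
    unfolding I1_def
    by (intro has_bochner_integral_add has_bochner_integral_sum has_bochner_integral_mult_right Tu Xu Yu T X) auto
  moreover have "A0 * (?h z * (dt \<psi> z + 0 * dx 2 \<psi> z)) + C0 * (?h z * dx 1 \<psi> z) + B0 * (?h z * dx 2 \<psi> z)
       + (\<Sum>i<n. a i * (?H (s i) z * (dt \<psi> z + s i * dx 2 \<psi> z)) + c i * (?H (s i) z * dx 1 \<psi> z))
     = ?h z * ((A0 + (\<Sum>i<n. a i * ?H (s i) z)) * dt \<psi> z + (C0 + (\<Sum>i<n. c i * ?H (s i) z)) * dx 1 \<psi> z
       + (B0 + (\<Sum>i<n. s i * a i * ?H (s i) z)) * dx 2 \<psi> z)" for z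
  proof (cases "z \<in> half_space")
    case True
    have "(\<Sum>i<n. a i * (?H (s i) z * (dt \<psi> z + s i * dx 2 \<psi> z)) + c i * (?H (s i) z * dx 1 \<psi> z))
      = (\<Sum>i<n. a i * ?H (s i) z) * dt \<psi> z + (\<Sum>i<n. c i * ?H (s i) z) * dx 1 \<psi> z + (\<Sum>i<n. s i * a i * ?H (s i) z) * dx 2 \<psi> z"
      unfolding sum_distrib_right by (simp add: sum.distrib[symmetric] algebra_simps)
    thus ?thesis using True by (simp add: algebra_simps)
  next
    case False
    hence "snd z < 0" by (cases z) auto
    hence "?H u z = 0" for u by (auto simp: strip_region_def indicator_def)
    thus ?thesis using False by simp
  qed
  ultimately have 1: "integral\<^sup>L lborel (\<lambda>z. ?h z * ((A0 + (\<Sum>i<n. a i * ?H (s i) z)) * dt \<psi> z + (C0 + (\<Sum>i<n. c i * ?H (s i) z)) * dx 1 \<psi> z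
       + (B0 + (\<Sum>i<n. s i * a i * ?H (s i) z)) * dx 2 \<psi> z)) = - (A0 * I0) - (\<Sum>i<n. a i) * I1"
    by (simp add: has_bochner_integral_iff sum_distrib_right sum_negf)
  have e: "(A0 + (\<Sum>i<n. a i * I)) * p = A0 * p + (\<Sum>i<n. a i) * (I * p)" for I p
  proof -
    have "(\<Sum>i<n. a i * I) = (\<Sum>i<n. a i) * I" by (rule sum_distrib_right[symmetric])
    thus ?thesis by (simp only:) (simp add: algebra_simps)
  qed
  have "integral\<^sup>L lborel (\<lambda>x. (A0 + (\<Sum>i<n. a i * indicator {0<..} (x $ 2))) * \<psi> (x, 0))
     = integral\<^sup>L lborel (\<lambda>x. A0 * \<psi> (x, 0) + (\<Sum>i<n. a i) * (indicator {0<..} (x $ 2) * \<psi> (x, 0)))"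
    by (simp only: e)
  also have "\<dots> = A0 * I0 + (\<Sum>i<n. a i) * I1"
    unfolding I0_def I1_def using i0[of UNIV] i0[of "{0<..}"] by simp
  finally show "integral\<^sup>L lborel (\<lambda>z. ?h z * ((A0 + (\<Sum>i<n. a i * ?H (s i) z)) * dt \<psi> z + (C0 + (\<Sum>i<n. c i * ?H (s i) z)) * dx 1 \<psi> z
       + (B0 + (\<Sum>i<n. s i * a i * ?H (s i) z)) * dx 2 \<psi> z))
     + integral\<^sup>L lborel (\<lambda>x. (A0 + (\<Sum>i<n. a i * indicator {0<..} (x $ 2))) * \<psi> (x, 0)) = 0"
    using 1 by simp
qed

section \<open>Weak solutions as scalar balances of mass and of the two momenta\<close>

lemma test_function_component:
  assumes "test_function (\<phi> :: (real^2) \<times> real \<Rightarrow> real^2)"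
  shows "test_function (\<lambda>z. \<phi> z $ i)" "dt (\<lambda>z. \<phi> z $ i) z = dt \<phi> z $ i" "dx j (\<lambda>z. \<phi> z $ i) z = dx j \<phi> z $ i"
proof -
  show "test_function (\<lambda>z. \<phi> z $ i)"
    unfolding test_function_def
  proof (intro conjI allI)
    show "Ck k (\<lambda>z. \<phi> z $ i)" for k
      using Ck_bounded_linear[OF bounded_linear_vec_nth] assms unfolding test_function_def by blast
    have "closure {z. \<phi> z $ i \<noteq> 0} \<subseteq> closure {z. \<phi> z \<noteq> 0}" by (rule closure_mono) auto
    thus "compact (closure {z. \<phi> z $ i \<noteq> 0})"
      using assms closed_closure compact_Int_closed[of "closure {z. \<phi> z \<noteq> 0}" "closure {z. \<phi> z $ i \<noteq> 0}"]
      unfolding test_function_def by (simp add: Int_absorb1)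
  qed
  have "((\<lambda>z. \<phi> z $ i) has_derivative (\<lambda>h. frechet_derivative \<phi> (at z) h $ i)) (at z)"
    using bounded_linear.has_derivative[OF bounded_linear_vec_nth test_function_has_derivative(1)[OF assms]] .
  from frechet_derivative_at[OF this]
  show "dt (\<lambda>z. \<phi> z $ i) z = dt \<phi> z $ i" "dx j (\<lambda>z. \<phi> z $ i) z = dx j \<phi> z $ i"
    unfolding dt_def dx_def by metis+
qed

lemma test_function_axis:
  assumes "test_function (\<psi> :: (real^2) \<times> real \<Rightarrow> real)"
  shows "test_function (\<lambda>z. \<psi> z *\<^sub>R axis i (1::real) :: real^2)"
    "dt (\<lambda>z. \<psi> z *\<^sub>R axis i (1::real) :: real^2) z = dt \<psi> z *\<^sub>R axis i 1"
    "dx j (\<lambda>z. \<psi> z *\<^sub>R axis i (1::real) :: real^2) z = dx j \<psi> z *\<^sub>R axis i 1"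
proof -
  show "test_function (\<lambda>z. \<psi> z *\<^sub>R axis i (1::real) :: real^2)"
    unfolding test_function_def
  proof (intro conjI allI)
    show "Ck k (\<lambda>z. \<psi> z *\<^sub>R axis i (1::real) :: real^2)" for k
      using Ck_bounded_linear[OF bounded_linear_scaleR_left] assms unfolding test_function_def by blast
    have "{z. \<psi> z *\<^sub>R axis i (1::real) \<noteq> (0 :: real^2)} = {z. \<psi> z \<noteq> 0}" by (auto simp: axis_eq_0_iff)
    thus "compact (closure {z. \<psi> z *\<^sub>R axis i (1::real) \<noteq> (0 :: real^2)})"
      using assms unfolding test_function_def by simp
  qed
  have "((\<lambda>z. \<psi> z *\<^sub>R axis i (1::real) :: real^2) has_derivative (\<lambda>h. frechet_derivative \<psi> (at z) h *\<^sub>R axis i 1)) (at z)"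
    using bounded_linear.has_derivative[OF bounded_linear_scaleR_left test_function_has_derivative(1)[OF assms]] .
  from frechet_derivative_at[OF this]
  show "dt (\<lambda>z. \<psi> z *\<^sub>R axis i (1::real) :: real^2) z = dt \<psi> z *\<^sub>R axis i 1"
    "dx j (\<lambda>z. \<psi> z *\<^sub>R axis i (1::real) :: real^2) z = dx j \<psi> z *\<^sub>R axis i 1"
    unfolding dt_def dx_def by metis+
qed

definition mass_balance where
  "mass_balance \<rho> v \<longleftrightarrow> weak_balance (\<lambda>(x, t). \<rho> x t) (\<lambda>(x, t). \<rho> x t * v x t $ 1) (\<lambda>(x, t). \<rho> x t * v x t $ 2) (\<lambda>x. \<rho> x 0)"

definition momentum_balance where
  "momentum_balance \<gamma> \<rho> v i \<longleftrightarrow> weak_balance (\<lambda>(x, t). \<rho> x t * v x t $ i)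
     (\<lambda>(x, t). \<rho> x t * v x t $ i * v x t $ 1 + (if i = 1 then pressure \<gamma> (\<rho> x t) else 0))
     (\<lambda>(x, t). \<rho> x t * v x t $ i * v x t $ 2 + (if i = 2 then pressure \<gamma> (\<rho> x t) else 0)) (\<lambda>x. \<rho> x 0 * v x 0 $ i)"

lemma sum_2: "(\<Sum>j\<in>(UNIV::2 set). f j) = f 1 + f 2"
  by (simp add: UNIV_2)

lemma mass_balance_iff:
  "mass_balance \<rho> v \<longleftrightarrow> (\<forall>\<psi> :: (real^2) \<times> real \<Rightarrow> real. test_function \<psi> \<longrightarrow>
        (LINT (x, t):half_space|lborel.
           \<rho> x t * dt \<psi> (x, t) + (\<Sum>j\<in>UNIV. \<rho> x t * v x t $ j * dx j \<psi> (x, t)))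
        + (LINT x|lborel. \<rho> x 0 * \<psi> (x, 0)) = 0)"
  unfolding mass_balance_def weak_balance_def set_lebesgue_integral_def sum_2
  by (simp add: case_prod_unfold algebra_simps)

lemma weak_solution_momentum_balance:
  assumes "weak_solution \<gamma> \<rho> v"
  shows "momentum_balance \<gamma> \<rho> v i"
  unfolding momentum_balance_def weak_balance_def
proof (intro allI impI)
  fix \<psi> :: "(real^2) \<times> real \<Rightarrow> real" assume t: "test_function \<psi>"
  have i12: "i = 1 \<or> i = 2" by (rule exhaust_2)
  have ax: "axis i (1::real) $ k = (if k = i then 1 else 0)" for k by (simp add: axis_def)
  have "(LINT (x, t):half_space|lborel.
           \<rho> x t * (v x t \<bullet> dt (\<lambda>z. \<psi> z *\<^sub>R axis i 1) (x, t))
           + (\<Sum>k\<in>UNIV. \<Sum>j\<in>UNIV. \<rho> x t * v x t $ k * v x t $ j * dx j (\<lambda>z. \<psi> z *\<^sub>R axis i 1) (x, t) $ k)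
           + pressure \<gamma> (\<rho> x t) * (\<Sum>j\<in>UNIV. dx j (\<lambda>z. \<psi> z *\<^sub>R axis i 1) (x, t) $ j))
        + (LINT x|lborel. \<rho> x 0 * (v x 0 \<bullet> (\<psi> (x, 0) *\<^sub>R axis i 1))) = 0"
    using assms test_function_axis(1)[OF t, of i] unfolding weak_solution_def by blast
  moreover have "(LINT (x, t):half_space|lborel.
           \<rho> x t * (v x t \<bullet> dt (\<lambda>z. \<psi> z *\<^sub>R axis i 1) (x, t))
           + (\<Sum>k\<in>UNIV. \<Sum>j\<in>UNIV. \<rho> x t * v x t $ k * v x t $ j * dx j (\<lambda>z. \<psi> z *\<^sub>R axis i 1) (x, t) $ k)
           + pressure \<gamma> (\<rho> x t) * (\<Sum>j\<in>UNIV. dx j (\<lambda>z. \<psi> z *\<^sub>R axis i 1) (x, t) $ j))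
    = integral\<^sup>L lborel (\<lambda>z. indicator half_space z * ((case z of (x, t) \<Rightarrow> \<rho> x t * v x t $ i) * dt \<psi> z
       + (case z of (x, t) \<Rightarrow> \<rho> x t * v x t $ i * v x t $ 1 + (if i = 1 then pressure \<gamma> (\<rho> x t) else 0)) * dx 1 \<psi> z
       + (case z of (x, t) \<Rightarrow> \<rho> x t * v x t $ i * v x t $ 2 + (if i = 2 then pressure \<gamma> (\<rho> x t) else 0)) * dx 2 \<psi> z))"
    unfolding set_lebesgue_integral_def sum_2 test_function_axis(2,3)[OF t]
    by (rule Bochner_Integration.integral_cong)
      (use i12 in \<open>auto simp: case_prod_unfold inner_axis ax algebra_simps\<close>)
  moreover have "(LINT x|lborel. \<rho> x 0 * (v x 0 \<bullet> (\<psi> (x, 0) *\<^sub>R axis i 1)))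
    = integral\<^sup>L lborel (\<lambda>x. \<rho> x 0 * v x 0 $ i * \<psi> (x, 0))"
    by (rule Bochner_Integration.integral_cong) (auto simp: inner_axis)
  ultimately show "integral\<^sup>L lborel (\<lambda>z. indicator half_space z * ((case z of (x, t) \<Rightarrow> \<rho> x t * v x t $ i) * dt \<psi> z
       + (case z of (x, t) \<Rightarrow> \<rho> x t * v x t $ i * v x t $ 1 + (if i = 1 then pressure \<gamma> (\<rho> x t) else 0)) * dx 1 \<psi> z
       + (case z of (x, t) \<Rightarrow> \<rho> x t * v x t $ i * v x t $ 2 + (if i = 2 then pressure \<gamma> (\<rho> x t) else 0)) * dx 2 \<psi> z))
     + integral\<^sup>L lborel (\<lambda>x. \<rho> x 0 * v x 0 $ i * \<psi> (x, 0)) = 0"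
    by simp
qed

text \<open>The vector identity is the sum of the two scalar ones. Splitting the integrals requires
  integrability, which is where measurability and bounds enter, also at t = 0.\<close>

lemma weak_solutionI:
  assumes bs: "bounded_state \<rho> v" and mass: "mass_balance \<rho> v" and mom: "\<And>i. momentum_balance \<gamma> \<rho> v i"
    and m: "bounded_measurable (\<lambda>(x, t). \<rho> x t)" "\<And>i. bounded_measurable (\<lambda>(x, t). v x t $ i)"
      "bounded_measurable (\<lambda>(x, t). pressure \<gamma> (\<rho> x t))"
    and m0: "(\<lambda>x. \<rho> x 0) \<in> borel_measurable borel" "\<And>i. (\<lambda>x. v x 0 $ i) \<in> borel_measurable borel"
    and b0: "\<And>x. \<bar>\<rho> x 0\<bar> \<le> M" "\<And>x i. \<bar>v x 0 $ i\<bar> \<le> M"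
  shows "weak_solution \<gamma> \<rho> v"
  unfolding weak_solution_def
proof (intro conjI allI impI)
  show "bounded_state \<rho> v" by (rule bs)
  show "(LINT (x, t):half_space|lborel.
           \<rho> x t * dt \<psi> (x, t) + (\<Sum>j\<in>UNIV. \<rho> x t * v x t $ j * dx j \<psi> (x, t)))
        + (LINT x|lborel. \<rho> x 0 * \<psi> (x, 0)) = 0" if "test_function \<psi>" for \<psi>
    using mass that unfolding mass_balance_iff by blast
  fix \<phi> :: "(real^2) \<times> real \<Rightarrow> real^2" assume t: "test_function \<phi>"
  let ?h = "indicator half_space :: (real^2) \<times> real \<Rightarrow> real"
  define E where "E i z = ?h z * ((case z of (x, t) \<Rightarrow> \<rho> x t * v x t $ i) * dt (\<lambda>z. \<phi> z $ i) z
       + (case z of (x, t) \<Rightarrow> \<rho> x t * v x t $ i * v x t $ 1 + (if i = 1 then pressure \<gamma> (\<rho> x t) else 0)) * dx 1 (\<lambda>z. \<phi> z $ i) z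
       + (case z of (x, t) \<Rightarrow> \<rho> x t * v x t $ i * v x t $ 2 + (if i = 2 then pressure \<gamma> (\<rho> x t) else 0)) * dx 2 (\<lambda>z. \<phi> z $ i) z)" for i :: 2 and z
  define F where "F i x = \<rho> x 0 * v x 0 $ i * \<phi> (x, 0) $ i" for i :: 2 and x
  have EF: "integral\<^sup>L lborel (E i) + integral\<^sup>L lborel (F i) = 0" for i
    using mom[of i] test_function_component(1)[OF t, of i] unfolding momentum_balance_def weak_balance_def E_def F_def by blast
  have mv: "bounded_measurable (\<lambda>(x, t). \<rho> x t * v x t $ i)" for i :: 2
    using bounded_measurable_intros(3)[OF m(1) m(2)[of i]] by (simp add: case_prod_unfold)
  have mf: "bounded_measurable (\<lambda>(x, t). \<rho> x t * v x t $ i * v x t $ j + (if i = k then pressure \<gamma> (\<rho> x t) else 0))"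
    for i j k :: 2
  proof -
    have "bounded_measurable (\<lambda>z. if i = k then pressure \<gamma> (\<rho> (fst z) (snd z)) else 0)"
      using m(3) bounded_measurable_intros(1)[of 0] by (cases "i = k") (simp_all add: case_prod_unfold)
    from bounded_measurable_intros(2)[OF bounded_measurable_intros(3)[OF mv[of i] m(2)[of j]] this]
    show ?thesis by (simp add: case_prod_unfold)
  qed
  have iE: "integrable lborel (E i)" for i
  proof -
    have "integrable lborel (\<lambda>z. ?h z * (case z of (x, t) \<Rightarrow> \<rho> x t * v x t $ i) * dt (\<lambda>z. \<phi> z $ i) z
       + ?h z * (case z of (x, t) \<Rightarrow> \<rho> x t * v x t $ i * v x t $ 1 + (if i = 1 then pressure \<gamma> (\<rho> x t) else 0)) * dx 1 (\<lambda>z. \<phi> z $ i) z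
       + ?h z * (case z of (x, t) \<Rightarrow> \<rho> x t * v x t $ i * v x t $ 2 + (if i = 2 then pressure \<gamma> (\<rho> x t) else 0)) * dx 2 (\<lambda>z. \<phi> z $ i) z)"
      by (intro Bochner_Integration.integrable_add bounded_measurable_integrable mv mf test_function_component(1) t)
    thus ?thesis unfolding E_def by (simp add: distrib_left mult.assoc)
  qed
  have iF: "integrable lborel (F i)" for i
  proof -
    note ti = test_function_component(1)[OF t, of i]
    obtain K where K: "\<And>z. K < norm z \<Longrightarrow> \<phi> z $ i = 0" using test_function_bounded_support[OF ti] by metis
    have c: "continuous_on UNIV (\<lambda>x. \<phi> (x, 0) $ i)"
      by (rule continuous_on_compose2[OF test_function_continuous[OF ti]]) (auto intro!: continuous_intros)
    show ?thesis unfolding F_def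
    proof (rule compact_support_integrable[OF c, of K _ "M * M"])
      show "\<phi> (x, 0) $ i = 0" if "K < norm x" for x using K[of "(x, 0)"] that by (simp add: norm_Pair)
      show "\<bar>\<rho> x 0 * v x 0 $ i\<bar> \<le> M * M" for x
        unfolding abs_mult by (rule mult_mono[OF b0 order_trans[OF abs_ge_zero b0(1)] abs_ge_zero])
    qed (use m0 in simp)
  qed
  have "(LINT (x, t):half_space|lborel.
           \<rho> x t * (v x t \<bullet> dt \<phi> (x, t))
           + (\<Sum>i\<in>UNIV. \<Sum>j\<in>UNIV. \<rho> x t * v x t $ i * v x t $ j * dx j \<phi> (x, t) $ i)
           + pressure \<gamma> (\<rho> x t) * (\<Sum>j\<in>UNIV. dx j \<phi> (x, t) $ j)) = integral\<^sup>L lborel (\<lambda>z. E 1 z + E 2 z)"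
    unfolding set_lebesgue_integral_def sum_2 E_def test_function_component(2,3)[OF t]
    by (rule Bochner_Integration.integral_cong) (auto simp: case_prod_unfold inner_vec_def sum_2 algebra_simps)
  moreover have "(LINT x|lborel. \<rho> x 0 * (v x 0 \<bullet> \<phi> (x, 0))) = integral\<^sup>L lborel (\<lambda>x. F 1 x + F 2 x)"
    unfolding F_def by (rule Bochner_Integration.integral_cong) (auto simp: inner_vec_def sum_2 algebra_simps)
  ultimately show "(LINT (x, t):half_space|lborel.
           \<rho> x t * (v x t \<bullet> dt \<phi> (x, t))
           + (\<Sum>i\<in>UNIV. \<Sum>j\<in>UNIV. \<rho> x t * v x t $ i * v x t $ j * dx j \<phi> (x, t) $ i)
           + pressure \<gamma> (\<rho> x t) * (\<Sum>j\<in>UNIV. dx j \<phi> (x, t) $ j))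
        + (LINT x|lborel. \<rho> x 0 * (v x 0 \<bullet> \<phi> (x, 0))) = 0"
    using EF[of 1] EF[of 2] iE iF by simp
qed

lemma AE_hyperplane:
  fixes a :: "'a::euclidean_space"
  assumes "a \<noteq> 0"
  shows "AE x in lborel. a \<bullet> x \<noteq> c"
proof -
  have "negligible {x. a \<bullet> x = c}" using assms by (intro negligible_hyperplane) simp
  moreover have "{x. a \<bullet> x = c} \<in> sets borel" by (intro borel_closed closed_hyperplane)
  ultimately have "{x. a \<bullet> x = c} \<in> null_sets lborel" by (auto simp: negligible_iff_null_sets null_sets_def)
  from AE_not_in[OF this] show ?thesis by eventually_elim simp
qed

lemma AE_component2_neq: "AE x in lborel. (x::real^2) $ 2 \<noteq> c"
  using AE_hyperplane[of "axis 2 1 :: real^2" c] by (simp add: axis_eq_0_iff inner_axis inner_commute)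

lemma AE_plane_neq: "AE z in lborel. fst (z :: (real^2) \<times> real) $ 2 \<noteq> s * snd z"
proof -
  have "(axis 2 1, - s) \<noteq> (0 :: (real^2) \<times> real)" by (simp add: axis_eq_0_iff zero_prod_def)
  from AE_hyperplane[OF this, of 0] show ?thesis
    by eventually_elim (auto simp: inner_prod_def inner_axis inner_commute[of "axis 2 1"])
qed

lemma AE_time_neq: "AE z in lborel. snd (z :: (real^2) \<times> real) \<noteq> c"
proof -
  have "(0, 1) \<noteq> (0 :: (real^2) \<times> real)" by (simp add: zero_prod_def)
  from AE_hyperplane[OF this, of c] show ?thesis by eventually_elim (auto simp: inner_prod_def)
qed

text \<open>The Riemann data leave the values at t = 0, x_2 = 0 open, whereas a competitor has to
  agree with the given solution at every initial point. Changing a solution on this null set is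
  therefore needed in both directions: to normalise a given solution and to adapt the
  competitor.\<close>

lemma weak_solution_cong:
  assumes ws: "weak_solution \<gamma> r' u'"
    and m: "set_borel_measurable borel half_space (\<lambda>(x, t). r x t)" "set_borel_measurable borel half_space (\<lambda>(x, t). u x t)"
    and eq: "\<And>x t. 0 \<le> t \<Longrightarrow> t \<noteq> 0 \<or> x $ 2 \<noteq> 0 \<Longrightarrow> r x t = r' x t \<and> u x t = u' x t"
  shows "weak_solution \<gamma> r u"
proof -
  have m': "set_borel_measurable borel half_space (\<lambda>(x, t). r' x t)" "set_borel_measurable borel half_space (\<lambda>(x, t). u' x t)"
    using ws unfolding weak_solution_def bounded_state_def by auto
  have slice: "AE x in lborel. r x t = r' x t \<and> u x t = u' x t" if "0 \<le> t" for t
    using AE_component2_neq[of 0] by eventually_elim (use eq that in blast)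
  have bs: "bounded_state r u"
  proof -
    obtain M where M: "\<And>t. t \<ge> 0 \<Longrightarrow> AE x in lborel. 0 \<le> r' x t \<and> r' x t \<le> M \<and> norm (u' x t) \<le> M"
      using ws unfolding weak_solution_def bounded_state_def by blast
    have "AE x in lborel. 0 \<le> r x t \<and> r x t \<le> M \<and> norm (u x t) \<le> M" if "t \<ge> 0" for t
      using M[OF that] slice[OF that] by eventually_elim auto
    thus ?thesis unfolding bounded_state_def using m by blast
  qed
  have ae: "AE z in lborel. z \<in> half_space \<longrightarrow> r (fst z) (snd z) = r' (fst z) (snd z) \<and> u (fst z) (snd z) = u' (fst z) (snd z)"
    using AE_time_neq[of 0] by eventually_elim (use eq in auto)
  have cont: "continuous_on UNIV (\<lambda>x. f (x, 0::real))" if "continuous_on UNIV f" for f :: "(real^2) \<times> real \<Rightarrow> 'b::topological_space"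
    by (rule continuous_on_compose2[OF that]) (auto intro!: continuous_intros)
  have emb: "(\<lambda>x::real^2. (x, 0::real)) \<in> borel_measurable borel" by (intro borel_measurable_continuous_onI continuous_intros)
  have R: "(\<lambda>z. indicator half_space z * r (fst z) (snd z)) \<in> borel_measurable borel"
    "(\<lambda>z. indicator half_space z * r' (fst z) (snd z)) \<in> borel_measurable borel"
    using m(1) m'(1) unfolding set_borel_measurable_def by (simp_all add: case_prod_unfold)
  have comp: "(\<lambda>x::real^2. x $ i) \<in> borel_measurable borel" for i by (intro borel_measurable_continuous_onI continuous_intros)
  have U: "(\<lambda>z. indicator half_space z * u (fst z) (snd z) $ i) \<in> borel_measurable borel"
    "(\<lambda>z. indicator half_space z * u' (fst z) (snd z) $ i) \<in> borel_measurable borel" for i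
    using measurable_compose[OF m(2)[unfolded set_borel_measurable_def] comp[of i]]
      measurable_compose[OF m'(2)[unfolded set_borel_measurable_def] comp[of i]] by (simp_all add: case_prod_unfold)
  have R0: "(\<lambda>x. r x 0) \<in> borel_measurable borel" "(\<lambda>x. r' x 0) \<in> borel_measurable borel"
    using measurable_compose[OF emb R(1)] measurable_compose[OF emb R(2)] by simp_all
  have U0: "(\<lambda>x. u x 0 $ i) \<in> borel_measurable borel" "(\<lambda>x. u' x 0 $ i) \<in> borel_measurable borel" for i
    using measurable_compose[OF emb U(1)] measurable_compose[OF emb U(2)] by simp_all
  have cut: "set_lebesgue_integral lborel half_space f = set_lebesgue_integral lborel half_space g"
    if "(\<lambda>z. indicator half_space z * f z) \<in> borel_measurable borel" "(\<lambda>z. indicator half_space z * g z) \<in> borel_measurable borel"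
      "\<And>z. r (fst z) (snd z) = r' (fst z) (snd z) \<Longrightarrow> u (fst z) (snd z) = u' (fst z) (snd z) \<Longrightarrow> f z = g z" for f g :: "(real^2) \<times> real \<Rightarrow> real"
    unfolding set_lebesgue_integral_def
  proof (rule integral_cong_AE)
    show "AE z in lborel. indicator half_space z *\<^sub>R f z = indicator half_space z *\<^sub>R g z"
      using ae by eventually_elim (use that(3) in \<open>auto simp: indicator_def\<close>)
  qed (use that in simp_all)
  have cut0: "integral\<^sup>L lborel f = integral\<^sup>L lborel g"
    if "f \<in> borel_measurable borel" "g \<in> borel_measurable borel"
      "\<And>x. r x 0 = r' x 0 \<Longrightarrow> u x 0 = u' x 0 \<Longrightarrow> f x = g x" for f g :: "real^2 \<Rightarrow> real"
  proof (rule integral_cong_AE)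
    show "AE x in lborel. f x = g x" using slice[OF order_refl] by eventually_elim (use that(3) in blast)
  qed (use that in simp_all)
  let ?h = "\<lambda>z :: (real^2) \<times> real. indicator half_space z :: real"
  have h2: "?h z * ?h z = ?h z" for z by (simp add: indicator_def)
  \<comment> \<open>Outside the half space this is \<open>0 powr \<gamma> = 0\<close>; it moves the
    indicator into the nonlinearity, where measurability is known.\<close>
  have hp: "?h z * pressure \<gamma> y = pressure \<gamma> (?h z * y)" for z y
    by (simp add: indicator_def pressure_def)
  have mp: "(\<lambda>z. pressure \<gamma> (f z)) \<in> borel_measurable borel" if "f \<in> borel_measurable borel" for f :: "(real^2) \<times> real \<Rightarrow> real"
    unfolding pressure_def using that by measurable
  have cd: "continuous_on UNIV (dt \<phi>)" "continuous_on UNIV (dx j \<phi>)" "continuous_on UNIV \<phi>" if "test_function \<phi>"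
    for j and \<phi> :: "(real^2) \<times> real \<Rightarrow> 'b::real_normed_vector"
    using dt_dx_continuous[of \<phi>] test_function_continuous[OF that] that test_function_has_derivative(2)[OF that]
    unfolding dt_def[abs_def] dx_def[abs_def] by auto
  show ?thesis
    unfolding weak_solution_def
  proof (intro conjI allI impI)
    show "bounded_state r u" by (rule bs)
    fix \<psi> :: "(real^2) \<times> real \<Rightarrow> real" assume t: "test_function \<psi>"
    have D: "dt \<psi> \<in> borel_measurable borel" "dx j \<psi> \<in> borel_measurable borel" "(\<lambda>x. \<psi> (x, 0)) \<in> borel_measurable borel" for j
      using cd[OF t] cont by (auto intro!: borel_measurable_continuous_onI)
    have msr: "(\<lambda>z. ?h z * (case z of (x, t) \<Rightarrow> \<rho> x t * dt \<psi> (x, t) + (\<Sum>j\<in>UNIV. \<rho> x t * v x t $ j * dx j \<psi> (x, t)))) \<in> borel_measurable borel"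
      if "(\<lambda>z. ?h z * \<rho> (fst z) (snd z)) \<in> borel_measurable borel" "\<And>i. (\<lambda>z. ?h z * v (fst z) (snd z) $ i) \<in> borel_measurable borel"
      for \<rho> :: "real^2 \<Rightarrow> real \<Rightarrow> real" and v :: "real^2 \<Rightarrow> real \<Rightarrow> real^2"
    proof -
      have "(\<lambda>z. ?h z * (case z of (x, t) \<Rightarrow> \<rho> x t * dt \<psi> (x, t) + (\<Sum>j\<in>UNIV. \<rho> x t * v x t $ j * dx j \<psi> (x, t))))
        = (\<lambda>z. (?h z * \<rho> (fst z) (snd z)) * dt \<psi> z + (\<Sum>j\<in>UNIV. (?h z * \<rho> (fst z) (snd z)) * (?h z * v (fst z) (snd z) $ j) * dx j \<psi> z))"
        by (auto simp: fun_eq_iff indicator_def case_prod_unfold)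
      moreover have "\<dots> \<in> borel_measurable borel"
        by (intro borel_measurable_add borel_measurable_sum borel_measurable_times that D)
      ultimately show ?thesis by simp
    qed
    have "(LINT (x, t):half_space|lborel. r x t * dt \<psi> (x, t) + (\<Sum>j\<in>UNIV. r x t * u x t $ j * dx j \<psi> (x, t)))
       = (LINT (x, t):half_space|lborel. r' x t * dt \<psi> (x, t) + (\<Sum>j\<in>UNIV. r' x t * u' x t $ j * dx j \<psi> (x, t)))"
      by (rule cut[OF msr[OF R(1) U(1)] msr[OF R(2) U(2)]]) (simp add: case_prod_unfold)
    moreover have "(LINT x|lborel. r x 0 * \<psi> (x, 0)) = (LINT x|lborel. r' x 0 * \<psi> (x, 0))"
      by (rule cut0) (use R0 D in auto)
    ultimately show "(LINT (x, t):half_space|lborel. r x t * dt \<psi> (x, t) + (\<Sum>j\<in>UNIV. r x t * u x t $ j * dx j \<psi> (x, t)))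
       + (LINT x|lborel. r x 0 * \<psi> (x, 0)) = 0"
      using ws[unfolded weak_solution_def, THEN conjunct2, THEN conjunct1, rule_format, OF t] by (simp only:)
  next
    fix \<phi> :: "(real^2) \<times> real \<Rightarrow> real^2" assume t: "test_function \<phi>"
    have D: "(\<lambda>z. dt \<phi> z $ i) \<in> borel_measurable borel" "(\<lambda>z. dx j \<phi> z $ i) \<in> borel_measurable borel" "(\<lambda>x. \<phi> (x, 0) $ i) \<in> borel_measurable borel" for i j
      using cd[OF t] cont[OF cd(3)[OF t]]
      by (auto intro!: borel_measurable_continuous_onI continuous_intros)
    have msr: "(\<lambda>z. ?h z * (case z of (x, t) \<Rightarrow> \<rho> x t * (v x t \<bullet> dt \<phi> (x, t))
           + (\<Sum>i\<in>UNIV. \<Sum>j\<in>UNIV. \<rho> x t * v x t $ i * v x t $ j * dx j \<phi> (x, t) $ i)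
           + pressure \<gamma> (\<rho> x t) * (\<Sum>j\<in>UNIV. dx j \<phi> (x, t) $ j))) \<in> borel_measurable borel"
      if "(\<lambda>z. ?h z * \<rho> (fst z) (snd z)) \<in> borel_measurable borel" "\<And>i. (\<lambda>z. ?h z * v (fst z) (snd z) $ i) \<in> borel_measurable borel"
      for \<rho> :: "real^2 \<Rightarrow> real \<Rightarrow> real" and v :: "real^2 \<Rightarrow> real \<Rightarrow> real^2"
    proof -
      have "(\<lambda>z. ?h z * (case z of (x, t) \<Rightarrow> \<rho> x t * (v x t \<bullet> dt \<phi> (x, t))
           + (\<Sum>i\<in>UNIV. \<Sum>j\<in>UNIV. \<rho> x t * v x t $ i * v x t $ j * dx j \<phi> (x, t) $ i)
           + pressure \<gamma> (\<rho> x t) * (\<Sum>j\<in>UNIV. dx j \<phi> (x, t) $ j)))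
        = (\<lambda>z. (\<Sum>i\<in>UNIV. (?h z * \<rho> (fst z) (snd z)) * (?h z * v (fst z) (snd z) $ i) * dt \<phi> z $ i)
           + (\<Sum>i\<in>UNIV. \<Sum>j\<in>UNIV. (?h z * \<rho> (fst z) (snd z)) * (?h z * v (fst z) (snd z) $ i) * (?h z * v (fst z) (snd z) $ j) * dx j \<phi> z $ i)
           + pressure \<gamma> (?h z * \<rho> (fst z) (snd z)) * (\<Sum>j\<in>UNIV. dx j \<phi> z $ j))"
      proof
        fix z :: "(real^2) \<times> real"
        show "?h z * (case z of (x, t) \<Rightarrow> \<rho> x t * (v x t \<bullet> dt \<phi> (x, t))
           + (\<Sum>i\<in>UNIV. \<Sum>j\<in>UNIV. \<rho> x t * v x t $ i * v x t $ j * dx j \<phi> (x, t) $ i)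
           + pressure \<gamma> (\<rho> x t) * (\<Sum>j\<in>UNIV. dx j \<phi> (x, t) $ j))
        = (\<Sum>i\<in>UNIV. (?h z * \<rho> (fst z) (snd z)) * (?h z * v (fst z) (snd z) $ i) * dt \<phi> z $ i)
           + (\<Sum>i\<in>UNIV. \<Sum>j\<in>UNIV. (?h z * \<rho> (fst z) (snd z)) * (?h z * v (fst z) (snd z) $ i) * (?h z * v (fst z) (snd z) $ j) * dx j \<phi> z $ i)
           + pressure \<gamma> (?h z * \<rho> (fst z) (snd z)) * (\<Sum>j\<in>UNIV. dx j \<phi> z $ j)"
          by (cases "z \<in> half_space") (simp_all add: case_prod_unfold inner_vec_def sum_distrib_left mult.assoc pressure_def)
      qed
      moreover have "\<dots> \<in> borel_measurable borel"
        by (intro borel_measurable_add borel_measurable_sum borel_measurable_times mp that D)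
      ultimately show ?thesis by simp
    qed
    have "(LINT (x, t):half_space|lborel. r x t * (u x t \<bullet> dt \<phi> (x, t))
           + (\<Sum>i\<in>UNIV. \<Sum>j\<in>UNIV. r x t * u x t $ i * u x t $ j * dx j \<phi> (x, t) $ i)
           + pressure \<gamma> (r x t) * (\<Sum>j\<in>UNIV. dx j \<phi> (x, t) $ j))
       = (LINT (x, t):half_space|lborel. r' x t * (u' x t \<bullet> dt \<phi> (x, t))
           + (\<Sum>i\<in>UNIV. \<Sum>j\<in>UNIV. r' x t * u' x t $ i * u' x t $ j * dx j \<phi> (x, t) $ i)
           + pressure \<gamma> (r' x t) * (\<Sum>j\<in>UNIV. dx j \<phi> (x, t) $ j))"
      by (rule cut[OF msr[OF R(1) U(1)] msr[OF R(2) U(2)]]) (simp add: case_prod_unfold)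
    moreover have "(LINT x|lborel. r x 0 * (u x 0 \<bullet> \<phi> (x, 0))) = (LINT x|lborel. r' x 0 * (u' x 0 \<bullet> \<phi> (x, 0)))"
      by (rule cut0) (use R0 U0 D in \<open>auto simp: inner_vec_def intro!: borel_measurable_times borel_measurable_sum\<close>)
    ultimately show "(LINT (x, t):half_space|lborel. r x t * (u x t \<bullet> dt \<phi> (x, t))
           + (\<Sum>i\<in>UNIV. \<Sum>j\<in>UNIV. r x t * u x t $ i * u x t $ j * dx j \<phi> (x, t) $ i)
           + pressure \<gamma> (r x t) * (\<Sum>j\<in>UNIV. dx j \<phi> (x, t) $ j))
       + (LINT x|lborel. r x 0 * (u x 0 \<bullet> \<phi> (x, 0))) = 0"
      using ws[unfolded weak_solution_def, THEN conjunct2, THEN conjunct2, rule_format, OF t] by (simp only:)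
  qed
qed

section \<open>Energy of planar profiles\<close>

lemma strip_distr_vec2:
  assumes L: "L > 0"
  shows "distr (density lborel (\<lambda>x::real^2. indicator {-L<..<L} (x $ 1))) borel (\<lambda>x. x $ 2) = density lborel (\<lambda>_. ennreal (2 * L))"
proof (rule measure_eqI)
  fix A :: "real set" assume "A \<in> sets (distr (density lborel (\<lambda>x::real^2. indicator {-L<..<L} (x $ 1))) borel (\<lambda>x. x $ 2))"
  hence A [measurable]: "A \<in> sets borel" by simp
  have comp [measurable]: "(\<lambda>x::real^2. x $ i) \<in> borel_measurable borel" for i by (intro borel_measurable_continuous_onI continuous_intros)
  define f where "f b = (if b = axis 1 1 then indicator {-L<..<L} else indicator A :: real \<Rightarrow> ennreal)" for b :: "real^2"
  have B: "(Basis :: (real^2) set) = {axis 1 1, axis 2 1}" by (auto simp: Basis_vec_def UNIV_2)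
  have ne: "(axis 1 1 :: real^2) \<noteq> axis 2 1" by (simp add: axis_eq_axis)
  have pA: "(\<lambda>x::real^2. x $ 2) -` A \<in> sets borel" using measurable_sets[OF comp[of 2] A] by simp
  have "emeasure (distr (density lborel (\<lambda>x::real^2. indicator {-L<..<L} (x $ 1))) borel (\<lambda>x. x $ 2)) A
     = emeasure (density lborel (\<lambda>x::real^2. indicator {-L<..<L} (x $ 1))) ((\<lambda>x. x $ 2) -` A)"
    by (subst emeasure_distr) auto
  also have "\<dots> = (\<integral>\<^sup>+x. indicator {-L<..<L} (x $ 1) * indicator ((\<lambda>x. x $ 2) -` A) x \<partial>(lborel :: (real^2) measure))"
    using pA by (intro emeasure_density) auto
  also have "\<dots> = (\<integral>\<^sup>+x. (\<Prod>b\<in>Basis. f b (x \<bullet> b)) \<partial>(lborel :: (real^2) measure))"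
    unfolding B using ne by (auto simp: f_def inner_axis indicator_def intro!: nn_integral_cong)
  also have "\<dots> = (\<Prod>b\<in>Basis. (\<integral>\<^sup>+x. f b x \<partial>lborel))"
    by (rule nn_integral_lborel_prod) (auto simp: f_def)
  also have "\<dots> = ennreal (2 * L) * emeasure lborel A"
    unfolding B using ne L by (simp add: f_def)
  also have "\<dots> = emeasure (density lborel (\<lambda>_. ennreal (2 * L))) A"
    by (simp add: emeasure_density nn_integral_cmult)
  finally show "emeasure (distr (density lborel (\<lambda>x::real^2. indicator {-L<..<L} (x $ 1))) borel (\<lambda>x. x $ 2)) A
    = emeasure (density lborel (\<lambda>_. ennreal (2 * L))) A" .
qed simp

lemma strip_integral_vec2:
  fixes f :: "real \<Rightarrow> real"
  assumes L: "L > 0" and f [measurable]: "f \<in> borel_measurable borel"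
  shows "integral\<^sup>L lborel (\<lambda>x::real^2. indicator {-L<..<L} (x $ 1) * f (x $ 2)) = 2 * L * integral\<^sup>L lborel f"
proof -
  have comp [measurable]: "(\<lambda>x::real^2. x $ i) \<in> borel_measurable borel" for i by (intro borel_measurable_continuous_onI continuous_intros)
  let ?M = "density lborel (\<lambda>x::real^2. ennreal (indicator {-L<..<L} (x $ 1)))"
  have M: "?M = density lborel (\<lambda>x::real^2. indicator {-L<..<L} (x $ 1))" by (simp add: ennreal_indicator)
  have "integral\<^sup>L lborel (\<lambda>x::real^2. indicator {-L<..<L} (x $ 1) * f (x $ 2)) = integral\<^sup>L ?M (\<lambda>x. f (x $ 2))"
    by (subst integral_density) auto
  also have "\<dots> = integral\<^sup>L (distr ?M borel (\<lambda>x. x $ 2)) f" by (subst integral_distr) auto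
  also have "\<dots> = integral\<^sup>L (density lborel (\<lambda>_. ennreal (2 * L))) f" unfolding M strip_distr_vec2[OF L] ..
  also have "\<dots> = 2 * L * integral\<^sup>L lborel f" using L by (subst integral_density) auto
  finally show ?thesis .
qed

lemma energy_planar:
  assumes L: "L > 0" and f: "f \<in> borel_measurable borel"
    and eq: "\<And>x. x $ 2 \<noteq> c \<Longrightarrow> energy_density \<gamma> (\<rho> x t) (v x t) = f (x $ 2)"
    and m: "(\<lambda>x. energy_density \<gamma> (\<rho> x t) (v x t)) \<in> borel_measurable borel"
  shows "energy \<gamma> L \<rho> v t = 2 * L * integral\<^sup>L lborel (\<lambda>s. indicator {-L<..<L} s * f s)"
proof -
  have comp: "(\<lambda>x::real^2. x $ i) \<in> borel_measurable borel" for i by (intro borel_measurable_continuous_onI continuous_intros)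
  have box: "indicator {x::real^2. \<forall>i. - L < x $ i \<and> x $ i < L} x = (indicator {-L<..<L} (x $ 1) * indicator {-L<..<L} (x $ 2) :: real)" for x
    by (auto simp: indicator_def forall_2)
  have mi: "(\<lambda>x::real^2. indicator {-L<..<L} (x $ i) :: real) \<in> borel_measurable borel" for i
    by (rule measurable_compose[OF comp]) simp
  have "energy \<gamma> L \<rho> v t = integral\<^sup>L lborel (\<lambda>x::real^2. indicator {-L<..<L} (x $ 1) * (indicator {-L<..<L} (x $ 2) * f (x $ 2)))"
    unfolding energy_def set_lebesgue_integral_def
  proof (rule integral_cong_AE)
    show "AE x in lborel. indicator {x. \<forall>i. - L < x $ i \<and> x $ i < L} x *\<^sub>R energy_density \<gamma> (\<rho> x t) (v x t)
        = indicator {-L<..<L} (x $ 1) * (indicator {-L<..<L} (x $ 2) * f (x $ 2))"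
      using AE_component2_neq[of c] by eventually_elim (simp add: box eq)
    show "(\<lambda>x. indicator {x. \<forall>i. - L < x $ i \<and> x $ i < L} x *\<^sub>R energy_density \<gamma> (\<rho> x t) (v x t)) \<in> borel_measurable lborel"
      unfolding box using mi m by simp
    show "(\<lambda>x::real^2. indicator {-L<..<L} (x $ 1) * (indicator {-L<..<L} (x $ 2) * f (x $ 2))) \<in> borel_measurable lborel"
      using mi measurable_compose[OF comp f] by simp
  qed
  also have "\<dots> = 2 * L * integral\<^sup>L lborel (\<lambda>s. indicator {-L<..<L} s * f s)"
    by (rule strip_integral_vec2[OF L]) (use f in simp)
  finally show ?thesis .
qed

text \<open>The energy of a field that depends on x_2/t up to oscillation of constant length is
  affine in t until the fan reaches the boundary of the box; its right derivative at 0 is then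
  exact.\<close>

lemma energy_rate_linear:
  assumes "\<delta> > 0" "\<And>t. 0 \<le> t \<Longrightarrow> t < \<delta> \<Longrightarrow> energy \<gamma> L \<rho> v t = E + t * d"
  shows "has_energy_rate \<gamma> L \<rho> v 0 d"
  unfolding has_energy_rate_def
proof -
  have "((\<lambda>t. (energy \<gamma> L \<rho> v t - energy \<gamma> L \<rho> v 0) / (t - 0)) \<longlongrightarrow> d) (at_right 0)"
  proof (rule Lim_transform_eventually[OF tendsto_const])
    have "energy \<gamma> L \<rho> v 0 = E" using assms(2)[of 0] assms(1) by simp
    thus "\<forall>\<^sub>F t in at_right 0. d = (energy \<gamma> L \<rho> v t - energy \<gamma> L \<rho> v 0) / (t - 0)"
      unfolding eventually_at_right_field using assms by (intro exI[of _ \<delta>]) auto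
  qed
  thus "(energy \<gamma> L \<rho> v has_real_derivative d) (at_right 0)" by (simp add: has_field_derivative_iff)
qed

section \<open>The turbulent competitor\<close>

definition above :: "real \<Rightarrow> (real^2) \<times> real \<Rightarrow> real" where
  "above s = indicator (strip_region s {0<..})"

lemma fan4_balance:
  fixes s1 s2 s3 s4 :: real
  assumes "b1 = s1 * a1" "b2 = s2 * a2" "b3 = s3 * a3" "b4 = s4 * a4"
  shows "weak_balance (\<lambda>z. A0 + (a1 * above s1 z + a2 * above s2 z + a3 * above s3 z + a4 * above s4 z))
    (\<lambda>z. C0 + (c1 * above s1 z + c2 * above s2 z + c3 * above s3 z + c4 * above s4 z))
    (\<lambda>z. B0 + (b1 * above s1 z + b2 * above s2 z + b3 * above s3 z + b4 * above s4 z))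
    (\<lambda>x. A0 + (a1 + a2 + a3 + a4) * indicator {0<..} (x $ 2))"
proof -
  have sum4: "(\<Sum>i<4. f i) = f 0 + f 1 + f 2 + f 3" for f :: "nat \<Rightarrow> real"
    by (simp add: eval_nat_numeral)
  show ?thesis
    using fan_balance[where n = 4 and ?A0.0 = A0 and ?B0.0 = B0 and ?C0.0 = C0 and s = "\<lambda>i. [s1, s2, s3, s4] ! i"
        and a = "\<lambda>i. [a1, a2, a3, a4] ! i" and c = "\<lambda>i. [c1, c2, c3, c4] ! i"]
    unfolding sum4 assms above_def[symmetric] by (simp add: distrib_right)
qed

lemma bounded_measurable_strip: "D \<in> sets borel \<Longrightarrow> bounded_measurable (indicator (strip_region s D))"
  unfolding bounded_measurable_def
  by (intro conjI exI[of _ 1] borel_measurable_times borel_measurable_indicator half_space_borel strip_region_borel)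
     (auto simp: indicator_def)

text \<open>One balance law of the competitor: a piecewise constant fan with Rankine-Hugoniot speeds
  plus a perturbation that solves the homogeneous law. The plane x_2 = s3 t is left out because
  there the half-open zones of the fan and the open turbulent wedge do not match.\<close>

lemma perturbed_fan_balance:
  fixes s1 s2 s3 s4 :: real and f g h :: "real^2 \<Rightarrow> real \<Rightarrow> real" and pa pb pc :: "(real^2) \<times> real \<Rightarrow> real"
  assumes RH: "b1 = s1 * a1" "b2 = s2 * a2" "b3 = s3 * a3" "b4 = s4 * a4"
    and bm: "bounded_measurable (\<lambda>(x, t). f x t)" "bounded_measurable (\<lambda>(x, t). g x t)" "bounded_measurable (\<lambda>(x, t). h x t)"
    and bp: "bounded_measurable pa" "bounded_measurable pb" "bounded_measurable pc"
    and null: "\<And>\<psi>. test_function \<psi> \<Longrightarrow> integral\<^sup>L lborel (\<lambda>z. indicator half_space z * (pa z * dt \<psi> z + pb z * dx 1 \<psi> z + pc z * dx 2 \<psi> z)) = 0"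
    and pt: "\<And>x t. 0 \<le> t \<Longrightarrow> x $ 2 \<noteq> s3 * t \<Longrightarrow>
        f x t = A0 + (a1 * above s1 (x, t) + a2 * above s2 (x, t) + a3 * above s3 (x, t) + a4 * above s4 (x, t)) + pa (x, t) \<and>
        g x t = C0 + (c1 * above s1 (x, t) + c2 * above s2 (x, t) + c3 * above s3 (x, t) + c4 * above s4 (x, t)) + pb (x, t) \<and>
        h x t = B0 + (b1 * above s1 (x, t) + b2 * above s2 (x, t) + b3 * above s3 (x, t) + b4 * above s4 (x, t)) + pc (x, t)"
    and pa0: "\<And>x. pa (x, 0) = 0" and m0: "(\<lambda>x. f x 0) \<in> borel_measurable borel"
  shows "weak_balance (\<lambda>(x, t). f x t) (\<lambda>(x, t). g x t) (\<lambda>(x, t). h x t) (\<lambda>x. f x 0)"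
proof -
  have bH: "bounded_measurable (above s)" for s unfolding above_def by (rule bounded_measurable_strip) simp
  have bfan: "bounded_measurable (\<lambda>z. k + (k1 * above s1 z + k2 * above s2 z + k3 * above s3 z + k4 * above s4 z))" for k k1 k2 k3 k4
    by (intro bounded_measurable_intros bH)
  have mind: "(\<lambda>x::real^2. k + l * indicator {0<..} (x $ 2) :: real) \<in> borel_measurable borel" for k l
  proof -
    have "(\<lambda>x::real^2. x $ 2) \<in> borel_measurable borel" by (intro borel_measurable_continuous_onI continuous_intros)
    from measurable_compose[OF this borel_measurable_indicator[of "{0<..}" borel]] show ?thesis by measurable
  qed
  have wb: "weak_balance (\<lambda>z. A0 + (a1 * above s1 z + a2 * above s2 z + a3 * above s3 z + a4 * above s4 z) + pa z)
    (\<lambda>z. C0 + (c1 * above s1 z + c2 * above s2 z + c3 * above s3 z + c4 * above s4 z) + pb z)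
    (\<lambda>z. B0 + (b1 * above s1 z + b2 * above s2 z + b3 * above s3 z + b4 * above s4 z) + pc z)
    (\<lambda>x. A0 + (a1 + a2 + a3 + a4) * indicator {0<..} (x $ 2))"
    by (rule weak_balance_add_null[OF fan4_balance[OF RH] bfan bfan bfan bp null])
  show ?thesis
  proof (rule weak_balance_cong_AE[OF wb])
    show "AE z in lborel. z \<in> half_space \<longrightarrow>
       A0 + (a1 * above s1 z + a2 * above s2 z + a3 * above s3 z + a4 * above s4 z) + pa z = (case z of (x, t) \<Rightarrow> f x t) \<and>
       C0 + (c1 * above s1 z + c2 * above s2 z + c3 * above s3 z + c4 * above s4 z) + pb z = (case z of (x, t) \<Rightarrow> g x t) \<and>
       B0 + (b1 * above s1 z + b2 * above s2 z + b3 * above s3 z + b4 * above s4 z) + pc z = (case z of (x, t) \<Rightarrow> h x t)"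
      using AE_plane_neq[of s3]
    proof eventually_elim
      case (elim z)
      show ?case
      proof
        assume "z \<in> half_space"
        hence "0 \<le> snd z" by (cases z) auto
        from pt[OF this elim] show "A0 + (a1 * above s1 z + a2 * above s2 z + a3 * above s3 z + a4 * above s4 z) + pa z = (case z of (x, t) \<Rightarrow> f x t) \<and>
          C0 + (c1 * above s1 z + c2 * above s2 z + c3 * above s3 z + c4 * above s4 z) + pb z = (case z of (x, t) \<Rightarrow> g x t) \<and>
          B0 + (b1 * above s1 z + b2 * above s2 z + b3 * above s3 z + b4 * above s4 z) + pc z = (case z of (x, t) \<Rightarrow> h x t)"
          unfolding prod.collapse case_prod_unfold by (simp only:)
      qed
    qed
    show "AE x in lborel. A0 + (a1 + a2 + a3 + a4) * indicator {0<..} (x $ 2) = f x 0"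
      using AE_component2_neq[of 0]
    proof eventually_elim
      case (elim x)
      have "above s (x, 0) = indicator {0<..} (x $ 2)" for s unfolding above_def strip_region_def by (simp add: indicator_def)
      thus ?case using pt[of 0 x] elim pa0[of x] by (simp add: distrib_right)
    qed
  qed (intro mind m0 bm bounded_measurable_intros(2)[OF bfan] bp)+
qed

text \<open>
  Density 2, normal velocities \<open>\<plusminus>b\<close> and tangential velocities \<open>\<plusminus>W\<close> behind the shocks \<open>x\<^sub>2 = \<plusminus>2 b t\<close>; density 1/4
  in the turbulent zone \<open>|x\<^sub>2| < 8/7 b t\<close>, where the velocity has mean 0, length \<open>sqrt C\<close> and the mean of \<open>v \<otimes> v\<close> has the
  entries \<open>W\<^sup>2/2\<close>, \<open>- 8/7 b W\<close> and \<open>normal_stress\<close>.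
\<close>

definition shock_velocity :: "real \<Rightarrow> real" where
  "shock_velocity \<gamma> = sqrt ((2 powr \<gamma> - 1) / 2)"

text \<open>The mean B of the squared normal velocity comes from the jump of normal momentum at x_2
  = 8/7 b t, a speed fixed by mass: 8/7 b (2 - 1/4) = 2 b. The condition is 8/7 b 2 b = 2 b^2 +
  2^\<gamma> - B/4 - (1/4)^\<gamma>. In the same manner b solves 2 b 2 b = 2 b^2 + 2^\<gamma> - 1 at
  the shock.\<close>

definition normal_stress :: "real \<Rightarrow> real" where
  "normal_stress \<gamma> = 4 * (2 powr \<gamma> + 2 * (shock_velocity \<gamma>)\<^sup>2 - (1/4) powr \<gamma> - 16 / 7 * (shock_velocity \<gamma>)\<^sup>2)"

text \<open>The rate divided by L. The factor 4 combines the upper and lower halves of the fan with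
  the width 2 L of the box in x_1; e0, e1 and e2 are the energy densities of the initial, the
  turbulent and the compressed states.\<close>

definition fan_energy_rate :: "real \<Rightarrow> real \<Rightarrow> real" where
  "fan_energy_rate \<gamma> W =
    (let b = shock_velocity \<gamma>;
         e0 = internal_energy \<gamma> 1 + W\<^sup>2 / 2;
         e1 = 1/4 * internal_energy \<gamma> (1/4) + 1/4 * (W\<^sup>2 / 2 + normal_stress \<gamma>) / 2;
         e2 = 2 * internal_energy \<gamma> 2 + W\<^sup>2 + b\<^sup>2
     in 4 * (2 * b * (e2 - e0) + 8/7 * b * (e1 - e2)))"

lemma shock_velocity_pos: "1 \<le> \<gamma> \<Longrightarrow> 0 < shock_velocity \<gamma>"
  and shock_velocity_sq: "1 \<le> \<gamma> \<Longrightarrow> 2 * (shock_velocity \<gamma>)\<^sup>2 = 2 powr \<gamma> - 1"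
  and two_powr_ge: "1 \<le> \<gamma> \<Longrightarrow> 2 \<le> (2::real) powr \<gamma>"
proof -
  assume g: "1 \<le> \<gamma>"
  have "(2::real) powr 1 \<le> 2 powr \<gamma>" using g by (intro powr_mono) auto
  thus p: "2 \<le> (2::real) powr \<gamma>" by simp
  show "0 < shock_velocity \<gamma>" unfolding shock_velocity_def using p by simp
  show "2 * (shock_velocity \<gamma>)\<^sup>2 = 2 powr \<gamma> - 1" unfolding shock_velocity_def using p by simp
qed

text \<open>Positive determinant (W^2/2) B > (8/7 b W)^2 of the prescribed mean of v \<otimes> v,
  with W cancelled. Since 2 b^2 = 2^\<gamma> - 1, it is a linear inequality in 2^\<gamma> and
  (1/4)^\<gamma>, which follows from 2^\<gamma> \<ge> 2 and (1/4)^\<gamma> \<le> 1/4.\<close>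

lemma normal_stress_gt:
  assumes g: "1 \<le> \<gamma>"
  shows "2 * (8/7 * shock_velocity \<gamma>)\<^sup>2 < normal_stress \<gamma>"
proof -
  have q: "(1/4::real) powr \<gamma> \<le> 1/4"
  proof -
    have "(1/4::real) powr \<gamma> \<le> (1/4) powr 1" using g by (intro powr_mono') auto
    thus ?thesis by simp
  qed
  show ?thesis
    unfolding normal_stress_def power_mult_distrib
    using q shock_velocity_sq[OF g] two_powr_ge[OF g] by (simp add: power_divide)
qed

text \<open>The coefficient of W^2 is 4 (2 b 1/2 - 8/7 b 15/16) = - 2/7 b: the wedge loses more than
  the compression brings in. All other terms form the constant \<open>K\<close>, so a large W
  decides the sign.\<close>

lemma fan_energy_rate_neg:
  assumes g: "1 \<le> \<gamma>"
  obtains W where "W > 0" "fan_energy_rate \<gamma> W < 0"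
proof -
  let ?b = "shock_velocity \<gamma>"
  have b: "?b > 0" by (rule shock_velocity_pos[OF g])
  define K where "K = 4 * (2 * ?b * (2 * internal_energy \<gamma> 2 + ?b\<^sup>2 - internal_energy \<gamma> 1)
     + 8/7 * ?b * (1/4 * internal_energy \<gamma> (1/4) + normal_stress \<gamma> / 8 - 2 * internal_energy \<gamma> 2 - ?b\<^sup>2))"
  have rate: "fan_energy_rate \<gamma> W = K - 2 / 7 * ?b * W\<^sup>2" for W
    unfolding fan_energy_rate_def K_def Let_def by (simp add: field_simps)
  define W where "W = 1 + 7 * \<bar>K\<bar> / (2 * ?b)"
  have W1: "W \<ge> 1" unfolding W_def using b by simp
  have "\<bar>K\<bar> < 2 / 7 * ?b * W" unfolding W_def using b by (simp add: field_simps)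
  also have "2 / 7 * ?b * W \<le> 2 / 7 * ?b * W\<^sup>2"
    using W1 b by (intro mult_left_mono) (auto simp: power2_eq_square)
  finally have "fan_energy_rate \<gamma> W < 0" unfolding rate by linarith
  thus ?thesis using that[of W] W1 by simp
qed

lemma planar_velocity_norm:
  fixes p q :: real
  shows "(norm (p *\<^sub>R axis 1 1 + q *\<^sub>R axis 2 1 :: real^2))\<^sup>2 = p\<^sup>2 + q\<^sup>2"
    "(p *\<^sub>R axis 1 1 + q *\<^sub>R axis 2 1 :: real^2) $ 1 = p" "(p *\<^sub>R axis 1 1 + q *\<^sub>R axis 2 1 :: real^2) $ 2 = q"
proof -
  show c: "(p *\<^sub>R axis 1 1 + q *\<^sub>R axis 2 1 :: real^2) $ 1 = p" "(p *\<^sub>R axis 1 1 + q *\<^sub>R axis 2 1 :: real^2) $ 2 = q"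
    by (simp_all add: axis_def)
  show "(norm (p *\<^sub>R axis 1 1 + q *\<^sub>R axis 2 1 :: real^2))\<^sup>2 = p\<^sup>2 + q\<^sup>2"
    unfolding power2_norm_eq_inner inner_vec_def sum_2 c by (simp add: power2_eq_square)
qed

theorem turbulent_competitor:
  fixes \<gamma> W :: real and \<rho>0 :: "real^2 \<Rightarrow> real" and v0 :: "real^2 \<Rightarrow> real^2"
  assumes g: "1 \<le> \<gamma>" and W: "W > 0"
    and init: "\<And>x. x $ 2 < 0 \<Longrightarrow> \<rho>0 x = 1 \<and> v0 x = (- W) *\<^sub>R axis 1 1"
      "\<And>x. x $ 2 > 0 \<Longrightarrow> \<rho>0 x = 1 \<and> v0 x = W *\<^sub>R axis 1 1"
    and m0: "\<rho>0 \<in> borel_measurable borel" "v0 \<in> borel_measurable borel"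
  obtains r u where "weak_solution \<gamma> r u" "\<And>x. r x 0 = \<rho>0 x \<and> u x 0 = v0 x"
    "\<And>L. L > 0 \<Longrightarrow> has_energy_rate \<gamma> L r u 0 (L * fan_energy_rate \<gamma> W)"
proof -
  define b \<sigma> \<nu> B P p1 C where "b = shock_velocity \<gamma>" and "\<sigma> = 2 * b" and "\<nu> = 8/7 * b" and "B = normal_stress \<gamma>"
    and "P = (2::real) powr \<gamma>" and "p1 = (1/4::real) powr \<gamma>" and "C = W\<^sup>2 / 2 + B"
  have b: "b > 0" unfolding b_def by (rule shock_velocity_pos[OF g])
  have sn: "\<sigma> > 0" "\<nu> > 0" "\<nu> < \<sigma>" unfolding \<sigma>_def \<nu>_def using b by auto
  have bP: "2 * b\<^sup>2 = P - 1" unfolding b_def P_def by (rule shock_velocity_sq[OF g])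
  have B: "B > 2 * \<nu>\<^sup>2" unfolding B_def \<nu>_def b_def by (rule normal_stress_gt[OF g])
  have B_eq: "B / 4 + p1 - 2 * b\<^sup>2 - P = - \<nu> * (2 * b)"
    unfolding B_def normal_stress_def b_def[symmetric] p1_def[symmetric] P_def[symmetric] \<nu>_def by (simp add: power2_eq_square field_simps)
  have Bp: "B > 0" using B zero_le_power2[of \<nu>] by linarith
  have C: "C > 0" unfolding C_def using Bp W by (simp add: add_nonneg_pos)
  \<comment> \<open>The trace-free part of the mean of v \<otimes> v: half the difference of the
    diagonal entries W^2/2 and B, and the off-diagonal entry - \<nu> W. The trace is C.\<close>
  define q0 where "q0 = Complex ((W\<^sup>2 / 2 - B) / 2) (- \<nu> * W)"
  have sub: "subsolution_state C 0 q0"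
  proof -
    have "2 * q0 = Complex (W\<^sup>2 / 2 - B) (- 2 * \<nu> * W)" by (simp add: q0_def complex_eq_iff)
    hence "(norm (2 * q0))\<^sup>2 = (W\<^sup>2 / 2 - B)\<^sup>2 + 4 * \<nu>\<^sup>2 * W\<^sup>2"
      by (simp only: cmod_power2 complex.sel) (simp add: power_mult_distrib)
    also have "\<dots> < (W\<^sup>2 / 2 - B)\<^sup>2 + 2 * B * W\<^sup>2"
      using mult_strict_right_mono[OF B, of "W\<^sup>2"] W by simp
    also have "\<dots> = C\<^sup>2" unfolding C_def by (simp add: power2_eq_square algebra_simps)
    finally have "norm (2 * q0) < C" by (rule power2_less_imp_less[OF _ less_imp_le[OF C]])
    thus ?thesis unfolding subsolution_state_def by simp
  qed
  define \<Omega> where "\<Omega> = {z :: (real^2) \<times> real. 0 < snd z \<and> \<bar>fst z $ 2\<bar> < \<nu> * snd z}"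
  have "open \<Omega>" unfolding \<Omega>_def by (intro open_Collect_conj open_Collect_less continuous_intros)
  then obtain V Q where mVQ: "V \<in> borel_measurable borel" "Q \<in> borel_measurable borel"
    and off: "\<And>y. y \<notin> \<Omega> \<Longrightarrow> V y = 0" "\<And>y. y \<notin> \<Omega> \<Longrightarrow> Q y = 0"
    and on: "\<And>y. y \<in> \<Omega> \<Longrightarrow> (norm (0 + V y))\<^sup>2 = C" "\<And>y. y \<in> \<Omega> \<Longrightarrow> 2 * (q0 + Q y) = (0 + V y)\<^sup>2"
    and null: "euler_null V Q"
    by (rule convex_integration_open[OF _ sub]) (rule that)
  have m\<Omega>: "\<Omega> \<in> sets borel" using \<open>open \<Omega>\<close> by (rule borel_open)
  \<comment> \<open>On the edge x_2 = \<nu> t, which belongs to the zone of density 1/4 but not to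
    \<Omega>, a vector of length sqrt C is used, so that the energy density is the same throughout
    the zone.\<close>
  define T where "T z = (if z \<in> \<Omega> then V z else of_real (sqrt C))" for z
  have nT: "(Re (T z))\<^sup>2 + (Im (T z))\<^sup>2 = C" for z
    using on(1)[of z] C unfolding T_def by (auto simp: cmod_power2)
  define r' :: "real^2 \<Rightarrow> real \<Rightarrow> real" where "r' x t = (if x $ 2 \<le> - \<sigma> * t then 1 else if x $ 2 \<le> - \<nu> * t then 2 else if x $ 2 \<le> \<nu> * t then 1/4
     else if x $ 2 \<le> \<sigma> * t then 2 else 1)" for x t
  define U1 where "U1 x t = (if x $ 2 \<le> - \<nu> * t then - W else if x $ 2 \<le> \<nu> * t then Re (T (x, t)) else W)" for x :: "real^2" and t
  define U2 where "U2 x t = (if x $ 2 \<le> - \<sigma> * t then 0 else if x $ 2 \<le> - \<nu> * t then - b else if x $ 2 \<le> \<nu> * t then Im (T (x, t))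
     else if x $ 2 \<le> \<sigma> * t then b else 0)" for x :: "real^2" and t
  define u' where "u' x t = (U1 x t *\<^sub>R axis 1 1 + U2 x t *\<^sub>R axis 2 1 :: real^2)" for x t
  have u'c: "u' x t $ 1 = U1 x t" "u' x t $ 2 = U2 x t" "(norm (u' x t))\<^sup>2 = (U1 x t)\<^sup>2 + (U2 x t)\<^sup>2" for x t
    unfolding u'_def by (rule planar_velocity_norm)+
  have H_eq: "above s (x, t) = (if s * t < x $ 2 then 1 else 0)" if "0 \<le> t" for s x t
    unfolding above_def strip_region_def indicator_def using that by simp
  have ps: "pressure \<gamma> 1 = 1" "pressure \<gamma> 2 = P" "pressure \<gamma> (1/4) = p1" unfolding pressure_def P_def p1_def by simp_all
  \<comment> \<open>Recovers all entries of v \<otimes> v from its trace C and its trace-free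
    part.\<close>
  have products: "Re w * Re w = W * W / 2 + Re q \<and> Re w * Im w = - (\<nu> * W) + Im q \<and> Im w * Im w = B - Re q"
    if "2 * (q0 + q) = w\<^sup>2" "(norm w)\<^sup>2 = C" for q w
  proof -
    have "2 * Re q0 + 2 * Re q = Re w * Re w - Im w * Im w" "2 * Im q0 + 2 * Im q = 2 * (Re w * Im w)"
      using arg_cong[OF that(1), of Re] arg_cong[OF that(1), of Im] by (simp_all add: power2_eq_square)
    moreover have "Re w * Re w + Im w * Im w = W * W / 2 + B"
      using that(2) unfolding cmod_power2 C_def by (simp add: power2_eq_square)
    moreover have "2 * Re q0 = W * W / 2 - B" "Im q0 = - (\<nu> * W)" unfolding q0_def by (simp_all add: power2_eq_square)
    ultimately show ?thesis by linarith
  qed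
  \<comment> \<open>The five zones with their conserved quantities and fluxes, from which all three
    balances are read off. On x_2 = \<nu> t the half-open zone and the open set \<Omega> disagree,
    hence the exclusion.\<close>
  have regions: "(above (-\<sigma>) (x,t) = 0 \<and> above (-\<nu>) (x,t) = 0 \<and> above \<nu> (x,t) = 0 \<and> above \<sigma> (x,t) = 0 \<and> r' x t = 1 \<and>
        r' x t * U1 x t = - W \<and> r' x t * U2 x t = 0 \<and> r' x t * U1 x t * U1 x t = W * W \<and> r' x t * U1 x t * U2 x t = 0 \<and>
        r' x t * U2 x t * U2 x t = 0 \<and> pressure \<gamma> (r' x t) = 1 \<and> V (x,t) = 0 \<and> Q (x,t) = 0)
    \<or> (above (-\<sigma>) (x,t) = 1 \<and> above (-\<nu>) (x,t) = 0 \<and> above \<nu> (x,t) = 0 \<and> above \<sigma> (x,t) = 0 \<and> r' x t = 2 \<and>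
        r' x t * U1 x t = - 2 * W \<and> r' x t * U2 x t = - 2 * b \<and> r' x t * U1 x t * U1 x t = 2 * (W * W) \<and> r' x t * U1 x t * U2 x t = 2 * (W * b) \<and>
        r' x t * U2 x t * U2 x t = 2 * (b * b) \<and> pressure \<gamma> (r' x t) = P \<and> V (x,t) = 0 \<and> Q (x,t) = 0)
    \<or> (above (-\<sigma>) (x,t) = 1 \<and> above (-\<nu>) (x,t) = 1 \<and> above \<nu> (x,t) = 0 \<and> above \<sigma> (x,t) = 0 \<and> r' x t = 1/4 \<and>
        r' x t * U1 x t = Re (V (x,t)) / 4 \<and> r' x t * U2 x t = Im (V (x,t)) / 4 \<and> r' x t * U1 x t * U1 x t = W * W / 8 + Re (Q (x,t)) / 4 \<and> r' x t * U1 x t * U2 x t = - (\<nu> * W) / 4 + Im (Q (x,t)) / 4 \<and>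
        r' x t * U2 x t * U2 x t = B / 4 - Re (Q (x,t)) / 4 \<and> pressure \<gamma> (r' x t) = p1)
    \<or> (above (-\<sigma>) (x,t) = 1 \<and> above (-\<nu>) (x,t) = 1 \<and> above \<nu> (x,t) = 1 \<and> above \<sigma> (x,t) = 0 \<and> r' x t = 2 \<and>
        r' x t * U1 x t = 2 * W \<and> r' x t * U2 x t = 2 * b \<and> r' x t * U1 x t * U1 x t = 2 * (W * W) \<and> r' x t * U1 x t * U2 x t = 2 * (W * b) \<and>
        r' x t * U2 x t * U2 x t = 2 * (b * b) \<and> pressure \<gamma> (r' x t) = P \<and> V (x,t) = 0 \<and> Q (x,t) = 0)
    \<or> (above (-\<sigma>) (x,t) = 1 \<and> above (-\<nu>) (x,t) = 1 \<and> above \<nu> (x,t) = 1 \<and> above \<sigma> (x,t) = 1 \<and> r' x t = 1 \<and>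
        r' x t * U1 x t = W \<and> r' x t * U2 x t = 0 \<and> r' x t * U1 x t * U1 x t = W * W \<and> r' x t * U1 x t * U2 x t = 0 \<and>
        r' x t * U2 x t * U2 x t = 0 \<and> pressure \<gamma> (r' x t) = 1 \<and> V (x,t) = 0 \<and> Q (x,t) = 0)"
    if t: "0 \<le> t" and ne: "x $ 2 \<noteq> \<nu> * t" for x t
  proof -
    have o: "- \<sigma> * t \<le> - \<nu> * t" "- \<nu> * t \<le> \<nu> * t" "\<nu> * t \<le> \<sigma> * t"
      using t sn by (auto intro!: mult_right_mono)
    consider "x $ 2 \<le> - \<sigma> * t" | "- \<sigma> * t < x $ 2" "x $ 2 \<le> - \<nu> * t" | "- \<nu> * t < x $ 2" "x $ 2 < \<nu> * t"
      | "\<nu> * t < x $ 2" "x $ 2 \<le> \<sigma> * t" | "\<sigma> * t < x $ 2" using ne by linarith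
    thus ?thesis
    proof cases
      case 3
      have "0 < \<nu> * t" using 3 o by linarith
      hence "t > 0" using sn(2) by (simp add: zero_less_mult_iff)
      hence z: "(x, t) \<in> \<Omega>" unfolding \<Omega>_def using 3 by auto
      have e: "r' x t = 1/4" "U1 x t = Re (V (x,t))" "U2 x t = Im (V (x,t))"
        using 3 o z unfolding r'_def U1_def U2_def T_def by auto
      have h: "above (-\<sigma>) (x,t) = 1" "above (-\<nu>) (x,t) = 1" "above \<nu> (x,t) = 0" "above \<sigma> (x,t) = 0"
        using 3 o t by (auto simp: H_eq)
      have p: "Re (V (x,t)) * Re (V (x,t)) = W * W / 2 + Re (Q (x,t))" "Re (V (x,t)) * Im (V (x,t)) = - (\<nu> * W) + Im (Q (x,t))"
        "Im (V (x,t)) * Im (V (x,t)) = B - Re (Q (x,t))"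
        using products[of "Q (x,t)" "V (x,t)"] on[OF z] by auto
      show ?thesis unfolding e h ps mult.assoc p by simp
    qed (use o off[of "(x,t)"] t in \<open>auto simp: H_eq r'_def U1_def U2_def \<Omega>_def ps\<close>)
  qed
  have msr: "(\<lambda>z. r' (fst z) (snd z)) \<in> borel_measurable borel" "(\<lambda>z. U1 (fst z) (snd z)) \<in> borel_measurable borel"
    "(\<lambda>z. U2 (fst z) (snd z)) \<in> borel_measurable borel"
  proof -
    have [measurable]: "(\<lambda>z :: (real^2) \<times> real. fst z $ 2) \<in> borel_measurable borel" "(\<lambda>z :: (real^2) \<times> real. snd z) \<in> borel_measurable borel"
      by (intro borel_measurable_continuous_onI continuous_intros)+
    have [measurable]: "T \<in> borel_measurable borel" unfolding T_def[abs_def] using mVQ m\<Omega> by measurable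
    show "(\<lambda>z. r' (fst z) (snd z)) \<in> borel_measurable borel" unfolding r'_def by measurable
    show "(\<lambda>z. U1 (fst z) (snd z)) \<in> borel_measurable borel" unfolding U1_def prod.collapse by measurable
    show "(\<lambda>z. U2 (fst z) (snd z)) \<in> borel_measurable borel" unfolding U2_def prod.collapse by measurable
  qed
  have bT: "\<bar>Re (T z)\<bar> \<le> sqrt C" "\<bar>Im (T z)\<bar> \<le> sqrt C" for z
    using nT[of z] zero_le_power2[of "Re (T z)"] zero_le_power2[of "Im (T z)"] by (auto intro!: real_le_rsqrt)
  define M where "M = 2 + W + b + sqrt C"
  have sC: "sqrt C > 0" using C by simp
  have bd: "0 \<le> r' x t" "r' x t \<le> 2" "\<bar>U1 x t\<bar> \<le> M" "\<bar>U2 x t\<bar> \<le> M" for x t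
    using W b sC bT[of "(x,t)"] unfolding r'_def U1_def U2_def M_def by auto
  have *: "bounded_measurable (\<lambda>(x, t). f x t)"
    if "(\<lambda>z. f (fst z) (snd z)) \<in> borel_measurable borel" "\<And>x t. \<bar>f x t\<bar> \<le> K" for f :: "real^2 \<Rightarrow> real \<Rightarrow> real" and K
    unfolding bounded_measurable_def case_prod_unfold
    using that by (auto intro!: borel_measurable_times borel_measurable_indicator half_space_borel)
  have bm: "bounded_measurable (\<lambda>(x, t). r' x t)" "bounded_measurable (\<lambda>(x, t). U1 x t)" "bounded_measurable (\<lambda>(x, t). U2 x t)"
    by (rule *[OF msr(1), of 2] *[OF msr(2) bd(3)] *[OF msr(3) bd(4)]; use bd in simp)+
  have bm_u: "bounded_measurable (\<lambda>(x, t). u' x t $ i)" for i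
    using bm(2,3) exhaust_2[of i] by (elim disjE) (simp_all add: u'c)
  have bm_p: "bounded_measurable (\<lambda>(x, t). pressure \<gamma> (r' x t))"
    unfolding bounded_measurable_def case_prod_unfold
  proof (intro conjI exI[of _ P] ballI)
    show "(\<lambda>z. indicator half_space z * pressure \<gamma> (r' (fst z) (snd z))) \<in> borel_measurable borel"
      unfolding pressure_def using msr(1) half_space_borel by measurable
    show "\<bar>pressure \<gamma> (r' (fst z) (snd z))\<bar> \<le> P" for z
      unfolding pressure_def P_def using bd(1,2) g by (simp add: powr_mono2)
  qed
  have bVQ: "bounded_measurable (\<lambda>z. Re (V z) / 4)" "bounded_measurable (\<lambda>z. Im (V z) / 4)"
    "bounded_measurable (\<lambda>z. Re (Q z) / 4)" "bounded_measurable (\<lambda>z. Im (Q z) / 4)" "bounded_measurable (\<lambda>z. - Re (Q z) / 4)"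
  proof -
    have nVQ: "norm (V z) \<le> sqrt C \<and> norm (Q z) \<le> C / 2 + norm q0" for z
    proof (cases "z \<in> \<Omega>")
      case True
      show ?thesis using subsolution_solution_bounds[OF C on(1)[OF True] on(2)[OF True]] by simp
    next
      case False
      have "0 \<le> sqrt C" "0 \<le> C / 2 + norm q0" using C by (simp_all add: add_nonneg_nonneg)
      thus ?thesis using off[OF False] by simp
    qed
    have *: "bounded_measurable (\<lambda>z. f z / 4)" if "f \<in> borel_measurable borel" "\<And>z. \<bar>f z\<bar> \<le> K" for f K
      unfolding bounded_measurable_def
    proof (intro conjI exI[of _ "K"] ballI)
      show "\<bar>f z / 4\<bar> \<le> K" for z using that(2)[of z] by simp
    qed (use that(1) half_space_borel in measurable)
    show "bounded_measurable (\<lambda>z. Re (V z) / 4)"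
      by (rule *[OF _ order_trans[OF abs_Re_le_cmod nVQ[THEN conjunct1]]]) (use mVQ in measurable)
    show "bounded_measurable (\<lambda>z. Im (V z) / 4)"
      by (rule *[OF _ order_trans[OF abs_Im_le_cmod nVQ[THEN conjunct1]]]) (use mVQ in measurable)
    show "bounded_measurable (\<lambda>z. Re (Q z) / 4)"
      by (rule *[OF _ order_trans[OF abs_Re_le_cmod nVQ[THEN conjunct2]]]) (use mVQ in measurable)
    show "bounded_measurable (\<lambda>z. Im (Q z) / 4)"
      by (rule *[OF _ order_trans[OF abs_Im_le_cmod nVQ[THEN conjunct2]]]) (use mVQ in measurable)
    have "\<bar>- Re (Q z)\<bar> \<le> C / 2 + norm q0" for z
      using order_trans[OF abs_Re_le_cmod nVQ[THEN conjunct2, of z]] by simp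
    thus "bounded_measurable (\<lambda>z. - Re (Q z) / 4)" by (intro *) (use mVQ in measurable)
  qed
  have b_zero: "bounded_measurable (\<lambda>_. 0)" by (rule bounded_measurable_intros)
  \<comment> \<open>\<Omega> lies in t > 0, so \<open>euler_null\<close> on the whole space is
    already a statement about the half space.\<close>
  have hV: "indicator half_space z * Re (V z) = Re (V z)" "indicator half_space z * Im (V z) = Im (V z)"
    "indicator half_space z * Re (Q z) = Re (Q z)" "indicator half_space z * Im (Q z) = Im (Q z)" for z
    using off[of z] by (cases "z \<in> \<Omega>"; cases z; auto simp: \<Omega>_def)+
  have n0: "integral\<^sup>L lborel (\<lambda>z. indicator half_space z * (0 * dt \<psi> z + Re (V z) / 4 * dx 1 \<psi> z + Im (V z) / 4 * dx 2 \<psi> z)) = 0"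
    and n1: "integral\<^sup>L lborel (\<lambda>z. indicator half_space z * (Re (V z) / 4 * dt \<psi> z + Re (Q z) / 4 * dx 1 \<psi> z + Im (Q z) / 4 * dx 2 \<psi> z)) = 0"
    and n2: "integral\<^sup>L lborel (\<lambda>z. indicator half_space z * (Im (V z) / 4 * dt \<psi> z + Im (Q z) / 4 * dx 1 \<psi> z + - Re (Q z) / 4 * dx 2 \<psi> z)) = 0"
    if t: "test_function \<psi>" for \<psi>
  proof -
    note n = null[unfolded euler_null_def, rule_format, OF t]
    have *: "integral\<^sup>L lborel f = 0" if "integral\<^sup>L lborel h = 0" "\<And>z. f z = 1 / 4 * h z" for f h :: "(real^2) \<times> real \<Rightarrow> real"
      unfolding that(2) using that(1) by simp
    show "integral\<^sup>L lborel (\<lambda>z. indicator half_space z * (0 * dt \<psi> z + Re (V z) / 4 * dx 1 \<psi> z + Im (V z) / 4 * dx 2 \<psi> z)) = 0"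
    proof (rule *[OF n[THEN conjunct1]])
      fix z show "indicator half_space z * (0 * dt \<psi> z + Re (V z) / 4 * dx 1 \<psi> z + Im (V z) / 4 * dx 2 \<psi> z)
        = 1 / 4 * (Re (V z) * dx 1 \<psi> z + Im (V z) * dx 2 \<psi> z)"
        using hV[of z] by (cases "z \<in> half_space") auto
    qed
    show "integral\<^sup>L lborel (\<lambda>z. indicator half_space z * (Re (V z) / 4 * dt \<psi> z + Re (Q z) / 4 * dx 1 \<psi> z + Im (Q z) / 4 * dx 2 \<psi> z)) = 0"
    proof (rule *[OF n[THEN conjunct2, THEN conjunct1]])
      fix z show "indicator half_space z * (Re (V z) / 4 * dt \<psi> z + Re (Q z) / 4 * dx 1 \<psi> z + Im (Q z) / 4 * dx 2 \<psi> z)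
        = 1 / 4 * (Re (V z) * dt \<psi> z + Re (Q z) * dx 1 \<psi> z + Im (Q z) * dx 2 \<psi> z)"
        using hV[of z] by (cases "z \<in> half_space") auto
    qed
    show "integral\<^sup>L lborel (\<lambda>z. indicator half_space z * (Im (V z) / 4 * dt \<psi> z + Im (Q z) / 4 * dx 1 \<psi> z + - Re (Q z) / 4 * dx 2 \<psi> z)) = 0"
    proof (rule *[OF n[THEN conjunct2, THEN conjunct2]])
      fix z show "indicator half_space z * (Im (V z) / 4 * dt \<psi> z + Im (Q z) / 4 * dx 1 \<psi> z + - Re (Q z) / 4 * dx 2 \<psi> z)
        = 1 / 4 * (Im (V z) * dt \<psi> z + Im (Q z) * dx 1 \<psi> z - Re (Q z) * dx 2 \<psi> z)"
        using hV[of z] by (cases "z \<in> half_space") auto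
    qed
  qed
  have emb: "(\<lambda>x::real^2. (x, 0::real)) \<in> borel_measurable borel" by (intro borel_measurable_continuous_onI continuous_intros)
  have at0: "(\<lambda>x. r' x 0) \<in> borel_measurable borel" "(\<lambda>x. U1 x 0) \<in> borel_measurable borel" "(\<lambda>x. U2 x 0) \<in> borel_measurable borel"
    using msr[THEN measurable_compose[OF emb]] by simp_all
  have off0: "V (x, 0) = 0" "Q (x, 0) = 0" for x by (rule off; simp add: \<Omega>_def)+
  note bi = bounded_measurable_intros(2,3)
  have bmf: "bounded_measurable (\<lambda>(x, t). r' x t * U1 x t)" "bounded_measurable (\<lambda>(x, t). r' x t * U2 x t)"
    "bounded_measurable (\<lambda>(x, t). r' x t * U1 x t * U1 x t + pressure \<gamma> (r' x t))"
    "bounded_measurable (\<lambda>(x, t). r' x t * U1 x t * U2 x t)"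
    "bounded_measurable (\<lambda>(x, t). r' x t * U2 x t * U2 x t + pressure \<gamma> (r' x t))"
    using bm bm_p unfolding case_prod_unfold by (auto intro!: bounded_measurable_intros(2,3))
  have mass: "mass_balance r' u'"
    unfolding mass_balance_def u'c
  \<comment> \<open>Here and in the two momentum balances, \<open>A0\<close>, \<open>C0\<close>,
    \<open>B0\<close> are the values below the fan, and the coefficients \<open>a\<close>,
    \<open>c\<close>, \<open>b\<close> are the jumps of density and fluxes across the four planes,
    from below to above.\<close>
  proof (rule perturbed_fan_balance[where ?s1.0 = "-\<sigma>" and ?s2.0 = "-\<nu>" and ?s3.0 = \<nu> and ?s4.0 = \<sigma>
        and ?A0.0 = 1 and ?C0.0 = "-W" and ?B0.0 = 0
        and ?a1.0 = "1" and ?a2.0 = "-7/4" and ?a3.0 = "7/4" and ?a4.0 = "-1"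
        and ?c1.0 = "-W" and ?c2.0 = "2*W" and ?c3.0 = "2*W" and ?c4.0 = "-W"
        and ?b1.0 = "-2*b" and ?b2.0 = "2*b" and ?b3.0 = "2*b" and ?b4.0 = "-2*b",
        OF _ _ _ _ bm(1) bmf(1,2) b_zero bVQ(1,2) n0])
    fix x :: "real^2" and t :: real assume "0 \<le> t" "x $ 2 \<noteq> \<nu> * t"
    from regions[OF this]
    show "r' x t = 1 + (1 * above (- \<sigma>) (x, t) + - 7 / 4 * above (- \<nu>) (x, t) + 7 / 4 * above \<nu> (x, t) + - 1 * above \<sigma> (x, t)) + 0 \<and>
      r' x t * U1 x t = - W + (- W * above (- \<sigma>) (x, t) + 2 * W * above (- \<nu>) (x, t) + 2 * W * above \<nu> (x, t) + - W * above \<sigma> (x, t)) + Re (V (x, t)) / 4 \<and>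
      r' x t * U2 x t = 0 + (- 2 * b * above (- \<sigma>) (x, t) + 2 * b * above (- \<nu>) (x, t) + 2 * b * above \<nu> (x, t) + - 2 * b * above \<sigma> (x, t)) + Im (V (x, t)) / 4"
      by (elim disjE conjE) (simp_all only:, simp_all)
  qed (use at0 in \<open>auto simp: \<sigma>_def \<nu>_def\<close>)
  have mom1: "momentum_balance \<gamma> r' u' 1"
  proof -
    have "weak_balance (\<lambda>(x, t). r' x t * U1 x t) (\<lambda>(x, t). r' x t * U1 x t * U1 x t + pressure \<gamma> (r' x t))
      (\<lambda>(x, t). r' x t * U1 x t * U2 x t) (\<lambda>x. r' x 0 * U1 x 0)"
    proof (rule perturbed_fan_balance[where ?s1.0 = "-\<sigma>" and ?s2.0 = "-\<nu>" and ?s3.0 = \<nu> and ?s4.0 = \<sigma>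
        and ?A0.0 = "-W" and ?C0.0 = "W * W + 1" and ?B0.0 = 0
        and ?a1.0 = "-W" and ?a2.0 = "2*W" and ?a3.0 = "2*W" and ?a4.0 = "-W"
        and ?c1.0 = "W * W + P - 1" and ?c2.0 = "p1 - 15/8 * (W * W) - P" and ?c3.0 = "- (p1 - 15/8 * (W * W) - P)" and ?c4.0 = "- (W * W + P - 1)"
        and ?b1.0 = "2*(W*b)" and ?b2.0 = "- (\<nu> * W) / 4 - 2 * (W * b)" and ?b3.0 = "\<nu> * W / 4 + 2 * (W * b)" and ?b4.0 = "-2 * (W * b)",
        OF _ _ _ _ bmf(1,3,4) bVQ(1,3,4) n1])
      fix x :: "real^2" and t :: real assume "0 \<le> t" "x $ 2 \<noteq> \<nu> * t"
      from regions[OF this]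
      show "r' x t * U1 x t = - W + (- W * above (- \<sigma>) (x, t) + 2 * W * above (- \<nu>) (x, t) + 2 * W * above \<nu> (x, t) + - W * above \<sigma> (x, t)) + Re (V (x, t)) / 4 \<and>
        r' x t * U1 x t * U1 x t + pressure \<gamma> (r' x t) = W * W + 1 + ((W * W + P - 1) * above (- \<sigma>) (x, t) + (p1 - 15 / 8 * (W * W) - P) * above (- \<nu>) (x, t)
          + - (p1 - 15 / 8 * (W * W) - P) * above \<nu> (x, t) + - (W * W + P - 1) * above \<sigma> (x, t)) + Re (Q (x, t)) / 4 \<and>
        r' x t * U1 x t * U2 x t = 0 + (2 * (W * b) * above (- \<sigma>) (x, t) + (- (\<nu> * W) / 4 - 2 * (W * b)) * above (- \<nu>) (x, t)
          + (\<nu> * W / 4 + 2 * (W * b)) * above \<nu> (x, t) + -2 * (W * b) * above \<sigma> (x, t)) + Im (Q (x, t)) / 4"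
        by (elim disjE conjE) (simp_all only:, simp_all)
    qed (use at0 off0 in \<open>auto simp: \<sigma>_def \<nu>_def field_simps\<close>)
    thus ?thesis unfolding momentum_balance_def u'c by simp
  qed
  have mom2: "momentum_balance \<gamma> r' u' 2"
  proof -
    have "weak_balance (\<lambda>(x, t). r' x t * U2 x t) (\<lambda>(x, t). r' x t * U1 x t * U2 x t)
      (\<lambda>(x, t). r' x t * U2 x t * U2 x t + pressure \<gamma> (r' x t)) (\<lambda>x. r' x 0 * U2 x 0)"
    proof (rule perturbed_fan_balance[where ?s1.0 = "-\<sigma>" and ?s2.0 = "-\<nu>" and ?s3.0 = \<nu> and ?s4.0 = \<sigma>
        and ?A0.0 = 0 and ?C0.0 = 0 and ?B0.0 = 1
        and ?a1.0 = "-2*b" and ?a2.0 = "2*b" and ?a3.0 = "2*b" and ?a4.0 = "-2*b"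
        and ?c1.0 = "2*(W*b)" and ?c2.0 = "- (\<nu> * W) / 4 - 2 * (W * b)" and ?c3.0 = "\<nu> * W / 4 + 2 * (W * b)" and ?c4.0 = "-2 * (W * b)"
        and ?b1.0 = "2 * (b * b) + P - 1" and ?b2.0 = "B / 4 + p1 - 2 * (b * b) - P" and ?b3.0 = "- (B / 4 + p1 - 2 * (b * b) - P)"
        and ?b4.0 = "- (2 * (b * b) + P - 1)",
        OF _ _ _ _ bmf(2,4,5) bVQ(2,4,5) n2])
      fix x :: "real^2" and t :: real assume "0 \<le> t" "x $ 2 \<noteq> \<nu> * t"
      from regions[OF this]
      show "r' x t * U2 x t = 0 + (-2 * b * above (- \<sigma>) (x, t) + 2 * b * above (- \<nu>) (x, t) + 2 * b * above \<nu> (x, t) + -2 * b * above \<sigma> (x, t)) + Im (V (x, t)) / 4 \<and>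
        r' x t * U1 x t * U2 x t = 0 + (2 * (W * b) * above (- \<sigma>) (x, t) + (- (\<nu> * W) / 4 - 2 * (W * b)) * above (- \<nu>) (x, t)
          + (\<nu> * W / 4 + 2 * (W * b)) * above \<nu> (x, t) + -2 * (W * b) * above \<sigma> (x, t)) + Im (Q (x, t)) / 4 \<and>
        r' x t * U2 x t * U2 x t + pressure \<gamma> (r' x t) = 1 + ((2 * (b * b) + P - 1) * above (- \<sigma>) (x, t) + (B / 4 + p1 - 2 * (b * b) - P) * above (- \<nu>) (x, t)
          + - (B / 4 + p1 - 2 * (b * b) - P) * above \<nu> (x, t) + - (2 * (b * b) + P - 1) * above \<sigma> (x, t)) + - Re (Q (x, t)) / 4"
        by (elim disjE conjE) (simp_all only:, simp_all)
    \<comment> \<open>\<open>bP\<close> is the jump condition of normal momentum at the shocks,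
      \<open>B_eq\<close> the one at the edges of the wedge.\<close>
    qed (use at0 off0 bP B_eq in \<open>auto simp: \<sigma>_def power2_eq_square\<close>)
    moreover have "(\<lambda>(x, t). r' x t * U1 x t * U2 x t) = (\<lambda>(x, t). r' x t * U2 x t * U1 x t)" by (auto simp: fun_eq_iff)
    ultimately show ?thesis unfolding momentum_balance_def u'c by simp
  qed
  have mom: "momentum_balance \<gamma> r' u' i" for i using mom1 mom2 exhaust_2[of i] by blast
  have nu: "norm (u' x t) \<le> 2 * M" for x t
  proof -
    have "norm (u' x t) \<le> norm (U1 x t *\<^sub>R (axis 1 1 :: real^2)) + norm (U2 x t *\<^sub>R (axis 2 1 :: real^2))"
      unfolding u'_def by (rule norm_triangle_ineq)
    thus ?thesis using bd(3,4)[of x t] by simp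
  qed
  have mu': "(\<lambda>z. u' (fst z) (snd z)) \<in> borel_measurable borel"
    unfolding u'_def using msr(2,3) by measurable
  have M2: "2 \<le> M" unfolding M_def using W b sC by simp
  have bs: "bounded_state r' u'"
    unfolding bounded_state_def set_borel_measurable_def case_prod_unfold
  proof (intro conjI exI[of _ "2 * M"] allI impI AE_I2)
    show "(\<lambda>x. indicator half_space x *\<^sub>R r' (fst x) (snd x)) \<in> borel_measurable borel"
      "(\<lambda>x. indicator half_space x *\<^sub>R u' (fst x) (snd x)) \<in> borel_measurable borel"
      using msr(1) mu' half_space_borel by (auto intro!: borel_measurable_scaleR borel_measurable_indicator)
    show "r' x t \<le> 2 * M" for x t using bd(2)[of x t] M2 by linarith
  qed (use bd nu in auto)
  have bd0: "\<bar>r' x 0\<bar> \<le> M" "\<bar>u' x 0 $ i\<bar> \<le> M" for x i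
    using bd[of x 0] M2 exhaust_2[of i] by (auto simp: u'c)
  have ws': "weak_solution \<gamma> r' u'"
  proof (rule weak_solutionI[OF bs mass mom bm(1) bm_u bm_p at0(1) _ bd0])
    show "(\<lambda>x. u' x 0 $ i) \<in> borel_measurable borel" for i using at0(2,3) exhaust_2[of i] by (auto simp: u'c)
  qed
  \<comment> \<open>The initial values are overwritten by the given data, including those on x_2 =
    0, since agreement is required at every point.\<close>
  define r where "r x t = (if t = 0 then \<rho>0 x else r' x t)" for x t
  define u where "u x t = (if t = 0 then v0 x else u' x t)" for x t
  have mfst: "(\<lambda>z :: (real^2) \<times> real. fst z) \<in> borel_measurable borel" "(\<lambda>z :: (real^2) \<times> real. snd z) \<in> borel_measurable borel"
    by (intro borel_measurable_continuous_onI continuous_intros)+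
  have ws: "weak_solution \<gamma> r u"
  proof (rule weak_solution_cong[OF ws'])
    have "(\<lambda>z :: (real^2) \<times> real. \<rho>0 (fst z)) \<in> borel_measurable borel" "(\<lambda>z :: (real^2) \<times> real. v0 (fst z)) \<in> borel_measurable borel"
      using measurable_compose[OF mfst(1) m0(1)] measurable_compose[OF mfst(1) m0(2)] by auto
    hence "(\<lambda>z. r (fst z) (snd z)) \<in> borel_measurable borel" "(\<lambda>z. u (fst z) (snd z)) \<in> borel_measurable borel"
      unfolding r_def u_def using msr(1) mu' mfst(2) by measurable
    thus "set_borel_measurable borel half_space (\<lambda>(x, t). r x t)" "set_borel_measurable borel half_space (\<lambda>(x, t). u x t)"
      unfolding set_borel_measurable_def case_prod_unfold using half_space_borel
      by (auto intro!: borel_measurable_scaleR borel_measurable_indicator)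
    show "r x t = r' x t \<and> u x t = u' x t" if "0 \<le> t" "t \<noteq> 0 \<or> x $ 2 \<noteq> 0" for x t
      using that init[of x] unfolding r_def u_def r'_def u'_def U1_def U2_def by auto
  qed
  define e0 e1 e2 where "e0 = internal_energy \<gamma> 1 + W\<^sup>2 / 2"
    and "e1 = 1/4 * internal_energy \<gamma> (1/4) + 1/4 * (W\<^sup>2 / 2 + normal_stress \<gamma>) / 2"
    and "e2 = 2 * internal_energy \<gamma> 2 + W\<^sup>2 + (shock_velocity \<gamma>)\<^sup>2"
  have rate: "fan_energy_rate \<gamma> W = 4 * (\<sigma> * (e2 - e0) + \<nu> * (e1 - e2))"
    unfolding fan_energy_rate_def Let_def \<sigma>_def \<nu>_def b_def e0_def e1_def e2_def by (simp add: mult.assoc)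
  define F where "F t s = e0 + (e2 - e0) * indicator {- \<sigma> * t<..\<sigma> * t} s + (e1 - e2) * indicator {- \<nu> * t<..\<nu> * t} s" for t s :: real
  have mF: "F t \<in> borel_measurable borel" for t unfolding F_def by measurable
  have eF: "energy_density \<gamma> (r x t) (u x t) = F t (x $ 2)" if t: "0 \<le> t" "t \<noteq> 0 \<or> x $ 2 \<noteq> 0" for x t
  proof -
    have "r x t = r' x t" "u x t = u' x t"
      using that init[of x] unfolding r_def u_def r'_def u'_def U1_def U2_def by auto
    hence "energy_density \<gamma> (r x t) (u x t) = r' x t * internal_energy \<gamma> (r' x t) + r' x t * ((U1 x t)\<^sup>2 + (U2 x t)\<^sup>2) / 2"
      unfolding energy_density_def by (simp add: u'c)
    also have "\<dots> = F t (x $ 2)"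
    proof -
      have o: "- \<sigma> * t \<le> - \<nu> * t" "- \<nu> * t \<le> \<nu> * t" "\<nu> * t \<le> \<sigma> * t"
        using t sn by (auto intro!: mult_right_mono)
      consider "x $ 2 \<le> - \<sigma> * t" | "- \<sigma> * t < x $ 2" "x $ 2 \<le> - \<nu> * t" | "- \<nu> * t < x $ 2" "x $ 2 \<le> \<nu> * t"
        | "\<nu> * t < x $ 2" "x $ 2 \<le> \<sigma> * t" | "\<sigma> * t < x $ 2" by linarith
      thus ?thesis
      proof cases
        case 3
        thus ?thesis using o nT[of "(x,t)"] unfolding r'_def U1_def U2_def F_def e1_def C_def B_def by auto
      qed (use o in \<open>auto simp: r'_def U1_def U2_def F_def e0_def e1_def e2_def b_def\<close>)
    qed
    finally show ?thesis .
  qed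
  \<comment> \<open>Before the time L/\<sigma> the shocks are still inside the box.\<close>
  have en: "energy \<gamma> L r u t = 4 * L\<^sup>2 * e0 + t * (L * fan_energy_rate \<gamma> W)" if L: "L > 0" and t: "0 \<le> t" "t < L / \<sigma>" for L t
  proof -
    have \<sigma>t: "\<sigma> * t < L" using t sn by (simp add: pos_less_divide_eq mult.commute)
    have \<nu>t: "\<nu> * t \<le> \<sigma> * t" "0 \<le> \<nu> * t" using t sn by (auto intro!: mult_right_mono)
    have "(\<lambda>x. energy_density \<gamma> (r x t) (u x t)) \<in> borel_measurable borel"
    proof (cases "t = 0")
      case True
      have "(\<lambda>x. internal_energy \<gamma> (\<rho>0 x)) \<in> borel_measurable borel"
        unfolding internal_energy_def using m0(1) by measurable
      thus ?thesis unfolding energy_density_def r_def u_def using True m0 by simp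
    next
      case False
      have "(\<lambda>x::real^2. x $ 2) \<in> borel_measurable borel" by (intro borel_measurable_continuous_onI continuous_intros)
      from measurable_compose[OF this mF[of t]] show ?thesis using eF[OF t(1)] False by simp
    qed
    hence "energy \<gamma> L r u t = 2 * L * integral\<^sup>L lborel (\<lambda>s. indicator {-L<..<L} s * F t s)"
      using eF[OF t(1)] by (intro energy_planar[OF L mF, where c = 0]) auto
    also have "(\<lambda>s. indicator {-L<..<L} s * F t s) = (\<lambda>s. e0 * indicator {-L<..<L} s + (e2 - e0) * indicator {- \<sigma> * t<..\<sigma> * t} s
        + (e1 - e2) * indicator {- \<nu> * t<..\<nu> * t} s)"
      using \<sigma>t \<nu>t by (auto simp: F_def indicator_def fun_eq_iff)
    also have "integral\<^sup>L lborel \<dots> = e0 * (2 * L) + (e2 - e0) * (2 * (\<sigma> * t)) + (e1 - e2) * (2 * (\<nu> * t))"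
      using L \<sigma>t \<nu>t by simp
    finally show ?thesis unfolding rate by (simp add: power2_eq_square algebra_simps)
  qed
  show ?thesis
  proof (rule that[OF ws])
    show "r x 0 = \<rho>0 x \<and> u x 0 = v0 x" for x unfolding r_def u_def by simp
    show "has_energy_rate \<gamma> L r u 0 (L * fan_energy_rate \<gamma> W)" if "L > 0" for L
      by (rule energy_rate_linear[of "L / \<sigma>"]) (use en[OF that] that sn in auto)
  qed
qed

section \<open>Self-similar test functions\<close>

lemma integral_derivative_support:
  fixes F f :: "real \<Rightarrow> real"
  assumes "\<And>s. (F has_real_derivative f s) (at s)" "continuous_on UNIV f" "a \<le> b" "\<And>s. s \<notin> {a..b} \<Longrightarrow> f s = 0"
  shows "integrable lborel f" "integral\<^sup>L lborel f = F b - F a"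
proof -
  have f: "(\<lambda>s. f s * indicator {a..b} s) = f" using assms(4) by (auto simp: indicator_def fun_eq_iff)
  have "has_bochner_integral lborel (\<lambda>s. f s * indicator {a..b} s) (F b - F a)"
    using assms(1,2) by (intro has_bochner_integral_FTC_Icc_real assms(3)) (auto simp: continuous_on_eq_continuous_at)
  thus "integrable lborel f" "integral\<^sup>L lborel f = F b - F a" unfolding f has_bochner_integral_iff by auto
qed

lemma component_borel [measurable]: "(\<lambda>x::real^2. x $ i) \<in> borel_measurable borel"
  by (intro borel_measurable_continuous_onI continuous_intros)

text \<open>Identifies \<open>real^2\<close> with a product measure, which opens Fubini in x_1 and
  x_2.\<close>

lemma distr_lborel_vec2: "distr lborel borel (\<lambda>x::real^2. (x $ 1, x $ 2)) = (lborel :: (real \<times> real) measure)"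
proof (rule lborel_eqI[symmetric])
  fix l u :: "real \<times> real" assume b: "\<And>b. b \<in> Basis \<Longrightarrow> l \<bullet> b \<le> u \<bullet> b"
  have B2: "(Basis :: (real \<times> real) set) = {(1, 0), (0, 1)}" by (auto simp: Basis_prod_def)
  have Bv: "(Basis :: (real^2) set) = {axis 1 1, axis 2 1}" by (auto simp: Basis_vec_def UNIV_2)
  have ne: "(axis 1 1 :: real^2) \<noteq> axis 2 1" by (simp add: axis_eq_axis)
  define L where "L = (\<chi> i. if i = (1::2) then fst l else snd l)"
  define U where "U = (\<chi> i. if i = (1::2) then fst u else snd u)"
  have LU: "L $ 1 = fst l" "L $ 2 = snd l" "U $ 1 = fst u" "U $ 2 = snd u" unfolding L_def U_def by simp_all
  have le: "fst l \<le> fst u" "snd l \<le> snd u" using b[of "(1, 0)"] b[of "(0, 1)"] unfolding B2 by (simp_all add: inner_prod_def)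
  have pre: "(\<lambda>x::real^2. (x $ 1, x $ 2)) -` box l u = box L U"
    by (auto simp: mem_box_cart forall_2 LU) (auto simp: box_def B2 inner_prod_def forall_2)
  have "emeasure (distr lborel borel (\<lambda>x::real^2. (x $ 1, x $ 2))) (box l u) = emeasure lborel (box L U)"
    by (subst emeasure_distr) (simp_all add: pre)
  also have "\<dots> = (\<Prod>b\<in>Basis. (U - L) \<bullet> b)"
    by (rule emeasure_lborel_box) (use le in \<open>auto simp: Bv inner_axis LU\<close>)
  also have "\<dots> = (\<Prod>b\<in>Basis. (u - l) \<bullet> b)" unfolding Bv B2 using ne by (simp add: inner_axis LU inner_prod_def)
  finally show "emeasure (distr lborel borel (\<lambda>x::real^2. (x $ 1, x $ 2))) (box l u) = (\<Prod>b\<in>Basis. (u - l) \<bullet> b)" .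
qed simp

lemma integral_vec2_product:
  fixes \<alpha> f :: "real \<Rightarrow> real"
  assumes a: "integrable lborel \<alpha>" and f: "integrable lborel f"
  shows "integrable lborel (\<lambda>x::real^2. \<alpha> (x $ 1) * f (x $ 2))"
    "integral\<^sup>L lborel (\<lambda>x::real^2. \<alpha> (x $ 1) * f (x $ 2)) = integral\<^sup>L lborel \<alpha> * integral\<^sup>L lborel f"
proof -
  have [measurable]: "\<alpha> \<in> borel_measurable borel" "f \<in> borel_measurable borel" using a f by auto
  have i: "integrable (lborel \<Otimes>\<^sub>M lborel) (\<lambda>p. \<alpha> (fst p) * f (snd p))"
  proof (rule lborel_pair.Fubini_integrable)
    show "integrable lborel (\<lambda>x. LINT y|lborel. norm (\<alpha> (fst (x, y)) * f (snd (x, y))))"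
      using a by (simp add: abs_mult)
    show "AE x in lborel. integrable lborel (\<lambda>y. \<alpha> (fst (x, y)) * f (snd (x, y)))" using f by simp
  qed simp
  have e: "integral\<^sup>L (lborel \<Otimes>\<^sub>M lborel) (\<lambda>p. \<alpha> (fst p) * f (snd p)) = integral\<^sup>L lborel \<alpha> * integral\<^sup>L lborel f"
    using lborel_pair.integral_fst'[OF i] by simp
  note d = distr_lborel_vec2[symmetric]
  have m: "(\<lambda>p. \<alpha> (fst p) * f (snd p)) \<in> borel_measurable (borel :: (real \<times> real) measure)"
    using i unfolding lborel_prod by auto
  have mv: "(\<lambda>x::real^2. (x $ 1, x $ 2)) \<in> borel_measurable lborel" by simp
  show "integrable lborel (\<lambda>x::real^2. \<alpha> (x $ 1) * f (x $ 2))"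
    using i unfolding lborel_prod d integrable_distr_eq[OF mv m] by simp
  show "integral\<^sup>L lborel (\<lambda>x::real^2. \<alpha> (x $ 1) * f (x $ 2)) = integral\<^sup>L lborel \<alpha> * integral\<^sup>L lborel f"
    using e unfolding lborel_prod d integral_distr[OF mv m] by simp
qed

text \<open>The power of 1/t makes the family closed under differentiation: a derivative in x_2 or t
  that falls on g(x_2/t) or on the power raises m by one. So smoothness is an induction over all
  members at once. The cutoff \<theta> will vanish for t < 1, which keeps 1/t away from its
  singularity.\<close>

definition similarity_wave :: "nat \<Rightarrow> (real \<Rightarrow> real) \<Rightarrow> (real \<Rightarrow> real) \<Rightarrow> (real \<Rightarrow> real) \<Rightarrow> (real^2) \<times> real \<Rightarrow> real" where
  "similarity_wave m \<alpha> g \<theta> z = \<alpha> (fst z $ 1) * (g (fst z $ 2 * inverse (snd z)) * (\<theta> (snd z) * inverse (snd z) ^ m))"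

lemma similarity_wave_has_derivative:
  assumes d: "\<And>s. (\<alpha> has_real_derivative \<alpha>' s) (at s)" "\<And>s. (g has_real_derivative g' s) (at s)" "\<And>s. (\<theta> has_real_derivative \<theta>' s) (at s)"
    and z: "\<And>t. t < 1 \<Longrightarrow> \<theta> t = 0"
  shows "(similarity_wave m \<alpha> g \<theta> has_derivative (\<lambda>h. fst h $ 1 * similarity_wave m \<alpha>' g \<theta> z
     + (fst h $ 2 * similarity_wave (Suc m) \<alpha> g' \<theta> z
     + snd h * (similarity_wave (Suc m) \<alpha> (\<lambda>s. - (s * g' s)) \<theta> z
        + (similarity_wave m \<alpha> g \<theta>' z + (- real m) * similarity_wave (Suc m) \<alpha> g \<theta> z)))) ) (at z)"
    (is "(_ has_derivative ?D) _")
proof (cases "snd z < 1")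
  case True
  have z': "\<theta>' t = 0" if "t < 1" for t
    using has_field_derivative_transform_within_open[OF DERIV_const[of 0] open_lessThan, of t 1 \<theta>] that z d(3)[of t]
    by (auto intro: DERIV_unique)
  have o: "open {z :: (real^2) \<times> real. snd z < 1}" by (intro open_Collect_less continuous_intros)
  have "((\<lambda>_. 0) has_derivative (\<lambda>_. 0)) (at z)" by (rule has_derivative_const)
  hence "(similarity_wave m \<alpha> g \<theta> has_derivative (\<lambda>_. 0)) (at z)"
    by (rule has_derivative_transform_within_open[OF _ o]) (use True z in \<open>auto simp: similarity_wave_def\<close>)
  moreover have "?D = (\<lambda>_. 0)" using z[OF True] z'[OF True] by (simp add: similarity_wave_def)
  ultimately show ?thesis by simp
next
  case False
  define x1 x2 t i where "x1 = fst z $ 1" and "x2 = fst z $ 2" and "t = snd z" and "i = inverse t"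
  have t: "t \<noteq> 0" using False unfolding t_def by auto
  have p: "((\<lambda>z::(real^2) \<times> real. fst z $ i) has_derivative (\<lambda>h. fst h $ i)) (at z)" for i
    by (rule bounded_linear_imp_has_derivative[OF bounded_linear_compose[OF bounded_linear_vec_nth bounded_linear_fst]])
  have A: "((\<lambda>z::(real^2) \<times> real. \<alpha> (fst z $ 1)) has_derivative (\<lambda>h. fst h $ 1 * \<alpha>' x1)) (at z)"
    unfolding x1_def using d(1)[unfolded has_field_derivative_def]
    by (intro has_derivative_eq_rhs[OF has_derivative_compose[of "\<lambda>z. fst z $ 1" "\<lambda>h. fst h $ 1" z UNIV \<alpha> "(*) (\<alpha>' (fst z $ 1))", OF p]])
      (auto simp: mult.commute)
  have I: "((\<lambda>z::(real^2) \<times> real. inverse (snd z)) has_derivative (\<lambda>h. - (i * snd h * i))) (at z)"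
    unfolding i_def t_def using t unfolding t_def by (auto intro!: derivative_eq_intros)
  have S: "((\<lambda>z::(real^2) \<times> real. fst z $ 2 * inverse (snd z)) has_derivative (\<lambda>h. x2 * - (i * snd h * i) + fst h $ 2 * i)) (at z)"
    unfolding x2_def i_def t_def
    by (rule has_derivative_mult[OF p I[unfolded i_def t_def]])
  have G: "((\<lambda>z::(real^2) \<times> real. g (fst z $ 2 * inverse (snd z))) has_derivative
      (\<lambda>h. g' (x2 * i) * (x2 * - (i * snd h * i) + fst h $ 2 * i))) (at z)"
    using has_derivative_compose[OF S, of g "(*) (g' (x2 * i))"] d(2)[of "x2 * i", unfolded has_field_derivative_def]
    unfolding x2_def i_def t_def by blast
  have T: "((\<lambda>z::(real^2) \<times> real. \<theta> (snd z)) has_derivative (\<lambda>h. \<theta>' t * snd h)) (at z)"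
    unfolding t_def using d(3)[unfolded has_field_derivative_def]
    by (intro has_derivative_eq_rhs[OF has_derivative_compose[of "\<lambda>z. snd z" "\<lambda>h. snd h" z UNIV \<theta> "(*) (\<theta>' (snd z))"]])
      (auto intro!: derivative_eq_intros)
  have P: "((\<lambda>z::(real^2) \<times> real. inverse (snd z) ^ m) has_derivative (\<lambda>h. - real m * snd h * i ^ Suc m)) (at z)"
  proof (rule has_derivative_eq_rhs[OF has_derivative_power[OF I]])
    show "(\<lambda>h. real m * - (i * snd h * i) * inverse (snd z) ^ (m - 1)) = (\<lambda>h. - real m * snd h * i ^ Suc m)"
      unfolding i_def t_def by (cases m) (auto simp: fun_eq_iff algebra_simps)
  qed
  have "(similarity_wave m \<alpha> g \<theta> has_derivative (\<lambda>h. \<alpha> x1 * (g (x2 * i) * (\<theta> t * (- real m * snd h * i ^ Suc m) + \<theta>' t * snd h * i ^ m)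
      + g' (x2 * i) * (x2 * - (i * snd h * i) + fst h $ 2 * i) * (\<theta> t * i ^ m)) + fst h $ 1 * \<alpha>' x1 * (g (x2 * i) * (\<theta> t * i ^ m)))) (at z)"
    unfolding similarity_wave_def[abs_def]
    using has_derivative_mult[OF A has_derivative_mult[OF G has_derivative_mult[OF T P]]]
    unfolding x1_def x2_def i_def t_def .
  moreover have "(\<lambda>h. \<alpha> x1 * (g (x2 * i) * (\<theta> t * (- real m * snd h * i ^ Suc m) + \<theta>' t * snd h * i ^ m)
      + g' (x2 * i) * (x2 * - (i * snd h * i) + fst h $ 2 * i) * (\<theta> t * i ^ m)) + fst h $ 1 * \<alpha>' x1 * (g (x2 * i) * (\<theta> t * i ^ m))) = ?D"
    unfolding similarity_wave_def x1_def[symmetric] x2_def[symmetric] t_def[symmetric] i_def[symmetric]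
    by (auto simp: fun_eq_iff algebra_simps)
  ultimately show ?thesis by simp
qed

lemma similarity_wave_smooth:
  assumes "\<And>k. Ck k \<alpha>" "\<And>k. Ck k g" "\<And>k. Ck k \<theta>" "\<And>t. t < 1 \<Longrightarrow> \<theta> t = 0"
  shows "Ck k (similarity_wave m \<alpha> g \<theta>)"
  using assms
proof (induction k arbitrary: \<alpha> g \<theta> m)
  case 0
  note d = Ck_real_SucD(1)[of 0]
  have "(similarity_wave m \<alpha> g \<theta>) differentiable (at z)" for z
    using similarity_wave_has_derivative[of \<alpha> "deriv \<alpha>" g "deriv g" \<theta> "deriv \<theta>" m z] d 0 unfolding differentiable_def by blast
  thus ?case unfolding Ck.simps by (intro continuous_at_imp_continuous_on ballI differentiable_imp_continuous_within)
next
  case (Suc k)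
  have der: "(\<alpha> has_real_derivative deriv \<alpha> s) (at s)" "(g has_real_derivative deriv g s) (at s)" "(\<theta> has_real_derivative deriv \<theta> s) (at s)" for s
    using Ck_real_SucD(1)[of 0] Suc.prems by blast+
  have sm: "Ck j (deriv \<alpha>)" "Ck j (deriv g)" "Ck j (deriv \<theta>)" for j using Ck_real_SucD(2) Suc.prems by blast+
  have Id: "Ck j (\<lambda>s::real. s)" for j
  proof (cases j)
    case (Suc i) show ?thesis unfolding Suc by (rule Ck_real_SucI[of _ "\<lambda>_. 1"]) (auto intro: Ck_const)
  qed simp
  have sg: "Ck j (\<lambda>s. - (s * deriv g s))" for j
    using Ck_cmult[OF Ck_mult[OF Id sm(2)], of j "- 1"] by simp
  have z': "deriv \<theta> t = 0" if "t < 1" for t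
    using has_field_derivative_transform_within_open[OF DERIV_const[of 0] open_lessThan, of t 1 \<theta>] that Suc.prems(4)
    by (auto intro: DERIV_imp_deriv)
  show ?case unfolding Ck.simps
  proof (intro exI conjI allI)
    fix z show "(similarity_wave m \<alpha> g \<theta> has_derivative (\<lambda>h. fst h $ 1 * similarity_wave m (deriv \<alpha>) g \<theta> z
     + (fst h $ 2 * similarity_wave (Suc m) \<alpha> (deriv g) \<theta> z
     + snd h * (similarity_wave (Suc m) \<alpha> (\<lambda>s. - (s * deriv g s)) \<theta> z
        + (similarity_wave m \<alpha> g (deriv \<theta>) z + (- real m) * similarity_wave (Suc m) \<alpha> g \<theta> z)))) ) (at z)"
      by (rule similarity_wave_has_derivative[OF der Suc.prems(4)])
  next
    fix h show "Ck k (\<lambda>z. fst h $ 1 * similarity_wave m (deriv \<alpha>) g \<theta> z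
     + (fst h $ 2 * similarity_wave (Suc m) \<alpha> (deriv g) \<theta> z
     + snd h * (similarity_wave (Suc m) \<alpha> (\<lambda>s. - (s * deriv g s)) \<theta> z
        + (similarity_wave m \<alpha> g (deriv \<theta>) z + (- real m) * similarity_wave (Suc m) \<alpha> g \<theta> z))))"
      by (intro Ck_add Ck_cmult Suc.IH sm sg Suc.prems z')
  qed
qed

lemma scaled_bump_integral:
  assumes r: "r > 0"
  shows "integrable lborel (scaled_bump c r)" "0 < integral\<^sup>L lborel (scaled_bump c r)"
proof -
  have cb: "continuous_on UNIV bump" using bump_smooth[of 0] by simp
  have cs: "continuous_on UNIV (scaled_bump c r)" using scaled_bump_smooth[of 0 c r] by simp
  have s0: "scaled_bump c r s = 0" if "\<bar>c\<bar> + r < norm s" for s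
    using that scaled_bump_support[of r s c] r by auto
  show i: "integrable lborel (scaled_bump c r)"
    using compact_support_integrable[OF cs s0, where w = "\<lambda>_. 1" and B = 1] by simp
  have "exp (-4) * r = integral\<^sup>L lborel (\<lambda>s. exp (-4 :: real) * indicator {c - r/2..c + r/2} s)"
    using r by simp
  also have "\<dots> \<le> integral\<^sup>L lborel (scaled_bump c r)"
  proof (rule integral_mono[OF _ i])
    show "integrable lborel (\<lambda>s. exp (-4 :: real) * indicator {c - r/2..c + r/2} s)"
      by (intro integrable_mult_right integrable_real_indicator) (auto simp: emeasure_lborel_Icc_eq)
    show "exp (-4) * indicator {c - r/2..c + r/2} s \<le> scaled_bump c r s" for s
    proof (cases "s \<in> {c - r/2..c + r/2}")
      case True
      hence "c - r / 2 \<le> s" "s \<le> c + r / 2" by simp_all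
      hence "\<bar>s - c\<bar> \<le> r / 2" unfolding abs_le_iff by linarith
      hence "\<bar>(s - c) / r\<bar> \<le> 1 / 2" using r by (simp add: field_simps)
      thus ?thesis using bump_ge[of "(s - c) / r"] True by (simp add: scaled_bump_def)
    qed (simp add: scaled_bump_def bump_nonneg)
  qed
  finally show "0 < integral\<^sup>L lborel (scaled_bump c r)" using r by (smt (verit) exp_gt_zero mult_pos_pos)
qed

lemma test_functionI:
  assumes "\<And>k. Ck k \<psi>" "\<And>z. K < norm z \<Longrightarrow> \<psi> z = 0"
  shows "test_function (\<psi> :: (real^2) \<times> real \<Rightarrow> real)"
  unfolding test_function_def compact_closure
proof (intro conjI allI assms(1))
  have "{z. \<psi> z \<noteq> 0} \<subseteq> cball 0 K" using assms(2) by (force simp: not_less[symmetric])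
  thus "bounded {z. \<psi> z \<noteq> 0}" using bounded_subset bounded_cball by blast
qed

text \<open>
  Testing with \<open>\<alpha>(x\<^sub>1) g(x\<^sub>2/t) \<theta>(t)\<close> turns a balance law for functions of \<open>s = x\<^sub>2/t\<close> into the weak form of the
  ordinary differential equation \<open>(B\<^sub>2 - s A)' = - A\<close>.
\<close>

lemma self_similar_balance:
  fixes A B1 B2 g g' :: "real \<Rightarrow> real"
  assumes wb: "weak_balance (\<lambda>(x, t). A' x t) (\<lambda>(x, t). B1' x t) (\<lambda>(x, t). B2' x t) A0"
    and eq: "\<And>x t. 0 < t \<Longrightarrow> A' x t = A (x $ 2 / t) \<and> B1' x t = B1 (x $ 2 / t) \<and> B2' x t = B2 (x $ 2 / t)"
    and m [measurable]: "A \<in> borel_measurable borel" "B1 \<in> borel_measurable borel" "B2 \<in> borel_measurable borel"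
    and bd: "\<And>s. \<bar>A s\<bar> \<le> M \<and> \<bar>B1 s\<bar> \<le> M \<and> \<bar>B2 s\<bar> \<le> M"
    and g: "\<And>k. Ck k g" "\<And>s. (g has_real_derivative g' s) (at s)" "\<And>s. K < \<bar>s\<bar> \<Longrightarrow> g s = 0"
  shows "integral\<^sup>L lborel (\<lambda>s. (B2 s - s * A s) * g' s) = integral\<^sup>L lborel (\<lambda>s. A s * g s)"
proof -
  \<comment> \<open>Supported in {1..2}, so the initial datum does not enter.\<close>
  define \<theta> where "\<theta> = scaled_bump (3/2) (1/2)"
  define \<theta>' where "\<theta>' = deriv \<theta>"
  define \<alpha> where "\<alpha> = scaled_bump 0 1"
  define \<alpha>' where "\<alpha>' = deriv \<alpha>"
  define K' where "K' = max K 0"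
  have sm: "Ck k \<alpha>" "Ck k \<theta>" for k unfolding \<alpha>_def \<theta>_def by (rule scaled_bump_smooth)+
  have der: "(\<alpha> has_real_derivative \<alpha>' s) (at s)" "(\<theta> has_real_derivative \<theta>' s) (at s)" for s
    unfolding \<alpha>'_def \<theta>'_def using Ck_real_SucD(1)[of 0] sm by blast+
  have sm': "continuous_on UNIV \<alpha>'" "continuous_on UNIV \<theta>'"
    unfolding \<alpha>'_def \<theta>'_def Ck.simps(1)[symmetric] by (rule Ck_real_SucD(2)[OF sm(1)] Ck_real_SucD(2)[OF sm(2)])+
  have g'_eq: "g' = deriv g" by (rule ext, rule DERIV_imp_deriv[OF g(2), symmetric])
  have cg': "continuous_on UNIV g'" unfolding g'_eq Ck.simps(1)[symmetric] by (rule Ck_real_SucD(2)[OF g(1)])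
  have cg: "continuous_on UNIV g" using g(1)[of 0] by simp
  have ca: "continuous_on UNIV \<alpha>" "continuous_on UNIV \<theta>" using sm[of 0] by simp_all
  have \<theta>0: "\<theta> t = 0" if "t \<notin> {1<..<2}" for t
    unfolding \<theta>_def using that by (intro scaled_bump_support) (auto simp: abs_if)
  have \<alpha>0: "\<alpha> t = 0" if "1 \<le> \<bar>t\<bar>" for t
    unfolding \<alpha>_def using that by (intro scaled_bump_support) auto
  have \<alpha>'0: "\<alpha>' t = 0" if "1 < \<bar>t\<bar>" for t
    unfolding \<alpha>'_def using deriv_tower_support[of 1 0 \<alpha> t 1] that \<alpha>0 by simp
  have \<theta>'0: "\<theta>' t = 0" if "t \<notin> {1..2}" for t
  proof -
    have "\<theta> s = 0" if "1/2 < \<bar>s - 3/2\<bar>" for s by (rule \<theta>0) (use that in \<open>auto simp: abs_if split: if_splits\<close>)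
    moreover have "1/2 < \<bar>t - 3/2\<bar>" using that by (auto simp: abs_if)
    ultimately show ?thesis unfolding \<theta>'_def using deriv_tower_support[of "1/2" "3/2" \<theta> t 1] by simp
  qed
  have g'0: "g' s = 0" if "K' < \<bar>s\<bar>" for s
    unfolding g'_eq using deriv_tower_support[of K' 0 g s 1] that g(3) unfolding K'_def by simp
  have g0: "g s = 0" if "K' < \<bar>s\<bar>" for s using g(3) that unfolding K'_def by simp
  define \<psi> where "\<psi> = similarity_wave 0 \<alpha> g \<theta>"
  have \<psi>0: "\<psi> z = 0" if "2 * K' + 3 < norm z" for z
  proof (rule ccontr)
    assume "\<psi> z \<noteq> 0"
    hence n: "\<alpha> (fst z $ 1) \<noteq> 0" "g (fst z $ 2 * inverse (snd z)) \<noteq> 0" "\<theta> (snd z) \<noteq> 0"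
      unfolding \<psi>_def similarity_wave_def by auto
    have t: "1 < snd z" "snd z < 2" using n(3) \<theta>0 by force+
    have x1: "\<bar>fst z $ 1\<bar> \<le> 1" using n(1) \<alpha>0 by force
    have "\<bar>fst z $ 2 * inverse (snd z)\<bar> \<le> K'" using n(2) g0 by force
    hence "\<bar>fst z $ 2\<bar> \<le> K' * snd z" using t by (simp add: abs_mult field_simps)
    also have "\<dots> \<le> K' * 2" using t unfolding K'_def by (intro mult_left_mono) auto
    finally have x2: "\<bar>fst z $ 2\<bar> \<le> 2 * K'" by simp
    have "norm z \<le> norm (fst z) + norm (snd z)" using norm_Pair_le[of "fst z" "snd z"] by simp
    also have "norm (fst z) \<le> \<bar>fst z $ 1\<bar> + \<bar>fst z $ 2\<bar>" using norm_le_l1_cart[of "fst z"] by (simp add: sum_2)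
    finally show False using that x1 x2 t by simp
  qed
  have tf: "test_function \<psi>"
    by (rule test_functionI[OF _ \<psi>0]) (unfold \<psi>_def, intro similarity_wave_smooth sm g(1), simp add: \<theta>0)
  have "(\<psi> has_derivative (\<lambda>h. fst h $ 1 * similarity_wave 0 \<alpha>' g \<theta> z
     + (fst h $ 2 * similarity_wave (Suc 0) \<alpha> g' \<theta> z
     + snd h * (similarity_wave (Suc 0) \<alpha> (\<lambda>s. - (s * g' s)) \<theta> z
        + (similarity_wave 0 \<alpha> g \<theta>' z + (- real 0) * similarity_wave (Suc 0) \<alpha> g \<theta> z)))) ) (at z)" for z
    unfolding \<psi>_def by (rule similarity_wave_has_derivative) (use der g(2) \<theta>0 in auto)
  note fd = frechet_derivative_at[OF this, symmetric]
  have d\<psi>: "dt \<psi> z = similarity_wave (Suc 0) \<alpha> (\<lambda>s. - (s * g' s)) \<theta> z + similarity_wave 0 \<alpha> g \<theta>' z"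
    "dx 1 \<psi> z = similarity_wave 0 \<alpha>' g \<theta> z" "dx 2 \<psi> z = similarity_wave (Suc 0) \<alpha> g' \<theta> z" for z
    unfolding dt_def dx_def fd by (simp_all add: axis_def)
  define I where "I z = indicator half_space z * (A' (fst z) (snd z) * dt \<psi> z + B1' (fst z) (snd z) * dx 1 \<psi> z + B2' (fst z) (snd z) * dx 2 \<psi> z)" for z
  have "(\<lambda>x::real^2. A0 x * \<psi> (x, 0)) = (\<lambda>_. 0)" unfolding \<psi>_def similarity_wave_def using \<theta>0 by auto
  hence I0: "integral\<^sup>L lborel I = 0"
    using wb[unfolded weak_balance_def, rule_format, OF tf] unfolding I_def[abs_def] case_prod_unfold by simp
  have slice: "I (x, t) = \<alpha> (x $ 1) * ((A (x $ 2 / t) * (\<theta>' t * g (x $ 2 / t)) + (B2 (x $ 2 / t) - x $ 2 / t * A (x $ 2 / t)) * g' (x $ 2 / t) * (\<theta> t / t)))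
      + \<alpha>' (x $ 1) * (B1 (x $ 2 / t) * g (x $ 2 / t) * \<theta> t)" for x t
  proof (cases "0 < t")
    case True
    thus ?thesis using eq[OF True, of x] unfolding I_def d\<psi> similarity_wave_def
      by (simp add: algebra_simps divide_inverse)
  next
    case False
    thus ?thesis using \<theta>0[of t] \<theta>'0[of t] unfolding I_def d\<psi> similarity_wave_def by simp
  qed
  have bm: "bounded_measurable (\<lambda>z. f (fst z $ 2 / snd z))" if "f \<in> borel_measurable borel" "\<And>s. \<bar>f s\<bar> \<le> M" for f
    unfolding bounded_measurable_def
  proof (intro conjI exI[of _ M] ballI that(2))
    have "(\<lambda>z :: (real^2) \<times> real. fst z $ 2) \<in> borel_measurable borel" "(\<lambda>z :: (real^2) \<times> real. snd z) \<in> borel_measurable borel"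
      by (intro borel_measurable_continuous_onI continuous_intros)+
    hence "(\<lambda>z :: (real^2) \<times> real. fst z $ 2 / snd z) \<in> borel_measurable borel" by (rule borel_measurable_divide)
    from measurable_compose[OF this that(1)]
    show "(\<lambda>z :: (real^2) \<times> real. indicator half_space z * f (fst z $ 2 / snd z)) \<in> borel_measurable borel"
      by (intro borel_measurable_times borel_measurable_indicator half_space_borel)
  qed
  have I_eq: "I = (\<lambda>z. indicator half_space z * A (fst z $ 2 / snd z) * dt \<psi> z + indicator half_space z * B1 (fst z $ 2 / snd z) * dx 1 \<psi> z
      + indicator half_space z * B2 (fst z $ 2 / snd z) * dx 2 \<psi> z)"
  proof
    fix z
    have "dt \<psi> z = 0" "dx 1 \<psi> z = 0" "dx 2 \<psi> z = 0" if "\<not> 0 < snd z"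
      using that \<theta>0[of "snd z"] \<theta>'0[of "snd z"] unfolding d\<psi> similarity_wave_def by simp_all
    thus "I z = indicator half_space z * A (fst z $ 2 / snd z) * dt \<psi> z + indicator half_space z * B1 (fst z $ 2 / snd z) * dx 1 \<psi> z
      + indicator half_space z * B2 (fst z $ 2 / snd z) * dx 2 \<psi> z"
      using eq[of "snd z" "fst z"] unfolding I_def by (cases "0 < snd z") (auto simp: algebra_simps)
  qed
  have iI: "integrable lborel I" unfolding I_eq
    by (intro Bochner_Integration.integrable_add bounded_measurable_integrable[OF _ tf] bm m) (use bd in auto)
  have i\<alpha>: "integrable lborel \<alpha>" "0 < integral\<^sup>L lborel \<alpha>" unfolding \<alpha>_def by (rule scaled_bump_integral; simp)+
  have i\<theta>: "integrable lborel \<theta>" "0 < integral\<^sup>L lborel \<theta>" unfolding \<theta>_def by (rule scaled_bump_integral; simp)+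
  \<comment> \<open>The mean of \<alpha>' is 0, which removes the flux in direction x_1.\<close>
  have i\<alpha>': "integrable lborel \<alpha>'" "integral\<^sup>L lborel \<alpha>' = 0"
  proof -
    have *: "\<alpha>' s = 0" if "s \<notin> {-1..1}" for s by (rule \<alpha>'0) (use that in \<open>auto simp: abs_if\<close>)
    show "integrable lborel \<alpha>'" "integral\<^sup>L lborel \<alpha>' = 0"
      using integral_derivative_support[OF der(1) sm'(1), of "-1" 1, OF _ *] \<alpha>0[of 1] \<alpha>0[of "-1"] by simp_all
  qed
  \<comment> \<open>The derivative of t \<theta>(t), with integral 0.\<close>
  define h where "h t = t * \<theta>' t + \<theta> t" for t
  have dh: "((\<lambda>t. t * \<theta> t) has_real_derivative h t) (at t)" for t
    unfolding h_def by (auto intro!: derivative_eq_intros der)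
  have ih: "integrable lborel h" "integral\<^sup>L lborel h = 0"
  proof -
    have ch: "continuous_on UNIV h" unfolding h_def[abs_def] by (intro continuous_intros sm' ca)
    have h0: "h t = 0" if "t \<notin> {1..2}" for t unfolding h_def using \<theta>0 \<theta>'0[OF that] that by auto
    show "integrable lborel h" "integral\<^sup>L lborel h = 0"
      using integral_derivative_support[OF dh ch, of 1 2, OF _ h0] \<theta>0[of 1] \<theta>0[of 2] by simp_all
  qed
  have bint: "integrable lborel (\<lambda>s. f s * k s)" if "f \<in> borel_measurable borel" "\<And>s. \<bar>s\<bar> \<le> K' \<Longrightarrow> \<bar>f s\<bar> \<le> N" "continuous_on UNIV k" "\<And>s. K' < \<bar>s\<bar> \<Longrightarrow> k s = 0"
    for f k :: "real \<Rightarrow> real" and N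
  proof -
    have e: "(\<lambda>s. f s * k s) = (\<lambda>s. (indicator {-K'..K'} s * f s) * k s)"
    proof
      fix s show "f s * k s = (indicator {-K'..K'} s * f s) * k s"
        using that(4)[of s] by (cases "K' < \<bar>s\<bar>") (auto simp: indicator_def abs_le_iff)
    qed
    show ?thesis unfolding e
    proof (rule compact_support_integrable[OF that(3), of K' _ "max N 0"])
      show "(\<lambda>s. indicator {- K'..K'} s * f s) \<in> borel_measurable borel" using that(1) by measurable
      show "\<bar>indicator {- K'..K'} s * f s\<bar> \<le> max N 0" for s
        using that(2)[of s] by (auto simp: indicator_def abs_le_iff)
    qed (use that(4) in auto)
  qed
  have iA: "integrable lborel (\<lambda>s. A s * g s)"
    by (rule bint[OF m(1) _ cg g0]) (use bd in auto)
  have iB1: "integrable lborel (\<lambda>s. B1 s * g s)"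
    by (rule bint[OF m(2) _ cg g0]) (use bd in auto)
  have iN: "integrable lborel (\<lambda>s. (B2 s - s * A s) * g' s)"
  proof (rule bint[OF _ _ cg' g'0])
    show "(\<lambda>s. B2 s - s * A s) \<in> borel_measurable borel" by measurable
    show "\<bar>B2 s - s * A s\<bar> \<le> M + K' * M" if "\<bar>s\<bar> \<le> K'" for s
    proof -
      have "\<bar>s * A s\<bar> \<le> K' * M" unfolding abs_mult using that bd[of s] by (intro mult_mono) auto
      thus ?thesis using bd[of s] abs_triangle_ineq4[of "B2 s" "s * A s"] by linarith
    qed
  qed
  let ?a = "integral\<^sup>L lborel \<alpha>"
  let ?X = "integral\<^sup>L lborel (\<lambda>s. A s * g s)" and ?Y = "integral\<^sup>L lborel (\<lambda>s. (B2 s - s * A s) * g' s)"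
  have sc: "integrable lborel (\<lambda>x. f (x / t))" "integral\<^sup>L lborel (\<lambda>x. f (x / t)) = t * integral\<^sup>L lborel f"
    if "integrable lborel f" "0 < t" for f :: "real \<Rightarrow> real" and t
    using lborel_integrable_real_affine[OF that(1), of "1/t" 0] lborel_integral_real_affine[of t "\<lambda>x. f (x / t)" 0] that(2) by simp_all
  \<comment> \<open>Substituting x_2 = t s produces a factor t, hence t \<theta>' X + \<theta> Y,
    and t \<theta>' = h - \<theta>. Integration in t then leaves Y - X times a positive
    number.\<close>
  have inner: "integral\<^sup>L lborel (\<lambda>x. I (x, t)) = ?a * ?X * h t + ?a * (?Y - ?X) * \<theta> t" for t
  proof (cases "t \<in> {1..2}")
    case False
    hence "\<theta> t = 0" "\<theta>' t = 0" using \<theta>0[of t] \<theta>'0[of t] by auto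
    thus ?thesis unfolding slice h_def by simp
  next
    case True
    hence t: "0 < t" by simp
    let ?f = "\<lambda>s. A s * g s * \<theta>' t + (B2 s - s * A s) * g' s * (\<theta> t / t)"
    have if': "integrable lborel ?f" by (intro Bochner_Integration.integrable_add integrable_mult_left iA iN)
    have f: "integral\<^sup>L lborel ?f = ?X * \<theta>' t + ?Y * (\<theta> t / t)"
      using iA iN by simp
    note p1 = integral_vec2_product[OF i\<alpha>(1) sc(1)[OF if' t]]
    note p2 = integral_vec2_product[OF i\<alpha>'(1) sc(1)[OF integrable_mult_left[OF iB1, of "\<theta> t"] t]]
    have "(\<lambda>x. I (x, t)) = (\<lambda>x. \<alpha> (x $ 1) * ?f (x $ 2 / t) + \<alpha>' (x $ 1) * (B1 (x $ 2 / t) * g (x $ 2 / t) * \<theta> t))"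
      unfolding slice by (simp add: mult_ac)
    hence "integral\<^sup>L lborel (\<lambda>x. I (x, t)) = ?a * (t * (?X * \<theta>' t + ?Y * (\<theta> t / t)))"
      using Bochner_Integration.integral_add[OF p1(1) p2(1)] unfolding p1(2) p2(2) i\<alpha>'(2) sc(2)[OF if' t] f by simp
    also have "\<dots> = ?a * ?X * h t + ?a * (?Y - ?X) * \<theta> t" unfolding h_def using t by (simp add: field_simps)
    finally show ?thesis .
  qed
  have "0 = integral\<^sup>L (lborel \<Otimes>\<^sub>M lborel) (case_prod (\<lambda>x t. I (x, t)))" using I0 by (simp add: lborel_prod)
  also have "\<dots> = integral\<^sup>L lborel (\<lambda>t. integral\<^sup>L lborel (\<lambda>x. I (x, t)))"
    by (rule lborel_pair.integral_snd[symmetric]) (use iI in \<open>simp add: lborel_prod\<close>)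
  also have "\<dots> = ?a * (?Y - ?X) * integral\<^sup>L lborel \<theta>"
    unfolding inner using ih i\<theta> by simp
  finally show ?thesis using i\<alpha>(2) i\<theta>(2) by simp
qed

lemma smooth_step:
  assumes d: "\<delta> > (0::real)"
  obtains E e :: "real \<Rightarrow> real" where "\<And>k. Ck k E" "\<And>s. (E has_real_derivative e s) (at s)" "continuous_on UNIV e" "\<And>s. 0 \<le> e s"
    "\<And>s. \<delta> \<le> \<bar>s\<bar> \<Longrightarrow> e s = 0" "\<And>s. s \<le> - \<delta> \<Longrightarrow> E s = 0" "\<And>s. \<delta> \<le> s \<Longrightarrow> E s = 1" "\<And>s. 0 \<le> E s \<and> E s \<le> 1"
proof -
  have cb: "continuous_on UNIV (scaled_bump 0 \<delta>)" using scaled_bump_smooth[of 0 0 \<delta>] by simp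
  have "\<exists>F. \<forall>x :: real. - \<infinity> < ereal x \<longrightarrow> ereal x < \<infinity> \<longrightarrow> (F has_vector_derivative scaled_bump 0 \<delta> x) (at x)"
    by (rule einterval_antiderivative) (use cb in \<open>auto simp: continuous_on_eq_continuous_at\<close>)
  then obtain F where F: "\<And>x. (F has_real_derivative scaled_bump 0 \<delta> x) (at x)"
    by (auto simp: has_real_derivative_iff_has_vector_derivative)
  have z: "scaled_bump 0 \<delta> s = 0" if "\<delta> \<le> \<bar>s\<bar>" for s using scaled_bump_support[of \<delta> s 0] d that by simp
  have nn: "0 \<le> scaled_bump 0 \<delta> s" for s unfolding scaled_bump_def by (rule bump_nonneg)
  have mono: "F x \<le> F y" if "x \<le> y" for x y
    by (rule DERIV_nonneg_imp_nondecreasing[OF that]) (use F nn in blast)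
  have cF: "isCont F s" for s by (rule DERIV_isCont[OF F])
  define c where "c = F \<delta> - F (- \<delta>)"
  have c: "c > 0"
  proof -
    have "integral\<^sup>L lborel (scaled_bump 0 \<delta>) = c" unfolding c_def
      by (rule integral_derivative_support[OF F cb]) (use d z in \<open>auto simp: abs_if\<close>)
    thus ?thesis using scaled_bump_integral(2)[OF d, of 0] by linarith
  qed
  have left: "F s = F (- \<delta>)" if "s \<le> - \<delta>" for s
  proof -
    have "F (- \<delta>) \<le> F s"
    proof (rule DERIV_nonpos_imp_nonincreasing[OF that])
      fix x assume "s \<le> x" "x \<le> - \<delta>"
      hence "scaled_bump 0 \<delta> x = 0" using d by (intro z) auto
      thus "\<exists>y. (F has_real_derivative y) (at x) \<and> y \<le> 0" using F[of x] by auto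
    qed
    thus ?thesis using mono[OF that] by simp
  qed
  have right: "F s = F \<delta>" if "\<delta> \<le> s" for s
  proof -
    have "F s \<le> F \<delta>"
    proof (rule DERIV_nonpos_imp_nonincreasing[OF that])
      fix x assume "\<delta> \<le> x" "x \<le> s"
      hence "scaled_bump 0 \<delta> x = 0" using d by (intro z) auto
      thus "\<exists>y. (F has_real_derivative y) (at x) \<and> y \<le> 0" using F[of x] by auto
    qed
    thus ?thesis using mono[OF that] by simp
  qed
  have E': "((\<lambda>s. 1 / c * (F s - F (- \<delta>))) has_real_derivative 1 / c * scaled_bump 0 \<delta> s) (at s)" for s
    using DERIV_cmult[OF DERIV_diff[OF F DERIV_const[of "F (- \<delta>)"]], of "1 / c" s] by simp
  show ?thesis
  proof (rule that[of "\<lambda>s. 1 / c * (F s - F (- \<delta>))" "\<lambda>s. 1 / c * scaled_bump 0 \<delta> s", OF _ E'])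
    show "Ck k (\<lambda>s. 1 / c * (F s - F (- \<delta>)))" for k
      by (rule Ck_SucD, rule Ck_real_SucI[OF E']) (intro Ck_cmult scaled_bump_smooth)
    show "continuous_on UNIV (\<lambda>s. 1 / c * scaled_bump 0 \<delta> s)" by (intro continuous_intros cb)
    show "0 \<le> 1 / c * scaled_bump 0 \<delta> s" for s using nn c by simp
    show "1 / c * scaled_bump 0 \<delta> s = 0" if "\<delta> \<le> \<bar>s\<bar>" for s using z[OF that] by simp
    show "1 / c * (F s - F (- \<delta>)) = 0" if "s \<le> - \<delta>" for s using left[OF that] by simp
    show "1 / c * (F s - F (- \<delta>)) = 1" if "\<delta> \<le> s" for s using right[OF that] c by (simp add: c_def[symmetric])
    show "0 \<le> 1 / c * (F s - F (- \<delta>)) \<and> 1 / c * (F s - F (- \<delta>)) \<le> 1" for s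
    proof -
      have "F (- \<delta>) \<le> F s"
      proof (cases "s \<le> - \<delta>")
        case True show ?thesis unfolding left[OF True] by simp
      next
        case False thus ?thesis by (intro mono) simp
      qed
      moreover have "F s \<le> F \<delta>"
      proof (cases "\<delta> \<le> s")
        case True show ?thesis unfolding right[OF True] by simp
      next
        case False thus ?thesis by (intro mono) simp
      qed
      ultimately have "0 \<le> F s - F (- \<delta>)" "F s - F (- \<delta>) \<le> c" unfolding c_def by auto
      thus ?thesis using c by (simp add: pos_divide_le_eq)
    qed
  qed
qed

section \<open>Self-similar solutions do not dissipate\<close>

text \<open>The test function is a smoothed indicator of {a..c}; its derivative is an approximate
  unit mass at a minus one at c. Continuity of N at these two points yields N a - N c, while N may
  jump elsewhere, as it does for shocks.\<close>

lemma du_bois_reymond: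
  fixes N R :: "real \<Rightarrow> real"
  assumes m: "N \<in> borel_measurable borel" "R \<in> borel_measurable borel"
    and weak: "\<And>g g' K. (\<And>k. Ck k g) \<Longrightarrow> (\<And>s. (g has_real_derivative g' s) (at s)) \<Longrightarrow> (\<And>s. K < \<bar>s\<bar> \<Longrightarrow> g s = 0) \<Longrightarrow>
       integral\<^sup>L lborel (\<lambda>s. N s * g' s) = integral\<^sup>L lborel (\<lambda>s. R s * g s)"
    and bR: "\<And>s. \<bar>R s\<bar> \<le> M" and bN: "\<And>r s. \<bar>s\<bar> \<le> r \<Longrightarrow> \<bar>N s\<bar> \<le> b r"
    and cont: "isCont N a" "isCont N c" and ac: "a < c"
  shows "N a - N c = integral {a..c} R"
proof -
  have M: "0 \<le> M" using bR[of 0] by linarith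
  have iR: "integrable lborel (\<lambda>s. R s * indicator {x..y} s)" for x y
  proof (rule Bochner_Integration.integrable_bound[of lborel "\<lambda>s. M * indicator {x..y} s"])
    show "integrable lborel (\<lambda>s. M * indicator {x..y} s)"
      by (intro integrable_mult_right integrable_real_indicator) (auto simp: emeasure_lborel_Icc_eq)
    show "(\<lambda>s. R s * indicator {x..y} s) \<in> borel_measurable lborel" using m by measurable
    have "norm (R s * indicator {x..y} s) \<le> norm (M * indicator {x..y} s)" for s
      using bR[of s] M by (simp add: indicator_def)
    thus "AE s in lborel. norm (R s * indicator {x..y} s) \<le> norm (M * indicator {x..y} s)" by simp
  qed
  have I: "integral\<^sup>L lborel (\<lambda>s. R s * indicator {a..c} s) = integral {a..c} R"
    using set_borel_integral_eq_integral(2)[of "{a..c}" R] iR[of a c]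
    unfolding set_integrable_def set_lebesgue_integral_def by (simp add: mult.commute)
  \<comment> \<open>Each mollification is off by \<epsilon>. The smoothed and the sharp indicator
    differ on two intervals of length 2 \<delta>, where the bound 2 M on the integrand gives 8 M
    \<delta>.\<close>
  have est: "\<bar>N a - N c - integral {a..c} R\<bar> \<le> (2 + 8 * M) * \<epsilon>" if e: "0 < \<epsilon>" for \<epsilon>
  proof -
    obtain d1 where d1: "d1 > 0" "\<And>s. \<bar>s - a\<bar> < d1 \<Longrightarrow> \<bar>N s - N a\<bar> < \<epsilon>"
      using cont(1) e unfolding continuous_at_eps_delta dist_real_def by blast
    obtain d2 where d2: "d2 > 0" "\<And>s. \<bar>s - c\<bar> < d2 \<Longrightarrow> \<bar>N s - N c\<bar> < \<epsilon>"
      using cont(2) e unfolding continuous_at_eps_delta dist_real_def by blast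
    define \<delta> where "\<delta> = min (min d1 d2) (min \<epsilon> 1)"
    have \<delta>: "\<delta> > 0" "\<delta> \<le> d1" "\<delta> \<le> d2" "\<delta> \<le> \<epsilon>" "\<delta> \<le> 1" unfolding \<delta>_def using d1 d2 e by auto
    obtain E f where E: "\<And>k. Ck k E" "\<And>s. (E has_real_derivative f s) (at s)" "continuous_on UNIV f" "\<And>s. 0 \<le> f s"
      "\<And>s. \<delta> \<le> \<bar>s\<bar> \<Longrightarrow> f s = 0" "\<And>s. s \<le> - \<delta> \<Longrightarrow> E s = 0" "\<And>s. \<delta> \<le> s \<Longrightarrow> E s = 1" "\<And>s. 0 \<le> E s \<and> E s \<le> 1"
      by (rule smooth_step[OF \<delta>(1)]) (rule that)
    have dE: "((\<lambda>s. E (s - x)) has_real_derivative f (s - x)) (at s)" for x s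
      using DERIV_shift[of E "f (s - x)" s "-x"] E(2)[of "s - x"] by simp
    have cf: "continuous_on UNIV (\<lambda>s. f (s - x))" for x
      by (rule continuous_on_compose2[OF E(3)]) (auto intro!: continuous_intros)
    have mollify: "integrable lborel (\<lambda>s. N s * f (s - x)) \<and> \<bar>integral\<^sup>L lborel (\<lambda>s. N s * f (s - x)) - N x\<bar> \<le> \<epsilon>"
      if x: "\<And>s. \<bar>s - x\<bar> < \<delta> \<Longrightarrow> \<bar>N s - N x\<bar> < \<epsilon>" for x
    proof -
      have z: "f (s - x) = 0" if "s \<notin> {x - \<delta>..x + \<delta>}" for s
      proof (rule E(5))
        show "\<delta> \<le> \<bar>s - x\<bar>" using that by (auto simp: abs_if)
      qed
      have i: "integrable lborel (\<lambda>s. f (s - x))" "integral\<^sup>L lborel (\<lambda>s. f (s - x)) = 1"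
        using integral_derivative_support[OF dE cf, of "x - \<delta>" "x + \<delta>" x, OF _ z] \<delta>(1) E(6)[of "- \<delta>"] E(7)[of \<delta>] by simp_all
      have ec: "(\<lambda>s. N s * f (s - x)) = (\<lambda>s. (indicator {x - \<delta>..x + \<delta>} s * N s) * f (s - x))"
      proof
        fix s show "N s * f (s - x) = (indicator {x - \<delta>..x + \<delta>} s * N s) * f (s - x)" using z[of s] by (auto simp: indicator_def)
      qed
      have iN: "integrable lborel (\<lambda>s. N s * f (s - x))" unfolding ec
      proof (rule compact_support_integrable[OF cf])
        show "f (s - x) = 0" if "\<bar>x\<bar> + \<delta> < norm s" for s using that by (intro z) auto
        show "(\<lambda>s. indicator {x - \<delta>..x + \<delta>} s * N s) \<in> borel_measurable borel" using m by measurable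
        show "\<bar>indicator {x - \<delta>..x + \<delta>} s * N s\<bar> \<le> \<bar>b (\<bar>x\<bar> + \<delta>)\<bar>" for s
        proof (cases "s \<in> {x - \<delta>..x + \<delta>}")
          case True
          hence "\<bar>s\<bar> \<le> \<bar>x\<bar> + \<delta>" by auto
          from bN[OF this] True show ?thesis by simp
        qed simp
      qed
      have pw: "(N x - \<epsilon>) * f (s - x) \<le> N s * f (s - x) \<and> N s * f (s - x) \<le> (N x + \<epsilon>) * f (s - x)" for s
      proof (cases "\<bar>s - x\<bar> < \<delta>")
        case True
        hence "N x - \<epsilon> \<le> N s" "N s \<le> N x + \<epsilon>" using x[OF True] by (auto simp: abs_less_iff)
        thus ?thesis using E(4)[of "s - x"] by (auto intro: mult_right_mono)
      next
        case False
        thus ?thesis using E(5)[of "s - x"] by simp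
      qed
      have "integral\<^sup>L lborel (\<lambda>s. (N x - \<epsilon>) * f (s - x)) \<le> integral\<^sup>L lborel (\<lambda>s. N s * f (s - x))"
        by (rule integral_mono[OF integrable_mult_right[OF i(1)] iN]) (use pw in blast)
      moreover have "integral\<^sup>L lborel (\<lambda>s. N s * f (s - x)) \<le> integral\<^sup>L lborel (\<lambda>s. (N x + \<epsilon>) * f (s - x))"
        by (rule integral_mono[OF iN integrable_mult_right[OF i(1)]]) (use pw in blast)
      ultimately have "N x - \<epsilon> \<le> integral\<^sup>L lborel (\<lambda>s. N s * f (s - x))" "integral\<^sup>L lborel (\<lambda>s. N s * f (s - x)) \<le> N x + \<epsilon>" using i by simp_all
      thus ?thesis using iN unfolding abs_le_iff by auto
    qed
    have fa: "integrable lborel (\<lambda>s. N s * f (s - a))" "\<bar>integral\<^sup>L lborel (\<lambda>s. N s * f (s - a)) - N a\<bar> \<le> \<epsilon>"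
      using mollify[of a] d1(2) \<delta>(2) by auto
    have fc: "integrable lborel (\<lambda>s. N s * f (s - c))" "\<bar>integral\<^sup>L lborel (\<lambda>s. N s * f (s - c)) - N c\<bar> \<le> \<epsilon>"
      using mollify[of c] d2(2) \<delta>(3) by auto
    define g where "g s = E (s - a) - E (s - c)" for s
    have Cg: "Ck k g" for k
    proof -
      have *: "Ck k (\<lambda>s. E (- x + s))" for x using Ck_compose_affine[OF bounded_linear_ident E(1)] .
      have "Ck k (\<lambda>s. E (- a + s) + - 1 * E (- c + s))" by (intro Ck_add Ck_cmult *)
      moreover have "(\<lambda>s. E (- a + s) + - 1 * E (- c + s)) = g" unfolding g_def by (auto simp: fun_eq_iff)
      ultimately show ?thesis by simp
    qed
    have g0: "g s = 0" if "\<bar>a\<bar> + \<bar>c\<bar> + \<delta> < \<bar>s\<bar>" for s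
    proof (cases "0 \<le> s")
      case True
      thus ?thesis unfolding g_def using that E(7)[of "s - a"] E(7)[of "s - c"] by simp
    next
      case False
      thus ?thesis unfolding g_def using that E(6)[of "s - a"] E(6)[of "s - c"] by simp
    qed
    have "integral\<^sup>L lborel (\<lambda>s. N s * (f (s - a) - f (s - c))) = integral\<^sup>L lborel (\<lambda>s. R s * g s)"
      by (rule weak[OF Cg _ g0]) (unfold g_def, intro DERIV_diff dE)
    hence w: "integral\<^sup>L lborel (\<lambda>s. N s * f (s - a)) - integral\<^sup>L lborel (\<lambda>s. N s * f (s - c)) = integral\<^sup>L lborel (\<lambda>s. R s * g s)"
      using fa(1) fc(1) by (simp add: right_diff_distrib)
    have cg: "continuous_on UNIV g" using Cg[of 0] by simp
    have iRg: "integrable lborel (\<lambda>s. R s * g s)"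
      by (rule compact_support_integrable[OF cg _ m(2) bR]) (use g0 in auto)
    have diff: "norm (R s * g s - R s * indicator {a..c} s) \<le> 2 * M * (indicator {a - \<delta>..a + \<delta>} s + indicator {c - \<delta>..c + \<delta>} s)" for s
    proof -
      have n: "0 \<le> E (s - a)" "E (s - a) \<le> 1" "0 \<le> E (s - c)" "E (s - c) \<le> 1" using E(8) by blast+
      have "\<bar>g s - indicator {a..c} s\<bar> \<le> 2 * (indicator {a - \<delta>..a + \<delta>} s + indicator {c - \<delta>..c + \<delta>} s)"
      proof (cases "s \<in> {a - \<delta>..a + \<delta>} \<or> s \<in> {c - \<delta>..c + \<delta>}")
        case True
        have "\<bar>g s - indicator {a..c} s\<bar> \<le> 2" unfolding g_def using n by (auto simp: indicator_def abs_le_iff)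
        also have "\<dots> \<le> 2 * (indicator {a - \<delta>..a + \<delta>} s + indicator {c - \<delta>..c + \<delta>} s)" using True by (auto simp: indicator_def)
        finally show ?thesis .
      next
        case False
        hence "g s = indicator {a..c} s"
          using ac \<delta>(1) E(6)[of "s - a"] E(6)[of "s - c"] E(7)[of "s - a"] E(7)[of "s - c"] unfolding g_def by (auto simp: indicator_def)
        thus ?thesis by simp
      qed
      hence "\<bar>R s\<bar> * \<bar>g s - indicator {a..c} s\<bar> \<le> M * (2 * (indicator {a - \<delta>..a + \<delta>} s + indicator {c - \<delta>..c + \<delta>} s))"
        using bR[of s] M by (intro mult_mono) auto
      thus ?thesis by (simp add: abs_mult[symmetric] right_diff_distrib mult_ac)
    qed
    have "\<bar>integral\<^sup>L lborel (\<lambda>s. R s * g s) - integral {a..c} R\<bar> = norm (integral\<^sup>L lborel (\<lambda>s. R s * g s - R s * indicator {a..c} s))"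
      using iRg iR[of a c] I by simp
    also have "\<dots> \<le> integral\<^sup>L lborel (\<lambda>s. 2 * M * (indicator {a - \<delta>..a + \<delta>} s + indicator {c - \<delta>..c + \<delta>} s))"
      by (rule Bochner_Integration.integral_norm_bound_integral[OF Bochner_Integration.integrable_diff[OF iRg iR] _ diff])
        (intro integrable_mult_right Bochner_Integration.integrable_add integrable_real_indicator; simp add: emeasure_lborel_Icc_eq)
    also have "\<dots> = 8 * M * \<delta>" using \<delta>(1) by simp
    also have "\<dots> \<le> 8 * M * \<epsilon>" using M \<delta>(4) by (intro mult_left_mono) auto
    finally have "\<bar>integral\<^sup>L lborel (\<lambda>s. R s * g s) - integral {a..c} R\<bar> \<le> 8 * M * \<epsilon>" .
    thus ?thesis using w fa(2) fc(2) unfolding abs_le_iff by (simp add: algebra_simps)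
  qed
  have "\<bar>N a - N c - integral {a..c} R\<bar> \<le> 0"
  proof (rule field_le_epsilon)
    fix e :: real assume "0 < e"
    hence "0 < e / (2 + 8 * M)" using M by simp
    from est[OF this] M show "\<bar>N a - N c - integral {a..c} R\<bar> \<le> 0 + e" by simp
  qed
  thus ?thesis by simp
qed

text \<open>Links the outermost state of a profile to the Riemann data. The test function is a bump
  around x_2 = y and t = 0, positive at t = 0; on its support in t > 0 the fields are constant, so
  the fluxes integrate to 0 and the time derivative returns the initial integral.\<close>

lemma outer_state:
  assumes wb: "weak_balance A B1 B2 A0" and bm: "bounded_measurable A" "bounded_measurable B1" "bounded_measurable B2"
    and eq: "\<And>x t. 0 < t \<Longrightarrow> t \<le> 2 \<Longrightarrow> \<bar>x $ 2 - y\<bar> \<le> 2 \<Longrightarrow> A (x, t) = a \<and> B1 (x, t) = b1 \<and> B2 (x, t) = b2"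
    and eq0: "\<And>x. \<bar>x $ 2 - y\<bar> \<le> 2 \<Longrightarrow> A0 x = a0"
  shows "a = a0"
proof -
  define \<psi> :: "(real^2) \<times> real \<Rightarrow> real" where "\<psi> z = scaled_bump 0 1 (fst z $ 1) * (scaled_bump y 1 (fst z $ 2) * scaled_bump 0 1 (snd z))" for z
  have sup: "\<bar>fst z $ 1\<bar> < 1 \<and> \<bar>fst z $ 2 - y\<bar> < 1 \<and> \<bar>snd z\<bar> < 1" if "\<psi> z \<noteq> 0" for z
    using that scaled_bump_support[of 1 "fst z $ 1" 0] scaled_bump_support[of 1 "fst z $ 2" y] scaled_bump_support[of 1 "snd z" 0]
    unfolding \<psi>_def by (auto simp: not_less[symmetric])
  have t: "test_function \<psi>"
  proof (rule test_functionI)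
    fix k
    have c: "Ck k (\<lambda>z. scaled_bump c r (L z))" if "bounded_linear L" for c r and L :: "(real^2) \<times> real \<Rightarrow> real"
      using Ck_compose_affine[OF that scaled_bump_smooth, of k c r 0] by simp
    show "Ck k \<psi>" unfolding \<psi>_def[abs_def]
      by (intro Ck_mult c bounded_linear_compose[OF bounded_linear_vec_nth bounded_linear_fst] bounded_linear_snd)
  next
    fix z :: "(real^2) \<times> real" assume n: "\<bar>y\<bar> + 3 < norm z"
    show "\<psi> z = 0"
    proof (rule ccontr)
      assume "\<psi> z \<noteq> 0"
      note s = sup[OF this]
      have "norm z \<le> norm (fst z) + norm (snd z)" using norm_Pair_le[of "fst z" "snd z"] by simp
      moreover have "norm (fst z) \<le> \<bar>fst z $ 1\<bar> + \<bar>fst z $ 2\<bar>" using norm_le_l1_cart[of "fst z"] by (simp add: sum_2)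
      ultimately show False using n s by (auto simp: abs_if split: if_splits)
    qed
  qed
  have d0: "frechet_derivative \<psi> (at z) h = 0" if "\<not> (\<bar>fst z $ 2 - y\<bar> \<le> 2 \<and> snd z \<le> 2)" for z h
  proof -
    have o: "open {z :: (real^2) \<times> real. 1 < \<bar>fst z $ 2 - y\<bar> \<or> 1 < snd z}"
      by (intro open_Collect_disj open_Collect_less continuous_intros)
    have "(\<psi> has_derivative (\<lambda>_. 0)) (at z)"
    proof (rule has_derivative_transform_within_open[OF has_derivative_const o])
      show "z \<in> {z. 1 < \<bar>fst z $ 2 - y\<bar> \<or> 1 < snd z}" using that by auto
      show "0 = \<psi> w" if "w \<in> {z. 1 < \<bar>fst z $ 2 - y\<bar> \<or> 1 < snd z}" for w using sup[of w] that by (cases "\<psi> w = 0") auto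
    qed
    from frechet_derivative_at[OF this] show ?thesis by metis
  qed
  let ?h = "indicator half_space :: (real^2) \<times> real \<Rightarrow> real"
  let ?P = "integral\<^sup>L lborel (\<lambda>x. \<psi> (x, 0))"
  have hs: "indicator (strip_region s UNIV) = ?h" for s unfolding strip_region_def by (auto simp: indicator_def fun_eq_iff)
  note i = bounded_measurable_integrable[OF _ t]
  note i1 = i[OF bounded_measurable_intros(1)[of 1], simplified]
  have T0: "integral\<^sup>L lborel (\<lambda>z. ?h z * dt \<psi> z) = - ?P"
    using strip_integral_transport[OF t, of UNIV 0] unfolding hs by simp
  have "integral\<^sup>L lborel (\<lambda>z. ?h z * dt \<psi> z + ?h z * dx 2 \<psi> z) = - ?P"
    using strip_integral_transport[OF t, of UNIV 1] unfolding hs by (simp add: distrib_left)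
  hence T2: "integral\<^sup>L lborel (\<lambda>z. ?h z * dx 2 \<psi> z) = 0" using T0 i1 by simp
  have T1: "integral\<^sup>L lborel (\<lambda>z. ?h z * dx 1 \<psi> z) = 0"
    using strip_integral_dx1[OF t, of UNIV 0] unfolding hs by simp
  have "integral\<^sup>L lborel (\<lambda>z. ?h z * (A z * dt \<psi> z + B1 z * dx 1 \<psi> z + B2 z * dx 2 \<psi> z))
     = integral\<^sup>L lborel (\<lambda>z. a * (?h z * dt \<psi> z) + b1 * (?h z * dx 1 \<psi> z) + b2 * (?h z * dx 2 \<psi> z))"
  proof (rule integral_cong_AE)
    have "integrable lborel (\<lambda>z. ?h z * A z * dt \<psi> z + ?h z * B1 z * dx 1 \<psi> z + ?h z * B2 z * dx 2 \<psi> z)"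
      by (intro Bochner_Integration.integrable_add i bm)
    thus "(\<lambda>z. ?h z * (A z * dt \<psi> z + B1 z * dx 1 \<psi> z + B2 z * dx 2 \<psi> z)) \<in> borel_measurable lborel"
      by (simp add: distrib_left mult.assoc borel_measurable_integrable)
    have "integrable lborel (\<lambda>z. a * (?h z * dt \<psi> z) + b1 * (?h z * dx 1 \<psi> z) + b2 * (?h z * dx 2 \<psi> z))"
      by (intro Bochner_Integration.integrable_add integrable_mult_right i1)
    thus "(\<lambda>z. a * (?h z * dt \<psi> z) + b1 * (?h z * dx 1 \<psi> z) + b2 * (?h z * dx 2 \<psi> z)) \<in> borel_measurable lborel"
      by (rule borel_measurable_integrable)
    show "AE z in lborel. ?h z * (A z * dt \<psi> z + B1 z * dx 1 \<psi> z + B2 z * dx 2 \<psi> z)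
      = a * (?h z * dt \<psi> z) + b1 * (?h z * dx 1 \<psi> z) + b2 * (?h z * dx 2 \<psi> z)"
      using AE_time_neq[of 0]
    proof eventually_elim
      case (elim z)
      show ?case
      proof (cases "\<bar>fst z $ 2 - y\<bar> \<le> 2 \<and> 0 < snd z \<and> snd z \<le> 2")
        case True
        thus ?thesis using eq[of "snd z" "fst z"] by (simp add: algebra_simps)
      next
        case False
        hence "?h z = 0 \<or> (\<forall>h. frechet_derivative \<psi> (at z) h = 0)" using elim d0[of z] by (cases z) (auto simp: indicator_def)
        thus ?thesis unfolding dt_def dx_def by auto
      qed
    qed
  qed
  also have "\<dots> = - (a * ?P)" using i1 T0 T1 T2 by simp
  finally have L: "integral\<^sup>L lborel (\<lambda>z. ?h z * (A z * dt \<psi> z + B1 z * dx 1 \<psi> z + B2 z * dx 2 \<psi> z)) = - (a * ?P)" .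
  have e0: "A0 x * \<psi> (x, 0) = a0 * \<psi> (x, 0)" for x using sup[of "(x, 0)"] eq0[of x] by (cases "\<psi> (x, 0) = 0") auto
  have "- (a * ?P) + a0 * ?P = 0"
    using wb[unfolded weak_balance_def, rule_format, OF t] unfolding L e0 by simp
  moreover have "?P > 0"
  proof -
    note sb = scaled_bump_integral[of 1, simplified]
    have "?P = integral\<^sup>L lborel (scaled_bump 0 1) * (integral\<^sup>L lborel (scaled_bump y 1) * scaled_bump 0 1 0)"
      unfolding \<psi>_def fst_conv snd_conv
      using integral_vec2_product(2)[OF sb(1)[of 0] integrable_mult_left[OF sb(1)[of y], of "scaled_bump 0 1 0"]] by simp
    moreover have "scaled_bump 0 1 0 > 0"
      using less_le_trans[OF exp_gt_zero[of "-4 :: real"], of "bump 0"] bump_ge[of 0] by (simp add: scaled_bump_def)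
    ultimately show ?thesis using sb(2)[of 0] sb(2)[of y] by simp
  qed
  ultimately show ?thesis by (simp add: algebra_simps)
qed

text \<open>On the strip |x_1| < 1 the coordinate x_2 is distributed like twice the Lebesgue
  measure.\<close>

lemma AE_vec2_component2:
  assumes Q: "{s. Q s} \<in> sets borel" and ae: "AE x in (lborel :: (real^2) measure). Q (x $ 2)"
  shows "AE s in lborel. Q s"
proof -
  have "AE x in density lborel (\<lambda>x::real^2. indicator {-1<..<1} (x $ 1)). Q (x $ 2)"
    using ae by (subst AE_density) auto
  hence "AE s in distr (density lborel (\<lambda>x::real^2. indicator {-1<..<1} (x $ 1))) borel (\<lambda>x. x $ 2). Q s"
    by (subst AE_distr_iff) (use Q in auto)
  hence "AE s in density lborel (\<lambda>_. ennreal (2 * 1)). Q s" unfolding strip_distr_vec2[OF zero_less_one] .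
  thus ?thesis by (subst (asm) AE_density) auto
qed

lemma AE_isCont_le:
  fixes f :: "real \<Rightarrow> real"
  assumes ae: "AE s in lborel. f s \<le> M" and c: "isCont f a"
  shows "f a \<le> M"
proof (rule ccontr)
  assume "\<not> f a \<le> M"
  hence "0 < f a - M" by simp
  then obtain d where d: "d > 0" "\<And>s. \<bar>s - a\<bar> < d \<Longrightarrow> \<bar>f s - f a\<bar> < f a - M"
    using c unfolding continuous_at_eps_delta dist_real_def by blast
  have "AE s in lborel. s \<notin> {a - d<..<a + d}"
    using ae
  proof eventually_elim
    case (elim s)
    show ?case
    proof
      assume "s \<in> {a - d<..<a + d}"
      hence "\<bar>s - a\<bar> < d" by (auto simp: abs_less_iff)
      from d(2)[OF this] elim show False by (auto simp: abs_less_iff)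
    qed
  qed
  hence "{a - d<..<a + d} \<in> null_sets lborel" by (subst AE_iff_null_sets) auto
  thus False using d(1) null_setsD1 by fastforce
qed

text \<open>Profiles are arbitrary at their finitely many jumps, whereas the integral identities ask
  for bounds at every point.\<close>

lemma bounded_off_finite:
  fixes f :: "real \<Rightarrow> real"
  assumes "finite B" "\<And>s. s \<notin> B \<Longrightarrow> \<bar>f s\<bar> \<le> M"
  obtains K where "\<And>s. \<bar>f s\<bar> \<le> K"
proof
  fix s
  have "0 \<le> (\<Sum>b\<in>B. \<bar>f b\<bar>)" by (rule sum_nonneg) simp
  moreover have "\<bar>f s\<bar> \<le> (\<Sum>b\<in>B. \<bar>f b\<bar>)" if "s \<in> B" using member_le_sum[OF that, of "\<lambda>b. \<bar>f b\<bar>"] assms(1) by simp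
  ultimately show "\<bar>f s\<bar> \<le> \<bar>M\<bar> + (\<Sum>b\<in>B. \<bar>f b\<bar>)" using assms(2)[of s] by (cases "s \<in> B") linarith+
qed

lemma integral_le_off_finite:
  fixes f g :: "real \<Rightarrow> real"
  assumes i: "f integrable_on {a..b}" "g integrable_on {a..b}" and B: "finite B" and le: "\<And>s. s \<in> {a..b} - B \<Longrightarrow> f s \<le> g s"
  shows "integral {a..b} f \<le> integral {a..b} g"
proof -
  have "((\<lambda>s. if s \<in> B then f s else g s) has_integral integral {a..b} g) {a..b}"
    by (rule has_integral_spike_finite[OF B _ integrable_integral[OF i(2)]]) simp
  thus ?thesis by (rule has_integral_le[OF integrable_integral[OF i(1)]]) (use le in auto)
qed

lemma sound_speed_le:
  assumes "1 \<le> \<gamma>" "0 < r" "r \<le> M"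
  shows "sound_speed \<gamma> r \<le> sqrt (\<gamma> * M powr (\<gamma> - 1))"
proof -
  have "(pressure \<gamma> has_real_derivative \<gamma> * r powr (\<gamma> - 1)) (at r)"
    using has_real_derivative_powr[OF assms(2), of \<gamma>] unfolding pressure_def[abs_def] .
  hence "deriv (pressure \<gamma>) r = \<gamma> * r powr (\<gamma> - 1)" by (rule DERIV_imp_deriv)
  thus ?thesis unfolding sound_speed_def using assms by (auto intro!: mult_left_mono powr_mono2)
qed

lemma profile_isCont:
  assumes s: "s \<notin> B" and B: "finite B"
    and C: "\<And>C. C \<in> components (- B) \<Longrightarrow> (R constant_on C \<and> V constant_on C) \<or> rarefaction_on \<gamma> R V C"
  shows "isCont R s" "isCont (\<lambda>s. V s $ i) s"
proof -
  define C where "C = connected_component_set (- B) s"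
  have CC: "C \<in> components (- B)" unfolding C_def using s by (intro componentsI) auto
  have o: "open C" using open_components[OF _ CC] finite_imp_closed[OF B] by (simp add: open_Compl)
  have sC: "s \<in> C" unfolding C_def using s by simp
  have const: "isCont f s" if "f constant_on C" for f :: "real \<Rightarrow> real"
  proof -
    from that obtain k where k: "\<And>x. x \<in> C \<Longrightarrow> f x = k" unfolding constant_on_def by blast
    have "\<forall>\<^sub>F x in nhds s. f x = k" using eventually_nhds_in_open[OF o sC] by eventually_elim (rule k)
    thus ?thesis using isCont_cong[of f "\<lambda>_. k" s] by simp
  qed
  from C[OF CC] have "isCont R s \<and> isCont (\<lambda>s. V s $ i) s"
  proof
    assume "R constant_on C \<and> V constant_on C"
    moreover from this have "(\<lambda>s. V s $ i) constant_on C" unfolding constant_on_def by auto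
    ultimately show ?thesis using const by blast
  next
    assume r: "rarefaction_on \<gamma> R V C"
    then obtain \<sigma> R' W' where d: "(R has_real_derivative R' s) (at s)" "((\<lambda>s. V s $ 2) has_real_derivative W' s) (at s)"
      unfolding rarefaction_on_def using sC by blast
    have "isCont (\<lambda>s. V s $ 1) s" using r const unfolding rarefaction_on_def by blast
    thus ?thesis using DERIV_isCont[OF d(1)] DERIV_isCont[OF d(2)] exhaust_2[of i] by auto
  qed
  thus "isCont R s" "isCont (\<lambda>s. V s $ i) s" by auto
qed

text \<open>In a rarefaction s equals v_2 plus or minus the sound speed, which is bounded when
  density and velocity are. An unbounded component can therefore not be a rarefaction.\<close>

lemma outer_constant:
  assumes g: "1 \<le> \<gamma>" and D: "connected D" "D \<subseteq> - B" "D \<noteq> {}" and unb: "\<And>K. \<exists>s\<in>D. K < \<bar>s\<bar>"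
    and C: "\<And>C. C \<in> components (- B) \<Longrightarrow> (R constant_on C \<and> V constant_on C) \<or> rarefaction_on \<gamma> R V C"
    and bd: "\<And>s. s \<notin> B \<Longrightarrow> R s \<le> M \<and> \<bar>V s $ 2\<bar> \<le> M"
  shows "R constant_on D \<and> V constant_on D"
proof -
  obtain C where CC: "C \<in> components (- B)" "D \<subseteq> C" using exists_component_superset[OF D(2) _ D(1)] D(2,3) by auto
  have "\<not> rarefaction_on \<gamma> R V C"
  proof
    assume "rarefaction_on \<gamma> R V C"
    then obtain \<sigma> where \<sigma>: "\<sigma> \<in> {-1, 1}" "\<And>s. s \<in> C \<Longrightarrow> R s > 0 \<and> V s $ 2 + \<sigma> * sound_speed \<gamma> (R s) = s"
      unfolding rarefaction_on_def by blast
    obtain s where s: "s \<in> D" "M + sqrt (\<gamma> * M powr (\<gamma> - 1)) < \<bar>s\<bar>" using unb by blast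
    have sC: "s \<in> C" "s \<notin> B" using s(1) D(2) CC(2) by auto
    have c: "sound_speed \<gamma> (R s) \<le> sqrt (\<gamma> * M powr (\<gamma> - 1))" using sound_speed_le[OF g] \<sigma>(2)[OF sC(1)] bd[OF sC(2)] by blast
    have c0: "0 \<le> sound_speed \<gamma> (R s)"
    proof -
      have p: "0 < R s" using \<sigma>(2)[OF sC(1)] by blast
      have "(pressure \<gamma> has_real_derivative \<gamma> * R s powr (\<gamma> - 1)) (at (R s))"
        using has_real_derivative_powr[OF p, of \<gamma>] unfolding pressure_def[abs_def] .
      hence "deriv (pressure \<gamma>) (R s) = \<gamma> * R s powr (\<gamma> - 1)" by (rule DERIV_imp_deriv)
      thus ?thesis unfolding sound_speed_def using g by simp
    qed
    have "\<bar>\<sigma> * sound_speed \<gamma> (R s)\<bar> = sound_speed \<gamma> (R s)" using \<sigma>(1) c0 by auto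
    hence "\<bar>s\<bar> \<le> M + sound_speed \<gamma> (R s)"
      using \<sigma>(2)[OF sC(1)] bd[OF sC(2)] abs_triangle_ineq[of "V s $ 2" "\<sigma> * sound_speed \<gamma> (R s)"] by linarith
    thus False using s(2) c by linarith
  qed
  hence "R constant_on C \<and> V constant_on C" using C[OF CC(1)] by blast
  thus ?thesis by (auto intro: constant_on_subset[OF _ CC(2)])
qed

text \<open>The tangent at r = 1 of the convex function r \<epsilon>(r): its slope is 1 for \<gamma>
  = 1 and \<gamma>/(\<gamma> - 1) otherwise. At r = 0 the function has the value 0, as the default
  values of the code provide.\<close>

lemma internal_energy_convex:
  assumes g: "1 \<le> \<gamma>"
  obtains l where "\<And>r. 0 \<le> r \<Longrightarrow> internal_energy \<gamma> 1 + l * (r - 1) \<le> r * internal_energy \<gamma> r"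
proof (cases "\<gamma> = 1")
  case True
  have "internal_energy \<gamma> 1 + 1 * (r - 1) \<le> r * internal_energy \<gamma> r" if r: "0 \<le> r" for r
  proof (cases "r = 0")
    case False
    hence "ln (1 / r) \<le> 1 / r - 1" using r by (intro ln_le_minus_one) simp
    hence "1 - 1 / r \<le> ln r" using False r by (simp add: ln_div)
    hence "r * (1 - 1 / r) \<le> r * ln r" using r by (intro mult_left_mono)
    thus ?thesis using True False by (simp add: internal_energy_def algebra_simps)
  qed (use True in \<open>simp add: internal_energy_def\<close>)
  thus ?thesis by (rule that)
next
  case False
  hence g1: "1 < \<gamma>" using g by simp
  have "internal_energy \<gamma> 1 + \<gamma> / (\<gamma> - 1) * (r - 1) \<le> r * internal_energy \<gamma> r" if r: "0 \<le> r" for r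
  proof -
    have "1 + \<gamma> * (r - 1) \<le> r powr \<gamma>"
    proof (cases "r = 0")
      case True thus ?thesis using g1 by simp
    next
      case False
      hence p: "r > 0" using r by simp
      define h where "h x = x powr \<gamma> - \<gamma> * x" for x :: real
      have dh: "(h has_real_derivative \<gamma> * (x powr (\<gamma> - 1) - 1)) (at x)" if "x > 0" for x
        unfolding h_def[abs_def] using that has_real_derivative_powr[OF that, of \<gamma>]
        by (auto intro!: derivative_eq_intros simp: algebra_simps)
      have "h 1 \<le> h r"
      proof (cases "1 \<le> r")
        case True
        show ?thesis
        proof (rule DERIV_nonneg_imp_nondecreasing[OF True])
          fix x :: real assume "1 \<le> x"
          hence "1 \<le> x powr (\<gamma> - 1)" using g1 by (intro ge_one_powr_ge_zero) auto
          thus "\<exists>y. (h has_real_derivative y) (at x) \<and> 0 \<le> y" using dh[of x] \<open>1 \<le> x\<close> g1 by (intro exI conjI) auto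
        qed
      next
        case False
        show ?thesis
        proof (rule DERIV_nonpos_imp_nonincreasing[of r 1])
          fix x :: real assume x: "r \<le> x" "x \<le> 1"
          hence "x powr (\<gamma> - 1) \<le> 1 powr (\<gamma> - 1)" using g1 p by (intro powr_mono2) auto
          thus "\<exists>y. (h has_real_derivative y) (at x) \<and> y \<le> 0" using dh[of x] x p g1
            by (intro exI conjI) (auto intro!: mult_nonneg_nonpos)
        qed (use False in simp)
      qed
      thus ?thesis unfolding h_def by (simp add: algebra_simps)
    qed
    moreover have "r * internal_energy \<gamma> r = r powr \<gamma> / (\<gamma> - 1)"
      using False r by (cases "r = 0") (simp_all add: internal_energy_def powr_mult_base)
    moreover have "internal_energy \<gamma> 1 = 1 / (\<gamma> - 1)" using False by (simp add: internal_energy_def)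
    ultimately show ?thesis using g1 by (simp add: add_divide_distrib[symmetric] divide_right_mono)
  qed
  thus ?thesis by (rule that)
qed

lemma internal_energy_bounded:
  assumes g: "1 \<le> \<gamma>"
  obtains K where "\<And>r. 0 \<le> r \<Longrightarrow> r \<le> M \<Longrightarrow> \<bar>r * internal_energy \<gamma> r\<bar> \<le> K"
proof -
  obtain l where l: "\<And>r. 0 \<le> r \<Longrightarrow> internal_energy \<gamma> 1 + l * (r - 1) \<le> r * internal_energy \<gamma> r" using internal_energy_convex[OF g] by metis
  define U where "U = (if \<gamma> = 1 then M * M else M * (M powr (\<gamma> - 1) / (\<gamma> - 1)))"
  have up: "r * internal_energy \<gamma> r \<le> U" if r: "0 \<le> r" "r \<le> M" for r
  proof (cases "\<gamma> = 1")
    case True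
    show ?thesis
    proof (cases "r = 0")
      case False
      hence "ln r \<le> M" using ln_le_minus_one[of r] r by linarith
      hence "r * ln r \<le> r * M" using r by (intro mult_left_mono) auto
      also have "\<dots> \<le> M * M" using r by (intro mult_right_mono) auto
      finally show ?thesis using True by (simp add: internal_energy_def U_def)
    qed (use r in \<open>simp add: U_def True\<close>)
  next
    case False
    have "r powr (\<gamma> - 1) / (\<gamma> - 1) \<le> M powr (\<gamma> - 1) / (\<gamma> - 1)" using g r by (intro divide_right_mono powr_mono2) auto
    hence "r * (r powr (\<gamma> - 1) / (\<gamma> - 1)) \<le> M * (M powr (\<gamma> - 1) / (\<gamma> - 1))" using r g by (intro mult_mono) auto
    thus ?thesis using False by (simp add: internal_energy_def U_def)
  qed
  have "\<bar>r * internal_energy \<gamma> r\<bar> \<le> \<bar>U\<bar> + \<bar>internal_energy \<gamma> 1\<bar> + \<bar>l\<bar> * (M + 1)" if r: "0 \<le> r" "r \<le> M" for r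
  proof -
    have "\<bar>l * (r - 1)\<bar> \<le> \<bar>l\<bar> * (M + 1)" unfolding abs_mult using r by (intro mult_left_mono) auto
    thus ?thesis using l[OF r(1)] up[OF r] by linarith
  qed
  thus ?thesis by (rule that)
qed

text \<open>
  The mass flux \<open>F(s) = R (v\<^sub>2 - s)\<close> relative to the line \<open>x\<^sub>2 = s t\<close> changes sign at some \<open>s\<^sub>0\<close>, and there the flux \<open>F v\<^sub>1\<close> of
  tangential momentum vanishes as well: the momenta of the two half spaces do not mix. Hence \<open>\<integral> R v\<^sub>1\<^sup>2\<close> is at least
  its initial value, since \<open>R (v\<^sub>1 \<plusminus> W)\<^sup>2 \<ge> 0\<close>.
\<close>

lemma tangential_energy_ge:
  fixes R V1 V2 :: "real \<Rightarrow> real"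
  assumes S: "0 < S" and B: "finite B" and bd: "\<And>s. \<bar>V1 s\<bar> \<le> M" and R0: "\<And>s. s \<notin> B \<Longrightarrow> 0 \<le> R s"
    and i: "R integrable_on {-S..S}" "(\<lambda>s. R s * V1 s) integrable_on {-S..S}" "(\<lambda>s. R s * (V1 s)\<^sup>2) integrable_on {-S..S}"
    and mass: "\<And>c. - S < c \<Longrightarrow> c \<notin> B \<Longrightarrow> S - (R c * V2 c - c * R c) = integral {-S..c} R"
    and mom: "\<And>c. - S < c \<Longrightarrow> c \<notin> B \<Longrightarrow> - S * W - (R c * V1 c * V2 c - c * (R c * V1 c)) = integral {-S..c} (\<lambda>s. R s * V1 s)"
    and out: "S \<notin> B" "R S = 1" "V1 S = W" "V2 S = 0"
  shows "integral {-S..S} R = 2 * S" "2 * S * W\<^sup>2 \<le> integral {-S..S} (\<lambda>s. R s * (V1 s)\<^sup>2)"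
proof -
  have R2: "integral {-S..S} R = 2 * S" using mass[of S] S out by simp
  show "integral {-S..S} R = 2 * S" by (rule R2)
  have P2: "integral {-S..S} (\<lambda>s. R s * V1 s) = 0" using mom[of S] S out by simp
  \<comment> \<open>Off \<open>B\<close> this is the relative mass flux, by \<open>mass\<close>; as
    an indefinite integral it is continuous across jumps too. It falls from S to - S.\<close>
  define F where "F c = S - integral {-S..c} R" for c
  define F1 where "F1 c = - S * W - integral {-S..c} (\<lambda>s. R s * V1 s)" for c
  have cF: "continuous_on {-S..S} F" "continuous_on {-S..S} F1" unfolding F_def F1_def
    by (intro continuous_intros indefinite_integral_continuous_1 i)+
  have "\<exists>s\<ge>-S. s \<le> S \<and> F s = 0"
    by (rule IVT2') (use S R2 cF in \<open>auto simp: F_def\<close>)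
  then obtain s0 where s0: "-S \<le> s0" "s0 \<le> S" "F s0 = 0" by blast
  have "F (-S) = S" "F S = - S" unfolding F_def using R2 by simp_all
  hence s1: "-S < s0" "s0 < S" using s0 S by (auto simp: le_less)
  have int: "s0 \<in> interior {-S..S}" using s1 by simp
  have c0: "isCont F s0" "isCont F1 s0" using continuous_on_interior[OF _ int] cF by auto
  \<comment> \<open>The velocity V1 may jump at s0 and F1 = V1 F is known off \<open>B\<close>; the
    inequality |F1| \<le> M |F| survives the limit c \<rightarrow> s0.\<close>
  have F1_0: "F1 s0 = 0"
  proof -
    have "\<bar>F1 s0\<bar> - M * \<bar>F s0\<bar> \<le> 0"
    proof (rule tendsto_upperbound)
      show "((\<lambda>c. \<bar>F1 c\<bar> - M * \<bar>F c\<bar>) \<longlongrightarrow> \<bar>F1 s0\<bar> - M * \<bar>F s0\<bar>) (at s0)"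
        using c0 unfolding isCont_def by (intro tendsto_intros)
      have "closed (B - {s0})" using B by (intro finite_imp_closed) simp
      hence "open (- (B - {s0}))" by (rule open_Compl)
      hence "\<forall>\<^sub>F c in at s0. c \<notin> B"
        unfolding eventually_at_topological by (intro exI[of _ "- (B - {s0})"]) auto
      moreover have "\<forall>\<^sub>F c in at s0. c \<in> {-S<..<S}"
        unfolding eventually_at_topological using s1 by (intro exI[of _ "{-S<..<S}"]) auto
      ultimately show "\<forall>\<^sub>F c in at s0. \<bar>F1 c\<bar> - M * \<bar>F c\<bar> \<le> 0"
      proof eventually_elim
        case (elim c)
        have "F c = R c * V2 c - c * R c" using mass[of c] elim unfolding F_def by simp
        moreover have "F1 c = R c * V1 c * V2 c - c * (R c * V1 c)" using mom[of c] elim unfolding F1_def by simp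
        moreover have "R c * V1 c * V2 c - c * (R c * V1 c) = V1 c * (R c * V2 c - c * R c)" by (simp add: algebra_simps)
        ultimately have "F1 c = V1 c * F c" by simp
        thus ?case using bd[of c] by (simp add: abs_mult mult_right_mono)
      qed
    qed simp
    thus ?thesis using s0(3) by simp
  qed
  have sub: "f integrable_on {-S..s0}" "f integrable_on {s0..S}" "integral {-S..S} f = integral {-S..s0} f + integral {s0..S} f"
    if "f integrable_on {-S..S}" for f :: "real \<Rightarrow> real"
    using that s0 integrable_subinterval_real[OF that] Henstock_Kurzweil_Integration.integral_combine[OF s0(1,2) that] by auto
  have PL: "integral {-S..s0} (\<lambda>s. R s * V1 s) = - S * W" using F1_0 unfolding F1_def by simp
  hence PR: "integral {s0..S} (\<lambda>s. R s * V1 s) = S * W" using sub(3)[OF i(2)] P2 by simp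
  \<comment> \<open>From R (V1 - k)^2 \<ge> 0, applied with k = - W below s0 and k = W
    above.\<close>
  have half: "2 * k * integral {a..b} (\<lambda>s. R s * V1 s) - k\<^sup>2 * integral {a..b} R \<le> integral {a..b} (\<lambda>s. R s * (V1 s)\<^sup>2)"
    if "R integrable_on {a..b}" "(\<lambda>s. R s * V1 s) integrable_on {a..b}" "(\<lambda>s. R s * (V1 s)\<^sup>2) integrable_on {a..b}" for k a b
  proof -
    have "integral {a..b} (\<lambda>s. 2 * k * (R s * V1 s) - k\<^sup>2 * R s) \<le> integral {a..b} (\<lambda>s. R s * (V1 s)\<^sup>2)"
    proof (rule integral_le_off_finite[OF _ that(3) B])
      show "(\<lambda>s. 2 * k * (R s * V1 s) - k\<^sup>2 * R s) integrable_on {a..b}"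
        using that by (intro integrable_diff integrable_on_mult_right)
      show "2 * k * (R s * V1 s) - k\<^sup>2 * R s \<le> R s * (V1 s)\<^sup>2" if "s \<in> {a..b} - B" for s
      proof -
        have "0 \<le> R s * (V1 s - k)\<^sup>2" using R0 that by simp
        thus ?thesis by (simp add: power2_diff algebra_simps)
      qed
    qed
    also have "integral {a..b} (\<lambda>s. 2 * k * (R s * V1 s) - k\<^sup>2 * R s) = 2 * k * integral {a..b} (\<lambda>s. R s * V1 s) - k\<^sup>2 * integral {a..b} R"
      using that by (subst Henstock_Kurzweil_Integration.integral_diff) (auto intro: integrable_on_mult_right)
    finally show ?thesis .
  qed
  \<comment> \<open>The two partial masses enter with the same factor - W^2, so their sum 2 S
    suffices: 2 S W^2 + 2 S W^2 - 2 S W^2.\<close>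
  have "2 * W * (S * W) - W\<^sup>2 * integral {s0..S} R \<le> integral {s0..S} (\<lambda>s. R s * (V1 s)\<^sup>2)"
    using half[OF sub(2)[OF i(1)] sub(2)[OF i(2)] sub(2)[OF i(3)], of W] PR by simp
  moreover have "2 * (- W) * (- S * W) - (- W)\<^sup>2 * integral {-S..s0} R \<le> integral {-S..s0} (\<lambda>s. R s * (V1 s)\<^sup>2)"
    using half[OF sub(1)[OF i(1)] sub(1)[OF i(2)] sub(1)[OF i(3)], of "- W"] unfolding PL .
  moreover have "W\<^sup>2 * integral {-S..s0} R + W\<^sup>2 * integral {s0..S} R = W\<^sup>2 * (2 * S)"
    using sub(3)[OF i(1)] R2 by (simp add: distrib_left[symmetric])
  ultimately show "2 * S * W\<^sup>2 \<le> integral {-S..S} (\<lambda>s. R s * (V1 s)\<^sup>2)"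
    using sub(3)[OF i(3)] by (simp add: power2_eq_square algebra_simps)
qed

section \<open>Energy rate of an arbitrary self-similar solution\<close>

lemma initial_state_measurable:
  assumes "weak_solution \<gamma> \<rho> v"
  shows "(\<lambda>x. \<rho> x 0) \<in> borel_measurable borel" "(\<lambda>x. v x 0) \<in> borel_measurable borel"
proof -
  have emb: "(\<lambda>x::real^2. (x, 0::real)) \<in> borel_measurable borel" by (intro borel_measurable_continuous_onI continuous_intros)
  have m: "(\<lambda>z. indicator half_space z *\<^sub>R \<rho> (fst z) (snd z)) \<in> borel_measurable borel" "(\<lambda>z. indicator half_space z *\<^sub>R v (fst z) (snd z)) \<in> borel_measurable borel"
    using assms unfolding weak_solution_def bounded_state_def set_borel_measurable_def case_prod_unfold by auto
  show "(\<lambda>x. \<rho> x 0) \<in> borel_measurable borel" "(\<lambda>x. v x 0) \<in> borel_measurable borel"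
    using measurable_compose[OF emb m(1)] measurable_compose[OF emb m(2)] by simp_all
qed

lemma self_similar_profile:
  assumes g: "1 \<le> \<gamma>" and sol: "self_similar_solution \<gamma> \<rho>m vm \<rho>p vp \<rho> v"
  obtains R V B S M Rl Vl Rr Vr where
    "\<And>x t. t > 0 \<Longrightarrow> \<rho> x t = R (x $ 2 / t) \<and> v x t = V (x $ 2 / t)"
    "R \<in> borel_measurable borel" "\<And>i. (\<lambda>s. V s $ i) \<in> borel_measurable borel" "finite B"
    "\<And>s. s \<notin> B \<Longrightarrow> 0 \<le> R s \<and> R s \<le> M \<and> (\<forall>i. \<bar>V s $ i\<bar> \<le> M)"
    "\<And>s. s \<notin> B \<Longrightarrow> isCont R s \<and> (\<forall>i. isCont (\<lambda>s. V s $ i) s)"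
    "S > 0" "\<And>s. S < \<bar>s\<bar> \<Longrightarrow> s \<notin> B"
    "\<And>s. s < - S \<Longrightarrow> R s = Rl \<and> V s = Vl" "\<And>s. S < s \<Longrightarrow> R s = Rr \<and> V s = Vr"
proof -
  from sol obtain R V B where prof: "\<And>x t. t > 0 \<Longrightarrow> \<rho> x t = R (x $ 2 / t) \<and> v x t = V (x $ 2 / t)" and B: "finite B"
    and C: "\<And>C. C \<in> components (- B) \<Longrightarrow> (R constant_on C \<and> V constant_on C) \<or> rarefaction_on \<gamma> R V C"
    unfolding self_similar_solution_def by blast
  have ws: "weak_solution \<gamma> \<rho> v" using sol unfolding self_similar_solution_def by blast
  hence m: "(\<lambda>z. indicator half_space z *\<^sub>R \<rho> (fst z) (snd z)) \<in> borel_measurable borel" "(\<lambda>z. indicator half_space z *\<^sub>R v (fst z) (snd z)) \<in> borel_measurable borel"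
    unfolding weak_solution_def bounded_state_def set_borel_measurable_def case_prod_unfold by auto
  \<comment> \<open>The profiles are the restrictions of the fields to x_1 = 0, t = 1, which makes
    them Borel measurable.\<close>
  have emb: "(\<lambda>s::real. (s *\<^sub>R (axis 2 1 :: real^2), 1::real)) \<in> borel_measurable borel" by (intro borel_measurable_continuous_onI continuous_intros)
  have a2: "(s *\<^sub>R (axis 2 1 :: real^2)) $ 2 = s" for s :: real by (simp add: axis_def)
  have RV: "\<rho> (s *\<^sub>R axis 2 1) 1 = R s" "v (s *\<^sub>R axis 2 1) 1 = V s" for s using prof[of 1 "s *\<^sub>R axis 2 1"] unfolding a2 by simp_all
  have mR: "R \<in> borel_measurable borel" using measurable_compose[OF emb m(1)] by (simp add: RV)
  have mV: "V \<in> borel_measurable borel" using measurable_compose[OF emb m(2)] by (simp add: RV)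
  have mVi: "(\<lambda>s. V s $ i) \<in> borel_measurable borel" for i by (rule measurable_compose[OF mV component_borel])
  obtain M where "\<And>t. t \<ge> 0 \<Longrightarrow> AE x in lborel. 0 \<le> \<rho> x t \<and> \<rho> x t \<le> M \<and> norm (v x t) \<le> M"
    using ws unfolding weak_solution_def bounded_state_def by blast
  from this[of 1] have "AE x in lborel. 0 \<le> \<rho> x 1 \<and> \<rho> x 1 \<le> M \<and> norm (v x 1) \<le> M" by simp
  hence aex: "AE x in (lborel :: (real^2) measure). 0 \<le> R (x $ 2) \<and> R (x $ 2) \<le> M \<and> norm (V (x $ 2)) \<le> M" by (simp add: prof)
  have ae: "AE s in lborel. 0 \<le> R s \<and> R s \<le> M \<and> norm (V s) \<le> M"
  proof (rule AE_vec2_component2[OF _ aex])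
    have "Measurable.pred borel (\<lambda>s. 0 \<le> R s \<and> R s \<le> M \<and> norm (V s) \<le> M)" using mR mV by measurable
    thus "{s. 0 \<le> R s \<and> R s \<le> M \<and> norm (V s) \<le> M} \<in> sets borel" by simp
  qed
  note cont = profile_isCont[OF _ B C]
  \<comment> \<open>The almost everywhere bounds on the slice t = 1 become pointwise at points of
    continuity, that is, off \<open>B\<close>.\<close>
  have bd: "0 \<le> R s \<and> R s \<le> M \<and> (\<forall>i. \<bar>V s $ i\<bar> \<le> M)" if s: "s \<notin> B" for s
  proof (intro conjI allI)
    have "- R s \<le> 0" by (rule AE_isCont_le[of "\<lambda>s. - R s"]) (use ae cont(1)[OF s] in \<open>auto elim: eventually_mono intro: continuous_intros\<close>)
    thus "0 \<le> R s" by simp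
    show "R s \<le> M" by (rule AE_isCont_le[of R]) (use ae cont(1)[OF s] in \<open>auto elim: eventually_mono\<close>)
    fix i
    have "AE s in lborel. \<bar>V s $ i\<bar> \<le> M"
      using ae by eventually_elim (use component_le_norm_cart order_trans in blast)
    thus "\<bar>V s $ i\<bar> \<le> M" by (rule AE_isCont_le) (intro continuous_intros cont(2)[OF s])
  qed
  \<comment> \<open>The sum of the absolute values exceeds none of its members from below; the 1
    makes S positive even when \<open>B\<close> is empty.\<close>
  define S where "S = 1 + (\<Sum>b\<in>B. \<bar>b\<bar>)"
  have S: "S > 0" unfolding S_def by (smt (verit) sum_nonneg abs_ge_zero)
  have SB: "s \<notin> B" if "S < \<bar>s\<bar>" for s using member_le_sum[of s B "\<lambda>b. \<bar>b\<bar>"] B that unfolding S_def by auto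
  have "R constant_on {..<- S} \<and> V constant_on {..<- S}"
  proof (rule outer_constant[OF g _ _ _ _ C])
    show "{..<- S} \<subseteq> - B" using SB S by auto
    show "\<exists>s\<in>{..<- S}. K < \<bar>s\<bar>" for K using S by (intro bexI[of _ "- S - \<bar>K\<bar> - 1"]) auto
  qed (use bd in auto)
  moreover have "R constant_on {S<..} \<and> V constant_on {S<..}"
  proof (rule outer_constant[OF g _ _ _ _ C])
    show "{S<..} \<subseteq> - B" using SB S by auto
    show "\<exists>s\<in>{S<..}. K < \<bar>s\<bar>" for K using S by (intro bexI[of _ "S + \<bar>K\<bar> + 1"]) auto
  qed (use bd in auto)
  ultimately obtain Rl Vl Rr Vr where o: "\<And>s. s < - S \<Longrightarrow> R s = Rl \<and> V s = Vl" "\<And>s. S < s \<Longrightarrow> R s = Rr \<and> V s = Vr"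
    unfolding constant_on_def by (metis greaterThan_iff lessThan_iff)
  show ?thesis by (rule that[OF prof mR mVi B bd _ S SB o]) (use cont in auto)
qed

text \<open>This holds for every self-similar solution of the vortex sheet data, whatever waves it
  contains: its weak form is turned into integrated identities for mass and tangential momentum of
  the profile, which feed \<open>tangential_energy_ge\<close>. Convexity of the internal energy and
  the sign of the normal kinetic energy supply the rest.\<close>

lemma self_similar_energy_rate:
  assumes g: "1 \<le> \<gamma>" and sol: "self_similar_solution \<gamma> 1 ((- W) *\<^sub>R axis 1 1) 1 (W *\<^sub>R axis 1 1) \<rho> v"
  obtains d where "0 \<le> d" "\<And>L. L > 0 \<Longrightarrow> has_energy_rate \<gamma> L \<rho> v 0 (L * d)"
proof -
  obtain R V B S M Rl Vl Rr Vr where prof: "\<And>x t. t > 0 \<Longrightarrow> \<rho> x t = R (x $ 2 / t) \<and> v x t = V (x $ 2 / t)"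
    and m: "R \<in> borel_measurable borel" "\<And>i. (\<lambda>s. V s $ i) \<in> borel_measurable borel" and B: "finite B"
    and bd: "\<And>s. s \<notin> B \<Longrightarrow> 0 \<le> R s \<and> R s \<le> M \<and> (\<forall>i. \<bar>V s $ i\<bar> \<le> M)"
    and cont: "\<And>s. s \<notin> B \<Longrightarrow> isCont R s \<and> (\<forall>i. isCont (\<lambda>s. V s $ i) s)"
    and S: "S > 0" and SB: "\<And>s. S < \<bar>s\<bar> \<Longrightarrow> s \<notin> B"
    and outer: "\<And>s. s < - S \<Longrightarrow> R s = Rl \<and> V s = Vl" "\<And>s. S < s \<Longrightarrow> R s = Rr \<and> V s = Vr"
    by (rule self_similar_profile[OF g sol]) (rule that)
  have ws: "weak_solution \<gamma> \<rho> v"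
    and init: "\<And>x. x $ 2 < 0 \<Longrightarrow> \<rho> x 0 = 1 \<and> v x 0 = (- W) *\<^sub>R axis 1 1" "\<And>x. x $ 2 > 0 \<Longrightarrow> \<rho> x 0 = 1 \<and> v x 0 = W *\<^sub>R axis 1 1"
    using sol unfolding self_similar_solution_def by blast+
  obtain KR where KR: "\<And>s. \<bar>R s\<bar> \<le> KR" by (rule bounded_off_finite[OF B, of R M]) (use bd in force, rule that)
  obtain K1 where K1: "\<And>s. \<bar>V s $ 1\<bar> \<le> K1" by (rule bounded_off_finite[OF B, of "\<lambda>s. V s $ 1" M]) (use bd in force, rule that)
  obtain K2 where K2: "\<And>s. \<bar>V s $ 2\<bar> \<le> K2" by (rule bounded_off_finite[OF B, of "\<lambda>s. V s $ 2" M]) (use bd in force, rule that)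
  have "\<bar>pressure \<gamma> (R s)\<bar> \<le> M powr \<gamma>" if "s \<notin> B" for s
    unfolding pressure_def using bd[OF that] g by (auto intro: powr_mono2)
  then obtain Kp where Kp: "\<And>s. \<bar>pressure \<gamma> (R s)\<bar> \<le> Kp" by (rule bounded_off_finite[OF B]) (assumption, rule that)
  define Q where "Q = 1 + \<bar>KR\<bar> + \<bar>K1\<bar> + \<bar>K2\<bar> + \<bar>Kp\<bar>"
  have Q: "1 \<le> Q" "\<bar>R s\<bar> \<le> Q" "\<bar>V s $ i\<bar> \<le> Q" "\<bar>pressure \<gamma> (R s)\<bar> \<le> Q" for s i
    unfolding Q_def using KR[of s] K1[of s] K2[of s] Kp[of s] exhaust_2[of i] by auto
  have p2: "\<bar>x * y\<bar> \<le> Q * Q" if "\<bar>x\<bar> \<le> Q" "\<bar>y\<bar> \<le> Q" for x y :: real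
    unfolding abs_mult using that Q(1) by (intro mult_mono) auto
  have p3: "\<bar>x * y * z\<bar> \<le> Q * Q * Q" if "\<bar>x\<bar> \<le> Q" "\<bar>y\<bar> \<le> Q" "\<bar>z\<bar> \<le> Q" for x y z :: real
    unfolding abs_mult[of "x * y"] using that p2[OF that(1,2)] Q(1) by (intro mult_mono) auto
  have QQ: "Q \<le> Q * Q" "Q * Q \<le> Q * Q * Q" "0 \<le> Q" using Q(1) mult_left_mono[of 1 Q Q] mult_left_mono[of 1 Q "Q * Q"] by simp_all
  define K where "K = Q * Q * Q + Q"
  have K: "\<bar>R s\<bar> \<le> K" "\<bar>R s * V s $ i\<bar> \<le> K" "\<bar>R s * V s $ i * V s $ j\<bar> \<le> K" "\<bar>R s * V s $ i * V s $ j + pressure \<gamma> (R s)\<bar> \<le> K" for s i j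
    using Q(2)[of s] Q(4)[of s] p2[OF Q(2)[of s] Q(3)[of s i]] p3[OF Q(2)[of s] Q(3)[of s i] Q(3)[of s j]] QQ
    unfolding K_def abs_le_iff by linarith+
  have mp: "(\<lambda>s. pressure \<gamma> (R s)) \<in> borel_measurable borel" unfolding pressure_def using m(1) by measurable

  \<comment> \<open>The given solution with its initial values on x_2 = 0 replaced, so that it is
    bounded at every point.\<close>
  define \<rho>' where "\<rho>' x t = (if t = 0 then 1 else R (x $ 2 / t))" for x :: "real^2" and t :: real
  define v' where "v' x t = (if t = 0 then (if x $ 2 \<le> 0 then (- W) *\<^sub>R axis 1 1 else W *\<^sub>R axis 1 1) else V (x $ 2 / t))" for x :: "real^2" and t :: real
  have ms: "(\<lambda>z :: (real^2) \<times> real. fst z $ 2) \<in> borel_measurable borel" "(\<lambda>z :: (real^2) \<times> real. snd z) \<in> borel_measurable borel"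
    by (intro borel_measurable_continuous_onI continuous_intros)+
  have mss: "(\<lambda>z :: (real^2) \<times> real. fst z $ 2 / snd z) \<in> borel_measurable borel" by (rule borel_measurable_divide[OF ms])
  have m\<rho>': "(\<lambda>z. \<rho>' (fst z) (snd z)) \<in> borel_measurable borel"
    unfolding \<rho>'_def using measurable_compose[OF mss m(1)] ms by measurable
  have mV: "V \<in> borel_measurable borel"
    using m(2) by (subst borel_measurable_euclidean_space) (auto simp: Basis_vec_def inner_axis)
  have mv': "(\<lambda>z. v' (fst z) (snd z)) \<in> borel_measurable borel"
    unfolding v'_def using measurable_compose[OF mss mV] ms by measurable
  have mv'i: "(\<lambda>z. v' (fst z) (snd z) $ i) \<in> borel_measurable borel" for i
    by (rule measurable_compose[OF mv' component_borel])
  have ws': "weak_solution \<gamma> \<rho>' v'"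
  proof (rule weak_solution_cong[OF ws])
    show "set_borel_measurable borel half_space (\<lambda>(x, t). \<rho>' x t)" "set_borel_measurable borel half_space (\<lambda>(x, t). v' x t)"
      unfolding set_borel_measurable_def case_prod_unfold using half_space_borel m\<rho>' mv'
      by (auto intro!: borel_measurable_scaleR borel_measurable_indicator)
    show "\<rho>' x t = \<rho> x t \<and> v' x t = v x t" if "0 \<le> t" "t \<noteq> 0 \<or> x $ 2 \<noteq> 0" for x t
      using that prof[of t x] init[of x] unfolding \<rho>'_def v'_def by auto
  qed
  define N where "N = Q + \<bar>W\<bar>"
  have b\<rho>': "\<bar>\<rho>' x t\<bar> \<le> N" for x t unfolding \<rho>'_def N_def using Q(1) Q(2)[of "x $ 2 / t"] by auto
  have bv': "\<bar>v' x t $ i\<bar> \<le> N" for x t i unfolding v'_def N_def using Q(1) Q(3)[of "x $ 2 / t" i] by (auto simp: axis_def)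
  have bmI: "bounded_measurable (\<lambda>(x, t). f x t)"
    if "(\<lambda>z. f (fst z) (snd z)) \<in> borel_measurable borel" "\<And>x t. \<bar>f x t\<bar> \<le> k" for f :: "real^2 \<Rightarrow> real \<Rightarrow> real" and k
    unfolding bounded_measurable_def case_prod_unfold
    using that by (auto intro!: borel_measurable_times borel_measurable_indicator half_space_borel)
  have bm: "bounded_measurable (\<lambda>(x, t). \<rho>' x t)" "bounded_measurable (\<lambda>(x, t). v' x t $ i)"
    "bounded_measurable (\<lambda>(x, t). pressure \<gamma> (\<rho>' x t))" for i
  proof -
    show "bounded_measurable (\<lambda>(x, t). \<rho>' x t)" by (rule bmI[OF m\<rho>' b\<rho>'])
    show "bounded_measurable (\<lambda>(x, t). v' x t $ i)" by (rule bmI[OF mv'i bv'])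
    show "bounded_measurable (\<lambda>(x, t). pressure \<gamma> (\<rho>' x t))"
    proof (rule bmI)
      show "(\<lambda>z. pressure \<gamma> (\<rho>' (fst z) (snd z))) \<in> borel_measurable borel" unfolding pressure_def using m\<rho>' by measurable
      show "\<bar>pressure \<gamma> (\<rho>' x t)\<bar> \<le> Q" for x t using Q(1) Q(4)[of "x $ 2 / t"] unfolding \<rho>'_def by (auto simp: pressure_def)
    qed
  qed
  have bmq: "bounded_measurable (\<lambda>(x, t). \<rho>' x t * v' x t $ i)" "bounded_measurable (\<lambda>(x, t). \<rho>' x t * v' x t $ i * v' x t $ j + (if c then pressure \<gamma> (\<rho>' x t) else 0))" for i j c
    using bm bounded_measurable_intros(1)[of 0] unfolding case_prod_unfold by (cases c; auto intro!: bounded_measurable_intros(2,3))+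
  have mass': "mass_balance \<rho>' v'" using ws' unfolding mass_balance_iff weak_solution_def by blast
  have mom': "momentum_balance \<gamma> \<rho>' v' i" for i by (rule weak_solution_momentum_balance[OF ws'])
  \<comment> \<open>Both outer states at once, the sign of y choosing the side. For |x_2 - y| \<le>
    2 and 0 < t \<le> 2 one has |x_2| \<ge> 2 S + 1 > S t, so such points lie outside the
    fan.\<close>
  have far: "r = 1 \<and> u = (sgn y * W) *\<^sub>R axis 1 1"
    if y: "\<bar>y\<bar> = 2 * S + 3" and const: "\<And>s. S < sgn y * s \<Longrightarrow> R s = r \<and> V s = u" for y r u
  proof -
    have s: "S < sgn y * (x $ 2 / t)" if "0 < t" "t \<le> 2" "\<bar>x $ 2 - y\<bar> \<le> 2" for x :: "real^2" and t
    proof -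
      have "S * t \<le> S * 2" using that(2) S by (intro mult_left_mono) auto
      also have "\<dots> < sgn y * x $ 2" using that(3) y S by (cases "y > 0") (auto simp: sgn_if abs_if split: if_splits)
      finally show ?thesis using that(1) by (simp add: pos_less_divide_eq)
    qed
    have eq: "\<rho>' x t = r \<and> v' x t = u" if "0 < t" "t \<le> 2" "\<bar>x $ 2 - y\<bar> \<le> 2" for x t
      using const[OF s[OF that]] that(1) unfolding \<rho>'_def v'_def by simp
    have eq0: "\<rho>' x 0 = 1 \<and> v' x 0 = (sgn y * W) *\<^sub>R axis 1 1" if "\<bar>x $ 2 - y\<bar> \<le> 2" for x
      using that y S unfolding \<rho>'_def v'_def by (cases "y > 0") (auto simp: sgn_if abs_if split: if_splits)
    have r: "r = 1"
    proof (rule outer_state[OF mass'[unfolded mass_balance_def] bm(1) bmq(1) bmq(1)])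
      show "(case (x, t) of (x, t) \<Rightarrow> \<rho>' x t) = r \<and> (case (x, t) of (x, t) \<Rightarrow> \<rho>' x t * v' x t $ 1) = r * u $ 1 \<and>
        (case (x, t) of (x, t) \<Rightarrow> \<rho>' x t * v' x t $ 2) = r * u $ 2" if "0 < t" "t \<le> 2" "\<bar>x $ 2 - y\<bar> \<le> 2" for x t
        using eq[OF that] by simp
      show "\<rho>' x 0 = 1" if "\<bar>x $ 2 - y\<bar> \<le> 2" for x using eq0[OF that] by simp
    qed
    have "r * u $ i = ((sgn y * W) *\<^sub>R axis 1 1 :: real^2) $ i" for i
    proof (rule outer_state[OF mom'[unfolded momentum_balance_def] bmq(1) bmq(2) bmq(2)])
      show "(case (x, t) of (x, t) \<Rightarrow> \<rho>' x t * v' x t $ i) = r * u $ i \<and>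
        (case (x, t) of (x, t) \<Rightarrow> \<rho>' x t * v' x t $ i * v' x t $ 1 + (if i = 1 then pressure \<gamma> (\<rho>' x t) else 0))
          = r * u $ i * u $ 1 + (if i = 1 then pressure \<gamma> r else 0) \<and>
        (case (x, t) of (x, t) \<Rightarrow> \<rho>' x t * v' x t $ i * v' x t $ 2 + (if i = 2 then pressure \<gamma> (\<rho>' x t) else 0))
          = r * u $ i * u $ 2 + (if i = 2 then pressure \<gamma> r else 0)" if "0 < t" "t \<le> 2" "\<bar>x $ 2 - y\<bar> \<le> 2" for x t
        using eq[OF that] by simp
      show "\<rho>' x 0 * v' x 0 $ i = ((sgn y * W) *\<^sub>R axis 1 1 :: real^2) $ i" if "\<bar>x $ 2 - y\<bar> \<le> 2" for x using eq0[OF that] by simp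
    qed
    thus ?thesis using r by (simp add: vec_eq_iff)
  qed
  have right: "R s = 1 \<and> V s = W *\<^sub>R axis 1 1" if "S < s" for s
  proof -
    have "Rr = 1 \<and> Vr = (sgn (2 * S + 3) * W) *\<^sub>R axis 1 1"
      by (rule far) (use S outer(2) in auto)
    thus ?thesis using outer(2)[OF that] S by simp
  qed
  have left: "R s = 1 \<and> V s = (- W) *\<^sub>R axis 1 1" if "s < - S" for s
  proof -
    have "Rl = 1 \<and> Vl = (sgn (- (2 * S + 3)) * W) *\<^sub>R axis 1 1"
      by (rule far) (use S outer(1) in auto)
    moreover have "sgn (- (2 * S + 3)) = - 1" using S by (simp add: sgn_if)
    ultimately show ?thesis using outer(1)[OF that] by simp
  qed

  \<comment> \<open>Strictly outside S, so that T and - T avoid \<open>B\<close> and carry the known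
    outer states.\<close>
  define T where "T = S + 1"
  have T: "0 < T" "S < T" "T \<notin> B" "- T \<notin> B" unfolding T_def using S SB[of "S + 1"] SB[of "- (S + 1)"] by auto
  have RT: "R T = 1" "R (- T) = 1" "V T $ 1 = W" "V (- T) $ 1 = - W" "V T $ 2 = 0" "V (- T) $ 2 = 0"
    using right[of T] left[of "- T"] T(2) by (auto simp: axis_def)
  have ibl: "integrable lborel (\<lambda>s. indicator {a..b} s * f s)" "f integrable_on {a..b}" "integral\<^sup>L lborel (\<lambda>s. indicator {a..b} s * f s) = integral {a..b} f"
    if f: "f \<in> borel_measurable borel" "\<And>s. \<bar>f s\<bar> \<le> k" for f :: "real \<Rightarrow> real" and k a b
  proof -
    have "set_integrable lborel {a..b} f"
      unfolding set_integrable_def real_scaleR_def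
    proof (rule Bochner_Integration.integrable_bound[of lborel "\<lambda>s. k * indicator {a..b} s"])
      show "integrable lborel (\<lambda>s. k * indicator {a..b} s)"
        by (intro integrable_mult_right integrable_real_indicator) (auto simp: emeasure_lborel_Icc_eq)
      show "(\<lambda>s. indicator {a..b} s * f s) \<in> borel_measurable lborel" using f(1) by measurable
      have "norm (indicator {a..b} s * f s) \<le> norm (k * indicator {a..b} s)" for s
        using f(2)[of s] by (auto simp: indicator_def)
      thus "AE s in lborel. norm (indicator {a..b} s * f s) \<le> norm (k * indicator {a..b} s)" by simp
    qed
    thus "integrable lborel (\<lambda>s. indicator {a..b} s * f s)" "f integrable_on {a..b}" "integral\<^sup>L lborel (\<lambda>s. indicator {a..b} s * f s) = integral {a..b} f"
      using set_borel_integral_eq_integral[of "{a..b}" f] unfolding set_integrable_def set_lebesgue_integral_def by simp_all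
  qed
  have mq: "(\<lambda>s. R s * V s $ i) \<in> borel_measurable borel" "(\<lambda>s. R s * V s $ i * V s $ j) \<in> borel_measurable borel"
    "(\<lambda>s. R s * V s $ i * V s $ j + pressure \<gamma> (R s)) \<in> borel_measurable borel" for i j using m mp by measurable
  have mass_eq: "T - (R c * V c $ 2 - c * R c) = integral {-T..c} R" if c: "- T < c" "c \<notin> B" for c
  proof -
    \<comment> \<open>The known left state makes the first bracket equal to T, the mass that the
      left half of {-T..T} holds initially.\<close>
    have "(R (- T) * V (- T) $ 2 - (- T) * R (- T)) - (R c * V c $ 2 - c * R c) = integral {-T..c} R"
    proof (rule du_bois_reymond[OF _ m(1) _ K(1) _ _ _ c(1)])
      show "(\<lambda>s. R s * V s $ 2 - s * R s) \<in> borel_measurable borel" using m by measurable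
      show "integral\<^sup>L lborel (\<lambda>s. (R s * V s $ 2 - s * R s) * g' s) = integral\<^sup>L lborel (\<lambda>s. R s * g s)"
        if g: "\<And>k. Ck k g" "\<And>s. (g has_real_derivative g' s) (at s)" "\<And>s. k < \<bar>s\<bar> \<Longrightarrow> g s = 0" for g g' k
        by (rule self_similar_balance[where M = K and ?B1.0 = "\<lambda>s. R s * V s $ 1",
              OF mass'[unfolded mass_balance_def] _ m(1) mq(1) mq(1) _ g]) (use K in \<open>auto simp: \<rho>'_def v'_def\<close>)
      show "\<bar>R s * V s $ 2 - s * R s\<bar> \<le> K + r * K" if "\<bar>s\<bar> \<le> r" for r s
      proof -
        have "\<bar>s * R s\<bar> \<le> r * K" unfolding abs_mult using that K(1)[of s] by (intro mult_mono) auto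
        thus ?thesis using K(2)[of s 2] by linarith
      qed
      show "isCont (\<lambda>s. R s * V s $ 2 - s * R s) (- T)" "isCont (\<lambda>s. R s * V s $ 2 - s * R s) c"
        using cont[OF T(4)] cont[OF c(2)] by (auto intro!: continuous_intros)
    qed
    thus ?thesis using RT by simp
  qed
  have mom_eq: "- T * W - (R c * V c $ 1 * V c $ 2 - c * (R c * V c $ 1)) = integral {-T..c} (\<lambda>s. R s * V s $ 1)" if c: "- T < c" "c \<notin> B" for c
  proof -
    have "(R (- T) * V (- T) $ 1 * V (- T) $ 2 - (- T) * (R (- T) * V (- T) $ 1)) - (R c * V c $ 1 * V c $ 2 - c * (R c * V c $ 1))
       = integral {-T..c} (\<lambda>s. R s * V s $ 1)"
    proof (rule du_bois_reymond[OF _ mq(1) _ K(2) _ _ _ c(1)])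
      show "(\<lambda>s. R s * V s $ 1 * V s $ 2 - s * (R s * V s $ 1)) \<in> borel_measurable borel" using m by measurable
      show "integral\<^sup>L lborel (\<lambda>s. (R s * V s $ 1 * V s $ 2 - s * (R s * V s $ 1)) * g' s) = integral\<^sup>L lborel (\<lambda>s. R s * V s $ 1 * g s)"
        if g: "\<And>k. Ck k g" "\<And>s. (g has_real_derivative g' s) (at s)" "\<And>s. k < \<bar>s\<bar> \<Longrightarrow> g s = 0" for g g' k
        by (rule self_similar_balance[where M = K and ?B1.0 = "\<lambda>s. R s * V s $ 1 * V s $ 1 + pressure \<gamma> (R s)",
              OF mom'[of 1, unfolded momentum_balance_def] _ mq(1) mq(3) mq(2) _ g]) (use K in \<open>auto simp: \<rho>'_def v'_def\<close>)
      show "\<bar>R s * V s $ 1 * V s $ 2 - s * (R s * V s $ 1)\<bar> \<le> K + r * K" if "\<bar>s\<bar> \<le> r" for r s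
      proof -
        have "\<bar>s * (R s * V s $ 1)\<bar> \<le> r * K" unfolding abs_mult[of s] using that K(2)[of s 1] by (intro mult_mono) auto
        thus ?thesis using K(3)[of s 1 2] by linarith
      qed
      show "isCont (\<lambda>s. R s * V s $ 1 * V s $ 2 - s * (R s * V s $ 1)) (- T)" "isCont (\<lambda>s. R s * V s $ 1 * V s $ 2 - s * (R s * V s $ 1)) c"
        using cont[OF T(4)] cont[OF c(2)] by (auto intro!: continuous_intros)
    qed
    thus ?thesis using RT by simp
  qed
  have sq: "(\<lambda>s. R s * (V s $ 1)\<^sup>2) = (\<lambda>s. R s * V s $ 1 * V s $ 1)" by (simp add: power2_eq_square mult.assoc)
  have iq: "R integrable_on {a..b}" "(\<lambda>s. R s * V s $ 1) integrable_on {a..b}" "(\<lambda>s. R s * (V s $ 1)\<^sup>2) integrable_on {a..b}" for a b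
    unfolding sq using ibl(2)[OF m(1) K(1)] ibl(2)[OF mq(1) K(2)] ibl(2)[OF mq(2) K(3)] by auto
  have IR: "integral {-T..T} R = 2 * T" and IV: "2 * T * W\<^sup>2 \<le> integral {-T..T} (\<lambda>s. R s * (V s $ 1)\<^sup>2)"
    by (rule tangential_energy_ge[OF T(1) B Q(3) _ iq mass_eq mom_eq T(3) RT(1,3,5)]; use bd in blast)+

  define e where "e s = energy_density \<gamma> (R s) (V s)" for s
  define e0 where "e0 = internal_energy \<gamma> 1 + W\<^sup>2 / 2"
  have e_eq: "e s = R s * internal_energy \<gamma> (R s) + R s * V s $ 1 * V s $ 1 / 2 + R s * V s $ 2 * V s $ 2 / 2" for s
    unfolding e_def energy_density_def power2_norm_eq_inner inner_vec_def sum_2 by (simp add: algebra_simps add_divide_distrib)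
  have me: "e \<in> borel_measurable borel"
  proof -
    have "(\<lambda>s. internal_energy \<gamma> (R s)) \<in> borel_measurable borel" unfolding internal_energy_def using m(1) by measurable
    thus ?thesis unfolding e_eq[abs_def] using m by measurable
  qed
  obtain Ki where Ki: "\<And>r. 0 \<le> r \<Longrightarrow> r \<le> M \<Longrightarrow> \<bar>r * internal_energy \<gamma> r\<bar> \<le> Ki" by (rule internal_energy_bounded[OF g]) (rule that)
  have "\<bar>e s\<bar> \<le> Ki + K" if "s \<notin> B" for s
    unfolding e_eq using Ki[of "R s"] bd[OF that] K(3)[of s 1 1] K(3)[of s 2 2] by linarith
  then obtain Ke where Ke: "\<And>s. \<bar>e s\<bar> \<le> Ke" by (rule bounded_off_finite[OF B]) (assumption, rule that)
  have e_out: "e s = e0" if "T < \<bar>s\<bar>" for s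
  proof -
    have "S < s \<or> s < - S" using that T(2) by (auto simp: abs_if split: if_splits)
    hence "R s = 1" "V s $ 1 = W \<or> V s $ 1 = - W" "V s $ 2 = 0" using right[of s] left[of s] by (auto simp: axis_def)
    thus ?thesis unfolding e_eq e0_def by (auto simp: power2_eq_square)
  qed
  obtain l where l: "\<And>r. 0 \<le> r \<Longrightarrow> internal_energy \<gamma> 1 + l * (r - 1) \<le> r * internal_energy \<gamma> r"
    by (rule internal_energy_convex[OF g]) (rule that)
  \<comment> \<open>Tangent line of the internal energy plus tangential kinetic energy; the normal
    part is dropped. As the total mass is 2 T, the slope l cancels on integration.\<close>
  let ?lower = "\<lambda>s. (internal_energy \<gamma> 1 - l) + (l * R s + 1 / 2 * (R s * (V s $ 1)\<^sup>2))"
  have J: "2 * T * e0 \<le> integral {-T..T} e"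
  proof -
    have il: "(\<lambda>s. l * R s + 1 / 2 * (R s * (V s $ 1)\<^sup>2)) integrable_on {-T..T}"
      by (intro integrable_add integrable_on_mult_right iq)
    have "integral {-T..T} ?lower \<le> integral {-T..T} e"
    proof (rule integral_le_off_finite[OF _ ibl(2)[OF me Ke] B])
      show "?lower integrable_on {-T..T}" by (intro integrable_add il integrable_const_ivl)
      show "?lower s \<le> e s" if "s \<in> {-T..T} - B" for s
      proof -
        have "0 \<le> R s" using bd that by blast
        moreover from this have "0 \<le> R s * V s $ 2 * V s $ 2" by (simp add: mult.assoc)
        moreover from \<open>0 \<le> R s\<close> have "internal_energy \<gamma> 1 + (l * R s - l) \<le> R s * internal_energy \<gamma> (R s)"
          using l[of "R s"] by (simp add: right_diff_distrib)
        moreover have "R s * (V s $ 1)\<^sup>2 = R s * V s $ 1 * V s $ 1" by (simp add: power2_eq_square)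
        ultimately show ?thesis unfolding e_eq by linarith
      qed
    qed
    moreover have "integral {-T..T} ?lower = (internal_energy \<gamma> 1 - l) * (2 * T) + (l * (2 * T) + 1 / 2 * integral {-T..T} (\<lambda>s. R s * (V s $ 1)\<^sup>2))"
    proof (rule integral_unique)
      have h1: "((\<lambda>_. internal_energy \<gamma> 1 - l) has_integral (internal_energy \<gamma> 1 - l) * (2 * T)) {-T..T}"
        using has_integral_const_real[of "internal_energy \<gamma> 1 - l" "-T" T] T(1) by (simp add: mult.commute)
      have h2: "(R has_integral 2 * T) {-T..T}" using integrable_integral[OF iq(1)[of "-T" T]] unfolding IR .
      show "(?lower has_integral (internal_energy \<gamma> 1 - l) * (2 * T) + (l * (2 * T) + 1 / 2 * integral {-T..T} (\<lambda>s. R s * (V s $ 1)\<^sup>2))) {-T..T}"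
        by (intro has_integral_add h1 has_integral_mult_right h2 integrable_integral iq)
    qed
    ultimately show ?thesis using IV unfolding e0_def by (simp add: algebra_simps)
  qed
  \<comment> \<open>With x_2 = t s, the energy changes by 2 L t times the excess of the profile
    energy in {-T..T} over the outer energy density e0.\<close>
  define d where "d = 2 * (integral {-T..T} e - 2 * T * e0)"
  have en: "energy \<gamma> L \<rho> v t = 4 * L\<^sup>2 * e0 + t * (L * d)" if L: "L > 0" and t: "0 \<le> t" "t < L / T" for L t
  proof (cases "t = 0")
    case True
    have "energy \<gamma> L \<rho> v t = 2 * L * integral\<^sup>L lborel (\<lambda>s. indicator {-L<..<L} s * e0)"
    proof (rule energy_planar[OF L, where c = 0])
      show "energy_density \<gamma> (\<rho> x t) (v x t) = e0" if "x $ 2 \<noteq> 0" for x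
        using init[of x] that True unfolding energy_density_def e0_def by (cases "x $ 2 < 0") auto
      have "(\<lambda>x. internal_energy \<gamma> (\<rho> x 0)) \<in> borel_measurable borel"
        unfolding internal_energy_def using initial_state_measurable(1)[OF ws] by measurable
      thus "(\<lambda>x. energy_density \<gamma> (\<rho> x t) (v x t)) \<in> borel_measurable borel"
        unfolding energy_density_def True using initial_state_measurable[OF ws] by measurable
    qed simp
    thus ?thesis using L True by (simp add: power2_eq_square)
  next
    case False
    hence t0: "t > 0" using t by simp
    have tT: "t * T < L" using t T by (simp add: pos_less_divide_eq)
    have met: "(\<lambda>s. e (s / t)) \<in> borel_measurable borel" by (rule measurable_compose[OF _ me]) simp
    have ed: "energy_density \<gamma> (\<rho> x t) (v x t) = e (x $ 2 / t)" for x using prof[OF t0, of x] unfolding e_def by simp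
    have "energy \<gamma> L \<rho> v t = 2 * L * integral\<^sup>L lborel (\<lambda>s. indicator {-L<..<L} s * e (s / t))"
    proof (rule energy_planar[OF L met, where c = 0])
      show "(\<lambda>x. energy_density \<gamma> (\<rho> x t) (v x t)) \<in> borel_measurable borel"
        unfolding ed by (rule measurable_compose[OF component_borel met])
    qed (rule ed)
    also have "integral\<^sup>L lborel (\<lambda>s. indicator {-L<..<L} s * e (s / t)) = t * integral\<^sup>L lborel (\<lambda>s. indicator {-L<..<L} (t * s) * e s)"
      using lborel_integral_real_affine[of t "\<lambda>s. indicator {-L<..<L} s * e (s / t)" 0] t0 by simp
    also have "(\<lambda>s. indicator {-L<..<L} (t * s) * e s) = (\<lambda>s. indicator {-T..T} s * e s + (e0 * indicator {-(L/t)<..<L/t} s - e0 * indicator {-T..T} s))"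
    proof
      fix s
      have mem: "t * s \<in> {-L<..<L} \<longleftrightarrow> s \<in> {-(L/t)<..<L/t}" using t0 by (auto simp: field_simps)
      have "T < L / t" using tT t0 by (simp add: field_simps)
      thus "indicator {-L<..<L} (t * s) * e s = indicator {-T..T} s * e s + (e0 * indicator {-(L/t)<..<L/t} s - e0 * indicator {-T..T} s)"
        using e_out[of s] mem by (cases "s \<in> {-T..T}") (auto simp: indicator_def abs_if)
    qed
    also have "integral\<^sup>L lborel \<dots> = integral {-T..T} e + (e0 * (2 * (L / t)) - e0 * (2 * T))"
    proof -
      have i1: "integrable lborel (\<lambda>s. e0 * indicator {-(L/t)<..<L/t} s)" "integrable lborel (\<lambda>s. e0 * indicator {-T..T} s)"
        by (intro integrable_mult_right integrable_real_indicator; use L t0 T in simp)+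
      have v1: "integral\<^sup>L lborel (\<lambda>s. e0 * indicator {-(L/t)<..<L/t} s) = e0 * (2 * (L / t))" "integral\<^sup>L lborel (\<lambda>s. e0 * indicator {-T..T} s) = e0 * (2 * T)"
        using L t0 T by simp_all
      show ?thesis
        unfolding Bochner_Integration.integral_add[OF ibl(1)[OF me Ke] Bochner_Integration.integrable_diff[OF i1]]
          Bochner_Integration.integral_diff[OF i1] ibl(3)[OF me Ke] v1 ..
    qed
    also have "t * (integral {-T..T} e + (e0 * (2 * (L / t)) - e0 * (2 * T))) = t * (integral {-T..T} e - 2 * T * e0) + 2 * L * e0"
      using t0 by (simp add: field_simps)
    finally show ?thesis unfolding d_def by (simp add: algebra_simps power2_eq_square)
  qed
  show ?thesis
  proof (rule that[of d])
    show "0 \<le> d" unfolding d_def using J by simp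
    show "has_energy_rate \<gamma> L \<rho> v 0 (L * d)" if "L > 0" for L
      by (rule energy_rate_linear[of "L / T"]) (use en[OF that] that T in auto)
  qed
qed

section \<open>Existence of the self-similar solution, and conclusion\<close>

text \<open>The stationary sheet, a contact discontinuity that satisfies the energy balance with
  equality. It ensures that the claim about all self-similar solutions is not vacuous.\<close>

lemma vortex_sheet_self_similar:
  obtains \<rho> v where "self_similar_solution \<gamma> 1 ((- W) *\<^sub>R axis 1 1) 1 (W *\<^sub>R axis 1 1) \<rho> v"
proof -
  define V where "V s = (- W + 2 * W * indicator {0<..} s) *\<^sub>R (axis 1 1 :: real^2)" for s :: real
  define v where "v x t = (- W + 2 * W * indicator (strip_region 0 {0<..}) (x, t)) *\<^sub>R (axis 1 1 :: real^2)" for x :: "real^2" and t :: real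
  define \<rho> where "\<rho> x t = (1::real)" for x :: "real^2" and t :: real
  have c: "v x t $ 1 = - W + 2 * W * indicator (strip_region 0 {0<..}) (x, t)" "v x t $ 2 = 0" for x t
    unfolding v_def by (simp_all add: axis_def)
  have v0: "v x 0 $ 1 = - W + 2 * W * indicator {0<..} (x $ 2)" for x unfolding c by (simp add: strip_region_def indicator_def)
  have n: "norm (v x t) = \<bar>W\<bar>" for x t unfolding v_def by (auto simp: indicator_def)
  have fan: "weak_balance (\<lambda>z. A) (\<lambda>z. k + l * indicator (strip_region 0 {0<..}) z) (\<lambda>z. B) (\<lambda>x. A)" for A B k l
    using fan_balance[where n = 1 and s = "\<lambda>_. 0" and a = "\<lambda>_. 0" and c = "\<lambda>_. l" and ?A0.0 = A and ?B0.0 = B and ?C0.0 = k] by simp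
  have fan1: "weak_balance (\<lambda>z. A + a * indicator (strip_region 0 {0<..}) z) (\<lambda>z. k) (\<lambda>z. B) (\<lambda>x. A + a * indicator {0<..} (x $ 2))" for A B k a
    using fan_balance[where n = 1 and s = "\<lambda>_. 0" and a = "\<lambda>_. a" and c = "\<lambda>_. 0" and ?A0.0 = A and ?B0.0 = B and ?C0.0 = k] by simp
  have bH: "bounded_measurable (indicator (strip_region 0 {0<..}))" by (rule bounded_measurable_strip) simp
  have mH: "(\<lambda>z. indicator (strip_region 0 {0<..}) z :: real) \<in> borel_measurable borel"
    by (intro borel_measurable_indicator strip_region_borel) simp
  have mv: "(\<lambda>z. v (fst z) (snd z)) \<in> borel_measurable borel" unfolding v_def prod.collapse using mH by measurable
  have emb: "(\<lambda>x::real^2. (x, 0::real)) \<in> borel_measurable borel" by (intro borel_measurable_continuous_onI continuous_intros)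
  have bs: "bounded_state \<rho> v"
    unfolding bounded_state_def set_borel_measurable_def case_prod_unfold
  proof (intro conjI exI[of _ "1 + \<bar>W\<bar>"] allI impI AE_I2)
    show "(\<lambda>x. indicator half_space x *\<^sub>R \<rho> (fst x) (snd x)) \<in> borel_measurable borel"
      "(\<lambda>x. indicator half_space x *\<^sub>R v (fst x) (snd x)) \<in> borel_measurable borel"
      unfolding \<rho>_def using mv half_space_borel by (auto intro!: borel_measurable_scaleR borel_measurable_indicator)
  qed (auto simp: \<rho>_def n)
  have p1: "pressure \<gamma> 1 = 1" unfolding pressure_def by simp
  have mass: "mass_balance \<rho> v"
    unfolding mass_balance_def c \<rho>_def case_prod_unfold using fan[of 1 "- W" "2 * W" 0] by simp
  have sq: "(- W + 2 * W * h) * (- W + 2 * W * h) = W * W" if "h = 0 \<or> h = (1::real)" for h using that by auto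
  have ind: "indicator (strip_region 0 {0<..}) z = (0::real) \<or> indicator (strip_region 0 {0<..}) z = (1::real)" for z
    by (simp add: indicator_def)
  have mom: "momentum_balance \<gamma> \<rho> v i" for i
  proof -
    have "momentum_balance \<gamma> \<rho> v 1"
      unfolding momentum_balance_def v0 unfolding c \<rho>_def p1 case_prod_unfold prod.collapse
      using fan1[of "- W" "2 * W" "W * W + 1" 0] sq[OF ind] by simp
    moreover have "momentum_balance \<gamma> \<rho> v 2"
      unfolding momentum_balance_def c \<rho>_def p1 case_prod_unfold using fan1[of 0 0 0 1] by simp
    ultimately show ?thesis using exhaust_2[of i] by auto
  qed
  have ws: "weak_solution \<gamma> \<rho> v"
  proof (rule weak_solutionI[OF bs mass mom])
    show "bounded_measurable (\<lambda>(x, t). v x t $ i)" for i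
    proof -
      have "bounded_measurable (\<lambda>z. - W + 2 * W * indicator (strip_region 0 {0<..}) z)"
        by (intro bounded_measurable_intros bH)
      thus ?thesis using exhaust_2[of i] bounded_measurable_intros(1)[of 0] by (auto simp: c case_prod_unfold)
    qed
    show "(\<lambda>x. v x 0 $ i) \<in> borel_measurable borel" for i
      using measurable_compose[OF measurable_compose[OF emb mv] component_borel[of i]] by simp
    show "\<bar>\<rho> x 0\<bar> \<le> 1 + \<bar>W\<bar>" "\<bar>v x 0 $ i\<bar> \<le> 1 + \<bar>W\<bar>" for x i
      using component_le_norm_cart[of "v x 0" i] unfolding n by (auto simp: \<rho>_def)
  qed (auto simp: \<rho>_def p1 case_prod_unfold intro: bounded_measurable_intros)
  define e0 where "e0 = internal_energy \<gamma> 1 + W\<^sup>2 / 2"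
  have e: "energy_density \<gamma> (\<rho> x t) (v x t) = e0" for x t unfolding energy_density_def n \<rho>_def e0_def by simp
  have ei: "energy_inequality \<gamma> \<rho> v"
    unfolding energy_inequality_def
  proof (intro allI impI, elim conjE)
    fix \<psi> :: "(real^2) \<times> real \<Rightarrow> real" assume t: "test_function \<psi>"
    have "integral\<^sup>L lborel (\<lambda>z. indicator half_space z * (e0 * dt \<psi> z + ((e0 + 1) * (- W) + (e0 + 1) * (2 * W) * indicator (strip_region 0 {0<..}) z) * dx 1 \<psi> z + 0 * dx 2 \<psi> z))
      + integral\<^sup>L lborel (\<lambda>x. e0 * \<psi> (x, 0)) = 0"
      using fan[of e0 "(e0 + 1) * (- W)" "(e0 + 1) * (2 * W)" 0, unfolded weak_balance_def, rule_format, OF t] .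
    thus "(LINT (x, t):half_space|lborel.
           energy_density \<gamma> (\<rho> x t) (v x t) * dt \<psi> (x, t)
           + (\<Sum>j\<in>UNIV. (energy_density \<gamma> (\<rho> x t) (v x t) + pressure \<gamma> (\<rho> x t))
                          * v x t $ j * dx j \<psi> (x, t)))
        + (LINT x|lborel. energy_density \<gamma> (\<rho> x 0) (v x 0) * \<psi> (x, 0)) \<ge> 0"
      unfolding e set_lebesgue_integral_def sum_2 c unfolding \<rho>_def p1 case_prod_unfold prod.collapse
      by (simp add: algebra_simps)
  qed
  have V0: "V s = (- W) *\<^sub>R axis 1 1" if "s \<le> 0" for s unfolding V_def using that by simp
  have V1: "V s = W *\<^sub>R axis 1 1" if "s > 0" for s unfolding V_def using that by simp
  have comp: "V constant_on C" if "C \<in> components (- {0::real})" for C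
  proof -
    have conn: "connected C" and C0: "0 \<notin> C" using that in_components_connected in_components_subset by blast+
    have "C \<subseteq> {..0} \<or> C \<subseteq> {0<..}"
    proof (rule ccontr)
      assume "\<not> (C \<subseteq> {..0} \<or> C \<subseteq> {0<..})"
      then obtain x y where "x \<in> C" "y \<in> C" "x \<le> 0" "0 < y" by (force simp: subset_eq not_le)
      hence "0 \<in> {x..y}" "{x..y} \<subseteq> C" using connected_contains_Icc[OF conn, of x y] by auto
      thus False using C0 by blast
    qed
    thus ?thesis unfolding constant_on_def using V0 V1 by (meson atMost_iff greaterThan_iff subsetD)
  qed
  have "self_similar_solution \<gamma> 1 ((- W) *\<^sub>R axis 1 1) 1 (W *\<^sub>R axis 1 1) \<rho> v"
    unfolding self_similar_solution_def
  proof (intro conjI ws ei exI[of _ "\<lambda>_. 1 :: real"] exI[of _ V] exI[of _ "{0}"] allI impI ballI disjI1)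
    show "v x 0 = (- W) *\<^sub>R axis 1 1" if "x $ 2 < 0" for x using that by (simp add: v_def strip_region_def)
    show "v x 0 = W *\<^sub>R axis 1 1" if "x $ 2 > 0" for x using that by (simp add: v_def strip_region_def)
    show "v x t = V (x $ 2 / t)" if "t > 0" for x t
      using that by (simp add: v_def V_def strip_region_def indicator_def zero_less_divide_iff)
  qed (auto simp: \<rho>_def comp constant_on_def[of "\<lambda>_. 1"])
  thus ?thesis by (rule that)
qed

theorem theorem2:
  fixes \<gamma> :: real
  assumes "1 \<le> \<gamma>" and "\<gamma> < 3"
  shows "\<exists>\<rho>m \<rho>p :: real. \<exists>vm vp :: real^2.
    \<rho>m > 0 \<and> \<rho>p > 0 \<and>
    (\<exists>\<rho> v. self_similar_solution \<gamma> \<rho>m vm \<rho>p vp \<rho> v) \<and>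
    (\<forall>\<rho> v. self_similar_solution \<gamma> \<rho>m vm \<rho>p vp \<rho> v \<longrightarrow>
      \<not> entropy_rate_admissible \<gamma> \<rho> v)"
proof -
  obtain W where W: "W > 0" "fan_energy_rate \<gamma> W < 0" by (rule fan_energy_rate_neg[OF assms(1)])
  let ?vm = "(- W) *\<^sub>R (axis 1 1 :: real^2)" and ?vp = "W *\<^sub>R (axis 1 1 :: real^2)"
  have "\<not> entropy_rate_admissible \<gamma> \<rho> v" if sol: "self_similar_solution \<gamma> 1 ?vm 1 ?vp \<rho> v" for \<rho> v
  proof
    assume "entropy_rate_admissible \<gamma> \<rho> v"
    then obtain Ls where Ls: "Ls > 0" "\<not> (\<exists>r u. weak_solution \<gamma> r u \<and>
        (\<exists>\<tau>\<ge>0. (\<forall>x. \<forall>t\<in>{0..\<tau>}. r x t = \<rho> x t \<and> u x t = v x t) \<and>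
           (\<forall>L\<ge>Ls. \<exists>d' d. has_energy_rate \<gamma> L r u \<tau> d' \<and> has_energy_rate \<gamma> L \<rho> v \<tau> d \<and> d' < d)))"
      unfolding entropy_rate_admissible_def by blast
    have ws: "weak_solution \<gamma> \<rho> v"
      and init: "\<And>x. x $ 2 < 0 \<Longrightarrow> \<rho> x 0 = 1 \<and> v x 0 = ?vm" "\<And>x. x $ 2 > 0 \<Longrightarrow> \<rho> x 0 = 1 \<and> v x 0 = ?vp"
      using sol unfolding self_similar_solution_def by blast+
    obtain d where d: "0 \<le> d" "\<And>L. L > 0 \<Longrightarrow> has_energy_rate \<gamma> L \<rho> v 0 (L * d)"
      by (rule self_similar_energy_rate[OF assms(1) sol]) (rule that)
    obtain r u where ru: "weak_solution \<gamma> r u" "\<And>x. r x 0 = \<rho> x 0 \<and> u x 0 = v x 0"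
      "\<And>L. L > 0 \<Longrightarrow> has_energy_rate \<gamma> L r u 0 (L * fan_energy_rate \<gamma> W)"
      by (rule turbulent_competitor[OF assms(1) W(1) init initial_state_measurable[OF ws]]) (assumption | rule that)+
    \<comment> \<open>Both rates are proportional to L, so one competitor, branching off at time 0,
      refutes every threshold \<open>Ls\<close>.\<close>
    have "has_energy_rate \<gamma> L r u 0 (L * fan_energy_rate \<gamma> W) \<and> has_energy_rate \<gamma> L \<rho> v 0 (L * d) \<and> L * fan_energy_rate \<gamma> W < L * d"
      if "L \<ge> Ls" for L
    proof -
      have L: "L > 0" using that Ls(1) by simp
      thus ?thesis using ru(3)[OF L] d(2)[OF L] d(1) W(2) by simp
    qed
    moreover have "\<forall>x. \<forall>t\<in>{0..0}. r x t = \<rho> x t \<and> u x t = v x t" using ru(2) by simp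
    ultimately show False using Ls(2) ru(1) by blast
  qed
  moreover have "\<exists>\<rho> v. self_similar_solution \<gamma> 1 ?vm 1 ?vp \<rho> v" by (rule vortex_sheet_self_similar[of \<gamma> W]) blast
  ultimately show ?thesis by (intro exI[of _ "1::real"] exI[of _ ?vm] exI[of _ ?vp] conjI) auto
qed

end
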